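(* Let $(u_h,\hat u_h)\in\mathcal{X}_h^k$, and let $\boldsymbol{p}_h\in\boldsymbol{\mathcal{V}}_h^k$ be determined by $$(\boldsymbol{p}_h,\boldsymbol{q}_h)_{\mathcal{T}_h}=(u_h,\nabla\cdot\boldsymbol{q}_h)_{\mathcal{T}_h}-\langle\hat u_h,\boldsymbol{q}_h\cdot\boldsymbol{n}\rangle_{\partial\mathcal{T}_h}\qquad\text{for all }\boldsymbol{q}_h\in\boldsymbol{\mathcal{V}}_h^k.$$ Let $\Gamma=\bigcup_{i=1}^N e_i$ be a union of distinct boundary faces $e_1,\dots,e_N\in\partial\mathcal{T}_h^b$ having positive $(d-1)$-dimensional measure. Then $$\|u_h\|_{L^2(\partial\mathcal{T}_h^b)}^2\lesssim(1+h)\|\boldsymbol{p}_h\|^2_{\boldsymbol{L}^2(\mathcal{T}_h)}+\|u_h-\hat u_h\|^2_{L^2(\partial\mathcal{T}_h)}+\left(\int_\Gamma\hat u_h\,ds\right)^2$$ and $$\|\hat u_h\|_{L^2(\partial\mathcal{T}_h^b)}^2\lesssim(1+h)\|\boldsymbol{p}_h\|^2_{\boldsymbol{L}^2(\mathcal{T}_h)}+\|u_h-\hat u_h\|^2_{L^2(\partial\mathcal{T}_h)}+\left(\int_\Gamma\hat u_h\,ds\right)^2.$$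
   Context: $\Omega\subset\mathbb{R}^d$, $d\in\{2,3\}$, is a connected, bounded, open polyhedral domain; $k\ge 0$ is an integer. $\mathcal{T}_h$ is a triangulation of $\Omega$ into simplices $K$ (triangles if $d=2$, tetrahedra if $d=3$), with no hanging nodes, which is shape regular, $\min_{K\in\mathcal{T}_h}|K|/\mathrm{diam}(K)^d\ge\kappa_{\mathcal{T}}>0$, and quasi-uniform, $\mathrm{diam}(K)/\mathrm{diam}(K')\le A_{\mathrm{qu}}$ for all $K,K'\in\mathcal{T}_h$, with constants $\kappa_{\mathcal{T}},A_{\mathrm{qu}}$ not depending on the mesh. $h_K=\mathrm{diam}(K)$ and $h=\max_K h_K$. $\partial\mathcal{T}_h=\partial\mathcal{T}_h^i\cup\partial\mathcal{T}_h^b$ is the set of all faces (the skeleton), split into interior and boundary faces; $\boldsymbol{n}$ is the outward unit normal of the element under consideration. Spaces: $\mathcal{P}^k$ denotes polynomials of degree at most $k$ and $\boldsymbol{\mathcal{P}}^k$ the $\mathbb{R}^d$-valued ones; $\mathcal{U}_h^k=\{f\in L^2(\mathcal{T}_h): f|_K\in\mathcal{P}^k(K)\ \forall K\in\mathcal{T}_h\}$; $\mathcal{F}_h^k=\{\hat f\in L^2(\partial\mathcal{T}_h):\hat f|_e\in\mathcal{P}^k(e)\ \forall e\in\partial\mathcal{T}_h\}$ (one value on each face); $\mathcal{X}_h^k=\mathcal{U}_h^k\times\mathcal{F}_h^k$; $\boldsymbol{\mathcal{V}}_h^k=\{\boldsymbol{f}\in\boldsymbol{L}^2(\mathcal{T}_h):\boldsymbol{f}|_K\in\boldsymbol{\mathcal{P}}^k(K)\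 \forall K\}$. Inner products and norms: $(\cdot,\cdot)_{\mathcal{T}_h}=\sum_K(\cdot,\cdot)_{L^2(K)}$ with elementwise derivatives; $\langle\cdot,\cdot\rangle_{\partial\mathcal{T}_h}=\sum_K\langle\cdot,\cdot\rangle_{L^2(\partial K)}$; $\|\cdot\|_{\boldsymbol{L}^2(\mathcal{T}_h)}^2=\sum_K\|\cdot\|_{\boldsymbol{L}^2(K)}^2$; $\|w\|_{L^2(\partial\mathcal{T}_h)}^2=\sum_{K}\|w\|_{L^2(\partial K)}^2$, where on $\partial K$ the trace of $u_h|_K$ is used (so each interior face is counted twice, once from each side); $\|w\|_{L^2(\partial\mathcal{T}_h^b)}^2=\sum_{e\in\partial\mathcal{T}_h^b}\|w\|_{L^2(e)}^2$, i.e. the $L^2(\partial\Omega)$ norm. Convention: $A\lesssim B$ means $A\le CB$ with a constant $C>0$ independent of the functions involved and of the mesh (hence of $h$); it may depend on $\Omega$, $d$, $k$, $\kappa_{\mathcal{T}}$, $A_{\mathrm{qu}}$ and the set $\Gamma\subset\partial\Omega$. *)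

theory Defs
  imports "HOL-Analysis.Analysis"
begin

section \<open>Polyhedral domains and their meshes\<close>

text \<open>A bounded set of the form \<open>interior (\<Union>P)\<close> with closed \<open>\<Union>P\<close> lies on one side only of each
  of its boundary faces; domains with slits or cracks are thereby not polyhedral.\<close>

definition polyhedral :: "'a::euclidean_space set \<Rightarrow> bool" where
  "polyhedral \<Omega> \<longleftrightarrow> (\<exists>P. finite P \<and> (\<forall>X\<in>P. polytope X) \<and> \<Omega> = interior (\<Union>P))"

text \<open>The library notion \<^const>\<open>triangulation\<close> demands that two elements meet in a common
  (possibly empty) face, which is the absence of hanging nodes.\<close>

definition mesh_of :: "(real^'d) set \<Rightarrow> (real^'d) set set \<Rightarrow> bool" where
  "mesh_of \<Omega> T \<longleftrightarrow>
     triangulation T \<and> (\<forall>K\<in>T. int CARD('d) simplex K) \<and> \<Union>T = closure \<Omega>"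

definition shape_regular :: "real \<Rightarrow> (real^'d) set set \<Rightarrow> bool" where
  "shape_regular \<kappa> T \<longleftrightarrow> (\<forall>K\<in>T. \<kappa> \<le> measure lebesgue K / diameter K ^ CARD('d))"

definition quasi_uniform :: "real \<Rightarrow> (real^'d) set set \<Rightarrow> bool" where
  "quasi_uniform A T \<longleftrightarrow> (\<forall>K\<in>T. \<forall>K'\<in>T. diameter K / diameter K' \<le> A)"

definition mesh_size :: "(real^'d) set set \<Rightarrow> real" where
  "mesh_size T = Max (diameter ` T)"

definition faces :: "(real^'d) set set \<Rightarrow> (real^'d) set set" where
  "faces T = {e. \<exists>K\<in>T. e facet_of K}"

definition boundary_faces :: "(real^'d) set \<Rightarrow> (real^'d) set set \<Rightarrow> (real^'d) set set" where
  "boundary_faces \<Omega> T = {e \<in> faces T. e \<subseteq> frontier \<Omega>}"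

text \<open>The element of which a boundary face is a facet (there is exactly one).\<close>

definition elem_at :: "(real^'d) set set \<Rightarrow> (real^'d) set \<Rightarrow> (real^'d) set" where
  "elem_at T e = (THE K. K \<in> T \<and> e facet_of K)"

definition outward_normal :: "(real^'d) set \<Rightarrow> (real^'d) set \<Rightarrow> real^'d" where
  "outward_normal K e =
     (THE n. norm n = 1 \<and> (\<exists>c. (\<forall>x\<in>e. n \<bullet> x = c) \<and> (\<forall>x\<in>K. n \<bullet> x \<le> c)))"

lemma outward_normal_unique:
  fixes K :: "(real^'d) set"
  assumes K: "int CARD('d) simplex K" and e: "e facet_of K"
  shows "\<exists>!n. norm n = 1 \<and> (\<exists>c. (\<forall>x\<in>e. n \<bullet> x = c) \<and> (\<forall>x\<in>K. n \<bullet> x \<le> c))"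
proof -
  have poly: "polyhedron K" using K unfolding simplex_def by (metis aff_independent_finite polytope_def polytope_imp_polyhedron)
  have dK: "aff_dim K = int CARD('d)" using aff_dim_simplex[OF K] by simp
  have de: "aff_dim e = int CARD('d) - 1" "e \<noteq> {}" using e dK by (auto simp: facet_of_def)
  obtain a b where ab: "a \<noteq> 0" "K \<subseteq> {x. a \<bullet> x \<le> b}" "e = K \<inter> {x. a \<bullet> x = b}"
    using facet_of_polyhedron[OF poly e] by metis
  have hull: "affine hull e = {x. n \<bullet> x = c}"
    if "norm n = 1" "\<forall>x\<in>e. n \<bullet> x = c" for n :: "real^'d" and c
  proof -
    have "affine hull e \<subseteq> {x. n \<bullet> x = c}"
      using that by (intro hull_minimal) (auto simp: affine_hyperplane)
    moreover have "aff_dim {x. n \<bullet> x = c} = aff_dim (affine hull e)"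
      using that de by (subst aff_dim_hyperplane) auto
    ultimately show ?thesis
      using affine_dim_equal[of "affine hull e" "{x. n \<bullet> x = c}"] de
      by (simp add: affine_hyperplane)
  qed
  show ?thesis
  proof (rule ex1I[of _ "a /\<^sub>R norm a"], goal_cases)
    case 1
    have "norm (a /\<^sub>R norm a) = 1" using ab by simp
    moreover have "\<forall>x\<in>e. (a /\<^sub>R norm a) \<bullet> x = b / norm a" using ab by (auto simp: field_simps)
    moreover have "\<forall>x\<in>K. (a /\<^sub>R norm a) \<bullet> x \<le> b / norm a" using ab by (auto simp: field_simps)
    ultimately show ?case by blast
  next
    case (2 m)
    define n where "n = a /\<^sub>R norm a"
    define c where "c = b / norm a"
    have n: "norm n = 1" "\<forall>x\<in>e. n \<bullet> x = c" "\<forall>x\<in>K. n \<bullet> x \<le> c"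
      using ab by (auto simp: n_def c_def field_simps)
    obtain c' where m: "norm m = 1" "\<forall>x\<in>e. m \<bullet> x = c'" "\<forall>x\<in>K. m \<bullet> x \<le> c'" using 2 by blast
    have eq: "{x. n \<bullet> x = c} = {x. m \<bullet> x = c'}"
      using hull n m by metis
    obtain x0 where x0: "x0 \<in> e" using de by auto
    define w where "w = m - (m \<bullet> n) *\<^sub>R n"
    have wn: "w \<bullet> n = 0" using n(1) by (simp add: w_def inner_diff_left norm_eq_1)
    have "x0 + w \<in> {x. n \<bullet> x = c}" using wn x0 n by (simp add: inner_add_right inner_commute[of w])
    then have "m \<bullet> w = 0" using eq x0 m by (auto simp: inner_add_right)
    then have "w \<bullet> w = 0" using wn by (simp add: w_def inner_diff_left inner_commute)
    then have mn: "m = (m \<bullet> n) *\<^sub>R n" by (simp add: w_def)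
    have "norm m = \<bar>m \<bullet> n\<bar> * norm n" by (subst mn) simp
    then have "\<bar>m \<bullet> n\<bar> = 1" using m(1) n(1) by simp
    moreover have "m \<bullet> n \<noteq> -1"
    proof
      assume "m \<bullet> n = -1"
      with mn have m': "m = - n" by (metis scaleR_minus1_left)
      have c': "c' = - c" using bspec[OF m(2) x0] bspec[OF n(2) x0] m' by simp
      have "n \<bullet> x = c" if "x \<in> K" for x
        using bspec[OF m(3) that] bspec[OF n(3) that] m' c' by simp
      then have "aff_dim K \<le> aff_dim {x. n \<bullet> x = c}"
        by (intro aff_dim_subset) auto
      also have "\<dots> = int CARD('d) - 1" using n(1) by (subst aff_dim_hyperplane) auto
      finally show False using dK by simp
    qed
    ultimately have "m \<bullet> n = 1" by linarith
    then have "m = n" using mn by (metis scaleR_one)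
    then show ?case by (simp only: n_def)
  qed
qed


section \<open>Surface measure on flat pieces\<close>

text \<open>The \<open>m\<close>-dimensional Lebesgue measure on the \<open>m\<close>-dimensional affine hull of \<open>S\<close>, transported
  from coordinates with respect to an orthonormal basis \<open>B\<close> of its direction space and an
  origin \<open>a\<close>, exactly as \<^const>\<open>lborel\<close> is defined from \<^const>\<open>Basis\<close>. It does not depend on the
  choice of \<open>a\<close> and \<open>B\<close>. For a face \<open>S\<close> of a mesh this is the surface measure \<open>ds\<close>.\<close>

definition orthonormal_frame :: "'a::euclidean_space set \<Rightarrow> 'a \<Rightarrow> 'a set \<Rightarrow> bool" where
  "orthonormal_frame S a B \<longleftrightarrow>
     a \<in> affine hull S \<and> pairwise orthogonal B \<and> (\<forall>b\<in>B. norm b = 1) \<and>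
     span B = (\<lambda>x. x - a) ` (affine hull S)"

definition surface_lborel :: "'a::euclidean_space set \<Rightarrow> 'a measure" where
  "surface_lborel S =
     (case (SOME (a, B). orthonormal_frame S a B) of (a, B) \<Rightarrow>
        distr (\<Pi>\<^sub>M b\<in>B. lborel) borel (\<lambda>c. a + (\<Sum>b\<in>B. c b *\<^sub>R b)))"

lemma orthonormal_frame_exists:
  assumes "S \<noteq> {}"
  shows "\<exists>a B. orthonormal_frame S a B"
proof -
  obtain a where a: "a \<in> affine hull S" using assms by (meson ex_in_conv hull_inc)
  have "subspace ((\<lambda>x. x - a) ` (affine hull S))"
    using affine_diffs_subspace_subtract[OF affine_affine_hull a]
    by (simp add: image_def setcompr_eq_image)
  from orthonormal_basis_subspace[OF this] obtain B where "pairwise orthogonal B"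
      "\<And>x. x \<in> B \<Longrightarrow> norm x = 1" "span B = (\<lambda>x. x - a) ` (affine hull S)" by metis
  then show ?thesis using a unfolding orthonormal_frame_def by blast
qed


section \<open>Discrete spaces\<close>

text \<open>Polynomials of total degree at most \<open>k\<close>; the multi-indices \<open>\<alpha>\<close> form a finite set.\<close>

definition polys :: "nat \<Rightarrow> (real^'d \<Rightarrow> real) set" where
  "polys k = {f. \<exists>c. \<forall>x. f x =
     (\<Sum>\<alpha> | (\<Sum>i\<in>UNIV. \<alpha> i) \<le> k. c \<alpha> * (\<Prod>i\<in>UNIV. (x $ i) ^ \<alpha> i))}"

definition polys_on :: "nat \<Rightarrow> (real^'d) set \<Rightarrow> (real^'d \<Rightarrow> real) set" where
  "polys_on k D = {f. \<exists>g\<in>polys k. \<forall>x\<in>D. f x = g x}"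

text \<open>Functions on the mesh are families indexed by the elements \<open>K\<close>, functions on the skeleton are
  families indexed by the faces \<open>e\<close>; only the values on \<open>K\<close> and on \<open>e\<close> matter. The value on
  \<open>\<partial>K\<close> of the member with index \<open>K\<close> is its trace taken from within \<open>K\<close>.\<close>

type_synonym ('d, 'b) broken = "(real^'d) set \<Rightarrow> real^'d \<Rightarrow> 'b"

definition U_space :: "nat \<Rightarrow> (real^'d) set set \<Rightarrow> ('d, real) broken set" where
  "U_space k T = {u. \<forall>K\<in>T. u K \<in> polys_on k K}"

definition V_space :: "nat \<Rightarrow> (real^'d) set set \<Rightarrow> ('d, real^'d) broken set" where
  "V_space k T = {q. \<forall>K\<in>T. \<forall>i. (\<lambda>x. q K x $ i) \<in> polys_on k K}"

definition F_space :: "nat \<Rightarrow> (real^'d) set set \<Rightarrow> ('d, real) broken set" where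
  "F_space k T = {w. \<forall>e\<in>faces T. w e \<in> polys_on k e}"

definition X_space :: "nat \<Rightarrow> (real^'d) set set \<Rightarrow> (('d, real) broken \<times> ('d, real) broken) set" where
  "X_space k T = U_space k T \<times> F_space k T"


section \<open>Inner products and norms\<close>

definition mesh_inner ::
  "(real^'d) set set \<Rightarrow> ('d, 'b::real_inner) broken \<Rightarrow> ('d, 'b) broken \<Rightarrow> real" where
  "mesh_inner T f g = (\<Sum>K\<in>T. LINT x:K|lborel. f K x \<bullet> g K x)"

text \<open>Elementwise divergence; the derivative is one-sided on \<open>\<partial>K\<close>, so that values outside \<open>K\<close> play
  no role.\<close>

definition broken_div :: "('d, real^'d) broken \<Rightarrow> ('d, real) broken" where
  "broken_div q = (\<lambda>K x. \<Sum>i\<in>UNIV. frechet_derivative (q K) (at x within K) (axis i 1) $ i)"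

text \<open>The arguments are families \<open>v K e\<close> giving the values on the facet \<open>e\<close> as seen from \<open>K\<close>; interior
  faces are thus visited once from each side.\<close>

definition skel_inner ::
  "(real^'d) set set \<Rightarrow> ((real^'d) set \<Rightarrow> ('d, real) broken)
     \<Rightarrow> ((real^'d) set \<Rightarrow> ('d, real) broken) \<Rightarrow> real" where
  "skel_inner T v w =
     (\<Sum>K\<in>T. \<Sum>e | e facet_of K. LINT x:e|surface_lborel e. v K e x * w K e x)"

definition mesh_norm :: "(real^'d) set set \<Rightarrow> ('d, 'b::real_inner) broken \<Rightarrow> real" where
  "mesh_norm T f = sqrt (mesh_inner T f f)"

definition skel_norm :: "(real^'d) set set \<Rightarrow> ((real^'d) set \<Rightarrow> ('d, real) broken) \<Rightarrow> real" where
  "skel_norm T w = sqrt (skel_inner T w w)"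

definition bdry_norm ::
  "(real^'d) set \<Rightarrow> (real^'d) set set \<Rightarrow> ('d, real) broken \<Rightarrow> real" where
  "bdry_norm \<Omega> T w =
     sqrt (\<Sum>e\<in>boundary_faces \<Omega> T. LINT x:e|surface_lborel e. (w e x)\<^sup>2)"


section \<open>The discrete gradient equation\<close>

definition gradient_eq ::
  "nat \<Rightarrow> (real^'d) set set \<Rightarrow> ('d, real) broken \<Rightarrow> ('d, real) broken
     \<Rightarrow> ('d, real^'d) broken \<Rightarrow> bool" where
  "gradient_eq k T u uhat p \<longleftrightarrow> (\<forall>q\<in>V_space k T.
     mesh_inner T p q =
       mesh_inner T u (broken_div q)
       - skel_inner T (\<lambda>K e. uhat e) (\<lambda>K e x. q K x \<bullet> outward_normal K e))"

end

theory Submission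
  imports Defs "HOL-Computational_Algebra.Polynomial"
begin

text \<open>
  The estimate is a discrete trace and Poincare inequality: the energy, which is the sum over all
  elements of \<open>\<integral>\<^sub>K \<bar>p\<bar>\<^sup>2\<close> and of the squared jumps \<open>\<integral> (u - uhat)\<^sup>2\<close> over the facets of \<open>K\<close>, controls
  \<open>u\<close> on the boundary up to one constant \<open>c\<close>, and the mean of \<open>uhat\<close> over \<open>\<Gamma>\<close> controls \<open>c\<close>. The proof
  compares averages of \<open>u\<close> over balls of all sizes between the mesh size \<open>h\<close> and the size of \<open>\<Omega>\<close>.

  \<^item> \<^emph>\<open>One field.\<close> Let \<open>Q\<close> be a continuously differentiable vector field that vanishes outside \<open>\<Omega>\<close>. As
  \<open>Q\<close> is continuous across the faces, \<open>uhat\<close> drops out of the sum of all boundary terms. Integration by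
  parts on every element, and the discrete equation with the test function that is constant on \<open>K\<close> and
  equal there to a value of \<open>Q\<close>, express \<open>\<integral> u div Q\<close> by \<open>p\<close>, by the jumps and by \<open>grad u\<close> times
  the oscillation of \<open>Q\<close> on one element (\<open>field_identity\<close>). The gradient is bounded by the
  energy because the discrete equation may be tested with \<open>grad u\<close> itself (\<open>gradient_bound\<close>). Hence
  \<open>\<integral> u div Q\<close> is bounded by the energy near the support of \<open>Q\<close> (\<open>field_estimate\<close>).

  \<^item> \<^emph>\<open>Moving a ball.\<close> Let \<open>avg a r\<close> be the integral of \<open>u\<close> against a bump function of fixed mass on
  the ball with centre \<open>a\<close> and radius \<open>r\<close>. When the ball moves and shrinks affinely, the bump function
  changes by the divergence of a field supported in the moving ball, so that
  the change of the average is an integral of the terms just bounded (\<open>path_estimate\<close>).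

  \<^item> \<^emph>\<open>Zooming in.\<close> Fix a reference mesh \<open>T0\<close> of the class. A boundary element \<open>K\<close> has its centre
  \<open>x\<close> in a simplex \<open>G\<close> of \<open>T0\<close>; if \<open>G\<close> contains the ball with centre \<open>g\<close> and radius \<open>R\<close>, convexity
  of \<open>G\<close> keeps the balls with centre \<open>x + t (g - x)\<close> and radius \<open>t R\<close> in \<open>\<Omega>\<close>. For \<open>t = 2\<^sup>-\<^sup>j\<close> they lead from
  the ball at \<open>g\<close> to a ball inside \<open>K\<close>. A step at scale \<open>t\<close> costs about \<open>(t\<^sup>2 + h) / t\<^sup>d\<close> times the energy
  at distance \<open>O(t)\<close> from \<open>x\<close> (\<open>chain_step\<close>). The boundary lies in finitely many hyperplanes, so
  only \<open>O((t / h)\<^sup>d\<^sup>-\<^sup>1)\<close> boundary elements are at distance \<open>O(t)\<close> from a given element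
  (\<open>count_boundary\<close>). After summation over \<open>K\<close> with the weight \<open>h\<^sup>d\<^sup>-\<^sup>1\<close> of a face, level \<open>j\<close> contributes
  \<open>t + h / t\<close> times the total energy, which is summable over \<open>h \<le> t \<le> 1\<close> (\<open>chain_sum\<close>).

  \<^item> \<^emph>\<open>One constant.\<close> The finitely many reference balls are joined by paths of balls in the connected set
  \<open>\<Omega>\<close> (\<open>balls_linked_connected\<close>). Thus all averages are close to a single number, and
  \<open>\<integral> (u - c)\<^sup>2\<close> over the boundary is bounded by the energy (\<open>boundary_trace\<close>). Integrating
  \<open>uhat - c\<close> over \<open>\<Gamma>\<close> bounds \<open>c\<close> (\<open>mean_controls_boundary\<close>), with a constant that depends on a lower
  bound for the measure of \<open>\<Gamma>\<close>. This measure is presented as a sum over faces of a varying mesh; a face of the reference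
  mesh that has positive measure and lies in \<open>\<Gamma>\<close> bounds all these sums from below (\<open>faces_cover_measure\<close>).

  The constant depends on the reference mesh; if the class contains no mesh for which \<open>\<Gamma>\<close> is
  a union of boundary faces with positive measure, there is nothing to prove.
\<close>

section \<open>Surface measure on hyperplanes\<close>

text \<open>This lets any orthonormal basis replace the standard one in the construction of
  \<^const>\<open>lborel\<close>.\<close>

lemma lborel_distr_orthogonal:
  fixes f :: "'a::euclidean_space \<Rightarrow> 'a"
  assumes f: "orthogonal_transformation f"
  shows "distr lborel borel f = lborel"
proof -
  have lf: "linear f" using f by (simp add: orthogonal_transformation_linear)
  have [measurable]: "f \<in> borel_measurable borel"
    using lf by (auto intro!: borel_measurable_continuous_onI linear_continuous_on linear_linear[THEN iffD2])
  define \<nu> where "\<nu> = distr lborel borel f"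
  have sets\<nu>[measurable_cong, simp]: "sets \<nu> = sets borel" by (simp add: \<nu>_def)
  have ball: "emeasure \<nu> (ball 0 r) = emeasure lborel (ball 0 r :: 'a set)" for r
  proof -
    have "f -` ball 0 r = ball 0 r" using orthogonal_transformation_norm[OF f] by auto
    then show ?thesis by (simp add: \<nu>_def emeasure_distr)
  qed
  have fin: "emeasure lborel (ball 0 r :: 'a set) < \<infinity>" for r
    by (rule emeasure_bounded_finite) simp
  interpret \<nu>: sigma_finite_measure \<nu>
  proof (rule sigma_finite_measure.intro, intro exI conjI)
    show "countable (range (\<lambda>n::nat. ball (0::'a) n))" by simp
    show "\<Union> (range (\<lambda>n::nat. ball (0::'a) n)) = space \<nu>"
      using reals_Archimedean2 by (auto simp: \<nu>_def)
    show "\<forall>A\<in>range (\<lambda>n::nat. ball (0::'a) n). emeasure \<nu> A \<noteq> \<infinity>"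
      using ball fin by (auto simp: less_top)
  qed auto
  interpret P: pair_sigma_finite \<nu> "lborel :: 'a measure" by standard
  have lt: "(\<integral>\<^sup>+x. h (c + x) \<partial>lborel) = (\<integral>\<^sup>+x. h x \<partial>lborel)"
    if [measurable]: "h \<in> borel_measurable borel" for h :: "'a \<Rightarrow> ennreal" and c
  proof -
    have "(\<integral>\<^sup>+x. h x \<partial>lborel) = (\<integral>\<^sup>+x. h x \<partial>distr lborel borel ((+) c))" by (simp add: lborel_distr_plus)
    also have "\<dots> = (\<integral>\<^sup>+x. h (c + x) \<partial>lborel)" by (rule nn_integral_distr) auto
    finally show ?thesis by simp
  qed
  have \<nu>t: "(\<integral>\<^sup>+x. h (c + x) \<partial>\<nu>) = (\<integral>\<^sup>+x. h x \<partial>\<nu>)"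
    if [measurable]: "h \<in> borel_measurable borel" for h :: "'a \<Rightarrow> ennreal" and c
  proof -
    obtain c' where c: "c = f c'" using orthogonal_transformation_surj[OF f] by (metis surjD)
    have "(\<integral>\<^sup>+x. h (c + x) \<partial>\<nu>) = (\<integral>\<^sup>+x. h (f (c' + x)) \<partial>lborel)"
      unfolding \<nu>_def by (subst nn_integral_distr) (auto simp: c linear_add[OF lf])
    also have "\<dots> = (\<integral>\<^sup>+x. h (f x) \<partial>lborel)" by (rule lt[of "\<lambda>x. h (f x)"]) simp
    also have "\<dots> = (\<integral>\<^sup>+x. h x \<partial>\<nu>)" unfolding \<nu>_def by (subst nn_integral_distr) auto
    finally show ?thesis .
  qed
  have neg: "(\<integral>\<^sup>+x. h (- x) \<partial>lborel) = (\<integral>\<^sup>+x. h x \<partial>lborel)"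
    if [measurable]: "h \<in> borel_measurable borel" for h :: "'a \<Rightarrow> ennreal"
  proof -
    have "(\<integral>\<^sup>+x. h x \<partial>lborel) = (\<integral>\<^sup>+x. h x \<partial>distr lborel borel uminus)"
      using lborel_affine[of "-1" "0::'a"] by (simp add: density_1)
    also have "\<dots> = (\<integral>\<^sup>+x. h (- x) \<partial>lborel)" by (rule nn_integral_distr) auto
    finally show ?thesis by simp
  qed
  define B where "B = (ball 0 1 :: 'a set)"
  have [measurable]: "B \<in> sets borel" by (simp add: B_def)
  have B: "emeasure lborel B \<noteq> 0" "emeasure lborel B \<noteq> \<infinity>"
    using content_ball_pos[of 1 "0::'a"] fin[of 1] by (auto simp: B_def measure_def)
  have "emeasure \<nu> A = emeasure lborel A" if A[measurable]: "A \<in> sets borel" for A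
  proof -
    define a b :: "'a \<Rightarrow> ennreal" where "a = indicator A" and "b = indicator B"
    have [measurable]: "a \<in> borel_measurable borel" "b \<in> borel_measurable borel" by (auto simp: a_def b_def)
    have "emeasure \<nu> A * emeasure lborel B = (\<integral>\<^sup>+x. (\<integral>\<^sup>+y. a x * b y \<partial>lborel) \<partial>\<nu>)"
      by (simp add: nn_integral_cmult nn_integral_multc a_def b_def)
    also have "\<dots> = (\<integral>\<^sup>+x. (\<integral>\<^sup>+y. a x * b (x + y) \<partial>lborel) \<partial>\<nu>)"
      by (intro nn_integral_cong lt[symmetric, of "\<lambda>y. a _ * b y"]) simp
    also have "\<dots> = (\<integral>\<^sup>+y. (\<integral>\<^sup>+x. a x * b (x + y) \<partial>\<nu>) \<partial>lborel)"
      by (rule P.Fubini'[symmetric]) simp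
    also have "\<dots> = (\<integral>\<^sup>+y. (\<integral>\<^sup>+x. a (- y + x) * b x \<partial>\<nu>) \<partial>lborel)"
    proof (rule nn_integral_cong)
      fix y show "(\<integral>\<^sup>+x. a x * b (x + y) \<partial>\<nu>) = (\<integral>\<^sup>+x. a (- y + x) * b x \<partial>\<nu>)"
        using \<nu>t[of "\<lambda>x. a x * b (x + y)" "- y"] by simp
    qed
    also have "\<dots> = (\<integral>\<^sup>+y. (\<integral>\<^sup>+x. a (y + x) * b x \<partial>\<nu>) \<partial>lborel)"
      by (rule neg[of "\<lambda>y. \<integral>\<^sup>+x. a (y + x) * b x \<partial>\<nu>"]) simp
    also have "\<dots> = (\<integral>\<^sup>+x. (\<integral>\<^sup>+y. a (y + x) * b x \<partial>lborel) \<partial>\<nu>)"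
      by (rule P.Fubini') simp
    also have "\<dots> = (\<integral>\<^sup>+x. (\<integral>\<^sup>+y. a y * b x \<partial>lborel) \<partial>\<nu>)"
    proof (rule nn_integral_cong)
      fix x show "(\<integral>\<^sup>+y. a (y + x) * b x \<partial>lborel) = (\<integral>\<^sup>+y. a y * b x \<partial>lborel)"
        using lt[of "\<lambda>y. a y * b x" x] by (simp add: add.commute)
    qed
    also have "\<dots> = emeasure lborel A * emeasure \<nu> B"
      by (simp add: nn_integral_cmult nn_integral_multc a_def b_def)
    finally have "emeasure \<nu> A * emeasure lborel B = emeasure lborel A * emeasure lborel B"
      using ball[of 1] by (simp add: B_def)
    then have "emeasure \<nu> A * emeasure lborel B / emeasure lborel B = emeasure lborel A * emeasure lborel B / emeasure lborel B"
      by simp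
    then show ?thesis using B by (simp add: mult_divide_eq_ennreal)
  qed
  then show ?thesis unfolding \<nu>_def[symmetric] by (intro measure_eqI) auto
qed

lemma lborel_orthonormal:
  fixes B :: "(real^'d) set"
  assumes orth: "pairwise orthogonal B" and unit: "\<And>b. b \<in> B \<Longrightarrow> norm b = 1"
    and card: "card B = CARD('d)"
  shows "distr (\<Pi>\<^sub>M b\<in>B. lborel) borel (\<lambda>c. \<Sum>b\<in>B. c b *\<^sub>R b) = lborel"
proof -
  have fin: "finite B" using card by (metis card.infinite zero_less_card_finite less_irrefl)
  obtain \<beta> :: "'d \<Rightarrow> real^'d" where \<beta>: "bij_betw \<beta> UNIV B"
    using card fin by (metis finite_class.finite_UNIV finite_same_card_bij)
  have inj: "inj \<beta>" and B: "B = range \<beta>" using \<beta> by (auto simp: bij_betw_def)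
  have ip: "\<beta> i \<bullet> \<beta> j = (if i = j then 1 else 0)" for i j
  proof (cases "i = j")
    case True then show ?thesis using unit[of "\<beta> i"] B by (simp add: norm_eq_1)
  next
    case False
    then have "\<beta> i \<noteq> \<beta> j" using inj by (auto dest: injD)
    then show ?thesis using orth False B by (auto simp: pairwise_def orthogonal_def)
  qed
  define f where "f x = (\<Sum>i\<in>UNIV. (x $ i) *\<^sub>R \<beta> i)" for x :: "real^'d"
  define g where "g x = (\<chi> i. \<beta> i \<bullet> x)" for x :: "real^'d"
  have lf: "linear f"
    unfolding f_def by (rule linearI) (auto simp: algebra_simps sum.distrib scaleR_sum_right)
  have lg: "linear g"
    unfolding g_def by (rule linearI) (auto simp: vec_eq_iff inner_add_right)
  have gf: "g (f x) = x" for x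
    by (simp add: f_def g_def vec_eq_iff inner_sum_right ip if_distrib[of "\<lambda>x. _ * x"] cong: if_cong)
  have of: "orthogonal_transformation f"
    unfolding orthogonal_transformation_def
  proof (intro conjI lf allI)
    fix v w :: "real^'d"
    have "f v \<bullet> f w = (\<Sum>i\<in>UNIV. v $ i * w $ i)"
      by (simp add: f_def inner_sum_left inner_sum_right ip if_distrib[of "\<lambda>x. _ * x"] mult.commute cong: if_cong)
    then show "f v \<bullet> f w = v \<bullet> w" by (simp add: inner_vec_def)
  qed
  have fg: "f (g x) = x" for x
    using orthogonal_transformation_surj[OF of] gf by (metis surjD)
  have og: "orthogonal_transformation g"
    using orthogonal_transformation_inv[OF of] fg gf
    by (metis inv_equality)
  have [measurable]: "f \<in> borel_measurable borel" "g \<in> borel_measurable borel"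
    using lf lg by (auto intro!: borel_measurable_continuous_onI linear_continuous_on linear_linear[THEN iffD2])
  define \<psi> where "\<psi> = (\<lambda>c. \<Sum>b\<in>B. c b *\<^sub>R (b::real^'d))"
  define P where "P = (\<Pi>\<^sub>M b\<in>B. (lborel :: real measure))"
  have \<psi>[measurable]: "\<psi> \<in> borel_measurable P" unfolding \<psi>_def P_def by measurable
  have g\<psi>: "g (\<psi> c) = (\<chi> i. c (\<beta> i))" for c
  proof -
    have "\<psi> c = (\<Sum>i\<in>UNIV. c (\<beta> i) *\<^sub>R \<beta> i)" unfolding \<psi>_def B by (simp add: sum.reindex[OF inj])
    then have "\<psi> c = f (\<chi> i. c (\<beta> i))" by (simp add: f_def)
    then show ?thesis by (simp add: gf)
  qed
  interpret product_sigma_finite "\<lambda>_::real^'d. (lborel :: real measure)" by standard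
  have \<nu>: "lborel = distr P borel (g \<circ> \<psi>)"
  proof (rule lborel_eqI)
    fix l u :: "real^'d" assume lu: "\<And>b. b \<in> Basis \<Longrightarrow> l \<bullet> b \<le> u \<bullet> b"
    have le: "l $ i \<le> u $ i" for i using lu[of "axis i 1"] by (simp add: inner_axis axis_in_Basis_iff)
    define \<gamma> where "\<gamma> = inv \<beta>"
    have \<gamma>: "\<gamma> (\<beta> i) = i" for i using inj by (simp add: \<gamma>_def)
    have "emeasure (distr P borel (g \<circ> \<psi>)) (box l u) = emeasure P ((g \<circ> \<psi>) -` box l u \<inter> space P)"
      by (subst emeasure_distr) (auto)
    also have "(g \<circ> \<psi>) -` box l u \<inter> space P = (\<Pi>\<^sub>E b\<in>B. {l $ \<gamma> b <..< u $ \<gamma> b})"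
    proof -
      have "(\<forall>b\<in>B. c b \<in> {l $ \<gamma> b <..< u $ \<gamma> b}) \<longleftrightarrow> (\<forall>i. l $ i < c (\<beta> i) \<and> c (\<beta> i) < u $ i)" for c
        unfolding B by (simp add: \<gamma>)
      then show ?thesis
        by (simp add: set_eq_iff P_def space_PiM mem_box_cart g\<psi> PiE_iff conj_commute)
    qed
    also have "emeasure P \<dots> = (\<Prod>b\<in>B. emeasure lborel {l $ \<gamma> b <..< u $ \<gamma> b})"
      unfolding P_def by (rule emeasure_PiM[OF fin]) auto
    also have "\<dots> = (\<Prod>i\<in>UNIV. ennreal (u $ i - l $ i))"
      unfolding B by (simp add: prod.reindex[OF inj] \<gamma> le)
    also have "\<dots> = ennreal (\<Prod>i\<in>UNIV. (u $ i - l $ i))" by (rule prod_ennreal) (simp add: le)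
    also have "(\<Prod>i\<in>UNIV. (u $ i - l $ i)) = (\<Prod>b\<in>Basis. (u - l) \<bullet> b)"
      by (simp add: Basis_vec_def UNION_singleton_eq_range prod.reindex axis_eq_axis inj_on_def inner_axis)
    finally show "emeasure (distr P borel (g \<circ> \<psi>)) (box l u) = ennreal (\<Prod>b\<in>Basis. (u - l) \<bullet> b)" .
  qed simp
  have "distr P borel \<psi> = distr (distr P borel (g \<circ> \<psi>)) borel f"
    by (subst distr_distr) (auto simp: comp_def fg)
  also have "\<dots> = distr lborel borel f" using \<nu> by simp
  also have "\<dots> = lborel"
    by (rule lborel_distr_orthogonal[OF of])
  finally show ?thesis unfolding P_def \<psi>_def .
qed

lemma surface_lborel_frame:
  assumes "S \<noteq> {}"
  obtains a B where "orthonormal_frame S a B"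
    "surface_lborel S = distr (\<Pi>\<^sub>M b\<in>B. lborel) borel (\<lambda>c. a + (\<Sum>b\<in>B. c b *\<^sub>R b))"
proof -
  obtain a B where aB: "(SOME (a, B). orthonormal_frame S a B) = (a, B)" by fastforce
  have "\<exists>p. case p of (a, B) \<Rightarrow> orthonormal_frame S a B" using orthonormal_frame_exists[OF assms] by auto
  from someI_ex[OF this] aB have "orthonormal_frame S a B" by simp
  then show ?thesis using that unfolding surface_lborel_def aB by simp
qed

lemma sets_surface_lborel[simp, measurable_cong]: "sets (surface_lborel S) = sets borel"
  by (simp add: surface_lborel_def split: prod.split)

lemma space_surface_lborel[simp]: "space (surface_lborel S) = UNIV"
  by (simp add: surface_lborel_def split: prod.split)

lemma surface_lborel_cong: "affine hull S = affine hull S' \<Longrightarrow> surface_lborel S = surface_lborel S'"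
  unfolding surface_lborel_def orthonormal_frame_def by simp

lemma orthonormal_frame_insert_normal:
  fixes n :: "real^'d"
  assumes n: "norm n = 1" and H: "affine hull S = {x. n \<bullet> x = \<alpha>}" and fr: "orthonormal_frame S a B"
  shows "n \<bullet> a = \<alpha>" "\<And>b. b \<in> B \<Longrightarrow> n \<bullet> b = 0" "n \<notin> B" "finite B"
    "pairwise orthogonal (insert n B)" "card (insert n B) = CARD('d)" "\<And>b. b \<in> insert n B \<Longrightarrow> norm b = 1"
proof -
  have po: "pairwise orthogonal B" and un: "\<And>b. b \<in> B \<Longrightarrow> norm b = 1"
    and sp: "span B = (\<lambda>x. x - a) ` {x. n \<bullet> x = \<alpha>}" and a: "n \<bullet> a = \<alpha>"
    using fr H by (auto simp: orthonormal_frame_def)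
  have "(\<lambda>x. x - a) ` {x. n \<bullet> x = \<alpha>} = {x. n \<bullet> x = 0}"
  proof (intro set_eqI iffI)
    fix x assume "x \<in> {x. n \<bullet> x = 0}"
    then show "x \<in> (\<lambda>x. x - a) ` {x. n \<bullet> x = \<alpha>}"
      using a by (intro image_eqI[of _ _ "x + a"]) (auto simp: inner_add_right)
  qed (auto simp: a inner_diff_right)
  with sp have sp0: "span B = {x. n \<bullet> x = 0}" by simp
  show a: "n \<bullet> a = \<alpha>" by fact
  show nb: "n \<bullet> b = 0" if "b \<in> B" for b using sp0 span_base[OF that] by auto
  show nB: "n \<notin> B" using nb n by (auto simp: norm_eq_1)
  have "0 \<notin> B" using un by force
  then have ind: "independent B" using po pairwise_orthogonal_independent by blast
  show fB: "finite B" using ind independent_imp_finite by blast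
  have "card B = dim {x. n \<bullet> x = 0}" using ind sp0 by (metis dim_span_eq_card_independent)
  also have "\<dots> = CARD('d) - 1" using n by (subst dim_hyperplane) auto
  finally show "card (insert n B) = CARD('d)" using fB nB by simp
  show "pairwise orthogonal (insert n B)"
    using po nb by (auto simp: pairwise_insert orthogonal_def inner_commute)
  show "\<And>b. b \<in> insert n B \<Longrightarrow> norm b = 1" using un n by auto
qed

lemma hyperplane_hull_nonempty:
  fixes n :: "real^'d"
  assumes n: "norm n = 1" and H: "affine hull S = {x. n \<bullet> x = \<alpha>}"
  shows "S \<noteq> {}"
proof
  assume S: "S = {}"
  have "\<alpha> *\<^sub>R n \<in> affine hull S" unfolding H using n by (simp add: norm_eq_1)
  then show False using S by simp
qed

text \<open>Fubini along the normal: an orthonormal frame of the hyperplane becomes an orthonormal basis of the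
  space when \<open>n\<close> is added to it.\<close>
lemma nn_integral_lborel_slices:
  fixes n :: "real^'d"
  assumes n: "norm n = 1" and H: "affine hull S = {x. n \<bullet> x = \<alpha>}"
    and g[measurable]: "g \<in> borel_measurable borel"
  shows "(\<integral>\<^sup>+x. g x \<partial>lborel) = (\<integral>\<^sup>+\<tau>. (\<integral>\<^sup>+x. g (x + \<tau> *\<^sub>R n) \<partial>surface_lborel S) \<partial>lborel)"
proof -
  have "S \<noteq> {}" by (rule hyperplane_hull_nonempty[OF n H])
  then obtain a B where fr: "orthonormal_frame S a B" and
    sl: "surface_lborel S = distr (\<Pi>\<^sub>M b\<in>B. lborel) borel (\<lambda>c. a + (\<Sum>b\<in>B. c b *\<^sub>R b))"
    by (rule surface_lborel_frame)
  note f = orthonormal_frame_insert_normal[OF n H fr]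
  let ?\<psi> = "\<lambda>c. \<Sum>b\<in>insert n B. c b *\<^sub>R b"
  interpret product_sigma_finite "\<lambda>_::real^'d. (lborel :: real measure)" by standard
  have upd: "?\<psi> (x(n := \<tau>)) = (\<Sum>b\<in>B. x b *\<^sub>R b) + \<tau> *\<^sub>R n" for x \<tau>
    using f(3,4) by (auto intro!: sum.cong)
  have "(\<integral>\<^sup>+x. g x \<partial>lborel) = (\<integral>\<^sup>+x. g x \<partial>distr lborel borel ((+) a))" by (simp add: lborel_distr_plus)
  also have "\<dots> = (\<integral>\<^sup>+x. g (a + x) \<partial>lborel)" by (rule nn_integral_distr) auto
  also have "\<dots> = (\<integral>\<^sup>+x. g (a + x) \<partial>distr (\<Pi>\<^sub>M b\<in>insert n B. lborel) borel ?\<psi>)"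
    using lborel_orthonormal[OF f(5) f(7) f(6)] by simp
  also have "\<dots> = (\<integral>\<^sup>+c. g (a + ?\<psi> c) \<partial>(\<Pi>\<^sub>M b\<in>insert n B. lborel))"
    by (rule nn_integral_distr) measurable
  also have "\<dots> = (\<integral>\<^sup>+\<tau>. (\<integral>\<^sup>+x. g (a + ?\<psi> (x(n := \<tau>))) \<partial>(\<Pi>\<^sub>M b\<in>B. lborel)) \<partial>lborel)"
    by (rule product_nn_integral_insert_rev[OF f(4,3)]) measurable
  also have "\<dots> = (\<integral>\<^sup>+\<tau>. (\<integral>\<^sup>+x. g (x + \<tau> *\<^sub>R n) \<partial>surface_lborel S) \<partial>lborel)"
    unfolding sl upd by (intro nn_integral_cong, subst nn_integral_distr) (auto simp: add.assoc)
  finally show ?thesis .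
qed

lemma AE_surface_lborel:
  fixes n :: "real^'d"
  assumes n: "norm n = 1" and H: "affine hull S = {x. n \<bullet> x = \<alpha>}"
  shows "AE x in surface_lborel S. n \<bullet> x = \<alpha>"
proof -
  have "S \<noteq> {}" by (rule hyperplane_hull_nonempty[OF n H])
  then obtain a B where fr: "orthonormal_frame S a B" and
    sl: "surface_lborel S = distr (\<Pi>\<^sub>M b\<in>B. lborel) borel (\<lambda>c. a + (\<Sum>b\<in>B. c b *\<^sub>R b))"
    by (rule surface_lborel_frame)
  note f = orthonormal_frame_insert_normal[OF n H fr]
  show ?thesis unfolding sl
    by (subst AE_distr_iff) (auto simp: inner_add_right inner_sum_right f(1,2))
qed

lemma emeasure_surface_lborel_bounded:
  fixes n :: "real^'d"
  assumes n: "norm n = 1" and H: "affine hull S = {x. n \<bullet> x = \<alpha>}" and A: "bounded A" "A \<in> sets borel"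
  shows "emeasure (surface_lborel S) A < \<infinity>"
proof -
  obtain r where r: "A \<subseteq> ball 0 r" using A(1) by (meson bounded_subset_ballD)
  have "emeasure (surface_lborel S) A \<le> emeasure (surface_lborel S) (ball 0 r)"
    using r by (intro emeasure_mono) auto
  also have "\<dots> = (\<integral>\<^sup>+\<tau>. emeasure (surface_lborel S) (ball 0 r) * indicator {0..1::real} \<tau> \<partial>lborel)"
    by (simp add: nn_integral_cmult)
  also have "\<dots> \<le> (\<integral>\<^sup>+\<tau>. (\<integral>\<^sup>+x. indicator (ball 0 (r + 1)) (x + \<tau> *\<^sub>R n) \<partial>surface_lborel S) \<partial>lborel)"
  proof (rule nn_integral_mono)
    fix \<tau> :: real
    have "x + \<tau> *\<^sub>R n \<in> ball 0 (r + 1)" if "x \<in> ball 0 r" "0 \<le> \<tau>" "\<tau> \<le> 1" for x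
      using that norm_triangle_ineq[of x "\<tau> *\<^sub>R n"] n by simp
    then have "\<tau> \<in> {0..1} \<Longrightarrow> (\<integral>\<^sup>+x. indicator (ball 0 r) x \<partial>surface_lborel S)
      \<le> (\<integral>\<^sup>+x. indicator (ball 0 (r + 1)) (x + \<tau> *\<^sub>R n) \<partial>surface_lborel S)"
      by (intro nn_integral_mono) (auto split: split_indicator)
    then show "emeasure (surface_lborel S) (ball 0 r) * indicator {0..1} \<tau>
      \<le> (\<integral>\<^sup>+x. indicator (ball 0 (r + 1)) (x + \<tau> *\<^sub>R n) \<partial>surface_lborel S)"
      by (cases "\<tau> \<in> {0..1}") auto
  qed
  also have "\<dots> = emeasure lborel (ball 0 (r + 1) :: (real^'d) set)"
    by (subst nn_integral_lborel_slices[OF n H, of "indicator (ball 0 (r + 1))", symmetric])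
       (auto intro!: borel_measurable_indicator)
  also have "\<dots> < \<infinity>" by (rule emeasure_bounded_finite) simp
  finally show ?thesis .
qed

lemma sigma_finite_surface_lborel:
  fixes n :: "real^'d"
  assumes n: "norm n = 1" and H: "affine hull S = {x. n \<bullet> x = \<alpha>}"
  shows "sigma_finite_measure (surface_lborel S)"
proof (rule sigma_finite_measure.intro, intro exI conjI)
  show "countable (range (\<lambda>n::nat. ball (0::real^'d) n))" by simp
  show "\<Union> (range (\<lambda>n::nat. ball (0::real^'d) n)) = space (surface_lborel S)"
    using reals_Archimedean2 by auto
  show "\<forall>A\<in>range (\<lambda>n::nat. ball (0::real^'d) n). emeasure (surface_lborel S) A \<noteq> \<infinity>"
    using emeasure_surface_lborel_bounded[OF n H] by (auto simp: less_top)
qed auto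


text \<open>The slab of thickness \<open>s\<close> over the hyperplane turns surface integrals into volume integrals, for
  which affine changes of variables are available.\<close>
lemma nn_integral_slab:
  fixes n :: "real^'d"
  assumes n: "norm n = 1" and H: "affine hull S = {x. n \<bullet> x = \<alpha>}" and s: "0 \<le> s"
    and \<psi>[measurable]: "\<psi> \<in> borel_measurable borel"
  shows "(\<integral>\<^sup>+y. \<psi> (y - (n \<bullet> y - \<alpha>) *\<^sub>R n) * indicator {0..s} (n \<bullet> y - \<alpha>) \<partial>lborel)
    = ennreal s * (\<integral>\<^sup>+x. \<psi> x \<partial>surface_lborel S)"
proof -
  have nn: "n \<bullet> n = 1" using n by (simp add: norm_eq_1)
  have "(\<integral>\<^sup>+y. \<psi> (y - (n \<bullet> y - \<alpha>) *\<^sub>R n) * indicator {0..s} (n \<bullet> y - \<alpha>) \<partial>lborel)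
    = (\<integral>\<^sup>+\<tau>. (\<integral>\<^sup>+x. \<psi> (x + \<tau> *\<^sub>R n - (n \<bullet> (x + \<tau> *\<^sub>R n) - \<alpha>) *\<^sub>R n)
        * indicator {0..s} (n \<bullet> (x + \<tau> *\<^sub>R n) - \<alpha>) \<partial>surface_lborel S) \<partial>lborel)"
    by (rule nn_integral_lborel_slices[OF n H]) simp
  also have "\<dots> = (\<integral>\<^sup>+\<tau>. (\<integral>\<^sup>+x. \<psi> x * indicator {0..s} \<tau> \<partial>surface_lborel S) \<partial>lborel)"
    by (intro nn_integral_cong nn_integral_cong_AE eventually_mono[OF AE_surface_lborel[OF n H]])
       (simp add: inner_add_right nn)
  also have "\<dots> = (\<integral>\<^sup>+\<tau>. (\<integral>\<^sup>+x. \<psi> x \<partial>surface_lborel S) * indicator {0..s} \<tau> \<partial>lborel)"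
    by (intro nn_integral_cong nn_integral_multc) simp
  also have "\<dots> = ennreal s * (\<integral>\<^sup>+x. \<psi> x \<partial>surface_lborel S)"
    using s by (simp add: nn_integral_cmult mult.commute)
  finally show ?thesis .
qed

section \<open>The divergence theorem on a simplex\<close>

text \<open>A dilation by \<open>s\<close> about \<open>c\<close> followed by a translation along \<open>n\<close> maps the hyperplane to itself. Its
  factor \<open>s\<^sup>d\<^sup>-\<^sup>1\<close> comes from the volume factor \<open>s\<^sup>d\<close> on a slab, divided by the change \<open>s\<close> of thickness.\<close>
lemma nn_integral_surface_dilation:
  fixes n :: "real^'d"
  assumes n: "norm n = 1" and H: "affine hull S = {x. n \<bullet> x = \<alpha>}" and s: "0 < s"
    and c: "n \<bullet> c = \<alpha> - \<eta>" and \<psi>[measurable]: "\<psi> \<in> borel_measurable borel"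
  shows "(\<integral>\<^sup>+x. \<psi> x \<partial>surface_lborel S)
    = ennreal (s ^ (CARD('d) - 1)) * (\<integral>\<^sup>+x. \<psi> (c + s *\<^sub>R (x - c) + ((1 - s) * \<eta>) *\<^sub>R n) \<partial>surface_lborel S)"
    (is "?J = _ * ?J'")
proof -
  have nn: "n \<bullet> n = 1" using n by (simp add: norm_eq_1)
  define t where "t = (1 - s) *\<^sub>R (c + \<eta> *\<^sub>R n)"
  have \<theta>: "c + s *\<^sub>R (x - c) + ((1 - s) * \<eta>) *\<^sub>R n = t + s *\<^sub>R x" for x
    by (simp add: t_def algebra_simps)
  have nt: "n \<bullet> (t + s *\<^sub>R y) - \<alpha> = s * (n \<bullet> y - \<alpha>)" for y
    by (simp add: t_def inner_add_right inner_diff_right c nn algebra_simps)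
  have "ennreal (s ^ CARD('d)) * ?J' = ennreal (s ^ CARD('d)) *
      (\<integral>\<^sup>+y. \<psi> (t + s *\<^sub>R (y - (n \<bullet> y - \<alpha>) *\<^sub>R n)) * indicator {0..1} (n \<bullet> y - \<alpha>) \<partial>lborel)"
    unfolding \<theta> using nn_integral_slab[OF n H, of 1 "\<lambda>x. \<psi> (t + s *\<^sub>R x)"] by simp
  also have "\<dots> = ennreal (s ^ CARD('d)) *
      (\<integral>\<^sup>+y. \<psi> (t + s *\<^sub>R y - (n \<bullet> (t + s *\<^sub>R y) - \<alpha>) *\<^sub>R n)
        * indicator {0..s} (n \<bullet> (t + s *\<^sub>R y) - \<alpha>) \<partial>lborel)"
  proof -
    have "indicator {0..s} (s * z) = (indicator {0..1} z :: ennreal)" for z :: real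
      using s by (simp add: indicator_def zero_le_mult_iff)
    then show ?thesis unfolding nt by (simp add: scaleR_diff_right add_diff_eq)
  qed
  also have "\<dots> = (\<integral>\<^sup>+y. \<psi> (y - (n \<bullet> y - \<alpha>) *\<^sub>R n) * indicator {0..s} (n \<bullet> y - \<alpha>) \<partial>lborel)"
    using s by (subst (2) lborel_affine[of s t]) (simp_all add: nn_integral_density nn_integral_distr nn_integral_cmult)
  also have "\<dots> = ennreal s * ?J" using s by (intro nn_integral_slab[OF n H]) auto
  finally have *: "ennreal (s ^ CARD('d)) * ?J' = ennreal s * ?J" .
  have "s ^ CARD('d) = s * s ^ (CARD('d) - 1)"
    by (metis Suc_pred' power_Suc zero_less_card_finite)
  then have "ennreal s * ?J = ennreal s * (ennreal (s ^ (CARD('d) - 1)) * ?J')"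
    using * s by (simp add: ennreal_mult mult.assoc)
  then have "ennreal s * ?J / ennreal s = ennreal s * (ennreal (s ^ (CARD('d) - 1)) * ?J') / ennreal s" by simp
  then show ?thesis using s by (simp add: mult_divide_eq_ennreal mult.commute[of "ennreal s"])
qed

text \<open>Polar coordinates with apex \<open>c\<close>, where the hyperplane plays the part of the sphere.\<close>
lemma nn_integral_cone:
  fixes n :: "real^'d"
  assumes n: "norm n = 1" and H: "affine hull S = {x. n \<bullet> x = \<alpha>}" and \<eta>: "0 < \<eta>"
    and c: "n \<bullet> c = \<alpha> - \<eta>" and G[measurable]: "G \<in> borel_measurable borel"
  shows "(\<integral>\<^sup>+y. G y * indicator {\<alpha> - \<eta> <.. \<alpha>} (n \<bullet> y) \<partial>lborel)
    = (\<integral>\<^sup>+s. (\<integral>\<^sup>+x. ennreal (\<eta> * s ^ (CARD('d) - 1)) * G (c + s *\<^sub>R (x - c)) \<partial>surface_lborel S)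
        * indicator {0 <.. 1} s \<partial>lborel)"
proof -
  have nn: "n \<bullet> n = 1" using n by (simp add: norm_eq_1)
  interpret sigma_finite_measure "surface_lborel S" by (rule sigma_finite_surface_lborel[OF n H])
  have "(\<integral>\<^sup>+y. G y * indicator {\<alpha> - \<eta> <.. \<alpha>} (n \<bullet> y) \<partial>lborel)
    = (\<integral>\<^sup>+\<tau>. (\<integral>\<^sup>+x. G (x + \<tau> *\<^sub>R n) * indicator {\<alpha> - \<eta> <.. \<alpha>} (n \<bullet> (x + \<tau> *\<^sub>R n)) \<partial>surface_lborel S) \<partial>lborel)"
    by (rule nn_integral_lborel_slices[OF n H]) simp
  also have "\<dots> = (\<integral>\<^sup>+\<tau>. (\<integral>\<^sup>+x. G (x + \<tau> *\<^sub>R n) * indicator {- \<eta> <.. 0} \<tau> \<partial>surface_lborel S) \<partial>lborel)"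
    by (intro nn_integral_cong nn_integral_cong_AE eventually_mono[OF AE_surface_lborel[OF n H]])
       (auto simp: inner_add_right nn split: split_indicator)
  also have "\<dots> = (\<integral>\<^sup>+\<tau>. (\<integral>\<^sup>+x. G (x + \<tau> *\<^sub>R n) \<partial>surface_lborel S) * indicator {- \<eta> <.. 0} \<tau> \<partial>lborel)"
    by (intro nn_integral_cong nn_integral_multc) simp
  also have "\<dots> = ennreal \<eta> * (\<integral>\<^sup>+s. (\<integral>\<^sup>+x. G (x + (- \<eta> + \<eta> * s) *\<^sub>R n) \<partial>surface_lborel S)
      * indicator {- \<eta> <.. 0} (- \<eta> + \<eta> * s) \<partial>lborel)"
    using \<eta> by (subst nn_integral_real_affine[of _ \<eta> "- \<eta>"]) auto
  also have "\<dots> = (\<integral>\<^sup>+s. ennreal \<eta> * ((\<integral>\<^sup>+x. G (x + (- \<eta> + \<eta> * s) *\<^sub>R n) \<partial>surface_lborel S)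
      * indicator {- \<eta> <.. 0} (- \<eta> + \<eta> * s)) \<partial>lborel)"
    by (rule nn_integral_cmult[symmetric]) simp
  also have "\<dots> = (\<integral>\<^sup>+s. (\<integral>\<^sup>+x. ennreal (\<eta> * s ^ (CARD('d) - 1)) * G (c + s *\<^sub>R (x - c)) \<partial>surface_lborel S)
        * indicator {0 <.. 1} s \<partial>lborel)"
  proof (rule nn_integral_cong)
    fix s :: real
    show "ennreal \<eta> * ((\<integral>\<^sup>+x. G (x + (- \<eta> + \<eta> * s) *\<^sub>R n) \<partial>surface_lborel S)
        * indicator {- \<eta> <.. 0} (- \<eta> + \<eta> * s))
      = (\<integral>\<^sup>+x. ennreal (\<eta> * s ^ (CARD('d) - 1)) * G (c + s *\<^sub>R (x - c)) \<partial>surface_lborel S)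
        * indicator {0 <.. 1} s"
    proof (cases "s \<in> {0 <.. 1}")
      case True
      then have s: "0 < s" "s \<le> 1" by auto
      have "- \<eta> + \<eta> * s \<in> {- \<eta> <.. 0}" using s \<eta> by (auto simp: mult_left_le)
      moreover have "(\<integral>\<^sup>+x. G (x + (- \<eta> + \<eta> * s) *\<^sub>R n) \<partial>surface_lborel S)
        = ennreal (s ^ (CARD('d) - 1)) * (\<integral>\<^sup>+x. G (c + s *\<^sub>R (x - c)) \<partial>surface_lborel S)"
        by (subst nn_integral_surface_dilation[OF n H s(1) c])
           (simp_all add: algebra_simps flip: scaleR_add_left)
      ultimately show ?thesis using True \<eta>
        by (simp add: nn_integral_cmult ennreal_mult mult.assoc)
    next
      case False
      then have "- \<eta> + \<eta> * s \<notin> {- \<eta> <.. 0}"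
        using \<eta> by (auto simp: not_less not_le zero_less_mult_iff)
      then show ?thesis using False by simp
    qed
  qed
  finally show ?thesis .
qed

text \<open>In the cone with apex \<open>c\<close> and base \<open>e\<close>, the integrand on the ray through \<open>x \<in> e\<close> is, up to the
  Jacobian, the derivative of \<open>\<eta> s\<^sup>d f (c + s (x - c))\<close> with respect to \<open>s\<close>. This is the divergence theorem for the
  field \<open>f x *\<^sub>R (x - c)\<close>, whose flux through the lateral faces vanishes.\<close>
lemma nn_cone_divergence:
  fixes n :: "real^'d"
  assumes n: "norm n = 1" and H: "affine hull e = {x. n \<bullet> x = \<alpha>}" and \<eta>: "0 < \<eta>"
    and c: "n \<bullet> c = \<alpha> - \<eta>" and e: "compact e"
    and K: "K = (\<lambda>(s, x). c + s *\<^sub>R (x - c)) ` ({0..1} \<times> e)"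
    and f: "\<And>x. (f has_derivative (\<lambda>h. g x \<bullet> h)) (at x)" and g: "continuous_on UNIV g"
    and pos: "\<And>x. x \<in> K \<Longrightarrow> 0 \<le> real CARD('d) * f x + g x \<bullet> (x - c)"
  shows "(\<integral>\<^sup>+x. ennreal (real CARD('d) * f x + g x \<bullet> (x - c)) * indicator K x \<partial>lborel)
    = (\<integral>\<^sup>+x. ennreal (\<eta> * f x) * indicator e x \<partial>surface_lborel e)"
proof -
  let ?d = "real CARD('d)" and ?m = "CARD('d) - 1"
  have en: "n \<bullet> x = \<alpha>" if "x \<in> e" for x using that H hull_inc[of x e] by auto
  have cf: "continuous_on UNIV f"
    using f by (intro continuous_at_imp_continuous_on ballI) (auto intro: has_derivative_continuous)
  have [measurable]: "f \<in> borel_measurable borel" "g \<in> borel_measurable borel"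
    using cf g by (auto intro: borel_measurable_continuous_onI)
  have cK: "compact K" unfolding K
    by (intro compact_continuous_image compact_Times e) (auto intro!: continuous_intros simp: case_prod_unfold)
  have [measurable]: "K \<in> sets borel" "e \<in> sets borel" using cK e by (auto intro: borel_compact)
  define G where "G x = ennreal (?d * f x + g x \<bullet> (x - c)) * indicator K x" for x
  have [measurable]: "G \<in> borel_measurable borel" unfolding G_def by measurable
  interpret S: sigma_finite_measure "surface_lborel e" by (rule sigma_finite_surface_lborel[OF n H])
  interpret P: pair_sigma_finite "surface_lborel e" "lborel :: real measure" by standard
  have neg: "AE x in lborel. n \<bullet> x \<noteq> \<alpha> - \<eta>"
  proof -
    have "negligible {x. n \<bullet> x = \<alpha> - \<eta>}" using n by (intro negligible_hyperplane) auto
    moreover have "closed {x. n \<bullet> x = \<alpha> - \<eta>}" by (rule closed_hyperplane)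
    ultimately have "{x. n \<bullet> x = \<alpha> - \<eta>} \<in> null_sets lborel"
      by (intro null_setsI) (auto simp: negligible_iff_null_sets null_sets_def dest: borel_closed)
    from AE_not_in[OF this] show ?thesis by simp
  qed
  have Kn: "n \<bullet> (c + s *\<^sub>R (x - c)) = \<alpha> - \<eta> + s * \<eta>" if "n \<bullet> x = \<alpha>" for s x
    using that c by (simp add: inner_add_right inner_diff_right)
  have Kstrip: "n \<bullet> y \<le> \<alpha> \<and> \<alpha> - \<eta> \<le> n \<bullet> y" if yK: "y \<in> K" for y
  proof -
    obtain s x where "0 \<le> s" "s \<le> 1" "x \<in> e" "y = c + s *\<^sub>R (x - c)" using yK by (auto simp: K)
    then show ?thesis using Kn[of x s] en \<eta> by (auto simp: mult_left_le_one_le)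
  qed
  have memK: "c + s *\<^sub>R (x - c) \<in> K \<longleftrightarrow> x \<in> e" if "n \<bullet> x = \<alpha>" "0 < s" "s \<le> 1" for s x
  proof
    assume "c + s *\<^sub>R (x - c) \<in> K"
    then obtain s' x' where *: "c + s *\<^sub>R (x - c) = c + s' *\<^sub>R (x' - c)" "x' \<in> e" by (auto simp: K)
    have "s * \<eta> = s' * \<eta>" using arg_cong[OF *(1), of "\<lambda>y. n \<bullet> y"] Kn[of x s] Kn[of x' s'] en[OF *(2)] that by auto
    with \<eta> have "s = s'" by simp
    with * that show "x \<in> e" by simp
  qed (use that in \<open>auto simp: K\<close>)
  have "(\<integral>\<^sup>+x. G x \<partial>lborel) = (\<integral>\<^sup>+y. G y * indicator {\<alpha> - \<eta> <.. \<alpha>} (n \<bullet> y) \<partial>lborel)"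
  proof (intro nn_integral_cong_AE eventually_mono[OF neg])
    fix y assume "n \<bullet> y \<noteq> \<alpha> - \<eta>"
    then have "G y \<noteq> 0 \<Longrightarrow> n \<bullet> y \<in> {\<alpha> - \<eta> <.. \<alpha>}"
      using Kstrip[of y] by (cases "y \<in> K") (auto simp: G_def)
    then show "G y = G y * indicator {\<alpha> - \<eta> <.. \<alpha>} (n \<bullet> y)" by (cases "G y = 0") auto
  qed
  also have "\<dots> = (\<integral>\<^sup>+s. (\<integral>\<^sup>+x. ennreal (\<eta> * s ^ ?m) * G (c + s *\<^sub>R (x - c)) \<partial>surface_lborel e)
        * indicator {0 <.. 1} s \<partial>lborel)"
    by (rule nn_integral_cone[OF n H \<eta> c]) simp
  also have "\<dots> = (\<integral>\<^sup>+s. (\<integral>\<^sup>+x. ennreal (\<eta> * s ^ ?m) * G (c + s *\<^sub>R (x - c)) * indicator {0 <.. 1} s \<partial>surface_lborel e) \<partial>lborel)"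
    by (intro nn_integral_cong nn_integral_multc[symmetric]) simp
  also have "\<dots> = (\<integral>\<^sup>+x. (\<integral>\<^sup>+s. ennreal (\<eta> * s ^ ?m) * G (c + s *\<^sub>R (x - c)) * indicator {0 <.. 1} s \<partial>lborel) \<partial>surface_lborel e)"
    by (rule P.Fubini'[of "\<lambda>x s. ennreal (\<eta> * s ^ ?m) * G (c + s *\<^sub>R (x - c)) * indicator {0 <.. 1} s"]) simp
  also have "\<dots> = (\<integral>\<^sup>+x. ennreal (\<eta> * f x) * indicator e x \<partial>surface_lborel e)"
  proof (rule nn_integral_cong_AE, rule eventually_mono[OF AE_surface_lborel[OF n H]])
    fix x assume x: "n \<bullet> x = \<alpha>"
    show "(\<integral>\<^sup>+s. ennreal (\<eta> * s ^ ?m) * G (c + s *\<^sub>R (x - c)) * indicator {0 <.. 1} s \<partial>lborel)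
      = ennreal (\<eta> * f x) * indicator e x"
    proof (cases "x \<in> e")
      case False
      then have "(\<integral>\<^sup>+s. ennreal (\<eta> * s ^ ?m) * G (c + s *\<^sub>R (x - c)) * indicator {0 <.. 1} s \<partial>lborel)
        = (\<integral>\<^sup>+s. 0 \<partial>(lborel :: real measure))"
        using memK[OF x] by (intro nn_integral_cong) (auto simp: G_def split: split_indicator)
      then show ?thesis using False by simp
    next
      case True
      define y where "y s = c + s *\<^sub>R (x - c)" for s
      define D where "D s = \<eta> * s ^ ?m * (?d * f (y s) + g (y s) \<bullet> (y s - c))" for s
      have [measurable]: "D \<in> borel_measurable borel" unfolding D_def y_def by measurable
      have yK: "y s \<in> K" if "0 \<le> s" "s \<le> 1" for s using that True by (auto simp: y_def K)
      have "AE s in lborel. s \<noteq> (0::real)"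
        by (rule AE_lborel_singleton)
      then have "(\<integral>\<^sup>+s. ennreal (\<eta> * s ^ ?m) * G (c + s *\<^sub>R (x - c)) * indicator {0 <.. 1} s \<partial>lborel)
        = (\<integral>\<^sup>+s. ennreal (D s) * indicator {0 .. 1} s \<partial>lborel)"
      proof (intro nn_integral_cong_AE, elim eventually_mono)
        fix s :: real assume s0: "s \<noteq> 0"
        show "ennreal (\<eta> * s ^ ?m) * G (c + s *\<^sub>R (x - c)) * indicator {0 <.. 1} s = ennreal (D s) * indicator {0 .. 1} s"
        proof (cases "s \<in> {0 <.. 1}")
          case True
          then have "y s \<in> K" using yK by auto
          then have "ennreal (\<eta> * s ^ ?m) * G (y s) = ennreal (D s)"
            unfolding G_def D_def using pos \<eta> True by (subst ennreal_mult) auto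
          then show ?thesis using True by (simp add: y_def)
        qed (use s0 in auto)
      qed
      also have "\<dots> = ennreal (\<eta> * 1 ^ CARD('d) * f (y 1) - \<eta> * 0 ^ CARD('d) * f (y 0))"
      proof (rule nn_integral_FTC_Icc[of D 0 1 "\<lambda>s. \<eta> * s ^ CARD('d) * f (y s)"])
        fix s :: real assume "s \<in> {0..1}"
        then have s: "0 \<le> s" "s \<le> 1" by auto
        show "0 \<le> D s" using s yK[OF s] pos \<eta> by (auto simp: D_def)
        have "(y has_derivative (\<lambda>h. h *\<^sub>R (x - c))) (at s)"
          unfolding y_def by (auto intro!: derivative_eq_intros)
        from has_derivative_compose[OF this f]
        have fd: "((\<lambda>s. f (y s)) has_real_derivative g (y s) \<bullet> (x - c)) (at s)"
          unfolding has_field_derivative_def by (rule has_derivative_eq_rhs) (simp add: fun_eq_iff mult.commute)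
        have *: "((\<lambda>s. \<eta> * s ^ CARD('d) * f (y s)) has_real_derivative
            \<eta> * (?d * s ^ ?m) * f (y s) + \<eta> * s ^ CARD('d) * (g (y s) \<bullet> (x - c))) (at s)"
          by (auto intro!: derivative_eq_intros fd)
        have dS: "CARD('d) = Suc ?m" by (simp add: Suc_pred')
        have "s ^ CARD('d) = s ^ ?m * s" by (subst dS) (rule power_Suc2)
        with * show "((\<lambda>s. \<eta> * s ^ CARD('d) * f (y s)) has_real_derivative D s) (at s)"
          by (simp add: D_def y_def algebra_simps)
      qed (auto)
      finally show ?thesis using True by (simp add: y_def zero_power)
    qed
  qed
  finally show ?thesis unfolding G_def .
qed

lemma set_integrable_compact_finite:
  fixes f :: "'a::euclidean_space \<Rightarrow> real"
  assumes K: "compact K" and N: "sets N = sets borel" "emeasure N K < \<infinity>" and f: "continuous_on UNIV f"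
  shows "set_integrable N K f"
proof -
  have "bounded (f ` K)"
    using K f by (intro compact_imp_bounded compact_continuous_image) (auto intro: continuous_on_subset)
  then obtain B where B: "\<And>x. x \<in> K \<Longrightarrow> norm (f x) \<le> B" by (auto simp: bounded_iff)
  have "f \<in> borel_measurable N" unfolding measurable_cong_sets[OF N(1) refl]
    using f by (rule borel_measurable_continuous_onI)
  moreover have "K \<in> sets N" using K N(1) by (simp add: borel_compact)
  ultimately show ?thesis unfolding set_integrable_def
    using B N(2) by (intro integrableI_bounded_set_indicator[where B=B]) auto
qed

lemma nn_set_integral_compact:
  fixes f :: "'a::euclidean_space \<Rightarrow> real"
  assumes K: "compact K" and N: "sets N = sets borel" "emeasure N K < \<infinity>" and f: "continuous_on UNIV f"
    and pos: "\<And>x. x \<in> K \<Longrightarrow> 0 \<le> f x"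
  shows "(\<integral>\<^sup>+x. ennreal (f x) * indicator K x \<partial>N) = ennreal (LINT x:K|N. f x)"
proof -
  have "(\<integral>\<^sup>+x. ennreal (f x) * indicator K x \<partial>N) = (\<integral>\<^sup>+x. ennreal (indicator K x *\<^sub>R f x) \<partial>N)"
    by (intro nn_integral_cong) (auto split: split_indicator)
  also have "\<dots> = ennreal (LINT x:K|N. f x)" unfolding set_lebesgue_integral_def
  proof (rule nn_integral_eq_integral)
    show "integrable N (\<lambda>x. indicat_real K x *\<^sub>R f x)"
      using set_integrable_compact_finite[OF K N f] unfolding set_integrable_def .
    show "AE x in N. 0 \<le> indicat_real K x *\<^sub>R f x"
      using pos by (intro AE_I2) (simp split: split_indicator)
  qed
  finally show ?thesis .
qed

text \<open>The sign condition is removed by adding a large constant to \<open>f\<close> and subtracting the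
  identity for the constant.\<close>
lemma cone_divergence:
  fixes n :: "real^'d"
  assumes n: "norm n = 1" and H: "affine hull e = {x. n \<bullet> x = \<alpha>}" and \<eta>: "0 < \<eta>"
    and c: "n \<bullet> c = \<alpha> - \<eta>" and e: "compact e"
    and K: "K = (\<lambda>(s, x). c + s *\<^sub>R (x - c)) ` ({0..1} \<times> e)"
    and f: "\<And>x. (f has_derivative (\<lambda>h. g x \<bullet> h)) (at x)" and g: "continuous_on UNIV g"
  shows "(LINT x:K|lborel. real CARD('d) * f x + g x \<bullet> (x - c)) = \<eta> * (LINT x:e|surface_lborel e. f x)"
proof -
  let ?d = "real CARD('d)"
  let ?\<phi> = "\<lambda>x. ?d * f x + g x \<bullet> (x - c)"
  have cf: "continuous_on UNIV f"
    using f by (intro continuous_at_imp_continuous_on ballI) (auto intro: has_derivative_continuous)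
  have c\<phi>: "continuous_on UNIV ?\<phi>" using cf g by (intro continuous_intros)
  have cK: "compact K" unfolding K
    by (intro compact_continuous_image compact_Times e) (auto intro!: continuous_intros simp: case_prod_unfold)
  have "bounded (?\<phi> ` K \<union> f ` e)"
    using cK e c\<phi> cf by (auto intro!: compact_imp_bounded compact_continuous_image intro: continuous_on_subset simp: bounded_Un)
  then obtain M where M: "\<And>z. z \<in> ?\<phi> ` K \<union> f ` e \<Longrightarrow> norm z \<le> M" "M > 0" by (auto simp: bounded_pos)
  have d1: "?d \<ge> 1" by (simp add: Suc_leI)
  then have dM: "?d * M \<ge> M" using M(2) by simp
  have fK: "emeasure lborel K < \<infinity>" using cK by (intro emeasure_bounded_finite compact_imp_bounded)
  have fe: "emeasure (surface_lborel e) e < \<infinity>"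
    using e by (intro emeasure_surface_lborel_bounded[OF n H] compact_imp_bounded borel_compact)
  have eqM: "?d * (f x + M) + g x \<bullet> (x - c) = ?\<phi> x + ?d * M" for x by (simp add: algebra_simps)
  have posK: "0 \<le> ?d * (f x + M) + g x \<bullet> (x - c)" if "x \<in> K" for x
    unfolding eqM using M(1)[of "?\<phi> x"] that dM by (auto simp: abs_le_iff)
  have pose: "0 \<le> \<eta> * (f x + M)" if "x \<in> e" for x
    using M(1)[of "f x"] that \<eta> by (auto simp: abs_le_iff)
  have "ennreal (LINT x:K|lborel. ?d * (f x + M) + g x \<bullet> (x - c))
      = (\<integral>\<^sup>+x. ennreal (?d * (f x + M) + g x \<bullet> (x - c)) * indicator K x \<partial>lborel)"
    by (rule nn_set_integral_compact[OF cK _ fK _ posK, symmetric]) (simp_all add: cf g continuous_intros)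
  also have "\<dots> = (\<integral>\<^sup>+x. ennreal (\<eta> * (f x + M)) * indicator e x \<partial>surface_lborel e)"
    by (rule nn_cone_divergence[OF n H \<eta> c e K _ g posK]) (auto intro!: derivative_eq_intros f)
  also have "\<dots> = ennreal (LINT x:e|surface_lborel e. \<eta> * (f x + M))"
    by (rule nn_set_integral_compact[OF e _ fe _ pose]) (simp_all add: cf continuous_intros)
  finally have 1: "ennreal (LINT x:K|lborel. ?d * (f x + M) + g x \<bullet> (x - c))
    = ennreal (LINT x:e|surface_lborel e. \<eta> * (f x + M))" .
  have "0 \<le> (LINT x:K|lborel. ?d * (f x + M) + g x \<bullet> (x - c))"
    unfolding set_lebesgue_integral_def using posK
    by (intro integral_nonneg_AE) (auto split: split_indicator)
  moreover have "0 \<le> (LINT x:e|surface_lborel e. \<eta> * (f x + M))"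
    unfolding set_lebesgue_integral_def using pose
    by (intro integral_nonneg_AE) (auto split: split_indicator)
  ultimately have 1: "(LINT x:K|lborel. ?\<phi> x + ?d * M) = (LINT x:e|surface_lborel e. \<eta> * f x + \<eta> * M)"
    using 1 unfolding eqM by (simp add: distrib_left)
  have "ennreal (LINT x:K|lborel. ?d * M) = (\<integral>\<^sup>+x. ennreal (?d * M) * indicator K x \<partial>lborel)"
    using M by (intro nn_set_integral_compact[OF cK _ fK, symmetric]) auto
  also have "\<dots> = (\<integral>\<^sup>+x. ennreal (?d * M + 0 \<bullet> (x - c)) * indicator K x \<partial>lborel)" by simp
  also have "\<dots> = (\<integral>\<^sup>+x. ennreal (\<eta> * M) * indicator e x \<partial>surface_lborel e)"
    using M by (intro nn_cone_divergence[OF n H \<eta> c e K]) auto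
  also have "\<dots> = ennreal (LINT x:e|surface_lborel e. \<eta> * M)"
    using M \<eta> by (intro nn_set_integral_compact[OF e _ fe]) auto
  finally have 2: "(LINT x:K|lborel. ?d * M) = (LINT x:e|surface_lborel e. \<eta> * M)"
    using M \<eta> by (simp add: set_lebesgue_integral_def)
  have "(LINT x:K|lborel. ?\<phi> x + ?d * M) = (LINT x:K|lborel. ?\<phi> x) + (LINT x:K|lborel. ?d * M)"
    by (intro set_integral_add set_integrable_compact_finite[OF cK _ fK] c\<phi>) auto
  moreover have "(LINT x:e|surface_lborel e. \<eta> * f x + \<eta> * M)
      = (LINT x:e|surface_lborel e. \<eta> * f x) + (LINT x:e|surface_lborel e. \<eta> * M)"
    by (intro set_integral_add set_integrable_compact_finite[OF e _ fe] continuous_intros cf) auto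
  ultimately have "(LINT x:K|lborel. ?\<phi> x) = (LINT x:e|surface_lborel e. \<eta> * f x)" using 1 2 by linarith
  then show ?thesis by simp
qed

text \<open>All geometric data of a simplex at once: the vertices \<open>c\<close>, the unit normal \<open>\<nu> c\<close> and the offset \<open>\<alpha> c\<close> of
  the facet opposite to \<open>c\<close>, and the height \<open>\<eta> c\<close> over that facet. The affine functions
  \<open>(\<alpha> c - \<nu> c \<bullet> x) / \<eta> c\<close> are the barycentric coordinates of \<open>x\<close>.\<close>
lemma simplex_barycentric:
  fixes K :: "(real^'d) set"
  assumes K: "int CARD('d) simplex K"
  obtains C and \<nu> :: "real^'d \<Rightarrow> real^'d" and \<alpha> \<eta> :: "real^'d \<Rightarrow> real" where
    "finite C" "card C = Suc CARD('d)" "K = convex hull C"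
    "{e. e facet_of K} = (\<lambda>c. convex hull (C - {c})) ` C" "inj_on (\<lambda>c. convex hull (C - {c})) C"
    "\<And>c. c \<in> C \<Longrightarrow> norm (\<nu> c) = 1" "\<And>c. c \<in> C \<Longrightarrow> 0 < \<eta> c"
    "\<And>c. c \<in> C \<Longrightarrow> outward_normal K (convex hull (C - {c})) = \<nu> c"
    "\<And>c. c \<in> C \<Longrightarrow> affine hull (convex hull (C - {c})) = {x. \<nu> c \<bullet> x = \<alpha> c}"
    "\<And>c. c \<in> C \<Longrightarrow> \<nu> c \<bullet> c = \<alpha> c - \<eta> c"
    "\<And>x. (\<Sum>c\<in>C. (\<alpha> c - \<nu> c \<bullet> x) / \<eta> c) = 1"
    "\<And>x. (\<Sum>c\<in>C. ((\<alpha> c - \<nu> c \<bullet> x) / \<eta> c) *\<^sub>R c) = x"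
    "K = {x. \<forall>c\<in>C. \<nu> c \<bullet> x \<le> \<alpha> c}"
proof -
  obtain C where C: "\<not> affine_dependent C" "int (card C) = int CARD('d) + 1" "K = convex hull C"
    using K unfolding simplex_def by auto
  have fC: "finite C" using aff_independent_finite[OF C(1)] .
  have cC: "card C = Suc CARD('d)" using C(2) by linarith
  define F where "F c = convex hull (C - {c})" for c
  have ne: "C - {c} \<noteq> {}" if "c \<in> C" for c
  proof -
    have "card (C - {c}) = CARD('d)" using fC cC that by simp
    then show ?thesis by (metis card.empty less_irrefl zero_less_card_finite)
  qed
  have facets: "{e. e facet_of K} = F ` C"
    using ne unfolding C(3) facet_of_convex_hull_affine_independent[OF C(1)] F_def by auto
  have cF: "c \<notin> affine hull F c" if "c \<in> C" for c
    using C(1) that unfolding F_def affine_dependent_def by simp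
  have inj: "inj_on F C"
  proof (rule inj_onI, rule ccontr)
    fix c c' assume "c \<in> C" "c' \<in> C" "F c = F c'" "c \<noteq> c'"
    then have "c \<in> F c'" unfolding F_def by (intro hull_inc) auto
    then show False using \<open>F c = F c'\<close> cF[OF \<open>c \<in> C\<close>] hull_inc by metis
  qed
  define \<nu> where "\<nu> c = outward_normal K (F c)" for c
  have \<nu>: "norm (\<nu> c) = 1 \<and> (\<exists>a. (\<forall>x\<in>F c. \<nu> c \<bullet> x = a) \<and> (\<forall>x\<in>K. \<nu> c \<bullet> x \<le> a))" if "c \<in> C" for c
    unfolding \<nu>_def outward_normal_def
    by (rule theI'[OF outward_normal_unique[OF K]]) (use facets that in auto)
  then obtain \<alpha> where \<alpha>: "\<And>c x. c \<in> C \<Longrightarrow> x \<in> F c \<Longrightarrow> \<nu> c \<bullet> x = \<alpha> c"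
    "\<And>c x. c \<in> C \<Longrightarrow> x \<in> K \<Longrightarrow> \<nu> c \<bullet> x \<le> \<alpha> c"
    by metis
  have n1: "norm (\<nu> c) = 1" if "c \<in> C" for c using \<nu> that by blast
  have dimK: "aff_dim K = int CARD('d)" using aff_dim_simplex[OF K] by simp
  have hullF: "affine hull F c = {x. \<nu> c \<bullet> x = \<alpha> c}" if c: "c \<in> C" for c
  proof -
    have "F c facet_of K" using facets c by auto
    then have "aff_dim (F c) = int CARD('d) - 1" "F c \<noteq> {}" using dimK by (auto simp: facet_of_def)
    moreover have "affine hull F c \<subseteq> {x. \<nu> c \<bullet> x = \<alpha> c}"
      using \<alpha>(1)[OF c] by (intro hull_minimal) (auto simp: affine_hyperplane)
    moreover have "aff_dim {x. \<nu> c \<bullet> x = \<alpha> c} = int CARD('d) - 1"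
      using n1[OF c] by (subst aff_dim_hyperplane) auto
    ultimately show ?thesis
      using affine_dim_equal[of "affine hull F c" "{x. \<nu> c \<bullet> x = \<alpha> c}"]
      by (simp add: affine_hyperplane)
  qed
  define \<eta> where "\<eta> c = \<alpha> c - \<nu> c \<bullet> c" for c
  have \<eta>: "0 < \<eta> c" if c: "c \<in> C" for c
  proof -
    have "c \<in> K" using c C(3) hull_inc by metis
    then have "\<nu> c \<bullet> c \<le> \<alpha> c" by (rule \<alpha>(2)[OF c])
    moreover have "\<nu> c \<bullet> c \<noteq> \<alpha> c" using cF[OF c] hullF[OF c] by auto
    ultimately show ?thesis by (simp add: \<eta>_def)
  qed
  define l where "l c x = (\<alpha> c - \<nu> c \<bullet> x) / \<eta> c" for c x
  have lv: "l c v = (if v = c then 1 else 0)" if "c \<in> C" "v \<in> C" for c v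
  proof (cases "v = c")
    case True then show ?thesis using \<eta>[OF that(1)] by (simp add: l_def \<eta>_def)
  next
    case False
    then have "v \<in> F c" using that unfolding F_def by (intro hull_inc) auto
    then show ?thesis using \<alpha>(1)[OF that(1)] False by (simp add: l_def)
  qed
  have "aff_dim C = int CARD('d)" using dimK C(3) by (simp add: aff_dim_convex_hull)
  then have affC: "affine hull C = UNIV" using aff_dim_eq_full[of C] by simp
  have lu: "l c (\<Sum>v\<in>C. u v *\<^sub>R v) = u c" if c: "c \<in> C" and u: "sum u C = 1" for u c
  proof -
    have "l c (\<Sum>v\<in>C. u v *\<^sub>R v) = (\<Sum>v\<in>C. u v * l c v)"
      using u by (simp add: l_def inner_sum_right sum_divide_distrib[symmetric] sum_subtractf right_diff_distrib flip: sum_distrib_right)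
    also have "\<dots> = (\<Sum>v\<in>C. if v = c then u v else 0)" using lv[OF c] by (intro sum.cong) auto
    also have "\<dots> = u c" using c fC by simp
    finally show ?thesis .
  qed
  have rep: "\<exists>u. sum u C = 1 \<and> (\<Sum>v\<in>C. u v *\<^sub>R v) = x" for x
    using affC unfolding affine_hull_finite[OF fC] by auto
  have 1: "(\<Sum>c\<in>C. l c x) = 1 \<and> (\<Sum>c\<in>C. l c x *\<^sub>R c) = x" for x
  proof -
    obtain u where u: "sum u C = 1" "(\<Sum>v\<in>C. u v *\<^sub>R v) = x" using rep by blast
    have "l c x = u c" if "c \<in> C" for c using lu[OF that u(1)] u(2) by simp
    then show ?thesis using u by simp
  qed
  have "K = {x. \<forall>c\<in>C. \<nu> c \<bullet> x \<le> \<alpha> c}"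
  proof (intro set_eqI iffI)
    fix x assume "x \<in> {x. \<forall>c\<in>C. \<nu> c \<bullet> x \<le> \<alpha> c}"
    then have "\<forall>c\<in>C. 0 \<le> l c x" using \<eta> by (auto simp: l_def intro!: divide_nonneg_pos)
    then show "x \<in> K" unfolding C(3) convex_hull_finite[OF fC] using 1[of x] by auto
  qed (use \<alpha>(2) in auto)
  note Kl = this
  show ?thesis
  proof (rule that[of C \<nu> \<eta> \<alpha>])
    show "{e. e facet_of K} = (\<lambda>c. convex hull (C - {c})) ` C" using facets unfolding F_def .
    show "inj_on (\<lambda>c. convex hull (C - {c})) C" using inj unfolding F_def .
    show "outward_normal K (convex hull (C - {c})) = \<nu> c" if "c \<in> C" for c by (simp add: \<nu>_def F_def)
    show "affine hull (convex hull (C - {c})) = {x. \<nu> c \<bullet> x = \<alpha> c}" if "c \<in> C" for c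
      using hullF[OF that] by (simp only: F_def)
    show "(\<Sum>c\<in>C. (\<alpha> c - \<nu> c \<bullet> x) / \<eta> c) = 1" "(\<Sum>c\<in>C. ((\<alpha> c - \<nu> c \<bullet> x) / \<eta> c) *\<^sub>R c) = x" for x
      using 1[of x] by (simp_all only: l_def)
    show "\<nu> c \<bullet> c = \<alpha> c - \<eta> c" if "c \<in> C" for c by (simp add: \<eta>_def)
  qed (fact fC cC C(3) n1 \<eta> Kl)+
qed

lemma set_integral_sum:
  fixes f :: "'i \<Rightarrow> 'a \<Rightarrow> real"
  assumes "\<And>i. i \<in> I \<Longrightarrow> set_integrable M A (f i)"
  shows "(LINT x:A|M. (\<Sum>i\<in>I. f i x)) = (\<Sum>i\<in>I. LINT x:A|M. f i x)"
  using assms unfolding set_lebesgue_integral_def set_integrable_def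
  by (simp add: sum_distrib_left Bochner_Integration.integral_sum)

lemma convex_hull_eq_cone:
  fixes c :: "'a::real_vector"
  assumes cC: "c \<in> C" and ne: "C - {c} \<noteq> {}"
  shows "convex hull C = (\<lambda>(s, x). c + s *\<^sub>R (x - c)) ` ({0..1} \<times> (convex hull (C - {c})))"
proof -
    have "convex hull C = convex hull (insert c (C - {c}))" using cC by (simp add: insert_absorb)
    also have "\<dots> = (\<lambda>(s, x). c + s *\<^sub>R (x - c)) ` ({0..1} \<times> (convex hull (C - {c})))"
    proof (intro set_eqI iffI)
      fix x assume "x \<in> convex hull (insert c (C - {c}))"
      then obtain u v b where uvb: "0 \<le> u" "0 \<le> v" "u + v = 1" "b \<in> convex hull (C - {c})" "x = u *\<^sub>R c + v *\<^sub>R b"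
        unfolding convex_hull_insert[OF ne] by auto
      moreover from this have "u = 1 - v" by simp
      ultimately have "v \<in> {0..1}" "x = c + v *\<^sub>R (b - c)" by (auto simp: algebra_simps)
      then show "x \<in> (\<lambda>(s, x). c + s *\<^sub>R (x - c)) ` ({0..1} \<times> (convex hull (C - {c})))"
        using uvb(4) by (intro image_eqI[of _ _ "(v, b)"]) auto
    next
      fix x assume "x \<in> (\<lambda>(s, x). c + s *\<^sub>R (x - c)) ` ({0..1} \<times> (convex hull (C - {c})))"
      then obtain s b where "0 \<le> s" "s \<le> 1" "b \<in> convex hull (C - {c})" "x = c + s *\<^sub>R (b - c)" by auto
      moreover from this have "x = (1 - s) *\<^sub>R c + s *\<^sub>R b" by (simp add: algebra_simps)
      ultimately show "x \<in> convex hull (insert c (C - {c}))"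
        unfolding convex_hull_insert[OF ne] by (intro CollectI exI[of _ "1 - s"] conjI exI[of _ s] exI[of _ b]) auto
    qed
    finally show ?thesis .
qed

text \<open>A simplex is a cone over each of its facets. The cone identities are added with the weights
  \<open>(\<nu> c \<bullet> v) / \<eta> c\<close>, the negative derivatives of the barycentric coordinates in direction \<open>v\<close>: these sum to \<open>0\<close>, and
  their first moment is \<open>- v\<close>.\<close>
lemma simplex_divergence:
  fixes K :: "(real^'d) set"
  assumes K: "int CARD('d) simplex K"
    and f: "\<And>x. (f has_derivative (\<lambda>h. g x \<bullet> h)) (at x)" and g: "continuous_on UNIV g"
  shows "(LINT x:K|lborel. g x \<bullet> v)
    = (\<Sum>e | e facet_of K. (v \<bullet> outward_normal K e) * (LINT x:e|surface_lborel e. f x))"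
proof -
  obtain C and \<nu> :: "real^'d \<Rightarrow> real^'d" and \<alpha> \<eta> :: "real^'d \<Rightarrow> real" where
    C: "finite C" "card C = Suc CARD('d)" "K = convex hull C"
    "{e. e facet_of K} = (\<lambda>c. convex hull (C - {c})) ` C" "inj_on (\<lambda>c. convex hull (C - {c})) C"
    and \<nu>: "\<And>c. c \<in> C \<Longrightarrow> norm (\<nu> c) = 1" and \<eta>: "\<And>c. c \<in> C \<Longrightarrow> 0 < \<eta> c"
    and on: "\<And>c. c \<in> C \<Longrightarrow> outward_normal K (convex hull (C - {c})) = \<nu> c"
    and H: "\<And>c. c \<in> C \<Longrightarrow> affine hull (convex hull (C - {c})) = {x. \<nu> c \<bullet> x = \<alpha> c}"
    and c: "\<And>c. c \<in> C \<Longrightarrow> \<nu> c \<bullet> c = \<alpha> c - \<eta> c"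
    and s1: "\<And>x. (\<Sum>c\<in>C. (\<alpha> c - \<nu> c \<bullet> x) / \<eta> c) = 1"
    and s2: "\<And>x. (\<Sum>c\<in>C. ((\<alpha> c - \<nu> c \<bullet> x) / \<eta> c) *\<^sub>R c) = x"
    and "K = {x. \<forall>c\<in>C. \<nu> c \<bullet> x \<le> \<alpha> c}"
    by (rule simplex_barycentric[OF K]) (rule that)
  define F where "F c = convex hull (C - {c})" for c
  let ?d = "real CARD('d)"
  have cK: "compact K" unfolding C(3) using C(1) by (intro finite_imp_compact_convex_hull)
  have fK: "emeasure lborel K < \<infinity>" using cK by (intro emeasure_bounded_finite compact_imp_bounded)
  have cf: "continuous_on UNIV f"
    using f by (intro continuous_at_imp_continuous_on ballI) (auto intro: has_derivative_continuous)
  have cone: "(LINT x:K|lborel. ?d * f x + g x \<bullet> (x - c)) = \<eta> c * (LINT x:F c|surface_lborel (F c). f x)"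
    if cC: "c \<in> C" for c
  proof (rule cone_divergence[OF \<nu>[OF cC] _ \<eta>[OF cC] c[OF cC] _ _ f g])
    show "affine hull F c = {x. \<nu> c \<bullet> x = \<alpha> c}" unfolding F_def by (rule H[OF cC])
    show "compact (F c)" unfolding F_def using C(1) by (intro finite_imp_compact_convex_hull) auto
    have ne: "C - {c} \<noteq> {}"
      using hyperplane_hull_nonempty[OF \<nu>[OF cC] H[OF cC]] by simp
    show "K = (\<lambda>(s, x). c + s *\<^sub>R (x - c)) ` ({0..1} \<times> F c)"
      unfolding C(3) F_def by (rule convex_hull_eq_cone[OF cC ne])
  qed
  have z1: "(\<Sum>c\<in>C. (\<nu> c \<bullet> v) / \<eta> c) = 0"
    using s1[of v] s1[of 0] by (simp add: diff_divide_distrib sum_subtractf)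
  have "- (\<Sum>c\<in>C. ((\<nu> c \<bullet> v) / \<eta> c) *\<^sub>R c) = v"
    using s2[of v] s2[of 0] by (simp add: diff_divide_distrib sum_subtractf scaleR_left_diff_distrib)
  from arg_cong[OF this, of uminus]
  have z2: "(\<Sum>c\<in>C. ((\<nu> c \<bullet> v) / \<eta> c) *\<^sub>R c) = - v" by simp
  have "(\<Sum>e | e facet_of K. (v \<bullet> outward_normal K e) * (LINT x:e|surface_lborel e. f x))
    = (\<Sum>c\<in>C. (\<nu> c \<bullet> v) * (LINT x:F c|surface_lborel (F c). f x))"
    unfolding C(4) sum.reindex[OF C(5)] by (auto intro!: sum.cong simp: on F_def inner_commute)
  also have "\<dots> = (\<Sum>c\<in>C. ((\<nu> c \<bullet> v) / \<eta> c) * (LINT x:K|lborel. ?d * f x + g x \<bullet> (x - c)))"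
  proof (rule sum.cong[OF refl])
    fix c assume cC: "c \<in> C"
    show "(\<nu> c \<bullet> v) * (LINT x:F c|surface_lborel (F c). f x)
      = ((\<nu> c \<bullet> v) / \<eta> c) * (LINT x:K|lborel. ?d * f x + g x \<bullet> (x - c))"
      unfolding cone[OF cC] using \<eta>[OF cC] by simp
  qed
  also have "\<dots> = (\<Sum>c\<in>C. (LINT x:K|lborel. ((\<nu> c \<bullet> v) / \<eta> c) * (?d * f x + g x \<bullet> (x - c))))" by simp
  also have "\<dots> = (LINT x:K|lborel. (\<Sum>c\<in>C. ((\<nu> c \<bullet> v) / \<eta> c) * (?d * f x + g x \<bullet> (x - c))))"
    using C(1)
    by (intro set_integral_sum[symmetric] set_integrable_compact_finite[OF cK _ fK] continuous_intros cf g) auto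
  also have "(\<lambda>x. \<Sum>c\<in>C. ((\<nu> c \<bullet> v) / \<eta> c) * (?d * f x + g x \<bullet> (x - c))) = (\<lambda>x. g x \<bullet> v)"
  proof
    fix x
    have "(\<Sum>c\<in>C. ((\<nu> c \<bullet> v) / \<eta> c) * (?d * f x + g x \<bullet> (x - c)))
      = (\<Sum>c\<in>C. (\<nu> c \<bullet> v) / \<eta> c) * (?d * f x + g x \<bullet> x) - g x \<bullet> (\<Sum>c\<in>C. ((\<nu> c \<bullet> v) / \<eta> c) *\<^sub>R c)"
      unfolding inner_sum_right sum_distrib_right sum_subtractf[symmetric]
      by (intro sum.cong refl) (simp add: inner_diff_right algebra_simps)
    then show "(\<Sum>c\<in>C. ((\<nu> c \<bullet> v) / \<eta> c) * (?d * f x + g x \<bullet> (x - c))) = g x \<bullet> v"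
      using z1 z2 by simp
  qed
  finally show ?thesis by simp
qed

section \<open>Shape regular simplices\<close>

lemma closed_orthonormal_box:
  "closed {y. \<forall>b\<in>B. l b \<le> b \<bullet> y \<and> b \<bullet> y \<le> u b}"
proof -
  have eq: "{y. \<forall>b\<in>B. l b \<le> b \<bullet> y \<and> b \<bullet> y \<le> u b} = (\<Inter>b\<in>B. {y. l b \<le> b \<bullet> y} \<inter> {y. b \<bullet> y \<le> u b})" by auto
  show ?thesis unfolding eq
    by (intro closed_INT ballI closed_Int closed_halfspace_le closed_halfspace_ge)
qed

lemma emeasure_orthonormal_box:
  fixes B :: "(real^'d) set"
  assumes orth: "pairwise orthogonal B" and unit: "\<And>b. b \<in> B \<Longrightarrow> norm b = 1"
    and card: "card B = CARD('d)" and lu: "\<And>b. b \<in> B \<Longrightarrow> l b \<le> u b"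
  shows "emeasure lborel {y. \<forall>b\<in>B. l b \<le> b \<bullet> y \<and> b \<bullet> y \<le> u b} = ennreal (\<Prod>b\<in>B. u b - l b)"
proof -
  have fin: "finite B" using card zero_less_card_finite[where 'a='d] by (intro card_ge_0_finite) simp
  have ip: "b \<bullet> b' = (if b = b' then 1 else 0)" if "b \<in> B" "b' \<in> B" for b b'
    using orth unit[OF that(1)] that by (auto simp: pairwise_def orthogonal_def norm_eq_1)
  define \<psi> where "\<psi> = (\<lambda>c. \<Sum>b\<in>B. c b *\<^sub>R (b::real^'d))"
  define P where "P = (\<Pi>\<^sub>M b\<in>B. (lborel :: real measure))"
  have \<psi>[measurable]: "\<psi> \<in> borel_measurable P" unfolding \<psi>_def P_def by measurable
  have b\<psi>: "b \<bullet> \<psi> c = c b" if "b \<in> B" for b c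
  proof -
    have "b \<bullet> \<psi> c = (\<Sum>b'\<in>B. if b = b' then c b' else 0)"
      unfolding \<psi>_def inner_sum_right using ip[OF that] by (intro sum.cong) auto
    then show ?thesis using that fin by simp
  qed
  interpret product_sigma_finite "\<lambda>_::real^'d. (lborel :: real measure)" by standard
  let ?A = "{y. \<forall>b\<in>B. l b \<le> b \<bullet> y \<and> b \<bullet> y \<le> u b}"
  have A[measurable]: "?A \<in> sets borel" by (rule borel_closed[OF closed_orthonormal_box])
  have "emeasure lborel ?A = emeasure (distr P borel \<psi>) ?A"
    using lborel_orthonormal[OF orth unit card] unfolding P_def \<psi>_def by simp
  also have "\<dots> = emeasure P (\<psi> -` ?A \<inter> space P)" by (rule emeasure_distr) auto
  also have "\<psi> -` ?A \<inter> space P = (\<Pi>\<^sub>E b\<in>B. {l b .. u b})"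
    by (auto simp: P_def space_PiM b\<psi> PiE_iff)
  also have "emeasure P \<dots> = (\<Prod>b\<in>B. emeasure lborel {l b .. u b})"
    unfolding P_def by (rule emeasure_PiM[OF fin]) auto
  also have "\<dots> = (\<Prod>b\<in>B. ennreal (u b - l b))"
    by (intro prod.cong) (auto simp: lu)
  also have "\<dots> = ennreal (\<Prod>b\<in>B. u b - l b)" by (rule prod_ennreal) (simp add: lu)
  finally show ?thesis .
qed

text \<open>The part of a ball between two parallel hyperplanes fits into a box whose edges are parallel to an
  orthonormal basis containing \<open>n\<close>.\<close>
lemma measure_ball_slab_le:
  fixes n :: "real^'d"
  assumes n: "norm n = 1" and r: "0 \<le> r" and w: "\<beta> \<le> \<gamma>"
    and A: "A \<subseteq> cball c r" "\<And>x. x \<in> A \<Longrightarrow> \<beta> \<le> n \<bullet> x \<and> n \<bullet> x \<le> \<gamma>"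
  shows "emeasure lborel A \<le> ennreal ((\<gamma> - \<beta>) * (2 * r) ^ (CARD('d) - 1))"
proof -
  obtain B where B: "n \<in> B" "pairwise orthogonal B" "\<And>b. b \<in> B \<Longrightarrow> norm b = 1" and "card B = DIM(real^'d)"
    by (rule vector_in_orthonormal_basis[OF n]) blast
  then have B4: "card B = CARD('d)" by simp
  note B = B B4
  have fin: "finite B" using B(4) zero_less_card_finite[where 'a='d] by (intro card_ge_0_finite) simp
  define l u where "l b = (if b = n then \<beta> else b \<bullet> c - r)" and "u b = (if b = n then \<gamma> else b \<bullet> c + r)" for b
  have lu: "l b \<le> u b" for b using r w by (auto simp: l_def u_def)
  have "A \<subseteq> {y. \<forall>b\<in>B. l b \<le> b \<bullet> y \<and> b \<bullet> y \<le> u b}"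
  proof (intro subsetI CollectI ballI)
    fix x b assume x: "x \<in> A" and b: "b \<in> B"
    have "\<bar>b \<bullet> (x - c)\<bar> \<le> norm b * norm (x - c)" by (rule Cauchy_Schwarz_ineq2)
    also have "\<dots> \<le> r" using A(1) x B(3)[OF b] by (auto simp: dist_norm norm_minus_commute)
    finally show "l b \<le> b \<bullet> x \<and> b \<bullet> x \<le> u b"
      using A(2)[OF x] by (auto simp: l_def u_def inner_diff_right)
  qed
  moreover have "{y. \<forall>b\<in>B. l b \<le> b \<bullet> y \<and> b \<bullet> y \<le> u b} \<in> sets lborel"
    unfolding sets_lborel by (rule borel_closed[OF closed_orthonormal_box])
  ultimately have "emeasure lborel A \<le> emeasure lborel {y. \<forall>b\<in>B. l b \<le> b \<bullet> y \<and> b \<bullet> y \<le> u b}"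
    by (rule emeasure_mono)
  also have "\<dots> = ennreal (\<Prod>b\<in>B. u b - l b)" using emeasure_orthonormal_box[OF B(2,3,4) lu] .
  also have "(\<Prod>b\<in>B. u b - l b) = (u n - l n) * (\<Prod>b\<in>B - {n}. u b - l b)"
    using fin B(1) by (rule prod.remove)
  also have "(\<Prod>b\<in>B - {n}. u b - l b) = (\<Prod>b\<in>B - {n}. 2 * r)"
    by (intro prod.cong) (auto simp: l_def u_def)
  also have "\<dots> = (2 * r) ^ (CARD('d) - 1)" using fin B by simp
  finally show ?thesis by (simp add: l_def u_def)
qed

lemma compact_facet: "int CARD('d) simplex (K :: (real^'d) set) \<Longrightarrow> e facet_of K \<Longrightarrow> compact e"
  unfolding simplex_def
  by (metis aff_independent_finite convex_convex_hull face_of_imp_compact facet_of_imp_face_of finite_imp_compact_convex_hull)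

lemma compact_simplex: "int CARD('d) simplex (K :: (real^'d) set) \<Longrightarrow> compact K \<and> convex K"
  unfolding simplex_def
  by (metis aff_independent_finite convex_convex_hull finite_imp_compact_convex_hull)

lemma finite_facets_simplex: "int CARD('d) simplex (K :: (real^'d) set) \<Longrightarrow>
    finite {e. e facet_of K} \<and> card {e. e facet_of K} = Suc CARD('d)"
  by (rule simplex_barycentric[of K]) (auto simp: card_image)

lemma facet_hyperplane:
  fixes K :: "(real^'d) set"
  assumes K: "int CARD('d) simplex K" and e: "e facet_of K"
  obtains a where "norm (outward_normal K e) = 1" "affine hull e = {x. outward_normal K e \<bullet> x = a}"
    "\<And>x. x \<in> e \<Longrightarrow> outward_normal K e \<bullet> x = a" "\<And>x. x \<in> K \<Longrightarrow> outward_normal K e \<bullet> x \<le> a"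
    "\<And>x. x \<in> K \<Longrightarrow> outward_normal K e \<bullet> x = a \<Longrightarrow> x \<in> e"
proof (rule simplex_barycentric[OF K])
  fix C and \<nu> :: "real^'d \<Rightarrow> real^'d" and \<alpha> \<eta> :: "real^'d \<Rightarrow> real"
  assume C: "finite C" "card C = Suc CARD('d)" "K = convex hull C"
    "{e. e facet_of K} = (\<lambda>c. convex hull (C - {c})) ` C"
    and \<nu>: "\<And>c. c \<in> C \<Longrightarrow> norm (\<nu> c) = 1"
    and on: "\<And>c. c \<in> C \<Longrightarrow> outward_normal K (convex hull (C - {c})) = \<nu> c"
    and H: "\<And>c. c \<in> C \<Longrightarrow> affine hull (convex hull (C - {c})) = {x. \<nu> c \<bullet> x = \<alpha> c}"
    and s1: "\<And>x. (\<Sum>c\<in>C. (\<alpha> c - \<nu> c \<bullet> x) / \<eta> c) = 1"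
    and s2: "\<And>x. (\<Sum>c\<in>C. ((\<alpha> c - \<nu> c \<bullet> x) / \<eta> c) *\<^sub>R c) = x"
    and \<eta>: "\<And>c. c \<in> C \<Longrightarrow> 0 < \<eta> c"
    and Kl: "K = {x. \<forall>c\<in>C. \<nu> c \<bullet> x \<le> \<alpha> c}"
  obtain c where c: "c \<in> C" "e = convex hull (C - {c})" using e C(4) by blast
  have n: "outward_normal K e = \<nu> c" using on c by simp
  show ?thesis
  proof (rule that[of "\<alpha> c"])
    show "norm (outward_normal K e) = 1" using n \<nu> c by simp
    show H': "affine hull e = {x. outward_normal K e \<bullet> x = \<alpha> c}" using n H c by simp
    show "outward_normal K e \<bullet> x = \<alpha> c" if "x \<in> e" for x using H' hull_inc[OF that] by blast
    show "outward_normal K e \<bullet> x \<le> \<alpha> c" if "x \<in> K" for x using that n Kl c by simp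
    fix x assume x: "x \<in> K" "outward_normal K e \<bullet> x = \<alpha> c"
    define u where "u c = (\<alpha> c - \<nu> c \<bullet> x) / \<eta> c" for c
    have u0: "u c = 0" using x n by (simp add: u_def)
    have "\<forall>v\<in>C - {c}. 0 \<le> u v" using x(1) Kl \<eta> by (auto simp: u_def intro!: divide_nonneg_pos)
    moreover have "sum u (C - {c}) = 1"
      using s1[of x] u0 C(1) c(1) by (simp add: u_def[symmetric] sum.remove)
    moreover have "(\<Sum>v\<in>C - {c}. u v *\<^sub>R v) = x"
      using s2[of x] u0 C(1) c(1) by (simp add: u_def[symmetric] sum.remove)
    ultimately show "x \<in> e" unfolding c(2) using C(1) by (subst convex_hull_finite) auto
  qed
qed

lemma emeasure_simplex_finite: "int CARD('d) simplex (K :: (real^'d) set) \<Longrightarrow> emeasure lborel K < \<infinity>"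
  using compact_simplex by (intro emeasure_bounded_finite compact_imp_bounded) auto

lemma emeasure_facet_finite:
  "int CARD('d) simplex (K :: (real^'d) set) \<Longrightarrow> e facet_of K \<Longrightarrow> emeasure (surface_lborel e) e < \<infinity>"
proof -
  assume K: "int CARD('d) simplex K" and e: "e facet_of K"
  note ce = compact_facet[OF K e]
  show "emeasure (surface_lborel e) e < \<infinity>"
    by (rule facet_hyperplane[OF K e])
       (rule emeasure_surface_lborel_bounded, auto simp: ce compact_imp_bounded borel_compact)
qed

text \<open>Every height is at least a multiple of the diameter, for otherwise the simplex would lie in a
  slab too thin for its volume. The ball about the barycentre and the bound for the facets, which are the volume
  times \<open>d\<close> divided by the height, follow.\<close>
lemma simplex_shape:
  fixes K :: "(real^'d) set"
  assumes K: "int CARD('d) simplex K" and \<kappa>: "0 < \<kappa>" "\<kappa> \<le> measure lebesgue K / diameter K ^ CARD('d)"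
  shows "0 < diameter K"
    and "\<exists>x. ball x (\<kappa> / (2 ^ CARD('d) * real (Suc CARD('d))) * diameter K) \<subseteq> K"
    and "\<And>e. e facet_of K \<Longrightarrow>
      measure (surface_lborel e) e \<le> real CARD('d) * 4 ^ CARD('d) / \<kappa> * diameter K ^ (CARD('d) - 1)"
proof -
  let ?m = "CARD('d) - 1" and ?h = "diameter K"
  obtain C and \<nu> :: "real^'d \<Rightarrow> real^'d" and \<alpha> \<eta> :: "real^'d \<Rightarrow> real" where
    C: "finite C" "card C = Suc CARD('d)" "K = convex hull C"
    "{e. e facet_of K} = (\<lambda>c. convex hull (C - {c})) ` C" "inj_on (\<lambda>c. convex hull (C - {c})) C"
    and \<nu>: "\<And>c. c \<in> C \<Longrightarrow> norm (\<nu> c) = 1" and \<eta>: "\<And>c. c \<in> C \<Longrightarrow> 0 < \<eta> c"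
    and on: "\<And>c. c \<in> C \<Longrightarrow> outward_normal K (convex hull (C - {c})) = \<nu> c"
    and H: "\<And>c. c \<in> C \<Longrightarrow> affine hull (convex hull (C - {c})) = {x. \<nu> c \<bullet> x = \<alpha> c}"
    and c: "\<And>c. c \<in> C \<Longrightarrow> \<nu> c \<bullet> c = \<alpha> c - \<eta> c"
    and s1: "\<And>x. (\<Sum>c\<in>C. (\<alpha> c - \<nu> c \<bullet> x) / \<eta> c) = 1"
    and s2: "\<And>x. (\<Sum>c\<in>C. ((\<alpha> c - \<nu> c \<bullet> x) / \<eta> c) *\<^sub>R c) = x"
    and Kl: "K = {x. \<forall>c\<in>C. \<nu> c \<bullet> x \<le> \<alpha> c}"
    by (rule simplex_barycentric[OF K]) (rule that)
  have cK: "compact K" and bK: "bounded K" using compact_simplex[OF K] compact_imp_bounded by auto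
  have dS: "CARD('d) = Suc ?m" by (simp add: Suc_pred')
  have hS: "?h ^ CARD('d) = ?h * ?h ^ ?m" by (metis dS power_Suc)
  have mK: "measure lebesgue K = measure lborel K" using cK by (simp add: borel_compact)
  have eK: "emeasure lborel K = ennreal (measure lborel K)"
    using emeasure_simplex_finite[OF K] by (simp add: emeasure_eq_ennreal_measure)
  have h0: "?h \<ge> 0" using diameter_ge_0[OF bK] .
  show h: "0 < ?h"
  proof (rule ccontr)
    assume "\<not> 0 < ?h"
    then have "?h ^ CARD('d) = 0" using h0 by (simp add: zero_power)
    then show False using \<kappa> by (simp only: div_by_0)
  qed
  have vol: "\<kappa> * ?h ^ CARD('d) \<le> measure lborel K"
    using \<kappa>(2) h mK by (simp add: pos_le_divide_eq)
  have inK: "v \<in> K" if "v \<in> C" for v using that C(3) hull_inc by metis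
  have sub: "K \<subseteq> cball v ?h" if "v \<in> C" for v
    using diameter_bounded_bound[OF bK inK[OF that]] by auto
  have \<alpha>\<eta>: "\<alpha> v - \<eta> v \<le> \<nu> v \<bullet> x \<and> \<nu> v \<bullet> x \<le> \<alpha> v" if v: "v \<in> C" and x: "x \<in> K" for v x
  proof -
    have "K \<subseteq> {x. \<alpha> v - \<eta> v \<le> \<nu> v \<bullet> x}" unfolding C(3)
    proof (rule hull_minimal)
      show "C \<subseteq> {x. \<alpha> v - \<eta> v \<le> \<nu> v \<bullet> x}"
      proof
        fix w assume w: "w \<in> C"
        show "w \<in> {x. \<alpha> v - \<eta> v \<le> \<nu> v \<bullet> x}"
        proof (cases "w = v")
          case False
          then have "w \<in> convex hull (C - {v})" using w by (intro hull_inc) auto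
          then have "w \<in> affine hull (convex hull (C - {v}))" by (rule hull_inc)
          then show ?thesis using H[OF v] \<eta>[OF v] by auto
        qed (use c[OF v] in auto)
      qed
    qed (rule convex_halfspace_ge)
    then show ?thesis using x Kl v by auto
  qed
  have \<eta>_ge: "\<kappa> / 2 ^ CARD('d) * ?h \<le> \<eta> v" if v: "v \<in> C" for v
  proof -
    have "emeasure lborel K \<le> ennreal ((\<alpha> v - (\<alpha> v - \<eta> v)) * (2 * ?h) ^ ?m)"
      using \<eta>[OF v] h by (intro measure_ball_slab_le[OF \<nu>[OF v] _ _ sub[OF v] \<alpha>\<eta>[OF v]]) auto
    then have upper: "measure lborel K \<le> \<eta> v * (2 * ?h) ^ ?m"
      using \<eta>[OF v] h unfolding eK by (subst (asm) ennreal_le_iff) auto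
    have "\<kappa> * ?h * ?h ^ ?m \<le> \<eta> v * 2 ^ ?m * ?h ^ ?m"
      using order_trans[OF vol upper] unfolding hS power_mult_distrib by (simp only: mult.assoc)
    then have "\<kappa> * ?h \<le> \<eta> v * 2 ^ ?m" using h by simp
    also have "\<dots> \<le> \<eta> v * 2 ^ CARD('d)" using \<eta>[OF v] by (intro mult_left_mono power_increasing) auto
    finally show ?thesis by (simp add: field_simps)
  qed
  show "\<exists>x. ball x (\<kappa> / (2 ^ CARD('d) * real (Suc CARD('d))) * ?h) \<subseteq> K"
  proof -
    define N where "N = real (Suc CARD('d))"
    have N: "N > 0" by (simp add: N_def)
    define z where "z = (\<Sum>v\<in>C. (1 / N) *\<^sub>R v)"
    have "ball z (\<kappa> / (2 ^ CARD('d) * N) * ?h) \<subseteq> K"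
    proof
      fix y assume y: "y \<in> ball z (\<kappa> / (2 ^ CARD('d) * N) * ?h)"
      have "\<nu> v \<bullet> y \<le> \<alpha> v" if v: "v \<in> C" for v
      proof -
        have "\<nu> v \<bullet> w = \<alpha> v - (if w = v then \<eta> v else 0)" if "w \<in> C" for w
        proof (cases "w = v")
          case False
          then have "w \<in> convex hull (C - {v})" using \<open>w \<in> C\<close> by (intro hull_inc) auto
          then have "w \<in> affine hull (convex hull (C - {v}))" by (rule hull_inc)
          then show ?thesis using H[OF v] False by auto
        qed (use c[OF v] in auto)
        then have "\<nu> v \<bullet> z = (\<Sum>w\<in>C. (1 / N) * (\<alpha> v - (if w = v then \<eta> v else 0)))"
          by (simp add: z_def inner_sum_right)
        also have "\<dots> = (1 / N) * (\<Sum>w\<in>C. \<alpha> v - (if w = v then \<eta> v else 0))" by (rule sum_distrib_left[symmetric])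
        also have "\<dots> = (1 / N) * (N * \<alpha> v - \<eta> v)" using C(1,2) v by (simp add: sum_subtractf N_def)
        finally have z: "\<nu> v \<bullet> z = \<alpha> v - \<eta> v / N" using N by (simp add: field_simps)
        have "\<nu> v \<bullet> (y - z) \<le> norm (\<nu> v) * norm (y - z)" by (rule norm_cauchy_schwarz)
        also have "\<dots> \<le> \<kappa> / (2 ^ CARD('d) * N) * ?h" using y \<nu>[OF v] by (simp add: dist_norm norm_minus_commute)
        also have "\<dots> \<le> \<eta> v / N" using \<eta>_ge[OF v] N by (simp add: field_simps)
        finally show ?thesis using z by (simp add: inner_diff_right)
      qed
      then show "y \<in> K" using Kl by auto
    qed
    then show ?thesis unfolding N_def by blast
  qed
  fix e assume e: "e facet_of K"
  show "measure (surface_lborel e) e \<le> real CARD('d) * 4 ^ CARD('d) / \<kappa> * ?h ^ ?m"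
  proof -
    obtain v where v: "v \<in> C" "e = convex hull (C - {v})" using e C(4) by blast
    note ce = compact_facet[OF K e]
    have fe: "emeasure (surface_lborel e) e < \<infinity>" by (rule emeasure_facet_finite[OF K e])
    have ne: "C - {v} \<noteq> {}"
      using hyperplane_hull_nonempty[OF \<nu>[OF v(1)] H[OF v(1)]] by simp
    have "(LINT x:K|lborel. real CARD('d) * 1 + 0 \<bullet> (x - v)) = \<eta> v * (LINT x:e|surface_lborel e. 1)"
      using convex_hull_eq_cone[OF v(1) ne] H[OF v(1)] v(2) C(3)
      by (intro cone_divergence[OF \<nu>[OF v(1)] _ \<eta>[OF v(1)] c[OF v(1)] ce]) auto
    then have eq: "real CARD('d) * measure lborel K = \<eta> v * measure (surface_lborel e) e"
      using fe emeasure_simplex_finite[OF K] cK ce by (simp add: set_integral_const borel_compact set_lebesgue_integral_def mult.commute)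
    have "emeasure lborel K \<le> ennreal ((\<alpha> v - (\<alpha> v - 2 * ?h)) * (2 * ?h) ^ ?m)"
    proof (rule measure_ball_slab_le[OF \<nu>[OF v(1)] _ _ sub[OF v(1)]])
      fix x assume x: "x \<in> K"
      have "\<nu> v \<bullet> (v - x) \<le> norm (\<nu> v) * norm (v - x)" by (rule norm_cauchy_schwarz)
      also have "\<dots> \<le> ?h" using diameter_bounded_bound[OF bK inK[OF v(1)] x] \<nu>[OF v(1)] by (simp add: dist_norm)
      finally have vx: "\<nu> v \<bullet> v - \<nu> v \<bullet> x \<le> ?h" by (simp add: inner_diff_right)
      obtain w where w: "w \<in> C - {v}" using ne by auto
      have "w \<in> convex hull (C - {v})" using w by (intro hull_inc)
      then have "w \<in> affine hull (convex hull (C - {v}))" by (rule hull_inc)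
      then have nw: "\<nu> v \<bullet> w = \<alpha> v" using H[OF v(1)] by auto
      have "\<nu> v \<bullet> (w - v) \<le> norm (\<nu> v) * norm (w - v)" by (rule norm_cauchy_schwarz)
      also have "\<dots> \<le> ?h" using diameter_bounded_bound[OF bK inK inK[OF v(1)], of w] w \<nu>[OF v(1)] by (simp add: dist_norm)
      finally have "\<nu> v \<bullet> w - \<nu> v \<bullet> v \<le> ?h" by (simp add: inner_diff_right)
      with vx show "\<alpha> v - 2 * ?h \<le> \<nu> v \<bullet> x \<and> \<nu> v \<bullet> x \<le> \<alpha> v"
        using nw \<alpha>\<eta>[OF v(1) x] by linarith
    qed (use h in auto)
    also have "(\<alpha> v - (\<alpha> v - 2 * ?h)) * (2 * ?h) ^ ?m = (2 * ?h) * (2 * ?h) ^ ?m" by simp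
    also have "\<dots> = (2 * ?h) ^ CARD('d)" by (metis dS power_Suc)
    finally have "measure lborel K \<le> (2 * ?h) ^ CARD('d)"
      using h unfolding eK by (subst (asm) ennreal_le_iff) auto
    then have "\<eta> v * measure (surface_lborel e) e \<le> real CARD('d) * (2 * ?h) ^ CARD('d)"
      unfolding eq[symmetric] by (intro mult_left_mono) auto
    then have "(\<kappa> / 2 ^ CARD('d) * ?h) * measure (surface_lborel e) e \<le> real CARD('d) * (2 * ?h) ^ CARD('d)"
      using mult_right_mono[OF \<eta>_ge[OF v(1)], of "measure (surface_lborel e) e"] by simp
    also have "(2 * ?h) ^ CARD('d) = 2 ^ CARD('d) * (?h * ?h ^ ?m)"
      unfolding power_mult_distrib by (simp only: hS)
    finally have "\<kappa> * measure (surface_lborel e) e * ?h \<le> real CARD('d) * (2 ^ CARD('d) * 2 ^ CARD('d)) * ?h ^ ?m * ?h"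
      by (simp add: field_simps)
    then have "\<kappa> * measure (surface_lborel e) e \<le> real CARD('d) * 4 ^ CARD('d) * ?h ^ ?m"
      using h by (simp add: power_mult_distrib[symmetric])
    then show ?thesis using \<kappa>(1) by (simp add: field_simps)
  qed
qed

section \<open>Polynomials on convex bodies\<close>

lemma finite_multiindices: "finite {\<alpha>::'d::finite \<Rightarrow> nat. (\<Sum>i\<in>UNIV. \<alpha> i) \<le> k}"
proof (rule finite_subset)
  show "{\<alpha>::'d \<Rightarrow> nat. (\<Sum>i\<in>UNIV. \<alpha> i) \<le> k} \<subseteq> UNIV \<rightarrow>\<^sub>E {..k}"
  proof
    fix \<alpha> :: "'d \<Rightarrow> nat" assume "\<alpha> \<in> {\<alpha>. (\<Sum>i\<in>UNIV. \<alpha> i) \<le> k}"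
    then have "\<alpha> i \<le> k" for i using member_le_sum[of i UNIV \<alpha>] by auto
    then show "\<alpha> \<in> UNIV \<rightarrow>\<^sub>E {..k}" by auto
  qed
  show "finite ((UNIV::'d set) \<rightarrow>\<^sub>E {..k})" by (intro finite_PiE) auto
qed

lemma polys_sum:
  assumes "\<And>i. i \<in> I \<Longrightarrow> f i \<in> polys k"
  shows "(\<lambda>x. \<Sum>i\<in>I. f i x) \<in> polys k"
proof -
  have "\<forall>i\<in>I. \<exists>c. \<forall>x. f i x = (\<Sum>\<alpha> | (\<Sum>i\<in>UNIV. \<alpha> i) \<le> k. c \<alpha> * (\<Prod>i\<in>UNIV. (x $ i) ^ \<alpha> i))"
    using assms unfolding polys_def by auto
  then obtain c where c: "\<And>i x. i \<in> I \<Longrightarrow> f i x = (\<Sum>\<alpha> | (\<Sum>i\<in>UNIV. \<alpha> i) \<le> k. c i \<alpha> * (\<Prod>i\<in>UNIV. (x $ i) ^ \<alpha> i))"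
    unfolding bchoice_iff by blast
  have "(\<Sum>i\<in>I. f i x) = (\<Sum>\<alpha> | (\<Sum>i\<in>UNIV. \<alpha> i) \<le> k. (\<Sum>i\<in>I. c i \<alpha>) * (\<Prod>i\<in>UNIV. (x $ i) ^ \<alpha> i))" for x
    unfolding sum_distrib_right by (subst sum.swap) (simp add: c)
  then show ?thesis unfolding polys_def by auto
qed

lemma polys_monomial:
  assumes "(\<Sum>i\<in>UNIV. \<beta> i) \<le> k"
  shows "(\<lambda>x. a * (\<Prod>i\<in>UNIV. (x $ i) ^ \<beta> i)) \<in> polys k"
proof -
  have "a * (\<Prod>i\<in>UNIV. (x $ i) ^ \<beta> i) = (\<Sum>\<alpha> | (\<Sum>i\<in>UNIV. \<alpha> i) \<le> k. (if \<alpha> = \<beta> then a else 0) * (\<Prod>i\<in>UNIV. (x $ i) ^ \<alpha> i))" for x :: "real^'a"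
  proof -
    have "(\<Sum>\<alpha> | (\<Sum>i\<in>UNIV. \<alpha> i) \<le> k. (if \<alpha> = \<beta> then a else 0) * (\<Prod>i\<in>UNIV. (x $ i) ^ \<alpha> i))
      = (\<Sum>\<alpha> | (\<Sum>i\<in>UNIV. \<alpha> i) \<le> k. (if \<alpha> = \<beta> then a * (\<Prod>i\<in>UNIV. (x $ i) ^ \<beta> i) else 0))"
      by (intro sum.cong) auto
    also have "\<dots> = a * (\<Prod>i\<in>UNIV. (x $ i) ^ \<beta> i)" using assms by (subst sum.delta) (auto simp: finite_multiindices)
    finally show ?thesis by simp
  qed
  then show ?thesis unfolding polys_def by (intro CollectI exI[of _ "\<lambda>\<alpha>. if \<alpha> = \<beta> then a else 0"]) blast
qed

lemma polys_const: "(\<lambda>x. a) \<in> polys k"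
  using polys_monomial[of "\<lambda>_. 0" k a] by simp

lemma polys_gradient:
  fixes f :: "real^'d \<Rightarrow> real"
  assumes "f \<in> polys k"
  obtains g where "\<And>x. (f has_derivative (\<lambda>h. g x \<bullet> h)) (at x)" "\<And>i. (\<lambda>x. g x $ i) \<in> polys k"
proof -
  obtain c where c: "\<And>x. f x = (\<Sum>\<alpha> | (\<Sum>i\<in>UNIV. \<alpha> i) \<le> k. c \<alpha> * (\<Prod>i\<in>UNIV. (x $ i) ^ \<alpha> i))"
    using assms unfolding polys_def by auto
  define D where "D \<alpha> j x = (real (\<alpha> j) * (x $ j) ^ (\<alpha> j - 1)) * (\<Prod>i\<in>UNIV - {j}. (x $ i) ^ \<alpha> i)"
    for \<alpha> :: "'d \<Rightarrow> nat" and j and x :: "real^'d"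
  define g where "g x = (\<chi> j. \<Sum>\<alpha> | (\<Sum>i\<in>UNIV. \<alpha> i) \<le> k. c \<alpha> * D \<alpha> j x)" for x
  have mono: "((\<lambda>x. \<Prod>i\<in>UNIV. (x $ i) ^ \<alpha> i) has_derivative (\<lambda>h. \<Sum>j\<in>UNIV. D \<alpha> j x * h $ j)) (at x)" for \<alpha> x
  proof -
    have "((\<lambda>x. \<Prod>i\<in>UNIV. (x $ i) ^ \<alpha> i) has_derivative
      (\<lambda>h. \<Sum>j\<in>UNIV. (real (\<alpha> j) * (h $ j) * (x $ j) ^ (\<alpha> j - 1)) * (\<Prod>i\<in>UNIV - {j}. (x $ i) ^ \<alpha> i))) (at x)"
      by (rule has_derivative_prod) (auto intro!: derivative_eq_intros bounded_linear_imp_has_derivative bounded_linear_vec_nth simp: mult_ac)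
    then show ?thesis by (simp add: D_def mult_ac)
  qed
  have "(f has_derivative (\<lambda>h. g x \<bullet> h)) (at x)" for x
  proof -
    have "(f has_derivative (\<lambda>h. \<Sum>\<alpha> | (\<Sum>i\<in>UNIV. \<alpha> i) \<le> k. c \<alpha> * (\<Sum>j\<in>UNIV. D \<alpha> j x * h $ j))) (at x)"
      unfolding c[abs_def] by (intro has_derivative_sum has_derivative_mult_right mono)
    also have "(\<lambda>h. \<Sum>\<alpha> | (\<Sum>i\<in>UNIV. \<alpha> i) \<le> k. c \<alpha> * (\<Sum>j\<in>UNIV. D \<alpha> j x * h $ j)) = (\<lambda>h. g x \<bullet> h)"
      unfolding g_def inner_vec_def
      by (rule ext) (simp add: sum_distrib_left sum_distrib_right mult.assoc, subst sum.swap, simp)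
    finally show ?thesis .
  qed
  moreover have "(\<lambda>x. g x $ j) \<in> polys k" for j
  proof -
    have "(\<lambda>x. c \<alpha> * D \<alpha> j x) \<in> polys k" if \<alpha>: "(\<Sum>i\<in>UNIV. \<alpha> i) \<le> k" for \<alpha>
    proof -
      let ?\<beta> = "\<alpha>(j := \<alpha> j - 1)"
      have "(\<Sum>i\<in>UNIV. ?\<beta> i) \<le> (\<Sum>i\<in>UNIV. \<alpha> i)" by (intro sum_mono) auto
      then have 1: "(\<Sum>i\<in>UNIV. ?\<beta> i) \<le> k" using \<alpha> by simp
      have "c \<alpha> * D \<alpha> j x = (c \<alpha> * real (\<alpha> j)) * (\<Prod>i\<in>UNIV. (x $ i) ^ ?\<beta> i)" for x
      proof -
        have "(\<Prod>i\<in>UNIV. (x $ i) ^ ?\<beta> i) = (x $ j) ^ (\<alpha> j - 1) * (\<Prod>i\<in>UNIV - {j}. (x $ i) ^ ?\<beta> i)"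
          by (subst prod.remove[of _ j]) auto
        also have "(\<Prod>i\<in>UNIV - {j}. (x $ i) ^ ?\<beta> i) = (\<Prod>i\<in>UNIV - {j}. (x $ i) ^ \<alpha> i)"
          by (intro prod.cong) auto
        finally show ?thesis by (simp add: D_def)
      qed
      then show ?thesis using polys_monomial[OF 1, of "c \<alpha> * real (\<alpha> j)"] by (simp only:)
    qed
    then show ?thesis unfolding g_def by (simp, intro polys_sum) auto
  qed
  ultimately show ?thesis by (rule that)
qed

lemma continuous_polys: "f \<in> polys k \<Longrightarrow> continuous_on S f"
proof -
  assume "f \<in> polys k"
  then obtain c where "f = (\<lambda>x. \<Sum>\<alpha> | (\<Sum>i\<in>UNIV. \<alpha> i) \<le> k. c \<alpha> * (\<Prod>i\<in>UNIV. (x $ i) ^ \<alpha> i))"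
    unfolding polys_def by blast
  then show ?thesis by (simp only:) (intro continuous_intros)
qed

lemma polys_line:
  fixes f :: "real^'d \<Rightarrow> real"
  assumes "f \<in> polys k"
  obtains P :: "real poly" where "degree P \<le> k" "\<And>t. f (x + t *\<^sub>R z) = poly P t"
proof -
  obtain c where c: "\<And>x. f x = (\<Sum>\<alpha> | (\<Sum>i\<in>UNIV. \<alpha> i) \<le> k. c \<alpha> * (\<Prod>i\<in>UNIV. (x $ i) ^ \<alpha> i))"
    using assms unfolding polys_def by auto
  define P where "P = (\<Sum>\<alpha> | (\<Sum>i\<in>UNIV. \<alpha> i) \<le> k. smult (c \<alpha>) (\<Prod>i\<in>UNIV. [:x $ i, z $ i:] ^ \<alpha> i))"
  have "degree P \<le> k" unfolding P_def
  proof (rule degree_sum_le[OF finite_multiindices])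
    fix \<alpha> assume "\<alpha> \<in> {\<alpha>::'d \<Rightarrow> nat. (\<Sum>i\<in>UNIV. \<alpha> i) \<le> k}"
    then have \<alpha>: "(\<Sum>i\<in>UNIV. \<alpha> i) \<le> k" by simp
    have "degree (\<Prod>i\<in>UNIV. [:x $ i, z $ i:] ^ \<alpha> i) \<le> (\<Sum>i\<in>UNIV. \<alpha> i)"
    proof (rule order_trans[OF degree_prod_sum_le])
      show "(\<Sum>i\<in>UNIV. (degree \<circ> (\<lambda>i. [:x $ i, z $ i:] ^ \<alpha> i)) i) \<le> (\<Sum>i\<in>UNIV. \<alpha> i)"
      proof (rule sum_mono)
        fix i
        have "degree ([:x $ i, z $ i:] ^ \<alpha> i) \<le> degree [:x $ i, z $ i:] * \<alpha> i" by (rule degree_power_le)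
        also have "\<dots> \<le> \<alpha> i" by simp
        finally show "(degree \<circ> (\<lambda>i. [:x $ i, z $ i:] ^ \<alpha> i)) i \<le> \<alpha> i" by simp
      qed
    qed simp
    from order_trans[OF degree_smult_le order_trans[OF this \<alpha>]]
    show "degree (smult (c \<alpha>) (\<Prod>i\<in>UNIV. [:x $ i, z $ i:] ^ \<alpha> i)) \<le> k" .
  qed
  moreover have "f (x + t *\<^sub>R z) = poly P t" for t
    by (simp add: c P_def poly_sum poly_prod poly_power)
  ultimately show ?thesis by (rule that)
qed

text \<open>Richardson extrapolation: \<open>2\<^sup>k\<^sup>+\<^sup>1 P (t / 2) - P t\<close> has no term of degree \<open>k + 1\<close>, so the
  value at \<open>0\<close> of a polynomial is a combination of its values at \<open>1, 1/2, 1/4, \<dots>\<close> with weights that depend on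
  the degree only.\<close>
lemma poly_extrapolate:
  "\<exists>c. \<forall>P::real poly. degree P \<le> k \<longrightarrow> poly P 0 = (\<Sum>j\<le>k. c j * poly P ((1/2) ^ j))"
proof (induction k)
  case 0
  have "poly P 0 = poly P 1" if "degree P = 0" for P :: "real poly"
    using that by (elim degree_eq_zeroE) simp
  then show ?case by (intro exI[of _ "\<lambda>_. 1"]) auto
next
  case (Suc k)
  then obtain c where c: "\<And>P::real poly. degree P \<le> k \<Longrightarrow> poly P 0 = (\<Sum>j\<le>k. c j * poly P ((1/2) ^ j))" by auto
  define a :: real where "a = 2 ^ Suc k"
  have a: "a - 1 > 0" using one_less_power[of "2::real" "Suc k"] by (simp add: a_def)
  define c' where "c' j = ((if 0 < j then a * c (j - 1) else 0) - (if j \<le> k then c j else 0)) / (a - 1)" for j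
  have c'a: "(a - 1) * c' j = (if 0 < j then a * c (j - 1) else 0) - (if j \<le> k then c j else 0)" for j
    using a by (simp add: c'_def)
  have "poly P 0 = (\<Sum>j\<le>Suc k. c' j * poly P ((1/2) ^ j))" if P: "degree P \<le> Suc k" for P :: "real poly"
  proof -
    define Q where "Q = smult a (pcompose P [:0, 1/2:]) - P"
    have pQ: "poly Q t = a * poly P (t / 2) - poly P t" for t by (simp add: Q_def poly_pcompose)
    have "degree (pcompose P [:0, 1/2:]) \<le> Suc k" using P by (simp add: degree_pcompose)
    then have "degree Q \<le> Suc k" unfolding Q_def using P by (intro degree_diff_le order_trans[OF degree_smult_le]) auto
    moreover have "coeff Q (Suc k) = 0"
    proof -
      have "a * (1/2) ^ Suc k = (2 * (1/2)) ^ Suc k" unfolding a_def by (rule power_mult_distrib[symmetric])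
      also have "\<dots> = 1" by (simp del: power_Suc)
      finally have "a * ((1/2) ^ Suc k * coeff P (Suc k)) = coeff P (Suc k)"
        by (simp only: mult.assoc[symmetric] mult_1)
      then show ?thesis unfolding Q_def coeff_diff coeff_smult coeff_pcompose_linear by linarith
    qed
    ultimately have cQ: "coeff Q i = 0" if "k < i" for i
    proof (cases "i = Suc k")
      case False
      then have "degree Q < i" using that \<open>degree Q \<le> Suc k\<close> by linarith
      then show ?thesis by (rule coeff_eq_0)
    qed (use \<open>coeff Q (Suc k) = 0\<close> in simp)
    have "degree Q \<le> k" by (rule degree_le) (use cQ in blast)
    from c[OF this] have "(a - 1) * poly P 0 = (\<Sum>j\<le>k. c j * (a * poly P ((1/2) ^ Suc j) - poly P ((1/2) ^ j)))"
      unfolding pQ by (simp add: left_diff_distrib)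
    also have "\<dots> = (\<Sum>j\<le>k. a * c j * poly P ((1/2) ^ Suc j)) - (\<Sum>j\<le>k. c j * poly P ((1/2) ^ j))"
      unfolding sum_subtractf[symmetric] by (intro sum.cong refl) (simp only: right_diff_distrib mult.assoc mult.left_commute)
    also have "(\<Sum>j\<le>k. a * c j * poly P ((1/2) ^ Suc j)) = (\<Sum>j\<le>Suc k. (if 0 < j then a * c (j - 1) else 0) * poly P ((1/2) ^ j))"
      unfolding sum.atMost_Suc_shift by (simp del: power_Suc)
    also have "(\<Sum>j\<le>k. c j * poly P ((1/2) ^ j)) = (\<Sum>j\<le>Suc k. (if j \<le> k then c j else 0) * poly P ((1/2) ^ j))"
      unfolding sum.atMost_Suc by (auto intro!: sum.cong)
    also have "(\<Sum>j\<le>Suc k. (if 0 < j then a * c (j - 1) else 0) * poly P ((1/2) ^ j))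
        - (\<Sum>j\<le>Suc k. (if j \<le> k then c j else 0) * poly P ((1/2) ^ j))
      = (a - 1) * (\<Sum>j\<le>Suc k. c' j * poly P ((1/2) ^ j))"
      unfolding sum_subtractf[symmetric] sum_distrib_left
      by (intro sum.cong refl) (simp only: left_diff_distrib[symmetric] c'a[symmetric] mult.assoc)
    finally have "(a - 1) * poly P 0 = (a - 1) * (\<Sum>j\<le>Suc k. c' j * poly P ((1/2) ^ j))" .
    then show ?thesis using a by simp
  qed
  then show ?case by (intro exI[of _ c']) auto
qed

lemma polys_extrapolate:
  "\<exists>c. \<forall>f\<in>polys k. \<forall>x z::real^'d. f x = (\<Sum>j\<le>k. c j * f (x + (1/2) ^ j *\<^sub>R z))"
proof -
  obtain c where c: "\<forall>P::real poly. degree P \<le> k \<longrightarrow> poly P 0 = (\<Sum>j\<le>k. c j * poly P ((1/2) ^ j))"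
    using poly_extrapolate[of k] by (rule exE)
  have "f x = (\<Sum>j\<le>k. c j * f (x + (1/2) ^ j *\<^sub>R z))" if f: "f \<in> polys k" for f :: "real^'d \<Rightarrow> real" and x z
  proof (rule polys_line[OF f, of x z])
    fix P assume P: "degree P \<le> k" "\<And>t. f (x + t *\<^sub>R z) = poly P t"
    have "f x = poly P 0" using P(2)[of 0] by simp
    also have "\<dots> = (\<Sum>j\<le>k. c j * poly P ((1/2) ^ j))" by (rule c[rule_format, OF P(1)])
    also have "\<dots> = (\<Sum>j\<le>k. c j * f (x + (1/2) ^ j *\<^sub>R z))" by (simp only: P(2))
    finally show ?thesis .
  qed
  then show ?thesis by (intro exI[of _ c] ballI allI)
qed

lemma set_integral_contraction:
  fixes f :: "real^'d \<Rightarrow> real"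
  assumes K: "convex K" "compact K" and x: "x \<in> K" and s: "0 < s" "s \<le> 1"
    and f: "continuous_on UNIV f" and pos: "\<And>y. 0 \<le> f y"
  shows "s ^ CARD('d) * (LINT y:K|lborel. f (x + s *\<^sub>R (y - x))) \<le> (LINT y:K|lborel. f y)"
proof -
  have fK: "emeasure lborel K < \<infinity>" using K by (intro emeasure_bounded_finite compact_imp_bounded)
  have [measurable]: "K \<in> sets borel" using K(2) by (rule borel_compact)
  have [measurable]: "f \<in> borel_measurable borel" using f by (rule borel_measurable_continuous_onI)
  define t where "t = (1 - s) *\<^sub>R x"
  have eq: "x + s *\<^sub>R (y - x) = t + s *\<^sub>R y" for y by (simp add: t_def algebra_simps)
  have inK: "t + s *\<^sub>R y \<in> K" if "y \<in> K" for y
    unfolding t_def using K(1) x that s by (intro convexD) auto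
  have I0: "0 \<le> (LINT y:K|lborel. f y)"
    unfolding set_lebesgue_integral_def using pos by (intro integral_nonneg_AE AE_I2) (simp split: split_indicator)
  have I1: "0 \<le> (LINT y:K|lborel. f (t + s *\<^sub>R y))"
    unfolding set_lebesgue_integral_def using pos by (intro integral_nonneg_AE AE_I2) (simp split: split_indicator)
  have cs: "continuous_on UNIV (\<lambda>y. f (t + s *\<^sub>R y))"
    by (rule continuous_on_compose2[OF f]) (auto intro!: continuous_intros)
  have "ennreal (LINT y:K|lborel. f y) = (\<integral>\<^sup>+y. ennreal (f y) * indicator K y \<partial>lborel)"
    by (rule nn_set_integral_compact[OF K(2) _ fK f, symmetric]) (auto simp: pos)
  also have "\<dots> = ennreal (s ^ CARD('d)) * (\<integral>\<^sup>+y. ennreal (f (t + s *\<^sub>R y)) * indicator K (t + s *\<^sub>R y) \<partial>lborel)"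
    using s by (subst lborel_affine[of s t]) (simp_all add: nn_integral_density nn_integral_distr nn_integral_cmult)
  also have "\<dots> \<ge> ennreal (s ^ CARD('d)) * (\<integral>\<^sup>+y. ennreal (f (t + s *\<^sub>R y)) * indicator K y \<partial>lborel)"
    using inK by (intro mult_left_mono nn_integral_mono) (auto split: split_indicator)
  also have "(\<integral>\<^sup>+y. ennreal (f (t + s *\<^sub>R y)) * indicator K y \<partial>lborel) = ennreal (LINT y:K|lborel. f (t + s *\<^sub>R y))"
    by (rule nn_set_integral_compact[OF K(2) _ fK cs]) (auto simp: pos)
  finally have "ennreal (s ^ CARD('d) * (LINT y:K|lborel. f (t + s *\<^sub>R y))) \<le> ennreal (LINT y:K|lborel. f y)"
    using s I1 by (simp add: ennreal_mult)
  then show ?thesis using I0 by (simp add: eq)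
qed

text \<open>The constant is the same for all convex bodies and needs no scaling to a reference element:
  \<open>f x\<close> is extrapolated from the points \<open>x + 2\<^sup>-\<^sup>j (y - x)\<close>, and this identity is squared and integrated
  over \<open>y \<in> K\<close>. The contraction towards \<open>x\<close> maps \<open>K\<close> into itself.\<close>
lemma polys_sup_bound:
  "\<exists>C>0. \<forall>f\<in>polys k. \<forall>K::(real^'d) set. convex K \<longrightarrow> compact K \<longrightarrow>
    (\<forall>x\<in>K. (f x)\<^sup>2 * measure lborel K \<le> C * (LINT y:K|lborel. (f y)\<^sup>2))"
proof -
  obtain c where "\<forall>f\<in>polys k. \<forall>x z::real^'d. f x = (\<Sum>j\<le>k. c j * f (x + (1/2) ^ j *\<^sub>R z))"
    using polys_extrapolate[of k] by (rule exE)
  then have c: "f x = (\<Sum>j\<le>k. c j * f (x + (1/2) ^ j *\<^sub>R z))" if "f \<in> polys k" for f and x z :: "real^'d"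
    using that by (elim ballE allE) auto
  define C where "C = (real (Suc k) * (\<Sum>j\<le>k. (c j)\<^sup>2 * (2 ^ j) ^ CARD('d))) + 1"
  have C: "0 < C" unfolding C_def by (intro add_nonneg_pos mult_nonneg_nonneg sum_nonneg) auto
  have "(f x)\<^sup>2 * measure lborel K \<le> C * (LINT y:K|lborel. (f y)\<^sup>2)"
    if f: "f \<in> polys k" and K: "convex K" "compact K" and x: "x \<in> K" for f and K :: "(real^'d) set" and x
  proof -
    have fK: "emeasure lborel K < \<infinity>" using K by (intro emeasure_bounded_finite compact_imp_bounded)
    have mK: "K \<in> sets lborel" using K(2) by (simp add: borel_compact)
    note cf = continuous_polys[OF f, of UNIV]
    have cfj: "continuous_on UNIV (\<lambda>y. (f (x + (1/2) ^ j *\<^sub>R (y - x)))\<^sup>2)" for j :: nat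
      by (intro continuous_intros continuous_on_compose2[OF cf]) auto
    have I0: "0 \<le> (LINT y:K|lborel. (f y)\<^sup>2)"
      unfolding set_lebesgue_integral_def by (intro integral_nonneg_AE AE_I2) (simp split: split_indicator)
    have pt: "(f x)\<^sup>2 \<le> real (Suc k) * (\<Sum>j\<le>k. (c j)\<^sup>2 * (f (x + (1/2) ^ j *\<^sub>R (y - x)))\<^sup>2)" for y
    proof -
      have "(f x)\<^sup>2 = (\<Sum>j\<le>k. c j * f (x + (1/2) ^ j *\<^sub>R (y - x)))\<^sup>2" by (subst c[OF f, of x "y - x"]) simp
      also have "\<dots> \<le> real (card {..k}) * (\<Sum>j\<le>k. (c j * f (x + (1/2) ^ j *\<^sub>R (y - x)))\<^sup>2)"
        using sum_squared_le_sum_of_squares[of "\<lambda>j. c j * f (x + (1/2) ^ j *\<^sub>R (y - x))" "{..k}"]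
        by (simp only: mult.commute)
      finally show ?thesis by (simp add: power_mult_distrib)
    qed
    have "(f x)\<^sup>2 * measure lborel K = (LINT y:K|lborel. (f x)\<^sup>2)"
      using fK mK by (simp add: set_lebesgue_integral_def mult.commute)
    also have "\<dots> \<le> (LINT y:K|lborel. real (Suc k) * (\<Sum>j\<le>k. (c j)\<^sup>2 * (f (x + (1/2) ^ j *\<^sub>R (y - x)))\<^sup>2))"
      by (intro set_integral_mono set_integrable_compact_finite[OF K(2) _ fK] continuous_intros cfj pt) auto
    also have "\<dots> = real (Suc k) * (\<Sum>j\<le>k. (c j)\<^sup>2 * (LINT y:K|lborel. (f (x + (1/2) ^ j *\<^sub>R (y - x)))\<^sup>2))"
      by (subst set_integral_mult_right, subst set_integral_sum)
         (auto intro!: set_integrable_compact_finite[OF K(2) _ fK] continuous_intros cfj)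
    also have "\<dots> \<le> real (Suc k) * (\<Sum>j\<le>k. (c j)\<^sup>2 * ((2 ^ j) ^ CARD('d) * (LINT y:K|lborel. (f y)\<^sup>2)))"
    proof (intro mult_left_mono sum_mono)
      fix j :: nat
      have "((1/2) ^ j) ^ CARD('d) * (LINT y:K|lborel. (f (x + (1/2) ^ j *\<^sub>R (y - x)))\<^sup>2) \<le> (LINT y:K|lborel. (f y)\<^sup>2)"
        by (rule set_integral_contraction[OF K x]) (auto simp: power_le_one intro!: continuous_intros cf)
      from mult_left_mono[OF this, of "(2 ^ j) ^ CARD('d)"]
      have "((2 ^ j) ^ CARD('d) * ((1/2) ^ j) ^ CARD('d)) * (LINT y:K|lborel. (f (x + (1/2) ^ j *\<^sub>R (y - x)))\<^sup>2)
        \<le> (2 ^ j) ^ CARD('d) * (LINT y:K|lborel. (f y)\<^sup>2)" by (simp only: mult.assoc zero_le_power zero_le_numeral)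
      also have "(2 ^ j) ^ CARD('d) * ((1/2) ^ j) ^ CARD('d) = (1::real)"
        unfolding power_mult_distrib[symmetric] by simp
      finally show "(LINT y:K|lborel. (f (x + (1/2) ^ j *\<^sub>R (y - x)))\<^sup>2) \<le> (2 ^ j) ^ CARD('d) * (LINT y:K|lborel. (f y)\<^sup>2)" by simp
    qed auto
    also have "\<dots> = (C - 1) * (LINT y:K|lborel. (f y)\<^sup>2)"
      unfolding C_def by (simp only: sum_distrib_right mult.assoc add_diff_cancel_right')
    also have "\<dots> \<le> C * (LINT y:K|lborel. (f y)\<^sup>2)" using I0 by (intro mult_right_mono) auto
    finally show ?thesis .
  qed
  with C show ?thesis by (intro exI[of _ C]) auto
qed

section \<open>Simplicial meshes\<close>

lemma polyhedral_interior_closure: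
  assumes "polyhedral \<Omega>"
  shows "interior (closure \<Omega>) = \<Omega>"
proof -
  obtain P where P: "finite P" "\<forall>X\<in>P. polytope X" "\<Omega> = interior (\<Union>P)"
    using assms unfolding polyhedral_def by auto
  have "closed (\<Union>P)" using P by (intro closed_Union) (auto intro: polytope_imp_closed)
  then have "closure \<Omega> \<subseteq> \<Union>P" unfolding P(3) by (simp add: closure_minimal interior_subset)
  then have "interior (closure \<Omega>) \<subseteq> \<Omega>" unfolding P(3) by (rule interior_mono)
  moreover have "open \<Omega>" by (simp add: P(3))
  then have "\<Omega> \<subseteq> interior (closure \<Omega>)" by (simp add: closure_subset interior_maximal)
  ultimately show ?thesis by blast
qed

lemma facets_eq_of_subset:
  assumes "convex K" "e facet_of K" "e' facet_of K" "e \<subseteq> e'"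
  shows "e = e'"
proof (rule ccontr)
  assume "e \<noteq> e'"
  have "e' face_of K" "e face_of K" using assms by (auto simp: facet_of_def)
  then have "e face_of e'" using assms(4) face_of_subset face_of_imp_subset by blast
  moreover have "convex e'" using \<open>e' face_of K\<close> assms(1) face_of_imp_convex by blast
  ultimately have "aff_dim e < aff_dim e'" using \<open>e \<noteq> e'\<close> face_of_aff_dim_lt by blast
  then show False using assms by (auto simp: facet_of_def)
qed

text \<open>Near a point in the relative interior of a facet only one of the inequalities that define the simplex is active.\<close>
lemma simplex_near_facet:
  fixes K :: "(real^'d) set"
  assumes K: "int CARD('d) simplex K" and e: "e facet_of K" and y: "y \<in> rel_interior e"
  obtains \<epsilon> where "0 < \<epsilon>" "\<And>x. x \<in> ball y \<epsilon> \<Longrightarrow> outward_normal K e \<bullet> x \<le> outward_normal K e \<bullet> y \<Longrightarrow> x \<in> K"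
proof (rule simplex_barycentric[OF K])
  fix C and \<nu> :: "real^'d \<Rightarrow> real^'d" and \<alpha> \<eta> :: "real^'d \<Rightarrow> real"
  assume C: "finite C" "card C = Suc CARD('d)" "K = convex hull C"
    "{e. e facet_of K} = (\<lambda>c. convex hull (C - {c})) ` C"
    and on: "\<And>c. c \<in> C \<Longrightarrow> outward_normal K (convex hull (C - {c})) = \<nu> c"
    and H: "\<And>c. c \<in> C \<Longrightarrow> affine hull (convex hull (C - {c})) = {x. \<nu> c \<bullet> x = \<alpha> c}"
    and \<eta>: "\<And>c. c \<in> C \<Longrightarrow> 0 < \<eta> c" and cc: "\<And>c. c \<in> C \<Longrightarrow> \<nu> c \<bullet> c = \<alpha> c - \<eta> c"
    and Kl: "K = {x. \<forall>c\<in>C. \<nu> c \<bullet> x \<le> \<alpha> c}"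
  obtain c where c: "c \<in> C" "e = convex hull (C - {c})" using e C(4) by blast
  have n: "outward_normal K e = \<nu> c" using on c by simp
  have ye: "y \<in> e" using y rel_interior_subset by blast
  have eK: "e \<subseteq> K" using e facet_of_imp_subset by blast
  have ny: "\<nu> c \<bullet> y = \<alpha> c" using hull_inc[OF ye, of affine] H[OF c(1)] c(2) by auto
  have strict: "\<nu> c' \<bullet> y < \<alpha> c'" if c': "c' \<in> C" "c' \<noteq> c" for c'
  proof (rule ccontr)
    assume "\<not> \<nu> c' \<bullet> y < \<alpha> c'"
    moreover have "\<nu> c' \<bullet> y \<le> \<alpha> c'" using ye eK Kl c' by auto
    ultimately have eq: "\<nu> c' \<bullet> y = \<alpha> c'" by simp
    define e' where "e' = convex hull (C - {c'})"
    have e': "e' facet_of K" using C(4) c' unfolding e'_def by blast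
    have n': "outward_normal K e' = \<nu> c'" using on[OF c'(1)] by (simp only: e'_def)
    have H': "affine hull e' = {x. \<nu> c' \<bullet> x = \<alpha> c'}" using H[OF c'(1)] by (simp only: e'_def)
    obtain a where a: "\<And>x. x \<in> e' \<Longrightarrow> \<nu> c' \<bullet> x = a" "\<And>x. x \<in> K \<Longrightarrow> \<nu> c' \<bullet> x = a \<Longrightarrow> x \<in> e'"
      using facet_hyperplane[OF K e'] n' by metis
    obtain x0 where "x0 \<in> e'" using e' by (auto simp: facet_of_def)
    then have "a = \<alpha> c'" using a(1)[of x0] hull_inc[of x0 e' affine] H' by auto
    then have "y \<in> e'" using a(2)[of y] eq ye eK by auto
    then have "e \<subseteq> e'" using subset_of_face_of[OF facet_of_imp_face_of[OF e'] eK] y by blast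
    then have "e = e'" using facets_eq_of_subset[OF _ e e'] compact_simplex[OF K] by blast
    moreover have "c \<in> e'" using c(1) c'(2) unfolding e'_def by (intro hull_inc) auto
    ultimately have "c \<in> e" by simp
    then have "\<nu> c \<bullet> c = \<alpha> c" using hull_inc[of c e affine] H[OF c(1)] c(2) by auto
    then show False using cc[OF c(1)] \<eta>[OF c(1)] by simp
  qed
  have "\<exists>\<epsilon>>0. \<forall>x\<in>ball y \<epsilon>. \<forall>c'\<in>C - {c}. \<nu> c' \<bullet> x \<le> \<alpha> c'"
  proof -
    have "open (\<Inter>c'\<in>C - {c}. {x. \<nu> c' \<bullet> x < \<alpha> c'})"
      using C(1) by (intro open_INT) (auto simp: open_halfspace_lt)
    moreover have "y \<in> (\<Inter>c'\<in>C - {c}. {x. \<nu> c' \<bullet> x < \<alpha> c'})" using strict by auto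
    ultimately obtain \<epsilon> where "0 < \<epsilon>" "ball y \<epsilon> \<subseteq> (\<Inter>c'\<in>C - {c}. {x. \<nu> c' \<bullet> x < \<alpha> c'})"
      using open_contains_ball by blast
    then show ?thesis by (intro exI[of _ \<epsilon>]) (auto intro: less_imp_le)
  qed
  then obtain \<epsilon> where \<epsilon>: "0 < \<epsilon>" "\<And>x c'. x \<in> ball y \<epsilon> \<Longrightarrow> c' \<in> C - {c} \<Longrightarrow> \<nu> c' \<bullet> x \<le> \<alpha> c'" by blast
  show ?thesis
  proof (rule that[OF \<epsilon>(1)])
    fix x assume x: "x \<in> ball y \<epsilon>" "outward_normal K e \<bullet> x \<le> outward_normal K e \<bullet> y"
    have "\<nu> c' \<bullet> x \<le> \<alpha> c'" if "c' \<in> C" for c'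
      using \<epsilon>(2)[OF x(1)] x(2) n ny that by (cases "c' = c") auto
    then show "x \<in> K" using Kl by auto
  qed
qed

locale regular_mesh =
  fixes \<Omega> :: "(real^'d) set" and T :: "(real^'d) set set" and \<kappa> A :: real
  assumes open_dom: "open \<Omega>" and bounded_dom: "bounded \<Omega>" and nonempty_dom: "\<Omega> \<noteq> {}"
    and regular_dom: "interior (closure \<Omega>) = \<Omega>" and mesh: "mesh_of \<Omega> T"
    and shape: "shape_regular \<kappa> T" and quasi: "quasi_uniform A T" and \<kappa>: "0 < \<kappa>"
begin

lemma finite_mesh: "finite T" and simplex: "K \<in> T \<Longrightarrow> int CARD('d) simplex K"
  and Union_mesh: "\<Union>T = closure \<Omega>"
  and face_Int: "K \<in> T \<Longrightarrow> K' \<in> T \<Longrightarrow> K \<inter> K' face_of K"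
  using mesh unfolding mesh_of_def triangulation_def by auto

lemma mesh_nonempty: "T \<noteq> {}"
  using Union_mesh nonempty_dom by (metis Union_empty closure_eq_empty)

lemma compact_elem: "K \<in> T \<Longrightarrow> compact K" and convex_elem: "K \<in> T \<Longrightarrow> convex K"
  using compact_simplex[OF simplex] by auto

lemma shape_elem: "K \<in> T \<Longrightarrow> \<kappa> \<le> measure lebesgue K / diameter K ^ CARD('d)"
  using shape unfolding shape_regular_def by auto

lemma diameter_pos: "K \<in> T \<Longrightarrow> 0 < diameter K"
  using simplex_shape(1)[OF simplex \<kappa> shape_elem] .

lemma interior_elem_nonempty: "K \<in> T \<Longrightarrow> interior K \<noteq> {}"
proof -
  assume K: "K \<in> T"
  obtain x where "ball x (\<kappa> / (2 ^ CARD('d) * real (Suc CARD('d))) * diameter K) \<subseteq> K"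
    using simplex_shape(2)[OF simplex[OF K] \<kappa> shape_elem[OF K]] by blast
  then have "ball x (\<kappa> / (2 ^ CARD('d) * real (Suc CARD('d))) * diameter K) \<subseteq> interior K"
    by (simp add: interior_maximal)
  moreover have "0 < \<kappa> / (2 ^ CARD('d) * real (Suc CARD('d))) * diameter K"
    using \<kappa> diameter_pos[OF K] by simp
  ultimately show ?thesis by (metis ball_eq_empty not_less subset_empty)
qed

lemma interior_elem_disjoint:
  assumes "K \<in> T" "K' \<in> T" "K \<noteq> K'"
  shows "interior K \<inter> K' = {}"
proof (cases "K \<inter> K' = K")
  case False
  then show ?thesis using face_of_disjoint_interior[OF face_Int[OF assms(1,2)]] interior_subset[of K] by blast
next
  case True
  then have "K \<subseteq> K'" by blast
  moreover have "K face_of K'" using face_Int[OF assms(2,1)] True by (simp add: Int_commute)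
  ultimately have "K \<inter> interior K' = {}" using face_of_disjoint_interior assms(3) by blast
  then show ?thesis using interior_mono[OF \<open>K \<subseteq> K'\<close>] interior_subset[of K] interior_elem_nonempty[OF assms(1)] by blast
qed

text \<open>A facet and a neighbour that touches its relative interior: the intersection is a common face containing
  the facet, and it cannot be all of \<open>K\<close>.\<close>
lemma facet_Int:
  assumes K: "K \<in> T" "K' \<in> T" "K \<noteq> K'" and e: "e facet_of K" and y: "y \<in> rel_interior e" "y \<in> K'"
  shows "K \<inter> K' = e" "e facet_of K'"
proof -
  have eK: "e \<subseteq> K" using e facet_of_imp_subset by blast
  have yK: "y \<in> K" using y rel_interior_subset eK by blast
  have F: "K \<inter> K' face_of K" "K \<inter> K' face_of K'" using face_Int[OF K(1,2)] face_Int[OF K(2,1)] by (simp_all add: Int_commute)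
  have sub: "e \<subseteq> K \<inter> K'" using subset_of_face_of[OF F(1) eK] y yK by blast
  have ne: "K \<inter> K' \<noteq> K"
    using interior_elem_disjoint[OF K] interior_elem_nonempty[OF K(1)] interior_subset[of K] by blast
  have "aff_dim (K \<inter> K') < aff_dim K" using face_of_aff_dim_lt[OF convex_elem[OF K(1)] F(1) ne] .
  moreover have "aff_dim e = aff_dim K - 1" using e by (simp add: facet_of_def)
  moreover have "e face_of K \<inter> K'" using face_of_subset[OF facet_of_imp_face_of[OF e] sub] by blast
  then have "e \<noteq> K \<inter> K' \<Longrightarrow> aff_dim e < aff_dim (K \<inter> K')"
    using face_of_aff_dim_lt face_of_imp_convex[OF F(1)] convex_elem[OF K(1)] by blast
  ultimately show eq: "K \<inter> K' = e" by (cases "e = K \<inter> K'") auto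
  have "aff_dim K = aff_dim K'" using aff_dim_simplex simplex K by metis
  then show "e facet_of K'" using e F(2) unfolding eq facet_of_def by simp
qed

lemma facet_rel_interior: "K \<in> T \<Longrightarrow> e facet_of K \<Longrightarrow> rel_interior e \<noteq> {} \<and> convex e \<and> e \<subseteq> closure (rel_interior e)"
proof -
  assume K: "K \<in> T" and e: "e facet_of K"
  have c: "convex e" using e convex_elem[OF K] face_of_imp_convex facet_of_imp_face_of by blast
  moreover have "e \<noteq> {}" using e by (simp add: facet_of_def)
  ultimately show ?thesis using convex_closure_rel_interior[OF c] rel_interior_eq_empty[OF c] closure_subset by blast
qed

text \<open>If the second element had a point strictly on the side of the first one, the segment from it to the
  facet would end in points that belong to both elements but not to their common facet.\<close>
lemma opposite_normals:
  assumes K: "K \<in> T" "K' \<in> T" "K \<noteq> K'" and e: "e facet_of K" "e facet_of K'"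
  shows "outward_normal K' e = - outward_normal K e"
proof -
  obtain y where y: "y \<in> rel_interior e" using facet_rel_interior[OF K(1) e(1)] by blast
  then have ye: "y \<in> e" using rel_interior_subset by blast
  have eK': "e \<subseteq> K'" using e(2) facet_of_imp_subset by blast
  have Int: "K \<inter> K' = e" using facet_Int(1)[OF K e(1) y] ye eK' by blast
  let ?n = "outward_normal K e"
  obtain \<epsilon> where \<epsilon>: "0 < \<epsilon>" "\<And>x. x \<in> ball y \<epsilon> \<Longrightarrow> ?n \<bullet> x \<le> ?n \<bullet> y \<Longrightarrow> x \<in> K"
    by (rule simplex_near_facet[OF simplex[OF K(1)] e(1) y]) blast
  obtain a where n: "norm ?n = 1" "\<And>x. x \<in> e \<Longrightarrow> ?n \<bullet> x = a"
    by (rule facet_hyperplane[OF simplex[OF K(1)] e(1)]) blast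
  have side: "a \<le> ?n \<bullet> z" if z: "z \<in> K'" for z
  proof (rule ccontr)
    assume less: "\<not> a \<le> ?n \<bullet> z"
    then have zy: "z \<noteq> y" using n(2)[OF ye] by auto
    define t where "t = min 1 (\<epsilon> / (2 * norm (z - y)))"
    have t: "0 < t" "t \<le> 1" "t * norm (z - y) < \<epsilon>"
    proof -
      have "t * norm (z - y) \<le> \<epsilon> / (2 * norm (z - y)) * norm (z - y)" unfolding t_def by (intro mult_right_mono) auto
      also have "\<dots> = \<epsilon> / 2" using zy by simp
      finally show "t * norm (z - y) < \<epsilon>" using \<epsilon>(1) by simp
    qed (use zy \<epsilon>(1) in \<open>auto simp: t_def\<close>)
    let ?w = "y + t *\<^sub>R (z - y)"
    have nw: "?n \<bullet> ?w = a + t * (?n \<bullet> z - a)" using n(2)[OF ye] by (simp add: inner_add_right inner_diff_right)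
    have lt: "t * (?n \<bullet> z - a) < 0" using t(1) less by (simp add: mult_pos_neg)
    have "?w \<in> K" using t lt nw n(2)[OF ye] by (intro \<epsilon>(2)) (auto simp: dist_norm)
    moreover have "?w = (1 - t) *\<^sub>R y + t *\<^sub>R z" by (simp add: algebra_simps)
    then have "?w \<in> K'" using convexD_alt[OF convex_elem[OF K(2)], of y z t] eK' ye z t by auto
    ultimately have "?n \<bullet> ?w = a" using Int n(2) by blast
    then show False using nw lt by linarith
  qed
  show ?thesis unfolding outward_normal_def[of K' e]
  proof (rule the1_equality[OF outward_normal_unique[OF simplex[OF K(2)] e(2)]])
    show "norm (- ?n) = 1 \<and> (\<exists>c. (\<forall>x\<in>e. - ?n \<bullet> x = c) \<and> (\<forall>x\<in>K'. - ?n \<bullet> x \<le> c))"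
      using n side by (intro conjI exI[of _ "- a"]) auto
  qed
qed

text \<open>Points of the domain just across the facet belong to elements other than \<open>K\<close>; there are finitely
  many of them and they are closed.\<close>
lemma interior_face_neighbour:
  assumes K: "K \<in> T" and e: "e facet_of K" and meets: "e \<inter> \<Omega> \<noteq> {}"
  obtains K' where "K' \<in> T" "K' \<noteq> K" "e facet_of K'"
proof -
  have "closure (rel_interior e) \<inter> \<Omega> \<noteq> {}" using facet_rel_interior[OF K e] meets by blast
  then obtain y where y: "y \<in> rel_interior e" "y \<in> \<Omega>"
    using open_Int_closure_eq_empty[OF open_dom, of "rel_interior e"] by blast
  obtain a where n: "norm (outward_normal K e) = 1" "\<And>x. x \<in> e \<Longrightarrow> outward_normal K e \<bullet> x = a"
      "\<And>x. x \<in> K \<Longrightarrow> outward_normal K e \<bullet> x \<le> a"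
    by (rule facet_hyperplane[OF simplex[OF K] e]) blast
  have "\<exists>K'\<in>T - {K}. y \<in> K'"
  proof (rule ccontr)
    assume "\<not> ?thesis"
    then have yU: "y \<in> \<Omega> - \<Union>(T - {K})" using y by blast
    have "closed (\<Union>(T - {K}))" using finite_mesh compact_elem by (intro closed_Union) (auto intro: compact_imp_closed)
    then have "open (\<Omega> - \<Union>(T - {K}))" using open_dom by (intro open_Diff)
    then obtain \<epsilon> where \<epsilon>: "0 < \<epsilon>" "ball y \<epsilon> \<subseteq> \<Omega> - \<Union>(T - {K})" using yU open_contains_ball by blast
    let ?w = "y + (\<epsilon>/2) *\<^sub>R outward_normal K e"
    have "?w \<in> ball y \<epsilon>" using \<epsilon>(1) n(1) by (simp add: dist_norm)
    then have "?w \<in> \<Omega> - \<Union>(T - {K})" using \<epsilon>(2) by blast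
    then have "?w \<in> K" using Union_mesh closure_subset[of \<Omega>] by blast
    then have "outward_normal K e \<bullet> ?w \<le> a" by (rule n(3))
    moreover have "outward_normal K e \<bullet> y = a" using y rel_interior_subset n(2) by blast
    moreover have "outward_normal K e \<bullet> outward_normal K e = 1" using n(1) by (simp add: norm_eq_1)
    ultimately show False using \<epsilon>(1) by (simp add: inner_add_right)
  qed
  then obtain K' where K': "K' \<in> T" "K' \<noteq> K" "y \<in> K'" by blast
  with facet_Int(2)[OF K K'(1) _ e y(1) K'(3)] that show ?thesis by blast
qed

text \<open>Summing a quantity that is odd in the normal over all facets of all elements, the two contributions
  of an interior face cancel. Three elements cannot share a face, since their normals would have to be opposite in pairs.\<close>
lemma skeleton_cancellation:
  fixes L :: "(real^'d) set \<Rightarrow> real^'d \<Rightarrow> real"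
  assumes odd: "\<And>e n. L e (- n) = - L e n" and out: "\<And>e n. e \<inter> \<Omega> = {} \<Longrightarrow> L e n = 0"
  shows "(\<Sum>K\<in>T. \<Sum>e | e facet_of K. L e (outward_normal K e)) = 0"
proof -
  have fin: "finite (faces T)"
  proof -
    have "faces T = (\<Union>K\<in>T. {e. e facet_of K})" unfolding faces_def by blast
    then show ?thesis using finite_mesh finite_facets_simplex[OF simplex] by auto
  qed
  have "(\<Sum>K\<in>T. \<Sum>e | e facet_of K. L e (outward_normal K e))
    = (\<Sum>K\<in>T. \<Sum>e | e \<in> faces T \<and> e facet_of K. L e (outward_normal K e))"
    by (intro sum.cong refl) (auto simp: faces_def)
  also have "\<dots> = (\<Sum>e\<in>faces T. \<Sum>K | K \<in> T \<and> e facet_of K. L e (outward_normal K e))"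
    by (rule sum.swap_restrict[OF finite_mesh fin])
  also have "\<dots> = (\<Sum>e\<in>faces T. 0)"
  proof (rule sum.cong[OF refl])
    fix e assume "e \<in> faces T"
    then obtain K where K: "K \<in> T" "e facet_of K" by (auto simp: faces_def)
    show "(\<Sum>K | K \<in> T \<and> e facet_of K. L e (outward_normal K e)) = 0"
    proof (cases "e \<inter> \<Omega> = {}")
      case True then show ?thesis using out by simp
    next
      case False
      obtain K' where K': "K' \<in> T" "K' \<noteq> K" "e facet_of K'" by (rule interior_face_neighbour[OF K False])
      have op: "outward_normal K' e = - outward_normal K e"
        using opposite_normals[OF K(1) K'(1) _ K(2) K'(3)] K'(2) by blast
      have "K'' = K \<or> K'' = K'" if K'': "K'' \<in> T" "e facet_of K''" for K''
      proof (rule ccontr)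
        assume "\<not> ?thesis"
        then have "outward_normal K'' e = - outward_normal K e" "outward_normal K'' e = - outward_normal K' e"
          using opposite_normals[OF K(1) K''(1) _ K(2) K''(2)] opposite_normals[OF K'(1) K''(1) _ K'(3) K''(2)] by auto
        then have "outward_normal K e \<bullet> outward_normal K e = - (outward_normal K e \<bullet> outward_normal K e)"
          using op by (metis inner_minus_left minus_minus)
        moreover have "norm (outward_normal K e) = 1" by (rule facet_hyperplane[OF simplex[OF K(1)] K(2)])
        ultimately show False by (simp add: norm_eq_1)
      qed
      then have "{K''. K'' \<in> T \<and> e facet_of K''} = {K, K'}" using K K' by blast
      then show ?thesis using K'(2) odd op by simp
    qed
  qed
  finally show ?thesis by simp
qed

text \<open>Two elements on both sides of \<open>e\<close> would cover a neighbourhood of a point of \<open>e\<close>, which would then be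
  interior to \<open>closure \<Omega>\<close>, that is, a point of \<open>\<Omega>\<close>.\<close>
lemma boundary_elem_unique:
  assumes e: "e \<subseteq> frontier \<Omega>" and K: "K \<in> T" "e facet_of K" and K': "K' \<in> T" "e facet_of K'"
  shows "K = K'"
proof (rule ccontr)
  assume ne: "K \<noteq> K'"
  obtain y where y: "y \<in> rel_interior e" using facet_rel_interior[OF K] by blast
  have op: "outward_normal K' e = - outward_normal K e" by (rule opposite_normals[OF K(1) K'(1) ne K(2) K'(2)])
  obtain \<epsilon> where \<epsilon>: "0 < \<epsilon>" "\<And>x. x \<in> ball y \<epsilon> \<Longrightarrow> outward_normal K e \<bullet> x \<le> outward_normal K e \<bullet> y \<Longrightarrow> x \<in> K"
    by (rule simplex_near_facet[OF simplex[OF K(1)] K(2) y]) blast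
  obtain \<epsilon>' where \<epsilon>': "0 < \<epsilon>'" "\<And>x. x \<in> ball y \<epsilon>' \<Longrightarrow> outward_normal K' e \<bullet> x \<le> outward_normal K' e \<bullet> y \<Longrightarrow> x \<in> K'"
    by (rule simplex_near_facet[OF simplex[OF K'(1)] K'(2) y]) blast
  have "ball y (min \<epsilon> \<epsilon>') \<subseteq> K \<union> K'"
  proof
    fix x assume "x \<in> ball y (min \<epsilon> \<epsilon>')"
    then show "x \<in> K \<union> K'" using \<epsilon>(2)[of x] \<epsilon>'(2)[of x] op by (cases "outward_normal K e \<bullet> x \<le> outward_normal K e \<bullet> y") auto
  qed
  also have "\<dots> \<subseteq> closure \<Omega>" using Union_mesh K K' by blast
  finally have "ball y (min \<epsilon> \<epsilon>') \<subseteq> \<Omega>" using interior_maximal[of "ball y (min \<epsilon> \<epsilon>')" "closure \<Omega>"] regular_dom by simp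
  then have "y \<in> \<Omega>" using \<epsilon>(1) \<epsilon>'(1) by (metis centre_in_ball min_less_iff_conj subsetD)
  moreover have "y \<in> frontier \<Omega>" using y rel_interior_subset e by blast
  ultimately show False using open_dom by (simp add: frontier_def interior_open)
qed

lemma elem_at_boundary:
  assumes "e \<in> boundary_faces \<Omega> T"
  shows "elem_at T e \<in> T" "e facet_of elem_at T e"
proof -
  have "\<exists>!K. K \<in> T \<and> e facet_of K"
    using assms boundary_elem_unique unfolding boundary_faces_def faces_def by blast
  then have "elem_at T e \<in> T \<and> e facet_of elem_at T e" unfolding elem_at_def by (rule theI')
  then show "elem_at T e \<in> T" "e facet_of elem_at T e" by auto
qed

end

section \<open>Integration by parts and the sizes of elements\<close>

text \<open>The divergence in the discrete equation is a derivative within a closed element. At boundary points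
  of the element it is still determined, because a convex body has directions spanning the whole space at each of its points.\<close>
lemma has_derivative_unique_within_convex:
  fixes f :: "'a::euclidean_space \<Rightarrow> 'b::real_normed_vector"
  assumes K: "convex K" "interior K \<noteq> {}" and x: "x \<in> K"
    and f': "(f has_derivative f') (at x within K)" and f'': "(f has_derivative f'') (at x within K)"
  shows "f' = f''"
proof
  define D where "D h = f' h - f'' h" for h
  have lD: "linear D" unfolding D_def
    using f' f'' by (intro linear_compose_sub) (auto dest: has_derivative_linear)
  have "((\<lambda>y. f y - f y) has_derivative D) (at x within K)"
    unfolding D_def by (intro has_derivative_diff f' f'')
  then have D: "((\<lambda>y. 0) has_derivative D) (at x within K)" by simp
  have zero: "D (y - x) = 0" if y: "y \<in> K" for y
  proof (rule ccontr)
    assume nz: "D (y - x) \<noteq> 0"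
    then have yx: "y \<noteq> x" using linear_0[OF lD] by auto
    define e where "e = norm (D (y - x)) / (2 * norm (y - x))"
    have e: "0 < e" using nz yx by (simp add: e_def)
    obtain d where d: "0 < d" "\<And>z. z \<in> K \<Longrightarrow> norm (z - x) < d \<Longrightarrow> norm (0 - 0 - D (z - x)) \<le> e * norm (z - x)"
      using D e unfolding has_derivative_within_alt by blast
    define t where "t = min 1 (d / (2 * norm (y - x)))"
    have t: "0 < t" "t \<le> 1" using d(1) yx by (auto simp: t_def)
    have "t * norm (y - x) \<le> d / (2 * norm (y - x)) * norm (y - x)" unfolding t_def by (intro mult_right_mono) auto
    also have "\<dots> = d / 2" using yx by simp
    finally have small: "t * norm (y - x) < d" using d(1) by simp
    let ?z = "(1 - t) *\<^sub>R x + t *\<^sub>R y"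
    have zK: "?z \<in> K" using convexD_alt[OF K(1) x y] t by auto
    have zx: "?z - x = t *\<^sub>R (y - x)" by (simp add: algebra_simps)
    have "norm (D (?z - x)) \<le> e * norm (?z - x)" using d(2)[OF zK] small t by (simp add: zx)
    then have "t * norm (D (y - x)) \<le> t * (e * norm (y - x))"
      unfolding zx using t by (simp add: linear_scale[OF lD] mult.left_commute)
    then have "norm (D (y - x)) \<le> norm (D (y - x)) / 2" using t yx by (simp add: e_def)
    then show False using nz by simp
  qed
  obtain z r where r: "0 < r" "ball z r \<subseteq> K" using K(2) by (meson ex_in_conv mem_interior)
  fix h
  have "D h = 0"
  proof (cases "h = 0")
    case False
    define s where "s = r / (2 * norm h)"
    have s: "0 < s" using r False by (simp add: s_def)
    have "z + s *\<^sub>R h \<in> ball z r" using r(1) False by (simp add: s_def dist_norm)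
    then have "D (z + s *\<^sub>R h - x) = 0" using zero r(2) by blast
    moreover have "D (z - x) = 0" using zero r by (meson centre_in_ball subsetD)
    moreover have "D (z + s *\<^sub>R h - x) = D (z - x) + s *\<^sub>R D h"
      by (simp add: linear_add[OF lD, symmetric] linear_scale[OF lD, symmetric] algebra_simps)
    ultimately show ?thesis using s by simp
  qed (simp add: linear_0[OF lD])
  then show "f' h = f'' h" by (simp add: D_def)
qed

lemma broken_div_eq:
  fixes K :: "(real^'d) set"
  assumes K: "convex K" "interior K \<noteq> {}" and x: "x \<in> K" and q: "\<And>y. y \<in> K \<Longrightarrow> q K y = Q y"
    and Q: "\<And>i. ((\<lambda>y. Q y $ i) has_derivative (\<lambda>h. J i x \<bullet> h)) (at x)"
  shows "broken_div q K x = (\<Sum>i\<in>UNIV. J i x $ i)"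
proof -
  have "(Q has_derivative (\<lambda>h. \<chi> i. J i x \<bullet> h)) (at x)"
    using Q by (subst has_derivative_componentwise_within) (auto simp: Basis_vec_def inner_axis)
  then have "(Q has_derivative (\<lambda>h. \<chi> i. J i x \<bullet> h)) (at x within K)" by (rule has_derivative_at_withinI)
  from has_derivative_transform[OF x q this]
  have 1: "(q K has_derivative (\<lambda>h. \<chi> i. J i x \<bullet> h)) (at x within K)" .
  then have "(q K has_derivative frechet_derivative (q K) (at x within K)) (at x within K)"
    using frechet_derivative_works differentiable_def by blast
  then have "frechet_derivative (q K) (at x within K) = (\<lambda>h. \<chi> i. J i x \<bullet> h)"
    using has_derivative_unique_within_convex[OF K x _ 1] by blast
  then show ?thesis by (simp add: broken_div_def inner_axis)
qed

lemma set_integrable_simplex: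
  fixes K :: "(real^'d) set"
  assumes "int CARD('d) simplex K" "continuous_on UNIV (f :: real^'d \<Rightarrow> real)"
  shows "set_integrable lborel K f"
  using assms compact_simplex emeasure_simplex_finite by (intro set_integrable_compact_finite) auto

lemma set_integrable_facet:
  fixes K :: "(real^'d) set"
  assumes "int CARD('d) simplex K" "e facet_of K" "continuous_on UNIV (f :: real^'d \<Rightarrow> real)"
  shows "set_integrable (surface_lborel e) e f"
  using assms compact_facet emeasure_facet_finite by (intro set_integrable_compact_finite) auto

lemma continuous_of_gradient:
  assumes "\<And>x. (f has_derivative (\<lambda>h. g x \<bullet> h)) (at x)"
  shows "continuous_on UNIV f"
  using assms by (intro continuous_at_imp_continuous_on ballI) (auto intro: has_derivative_continuous)

lemma continuous_on_components:
  fixes Q :: "'a::topological_space \<Rightarrow> real^'d"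
  assumes "\<And>i. continuous_on S (\<lambda>x. Q x $ i)"
  shows "continuous_on S Q"
proof -
  have "continuous_on S (\<lambda>x. \<chi> i. Q x $ i)" by (intro continuous_on_vec_lambda assms)
  then show ?thesis by simp
qed

lemma simplex_green:
  fixes K :: "(real^'d) set"
  assumes K: "int CARD('d) simplex K"
    and u: "\<And>x. (u has_derivative (\<lambda>h. G x \<bullet> h)) (at x)" and G: "continuous_on UNIV G"
    and Q: "\<And>i x. ((\<lambda>y. Q y $ i) has_derivative (\<lambda>h. J i x \<bullet> h)) (at x)"
    and J: "\<And>i. continuous_on UNIV (J i)"
  shows "(LINT x:K|lborel. u x * (\<Sum>i\<in>UNIV. J i x $ i)) + (LINT x:K|lborel. G x \<bullet> Q x)
    = (\<Sum>e | e facet_of K. LINT x:e|surface_lborel e. u x * (Q x \<bullet> outward_normal K e))"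
proof -
  have cu: "continuous_on UNIV u" by (rule continuous_of_gradient[OF u])
  have cQi: "continuous_on UNIV (\<lambda>x. Q x $ i)" for i by (rule continuous_of_gradient[OF Q])
  have cQ: "continuous_on UNIV Q" by (rule continuous_on_components[OF cQi])
  have der: "((\<lambda>y. u y * Q y $ i) has_derivative (\<lambda>h. (u x *\<^sub>R J i x + Q x $ i *\<^sub>R G x) \<bullet> h)) (at x)" for i x
    by (rule has_derivative_eq_rhs[OF has_derivative_mult[OF u Q]])
       (simp add: fun_eq_iff inner_add_left mult.commute)
  have "(LINT x:K|lborel. u x * (\<Sum>i\<in>UNIV. J i x $ i)) + (LINT x:K|lborel. G x \<bullet> Q x)
    = (LINT x:K|lborel. u x * (\<Sum>i\<in>UNIV. J i x $ i) + G x \<bullet> Q x)"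
    by (intro set_integral_add(2)[symmetric] set_integrable_simplex[OF K] continuous_intros cu G J cQ)
  also have "\<dots> = (LINT x:K|lborel. (\<Sum>i\<in>UNIV. (u x *\<^sub>R J i x + Q x $ i *\<^sub>R G x) \<bullet> axis i 1))"
  proof -
    have "u x * (\<Sum>i\<in>UNIV. J i x $ i) + G x \<bullet> Q x = (\<Sum>i\<in>UNIV. (u x *\<^sub>R J i x + Q x $ i *\<^sub>R G x) \<bullet> axis i 1)" for x
    proof -
      have "G x \<bullet> Q x = (\<Sum>i\<in>UNIV. G x $ i * Q x $ i)" by (simp add: inner_vec_def)
      then show ?thesis by (simp add: inner_axis sum.distrib sum_distrib_left mult.commute)
    qed
    then show ?thesis by (simp only:)
  qed
  also have "\<dots> = (\<Sum>i\<in>UNIV. LINT x:K|lborel. (u x *\<^sub>R J i x + Q x $ i *\<^sub>R G x) \<bullet> axis i 1)"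
    by (intro set_integral_sum set_integrable_simplex[OF K] continuous_intros cu G J cQi)
  also have "\<dots> = (\<Sum>i\<in>UNIV. \<Sum>e | e facet_of K. (axis i 1 \<bullet> outward_normal K e) * (LINT x:e|surface_lborel e. u x * Q x $ i))"
    by (intro sum.cong refl simplex_divergence[OF K der] continuous_intros cu G J cQi)
  also have "\<dots> = (\<Sum>e | e facet_of K. \<Sum>i\<in>UNIV. (LINT x:e|surface_lborel e. (axis i 1 \<bullet> outward_normal K e) * (u x * Q x $ i)))"
    by (subst sum.swap) simp
  also have "\<dots> = (\<Sum>e | e facet_of K. LINT x:e|surface_lborel e. (\<Sum>i\<in>UNIV. (axis i 1 \<bullet> outward_normal K e) * (u x * Q x $ i)))"
    by (intro sum.cong refl set_integral_sum[symmetric] set_integrable_facet[OF K] continuous_intros cu cQi) auto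
  also have "\<dots> = (\<Sum>e | e facet_of K. LINT x:e|surface_lborel e. u x * (Q x \<bullet> outward_normal K e))"
  proof -
    have "(\<Sum>i\<in>UNIV. (axis i 1 \<bullet> n) * (u x * Q x $ i)) = u x * (Q x \<bullet> n)" for x n :: "real^'d"
    proof -
      have "Q x \<bullet> n = (\<Sum>i\<in>UNIV. Q x $ i * n $ i)" by (simp add: inner_vec_def)
      then show ?thesis by (simp add: inner_axis' sum_distrib_left mult_ac)
    qed
    then show ?thesis by (simp only:)
  qed
  finally show ?thesis .
qed

lemma set_integral_Cauchy_Schwarz:
  fixes f :: "'a \<Rightarrow> real"
  assumes A: "A \<in> sets M" "emeasure M A < \<infinity>" and f: "set_integrable M A f" and f2: "set_integrable M A (\<lambda>x. (f x)\<^sup>2)"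
  shows "(LINT x:A|M. f x)\<^sup>2 \<le> measure M A * (LINT x:A|M. (f x)\<^sup>2)"
proof (cases "measure M A = 0")
  case True
  then have "emeasure M A = 0" using A(2) by (auto simp: measure_def enn2real_eq_0_iff dest: less_imp_neq)
  then have "A \<in> null_sets M" using A(1) by auto
  then have "(LINT x:A|M. f x) = 0" unfolding set_lebesgue_integral_def
    by (intro integral_eq_zero_AE eventually_mono[OF AE_not_in]) auto
  then show ?thesis using True by simp
next
  case False
  define m where "m = measure M A"
  define I where "I = (LINT x:A|M. f x)"
  have m: "m > 0" using False by (simp add: m_def less_le)
  have c: "set_integrable M A (\<lambda>x. c)" for c :: real
    using A by (simp add: set_integrable_def)
  have "0 \<le> (LINT x:A|M. (f x - I / m)\<^sup>2)"
    unfolding set_lebesgue_integral_def by (intro integral_nonneg_AE AE_I2) (simp split: split_indicator)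
  also have "(\<lambda>x. (f x - I / m)\<^sup>2) = (\<lambda>x. (f x)\<^sup>2 + ((- 2 * I / m) * f x + (I / m)\<^sup>2))"
    by (rule ext) (simp add: power2_eq_square algebra_simps)
  also have "(LINT x:A|M. (f x)\<^sup>2 + ((- 2 * I / m) * f x + (I / m)\<^sup>2))
    = (LINT x:A|M. (f x)\<^sup>2) + ((- 2 * I / m) * I + (I / m)\<^sup>2 * m)"
    using f f2 c A
    by (subst set_integral_add(2), simp_all add: set_integral_add set_integrable_mult_right I_def)
       (simp add: set_lebesgue_integral_def m_def)
  also have "\<dots> = (LINT x:A|M. (f x)\<^sup>2) - I\<^sup>2 / m"
    using m by (simp add: power2_eq_square field_simps)
  finally show ?thesis using m unfolding m_def[symmetric] I_def[symmetric] by (simp add: field_simps)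
qed

lemma set_integral_nonneg_pointwise: "(\<And>x. 0 \<le> f x) \<Longrightarrow> 0 \<le> (LINT x:S|M. (f x :: real))"
  unfolding set_lebesgue_integral_def by (intro integral_nonneg_AE AE_I2) (simp split: split_indicator)

text \<open>The Cauchy-Schwarz inequality in the form used for products: \<open>f\<close> is a product one factor of which
  has a square bounded by \<open>L\<close>, and \<open>g\<close> is the square of the other factor.\<close>
lemma set_integral_product_square_le:
  assumes N: "S \<in> sets M" "emeasure M S < \<infinity>" and L: "0 \<le> L"
    and f: "set_integrable M S f" "set_integrable M S (\<lambda>x. (f x)\<^sup>2)" and g: "set_integrable M S g"
    and fg: "\<And>x. x \<in> S \<Longrightarrow> (f x)\<^sup>2 \<le> L * g x"
  shows "(LINT x:S|M. (f x :: real))\<^sup>2 \<le> measure M S * (L * (LINT x:S|M. g x))"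
proof -
  have "(LINT x:S|M. f x)\<^sup>2 \<le> measure M S * (LINT x:S|M. (f x)\<^sup>2)"
    by (rule set_integral_Cauchy_Schwarz[OF N f])
  also have "\<dots> \<le> measure M S * (LINT x:S|M. L * g x)"
    using f g fg by (intro mult_left_mono set_integral_mono) auto
  finally show ?thesis by simp
qed

definition facet_const :: "nat \<Rightarrow> real \<Rightarrow> real" where
  "facet_const n \<kappa> = real n * 4 ^ n / \<kappa>"

definition sup_const :: "nat \<Rightarrow> real \<Rightarrow> real \<Rightarrow> real \<Rightarrow> real" where
  "sup_const n \<kappa> A Cs = Cs * A ^ n / \<kappa>"

definition grad_const :: "nat \<Rightarrow> real \<Rightarrow> real \<Rightarrow> real \<Rightarrow> real" where
  "grad_const n \<kappa> A Cs = 2 + 2 * facet_const n \<kappa> * sup_const n \<kappa> A Cs * real (Suc n)"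

definition flux_const :: "nat \<Rightarrow> real \<Rightarrow> real \<Rightarrow> real \<Rightarrow> real" where
  "flux_const n \<kappa> A Cs = 3 * (2 ^ n + 2 ^ n * grad_const n \<kappa> A Cs + real (Suc n) * facet_const n \<kappa>)"

context regular_mesh begin

lemma diameter_le_mesh_size: "K \<in> T \<Longrightarrow> diameter K \<le> mesh_size T"
  unfolding mesh_size_def using finite_mesh by (intro Max_ge) auto

lemma mesh_size_le_diameter: "K \<in> T \<Longrightarrow> mesh_size T \<le> A * diameter K"
proof -
  assume K: "K \<in> T"
  have "mesh_size T \<in> diameter ` T" unfolding mesh_size_def using finite_mesh mesh_nonempty by (intro Max_in) auto
  then obtain K' where K': "K' \<in> T" "mesh_size T = diameter K'" by auto
  have "diameter K' / diameter K \<le> A" using quasi K K' unfolding quasi_uniform_def by blast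
  then show ?thesis using K'(2) diameter_pos[OF K] by (simp add: pos_divide_le_eq)
qed

lemma mesh_size_pos: "0 < mesh_size T"
proof -
  obtain K where K: "K \<in> T" using mesh_nonempty by blast
  show ?thesis using diameter_le_mesh_size[OF K] diameter_pos[OF K] by linarith
qed

lemma A_ge_1: "1 \<le> A"
proof -
  obtain K where K: "K \<in> T" using mesh_nonempty by blast
  have "diameter K / diameter K \<le> A" using quasi K unfolding quasi_uniform_def by blast
  then show ?thesis using diameter_pos[OF K] by simp
qed

lemma dist_elem_le: "K \<in> T \<Longrightarrow> x \<in> K \<Longrightarrow> y \<in> K \<Longrightarrow> dist x y \<le> mesh_size T"
  using diameter_bounded_bound[of K x y] diameter_le_mesh_size compact_imp_bounded[OF compact_elem] by force

lemma facet_measure_le: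
  assumes K: "K \<in> T" and e: "e facet_of K"
  shows "measure (surface_lborel e) e \<le> facet_const CARD('d) \<kappa> * mesh_size T ^ (CARD('d) - 1)"
proof -
  have "measure (surface_lborel e) e \<le> real CARD('d) * 4 ^ CARD('d) / \<kappa> * diameter K ^ (CARD('d) - 1)"
    by (rule simplex_shape(3)[OF simplex[OF K] \<kappa> shape_elem[OF K] e])
  also have "\<dots> \<le> real CARD('d) * 4 ^ CARD('d) / \<kappa> * mesh_size T ^ (CARD('d) - 1)"
    using \<kappa> diameter_pos[OF K] diameter_le_mesh_size[OF K] by (intro mult_left_mono power_mono) auto
  finally show ?thesis unfolding facet_const_def .
qed

lemma elem_measure:
  assumes K: "K \<in> T"
  shows "measure lborel K \<le> (2 * mesh_size T) ^ CARD('d)"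
    and "\<kappa> / A ^ CARD('d) * mesh_size T ^ CARD('d) \<le> measure lborel K"
proof -
  have fK: "emeasure lborel K = ennreal (measure lborel K)"
    using emeasure_simplex_finite[OF simplex[OF K]] by (simp add: emeasure_eq_ennreal_measure)
  obtain z where z: "z \<in> K" using interior_elem_nonempty[OF K] interior_subset by blast
  let ?h = "mesh_size T"
  obtain i :: 'd where True by simp
  define n where "n = axis i (1::real)"
  have n: "norm n = 1" by (simp add: n_def)
  have "emeasure lborel K \<le> ennreal (((n \<bullet> z + ?h) - (n \<bullet> z - ?h)) * (2 * ?h) ^ (CARD('d) - 1))"
  proof (rule measure_ball_slab_le[OF n])
    show "K \<subseteq> cball z ?h" using dist_elem_le[OF K z] by auto
    fix x assume x: "x \<in> K"
    have "\<bar>n \<bullet> (x - z)\<bar> \<le> norm n * norm (x - z)" by (rule Cauchy_Schwarz_ineq2)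
    also have "\<dots> \<le> ?h" using dist_elem_le[OF K x z] n by (simp add: dist_norm)
    finally show "n \<bullet> z - ?h \<le> n \<bullet> x \<and> n \<bullet> x \<le> n \<bullet> z + ?h" by (auto simp: inner_diff_right abs_le_iff)
  qed (use mesh_size_pos in auto)
  also have "((n \<bullet> z + ?h) - (n \<bullet> z - ?h)) * (2 * ?h) ^ (CARD('d) - 1) = (2 * ?h) * (2 * ?h) ^ (CARD('d) - 1)" by simp
  also have "\<dots> = (2 * ?h) ^ CARD('d)" by (metis Suc_pred' power_Suc zero_less_card_finite)
  finally show "measure lborel K \<le> (2 * ?h) ^ CARD('d)"
    unfolding fK using mesh_size_pos by (subst (asm) ennreal_le_iff) auto
  have A: "A > 0" using A_ge_1 by simp
  have "(?h / A) ^ CARD('d) \<le> diameter K ^ CARD('d)"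
    using mesh_size_le_diameter[OF K] A mesh_size_pos by (intro power_mono) (auto simp: field_simps)
  then have "\<kappa> * (?h / A) ^ CARD('d) \<le> \<kappa> * diameter K ^ CARD('d)" using \<kappa> by simp
  also have "\<dots> \<le> measure lebesgue K" using shape_elem[OF K] diameter_pos[OF K] by (simp add: pos_le_divide_eq)
  also have "\<dots> = measure lborel K" using compact_elem[OF K] by (simp add: borel_compact)
  finally show "\<kappa> / A ^ CARD('d) * ?h ^ CARD('d) \<le> measure lborel K" by (simp add: power_divide)
qed

end

section \<open>The discrete gradient equation on one element\<close>

lemma young_scaled: "0 < \<theta> \<Longrightarrow> a * b \<le> \<theta> * b\<^sup>2 + a\<^sup>2 / (4 * \<theta>)" for a b \<theta> :: real
proof -
  assume t: "0 < \<theta>"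
  have "0 \<le> (2 * \<theta> * b - a)\<^sup>2 / (4 * \<theta>)" using t by simp
  also have "\<dots> = \<theta> * b\<^sup>2 + a\<^sup>2 / (4 * \<theta>) - a * b" using t by (simp add: power2_eq_square field_simps)
  finally show ?thesis by simp
qed

text \<open>The functions are polynomials on the whole space here, so that continuity and differentiability need no
  restriction to an element. The number \<open>Cs\<close> is a constant as in \<open>polys_sup_bound\<close>; it is a parameter in order that all
  further constants can be written as functions of \<open>Cs\<close>, \<open>\<kappa>\<close> and \<open>A\<close>.\<close>
locale discrete_gradient = regular_mesh \<Omega> T \<kappa> A
  for \<Omega> :: "(real^'d) set" and T and \<kappa> A :: real +
  fixes k :: nat and u uhat :: "('d, real) broken" and p :: "('d, real^'d) broken" and Cs :: real
  assumes u_poly: "K \<in> T \<Longrightarrow> u K \<in> polys k"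
    and uhat_poly: "e \<in> faces T \<Longrightarrow> uhat e \<in> polys k"
    and p_poly: "K \<in> T \<Longrightarrow> (\<lambda>x. p K x $ i) \<in> polys k"
    and equation: "gradient_eq k T u uhat p"
    and Cs: "0 < Cs" "\<And>f K x. f \<in> polys k \<Longrightarrow> convex K \<Longrightarrow> compact K \<Longrightarrow> x \<in> (K :: (real^'d) set) \<Longrightarrow>
        (f x)\<^sup>2 * measure lborel K \<le> Cs * (LINT y:K|lborel. (f y)\<^sup>2)"
begin

lemma consts_pos: "0 < facet_const CARD('d) \<kappa>" "0 < sup_const CARD('d) \<kappa> A Cs"
    "0 < grad_const CARD('d) \<kappa> A Cs" "0 < flux_const CARD('d) \<kappa> A Cs"
proof -
  show 1: "0 < facet_const CARD('d) \<kappa>" using \<kappa> by (simp add: facet_const_def)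
  show 2: "0 < sup_const CARD('d) \<kappa> A Cs" using \<kappa> Cs(1) A_ge_1 by (simp add: sup_const_def)
  have "0 \<le> 2 * facet_const CARD('d) \<kappa> * sup_const CARD('d) \<kappa> A Cs * real (Suc CARD('d))"
    using 1 2 by (intro mult_nonneg_nonneg) auto
  then show 3: "0 < grad_const CARD('d) \<kappa> A Cs" unfolding grad_const_def by linarith
  show "0 < flux_const CARD('d) \<kappa> A Cs" unfolding flux_const_def
    by (intro mult_pos_pos add_pos_nonneg mult_nonneg_nonneg) (use 1 3 in auto)
qed

definition jump where "jump K e = (LINT x:e|surface_lborel e. (u K x - uhat e x)\<^sup>2)"

definition energy where
  "energy K = (LINT x:K|lborel. p K x \<bullet> p K x) + (\<Sum>e | e facet_of K. jump K e)"

lemma facet_in_faces: "K \<in> T \<Longrightarrow> e facet_of K \<Longrightarrow> e \<in> faces T" by (auto simp: faces_def)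

lemma cont_u: "K \<in> T \<Longrightarrow> continuous_on UNIV (u K)" by (rule continuous_polys[OF u_poly])

lemma cont_uhat: "K \<in> T \<Longrightarrow> e facet_of K \<Longrightarrow> continuous_on UNIV (uhat e)"
  by (rule continuous_polys[OF uhat_poly[OF facet_in_faces]])

lemma cont_p: "K \<in> T \<Longrightarrow> continuous_on UNIV (p K)"
  by (rule continuous_on_components, rule continuous_polys[OF p_poly])

lemma jump_nonneg: "0 \<le> jump K e"
  unfolding jump_def by (rule set_integral_nonneg_pointwise) simp

lemma p_energy: "(LINT x:K|lborel. p K x \<bullet> p K x) \<le> energy K"
  unfolding energy_def using sum_nonneg[of "{e. e facet_of K}" "jump K"] jump_nonneg by simp

lemma jumps_energy: "(\<Sum>e | e facet_of K. jump K e) \<le> energy K"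
  unfolding energy_def using set_integral_nonneg_pointwise[where f = "\<lambda>x. p K x \<bullet> p K x" and S = K and M = lborel] by simp

lemma energy_nonneg: "0 \<le> energy K"
  by (rule order_trans[OF _ jumps_energy]) (intro sum_nonneg jump_nonneg)

definition grad where
  "grad K = (SOME g. (\<forall>x. (u K has_derivative (\<lambda>h. g x \<bullet> h)) (at x)) \<and> (\<forall>i. (\<lambda>x. g x $ i) \<in> polys k))"

lemma grad:
  assumes K: "K \<in> T"
  shows "(u K has_derivative (\<lambda>h. grad K x \<bullet> h)) (at x)" "(\<lambda>x. grad K x $ i) \<in> polys k"
proof -
  have "\<exists>g. (\<forall>x. (u K has_derivative (\<lambda>h. g x \<bullet> h)) (at x)) \<and> (\<forall>i. (\<lambda>x. g x $ i) \<in> polys k)"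
    using polys_gradient[OF u_poly[OF K]] by metis
  from someI_ex[OF this] show "(u K has_derivative (\<lambda>h. grad K x \<bullet> h)) (at x)" "(\<lambda>x. grad K x $ i) \<in> polys k"
    unfolding grad_def[symmetric] by auto
qed

lemma cont_grad: "K \<in> T \<Longrightarrow> continuous_on UNIV (grad K)"
  by (rule continuous_on_components, rule continuous_polys[OF grad(2)])

lemma sup_bound_vector:
  assumes K: "K \<in> T" and x: "x \<in> K" and f: "\<And>i. (\<lambda>x. f x $ i) \<in> polys k"
  shows "mesh_size T ^ CARD('d) * (f x \<bullet> f x) \<le> sup_const CARD('d) \<kappa> A Cs * (LINT y:K|lborel. f y \<bullet> f y)"
proof -
  have A: "A ^ CARD('d) > 0" using A_ge_1 by simp
  have cf: "continuous_on UNIV (\<lambda>x. f x $ i)" for i by (rule continuous_polys[OF f])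
  have eq: "f y \<bullet> f y = (\<Sum>i\<in>UNIV. (f y $ i)\<^sup>2)" for y by (simp add: inner_vec_def power2_eq_square)
  have "(f x \<bullet> f x) * measure lborel K = (\<Sum>i\<in>UNIV. (f x $ i)\<^sup>2 * measure lborel K)"
    unfolding eq by (rule sum_distrib_right)
  also have "\<dots> \<le> (\<Sum>i\<in>UNIV. Cs * (LINT y:K|lborel. (f y $ i)\<^sup>2))"
    by (intro sum_mono Cs(2)[OF f convex_elem[OF K] compact_elem[OF K] x])
  also have "\<dots> = Cs * (\<Sum>i\<in>UNIV. (LINT y:K|lborel. (f y $ i)\<^sup>2))" by (rule sum_distrib_left[symmetric])
  also have "(\<Sum>i\<in>UNIV. (LINT y:K|lborel. (f y $ i)\<^sup>2)) = (LINT y:K|lborel. f y \<bullet> f y)"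
    unfolding eq by (intro set_integral_sum[symmetric] set_integrable_simplex[OF simplex[OF K]] continuous_intros cf)
  finally have 1: "(f x \<bullet> f x) * measure lborel K \<le> Cs * (LINT y:K|lborel. f y \<bullet> f y)" .
  have "(f x \<bullet> f x) * (\<kappa> / A ^ CARD('d) * mesh_size T ^ CARD('d)) \<le> (f x \<bullet> f x) * measure lborel K"
    by (intro mult_left_mono elem_measure(2)[OF K]) simp
  with 1 have "(f x \<bullet> f x) * (\<kappa> / A ^ CARD('d) * mesh_size T ^ CARD('d)) \<le> Cs * (LINT y:K|lborel. f y \<bullet> f y)" by linarith
  then show ?thesis using A \<kappa> unfolding sup_const_def by (simp add: field_simps)
qed

text \<open>The test function is \<open>grad u\<close> on \<open>K\<close> and zero on the other elements; its divergence is integrated by parts.\<close>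
lemma gradient_tested:
  assumes K: "K \<in> T"
  shows "(LINT x:K|lborel. grad K x \<bullet> grad K x) =
    (\<Sum>e | e facet_of K. LINT x:e|surface_lborel e. (u K x - uhat e x) * (grad K x \<bullet> outward_normal K e))
    - (LINT x:K|lborel. p K x \<bullet> grad K x)"
proof -
  let ?G = "grad K"
  have "\<forall>i. \<exists>J. (\<forall>x. ((\<lambda>y. ?G y $ i) has_derivative (\<lambda>h. J x \<bullet> h)) (at x)) \<and> (\<forall>j. (\<lambda>x. J x $ j) \<in> polys k)"
    using polys_gradient[OF grad(2)[OF K]] by metis
  then obtain J where J: "\<And>i x. ((\<lambda>y. ?G y $ i) has_derivative (\<lambda>h. J i x \<bullet> h)) (at x)"
    "\<And>i j. (\<lambda>x. J i x $ j) \<in> polys k" by metis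
  have cJ: "continuous_on UNIV (J i)" for i
    by (rule continuous_on_components, rule continuous_polys[OF J(2)])
  define q where "q K' = (if K' = K then ?G else (\<lambda>_. 0))" for K'
  have qV: "q \<in> V_space k T"
    unfolding V_space_def polys_on_def q_def
    using grad(2)[OF K] polys_const[of 0 k] by (auto simp: zero_vec_def)
  have div: "broken_div q K' x = (if K' = K then (\<Sum>i\<in>UNIV. J i x $ i) else 0)" if K': "K' \<in> T" "x \<in> K'" for K' x
  proof (cases "K' = K")
    case True
    then show ?thesis
      using broken_div_eq[OF convex_elem[OF K'(1)] interior_elem_nonempty[OF K'(1)] K'(2), of q ?G J] J(1)
      by (simp add: q_def)
  next
    case False
    then show ?thesis
      using broken_div_eq[OF convex_elem[OF K'(1)] interior_elem_nonempty[OF K'(1)] K'(2), of q "\<lambda>_. 0" "\<lambda>_ _. 0"]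
      by (simp add: q_def)
  qed
  have single: "(\<Sum>K'\<in>T. if K' = K then a else 0) = a" for a :: real
    using K finite_mesh by simp
  have "mesh_inner T p q = (\<Sum>K'\<in>T. if K' = K then (LINT x:K|lborel. p K x \<bullet> ?G x) else 0)"
    unfolding mesh_inner_def by (intro sum.cong) (auto simp: q_def)
  moreover have "mesh_inner T u (broken_div q) = (\<Sum>K'\<in>T. if K' = K then (LINT x:K|lborel. u K x * (\<Sum>i\<in>UNIV. J i x $ i)) else 0)"
    unfolding mesh_inner_def
  proof (rule sum.cong[OF refl])
    fix K' assume K': "K' \<in> T"
    have "(LINT x:K'|lborel. u K' x \<bullet> broken_div q K' x) = (LINT x:K'|lborel. u K' x * (if K' = K then (\<Sum>i\<in>UNIV. J i x $ i) else 0))"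
      unfolding set_lebesgue_integral_def
    proof (intro Bochner_Integration.integral_cong refl)
      fix x show "indicat_real K' x *\<^sub>R (u K' x \<bullet> broken_div q K' x)
        = indicat_real K' x *\<^sub>R (u K' x * (if K' = K then (\<Sum>i\<in>UNIV. J i x $ i) else 0))"
      proof (cases "x \<in> K'")
        case True then show ?thesis by (simp only: div[OF K'] inner_real_def)
      qed simp
    qed
    then show "(LINT x:K'|lborel. u K' x \<bullet> broken_div q K' x)
      = (if K' = K then (LINT x:K|lborel. u K x * (\<Sum>i\<in>UNIV. J i x $ i)) else 0)" by simp
  qed
  moreover have "skel_inner T (\<lambda>K e. uhat e) (\<lambda>K e x. q K x \<bullet> outward_normal K e)
    = (\<Sum>K'\<in>T. if K' = K then (\<Sum>e | e facet_of K. LINT x:e|surface_lborel e. uhat e x * (?G x \<bullet> outward_normal K e)) else 0)"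
    unfolding skel_inner_def by (intro sum.cong) (auto simp: q_def)
  ultimately have eq: "(LINT x:K|lborel. p K x \<bullet> ?G x) = (LINT x:K|lborel. u K x * (\<Sum>i\<in>UNIV. J i x $ i))
      - (\<Sum>e | e facet_of K. LINT x:e|surface_lborel e. uhat e x * (?G x \<bullet> outward_normal K e))"
    using equation qV unfolding gradient_eq_def single by auto
  have green: "(LINT x:K|lborel. u K x * (\<Sum>i\<in>UNIV. J i x $ i)) + (LINT x:K|lborel. ?G x \<bullet> ?G x)
    = (\<Sum>e | e facet_of K. LINT x:e|surface_lborel e. u K x * (?G x \<bullet> outward_normal K e))"
    by (rule simplex_green[OF simplex[OF K] grad(1)[OF K] cont_grad[OF K] J(1) cJ])
  have "(\<Sum>e | e facet_of K. LINT x:e|surface_lborel e. (u K x - uhat e x) * (?G x \<bullet> outward_normal K e))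
    = (\<Sum>e | e facet_of K. LINT x:e|surface_lborel e. u K x * (?G x \<bullet> outward_normal K e))
      - (\<Sum>e | e facet_of K. LINT x:e|surface_lborel e. uhat e x * (?G x \<bullet> outward_normal K e))"
    unfolding sum_subtractf[symmetric] left_diff_distrib
    by (intro sum.cong refl set_integral_diff(2) set_integrable_facet[OF simplex[OF K]] continuous_intros cont_u[OF K] cont_uhat[OF K] cont_grad[OF K]) auto
  with eq green show ?thesis by linarith
qed

text \<open>In the tested equation, Young's inequality absorbs half of the gradient. On a facet this needs
  the inverse estimate \<open>\<bar>grad u\<bar>\<^sup>2 \<le> const * h\<^sup>-\<^sup>d * \<integral>\<^sub>K \<bar>grad u\<bar>\<^sup>2\<close>, which produces a factor \<open>h\<^sup>-\<^sup>1\<close> in front of the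
  jumps; the claim is therefore multiplied by \<open>h\<close>.\<close>
lemma gradient_bound:
  assumes K: "K \<in> T"
  shows "mesh_size T * (LINT x:K|lborel. grad K x \<bullet> grad K x)
    \<le> grad_const CARD('d) \<kappa> A Cs * (mesh_size T + 1) * energy K"
proof -
  define c1 c2 where c1: "c1 = facet_const CARD('d) \<kappa>" and c2: "c2 = sup_const CARD('d) \<kappa> A Cs"
  let ?h = "mesh_size T" and ?d1 = "real (Suc CARD('d))"
  define I where "I = (LINT x:K|lborel. grad K x \<bullet> grad K x)"
  have h: "?h > 0" by (rule mesh_size_pos)
  have I: "I \<ge> 0" unfolding I_def by (rule set_integral_nonneg_pointwise) simp
  have c: "c1 > 0" "c2 > 0" unfolding c1 c2 by (rule consts_pos)+
  \<comment> \<open>The parameter in Young's inequality is chosen such that each of the \<open>d + 1\<close> facets absorbs \<open>1 / (4 (d + 1))\<close> of the gradient.\<close>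
  define \<theta> where "\<theta> = ?h / (4 * c1 * c2 * ?d1)"
  have \<theta>: "\<theta> > 0" using h c by (simp add: \<theta>_def)
  note fin = finite_facets_simplex[OF simplex[OF K]]
  have vol: "- (LINT x:K|lborel. p K x \<bullet> grad K x) \<le> I / 4 + (LINT x:K|lborel. p K x \<bullet> p K x)"
  proof -
    have "- (LINT x:K|lborel. p K x \<bullet> grad K x) = (LINT x:K|lborel. - (p K x \<bullet> grad K x))"
      by (simp add: set_lebesgue_integral_def)
    also have "\<dots> \<le> (LINT x:K|lborel. (1/4) * (grad K x \<bullet> grad K x) + p K x \<bullet> p K x)"
    proof (intro set_integral_mono set_integrable_simplex[OF simplex[OF K]] continuous_intros cont_p[OF K] cont_grad[OF K])
      fix x
      have "0 \<le> ((1/2) *\<^sub>R grad K x + p K x) \<bullet> ((1/2) *\<^sub>R grad K x + p K x)" by simp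
      then show "- (p K x \<bullet> grad K x) \<le> (1/4) * (grad K x \<bullet> grad K x) + p K x \<bullet> p K x"
        by (simp add: inner_add_left inner_add_right inner_commute)
    qed
    also have "\<dots> = (1/4) * I + (LINT x:K|lborel. p K x \<bullet> p K x)" unfolding I_def
      by (subst set_integral_add(2)) (auto intro!: set_integrable_simplex[OF simplex[OF K]] continuous_intros cont_p[OF K] cont_grad[OF K])
    finally show ?thesis by simp
  qed
  have face: "(LINT x:e|surface_lborel e. (u K x - uhat e x) * (grad K x \<bullet> outward_normal K e))
    \<le> I / (4 * ?d1) + c1 * c2 * ?d1 / ?h * jump K e" if e: "e facet_of K" for e
  proof -
    note si = set_integrable_facet[OF simplex[OF K] e]
    have n1: "norm (outward_normal K e) = 1" by (rule facet_hyperplane[OF simplex[OF K] e])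
    have eK: "e \<subseteq> K" using e facet_of_imp_subset by blast
    have fe: "emeasure (surface_lborel e) e < \<infinity>" by (rule emeasure_facet_finite[OF simplex[OF K] e])
    have es: "e \<in> sets (surface_lborel e)" using compact_facet[OF simplex[OF K] e] by (simp add: borel_compact)
    define B where "B = c2 * I / ?h ^ CARD('d)"
    have B0: "0 \<le> B" unfolding B_def using I c h by simp
    have hd: "0 < ?h ^ CARD('d)" using h by simp
    have GB: "grad K x \<bullet> grad K x \<le> B" if "x \<in> e" for x
      using sup_bound_vector[OF K _ grad(2)[OF K], of x] that eK
      unfolding B_def I_def c2[symmetric] pos_le_divide_eq[OF hd] by (auto simp: mult.commute)
    have "(LINT x:e|surface_lborel e. (u K x - uhat e x) * (grad K x \<bullet> outward_normal K e))
      \<le> (LINT x:e|surface_lborel e. \<theta> * B + 1 / (4 * \<theta>) * (u K x - uhat e x)\<^sup>2)"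
    proof (intro set_integral_mono si continuous_intros cont_u[OF K] cont_uhat[OF K e] cont_grad[OF K])
      fix x assume x: "x \<in> e"
      have "(grad K x \<bullet> outward_normal K e)\<^sup>2 \<le> (grad K x \<bullet> grad K x) * (outward_normal K e \<bullet> outward_normal K e)"
        by (rule Cauchy_Schwarz_ineq)
      then have "(grad K x \<bullet> outward_normal K e)\<^sup>2 \<le> B" using GB[OF x] n1 by (simp add: norm_eq_1)
      then have "\<theta> * (grad K x \<bullet> outward_normal K e)\<^sup>2 \<le> \<theta> * B" using \<theta> by simp
      then show "(u K x - uhat e x) * (grad K x \<bullet> outward_normal K e) \<le> \<theta> * B + 1 / (4 * \<theta>) * (u K x - uhat e x)\<^sup>2"
        using young_scaled[OF \<theta>, of "u K x - uhat e x" "grad K x \<bullet> outward_normal K e"] by simp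
    qed
    also have "\<dots> = \<theta> * B * measure (surface_lborel e) e + 1 / (4 * \<theta>) * jump K e"
      unfolding jump_def using fe es \<theta>
      by (subst set_integral_add(2)) (auto intro!: si continuous_intros cont_u[OF K] cont_uhat[OF K e] simp: set_lebesgue_integral_def mult.commute)
    also have "\<dots> \<le> \<theta> * B * (c1 * ?h ^ (CARD('d) - 1)) + 1 / (4 * \<theta>) * jump K e"
      using facet_measure_le[OF K e] \<theta> B0 unfolding c1 by (intro add_right_mono mult_left_mono) auto
    also have "\<theta> * B * (c1 * ?h ^ (CARD('d) - 1)) = I / (4 * ?d1)"
    proof -
      have hS: "?h ^ CARD('d) = ?h * ?h ^ (CARD('d) - 1)" by (metis Suc_pred' power_Suc zero_less_card_finite)
      have "?h / (4 * c1 * c2 * D) * (c2 * I / (?h * H)) * (c1 * H) = I / (4 * D)" if "0 < D" "0 < H" for D H :: real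
        using h c that by (simp add: field_simps)
      from this[of ?d1 "?h ^ (CARD('d) - 1)"] show ?thesis unfolding \<theta>_def B_def hS using h by simp
    qed
    also have "1 / (4 * \<theta>) = c1 * c2 * ?d1 / ?h" unfolding \<theta>_def using h c by (simp add: field_simps)
    finally show ?thesis .
  qed
  have "I \<le> (\<Sum>e | e facet_of K. I / (4 * ?d1) + c1 * c2 * ?d1 / ?h * jump K e) + (I / 4 + (LINT x:K|lborel. p K x \<bullet> p K x))"
  proof -
    have "(\<Sum>e | e facet_of K. LINT x:e|surface_lborel e. (u K x - uhat e x) * (grad K x \<bullet> outward_normal K e))
      \<le> (\<Sum>e | e facet_of K. I / (4 * ?d1) + c1 * c2 * ?d1 / ?h * jump K e)"
      by (rule sum_mono) (rule face, simp)
    then show ?thesis using gradient_tested[OF K, folded I_def] vol by linarith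
  qed
  also have "(\<Sum>e | e facet_of K. I / (4 * ?d1) + c1 * c2 * ?d1 / ?h * jump K e)
    = I / 4 + c1 * c2 * ?d1 / ?h * (\<Sum>e | e facet_of K. jump K e)"
  proof -
    have "?d1 * (I / (4 * ?d1)) = I / 4" by (simp del: of_nat_Suc)
    then show ?thesis by (simp only: sum.distrib sum_constant sum_distrib_left fin)
  qed
  finally have "I / 2 \<le> c1 * c2 * ?d1 / ?h * (\<Sum>e | e facet_of K. jump K e) + (LINT x:K|lborel. p K x \<bullet> p K x)" by linarith
  also have "\<dots> \<le> c1 * c2 * ?d1 / ?h * energy K + energy K"
    using c h by (intro add_mono mult_left_mono jumps_energy p_energy) auto
  finally have "?h * (I / 2) \<le> ?h * (c1 * c2 * ?d1 / ?h * energy K + energy K)" using h by (intro mult_left_mono) auto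
  also have "\<dots> = c1 * c2 * ?d1 * energy K + ?h * energy K" using h by (simp add: distrib_left)
  also have "\<dots> \<le> c1 * c2 * ?d1 * ((?h + 1) * energy K) + (?h + 1) * energy K"
    using c h energy_nonneg[of K] by (intro add_mono mult_left_mono mult_right_mono) (auto simp: distrib_right)
  finally show ?thesis unfolding I_def grad_const_def c1[symmetric] c2[symmetric] by (simp add: algebra_simps)
qed

lemma oscillation_bound:
  assumes K: "K \<in> T" and x: "x \<in> K" and y: "y \<in> K"
  shows "mesh_size T ^ CARD('d) * (u K x - u K y)\<^sup>2
    \<le> sup_const CARD('d) \<kappa> A Cs * (mesh_size T)\<^sup>2 * (LINT x:K|lborel. grad K x \<bullet> grad K x)"
proof -
  define c2 where c2: "c2 = sup_const CARD('d) \<kappa> A Cs"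
  let ?h = "mesh_size T"
  define B where "B = sqrt (c2 * (LINT x:K|lborel. grad K x \<bullet> grad K x) / ?h ^ CARD('d))"
  have h: "?h > 0" by (rule mesh_size_pos)
  have I: "0 \<le> (LINT x:K|lborel. grad K x \<bullet> grad K x)" by (rule set_integral_nonneg_pointwise) simp
  have c: "c2 > 0" unfolding c2 by (rule consts_pos)
  have hd: "0 < ?h ^ CARD('d)" using h by simp
  have B2: "B\<^sup>2 = c2 * (LINT x:K|lborel. grad K x \<bullet> grad K x) / ?h ^ CARD('d)" and B0: "0 \<le> B"
    unfolding B_def using I c h by auto
  have nB: "norm (grad K z) \<le> B" if z: "z \<in> K" for z
  proof (rule power2_le_imp_le[OF _ B0])
    show "(norm (grad K z))\<^sup>2 \<le> B\<^sup>2"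
      using sup_bound_vector[OF K z grad(2)[OF K]]
      unfolding B2 c2[symmetric] pos_le_divide_eq[OF hd] by (simp add: mult.commute power2_norm_eq_inner)
  qed
  have "norm (u K x - u K y) \<le> B * norm (x - y)"
  proof (rule differentiable_bound[OF convex_elem[OF K] _ _ x y])
    show "(u K has_derivative (\<lambda>h. grad K z \<bullet> h)) (at z within K)" for z
      by (rule has_derivative_at_withinI[OF grad(1)[OF K]])
    show "onorm (\<lambda>h. grad K z \<bullet> h) \<le> B" if "z \<in> K" for z
    proof (rule onorm_bound[OF B0])
      fix h
      have "\<bar>grad K z \<bullet> h\<bar> \<le> norm (grad K z) * norm h" by (rule Cauchy_Schwarz_ineq2)
      also have "\<dots> \<le> B * norm h" by (rule mult_right_mono[OF nB[OF that]]) simp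
      finally show "norm (grad K z \<bullet> h) \<le> B * norm h" by simp
    qed
  qed
  also have "\<dots> \<le> B * ?h" using dist_elem_le[OF K x y] B0 by (intro mult_left_mono) (auto simp: dist_norm)
  finally have "\<bar>u K x - u K y\<bar> \<le> B * ?h" by simp
  then have "(u K x - u K y)\<^sup>2 \<le> (B * ?h)\<^sup>2" by (metis abs_ge_zero power2_abs power_mono)
  then have "?h ^ CARD('d) * (u K x - u K y)\<^sup>2 \<le> ?h ^ CARD('d) * (B * ?h)\<^sup>2" using h by simp
  also have "\<dots> = c2 * ?h\<^sup>2 * (LINT x:K|lborel. grad K x \<bullet> grad K x)"
    unfolding power_mult_distrib B2 using h by simp
  finally show ?thesis unfolding c2 .
qed

end

section \<open>Bump functions and the flow that moves them\<close>

lemma pos_part_square_deriv: "((\<lambda>t. (max 0 t)\<^sup>2) has_real_derivative 2 * max 0 t) (at t)" for t :: real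
proof -
  consider "t > 0" | "t < 0" | "t = 0" by linarith
  then show ?thesis
  proof cases
    case 1
    have "((\<lambda>t. t\<^sup>2) has_real_derivative 2 * max 0 t) (at t)"
      using 1 by (auto intro!: derivative_eq_intros)
    then show ?thesis
      by (rule has_field_derivative_transform_within_open[of _ _ _ "{0<..}"]) (use 1 in auto)
  next
    case 2
    have "((\<lambda>t. 0) has_real_derivative 2 * max 0 t) (at t)"
      using 2 by (auto intro!: derivative_eq_intros)
    then show ?thesis
      by (rule has_field_derivative_transform_within_open[of _ _ _ "{..<0}"]) (use 2 in auto)
  next
    case 3
    have "((\<lambda>h::real. (max 0 h)\<^sup>2 / h) \<longlongrightarrow> 0) (at 0)"
    proof (rule Lim_null_comparison)
      show "eventually (\<lambda>h::real. norm ((max 0 h)\<^sup>2 / h) \<le> \<bar>h\<bar>) (at 0)"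
        by (intro always_eventually allI) (auto simp: max_def power2_eq_square)
      show "((\<lambda>h::real. \<bar>h\<bar>) \<longlongrightarrow> 0) (at 0)" by (rule tendsto_eq_intros refl | simp)+
    qed
    then show ?thesis using 3 by (simp add: DERIV_def)
  qed
qed

text \<open>A bump function with one continuous derivative is enough, and this one has elementary bounds.\<close>
definition bump :: "'a::real_inner \<Rightarrow> real" where "bump z = (max 0 (1 - z \<bullet> z))\<^sup>2"

definition bump_grad :: "'a::real_inner \<Rightarrow> 'a" where "bump_grad z = (- 4 * max 0 (1 - z \<bullet> z)) *\<^sub>R z"

lemma bump_has_derivative: "(bump has_derivative (\<lambda>h. bump_grad z \<bullet> h)) (at z)"
proof -
  have 1: "((\<lambda>z. 1 - z \<bullet> z) has_derivative (\<lambda>h. - (2 * (z \<bullet> h)))) (at z)"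
    by (auto intro!: derivative_eq_intros simp: inner_commute)
  have 2: "((\<lambda>t. (max 0 t)\<^sup>2) has_derivative (\<lambda>h. 2 * max 0 (1 - z \<bullet> z) * h)) (at (1 - z \<bullet> z))"
    using pos_part_square_deriv unfolding has_field_derivative_def by blast
  have eq: "bump = (\<lambda>z::'a. (max 0 (1 - z \<bullet> z))\<^sup>2)" by (rule ext) (simp add: bump_def)
  have "((\<lambda>z. (max 0 (1 - z \<bullet> z))\<^sup>2) has_derivative (\<lambda>h. bump_grad z \<bullet> h)) (at z)"
    by (rule has_derivative_eq_rhs[OF has_derivative_compose[OF 1 2]]) (simp add: fun_eq_iff bump_grad_def)
  then show ?thesis by (subst eq)
qed

lemma bump_nonneg: "0 \<le> bump z" and bump_le_1: "bump z \<le> 1"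
proof -
  show "0 \<le> bump z" by (simp add: bump_def)
  have "max 0 (1 - z \<bullet> z) \<le> 1" by simp
  then show "bump z \<le> 1" unfolding bump_def by (intro power_le_one) auto
qed

lemma bump_outside: "1 \<le> norm z \<Longrightarrow> bump z = 0 \<and> bump_grad z = 0"
proof -
  assume "1 \<le> norm z"
  then have "1 \<le> (norm z)\<^sup>2" by (simp add: one_le_power)
  then have "max 0 (1 - z \<bullet> z) = 0" by (simp add: power2_norm_eq_inner)
  then show ?thesis by (simp add: bump_def bump_grad_def)
qed

lemma norm_bump_grad: "norm (bump_grad z) \<le> 4"
proof (cases "1 \<le> norm z")
  case False
  have "norm (bump_grad z) = 4 * max 0 (1 - z \<bullet> z) * norm z" by (simp add: bump_grad_def)
  also have "\<dots> \<le> 4 * 1 * 1" using False by (intro mult_mono) auto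
  finally show ?thesis by simp
qed (simp add: bump_outside)

definition kern :: "real^'d \<Rightarrow> real \<Rightarrow> real^'d \<Rightarrow> real" where
  "kern a r y = bump ((1 / r) *\<^sub>R (y - a)) / r ^ CARD('d)"

text \<open>The ball moves with velocity \<open>v\<close> and its radius grows at rate \<open>\<sigma>\<close>. The points of the ball then
  have velocity \<open>v + (\<sigma> / r) (y - a)\<close>, and this is the corresponding mass flux of the density \<open>kern a r\<close>.\<close>
definition flow :: "real^'d \<Rightarrow> real \<Rightarrow> real^'d \<Rightarrow> real \<Rightarrow> real^'d \<Rightarrow> real^'d" where
  "flow v \<sigma> a r y = kern a r y *\<^sub>R (v + (\<sigma> / r) *\<^sub>R (y - a))"

definition flow_grad :: "real^'d \<Rightarrow> real \<Rightarrow> real^'d \<Rightarrow> real \<Rightarrow> 'd \<Rightarrow> real^'d \<Rightarrow> real^'d" where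
  "flow_grad v \<sigma> a r i y = (1 / r ^ Suc CARD('d)) *\<^sub>R
     ((v $ i + (\<sigma> / r) * (y - a) $ i) *\<^sub>R bump_grad ((1 / r) *\<^sub>R (y - a))
      + (bump ((1 / r) *\<^sub>R (y - a)) * \<sigma>) *\<^sub>R axis i 1)"

lemma kern_has_derivative:
  fixes a y :: "real^'d"
  assumes r: "0 < r"
  shows "(kern a r has_derivative (\<lambda>h. (1 / r ^ Suc CARD('d)) * (bump_grad ((1 / r) *\<^sub>R (y - a)) \<bullet> h))) (at y)"
proof -
  have "((\<lambda>y. (1 / r) *\<^sub>R (y - a)) has_derivative (\<lambda>h. (1 / r) *\<^sub>R h)) (at y)"
    by (auto intro!: derivative_eq_intros)
  from has_derivative_compose[OF this bump_has_derivative]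
  have "((\<lambda>y. (1 / r ^ CARD('d)) * bump ((1 / r) *\<^sub>R (y - a))) has_derivative
      (\<lambda>h. (1 / r ^ CARD('d)) * (bump_grad ((1 / r) *\<^sub>R (y - a)) \<bullet> ((1 / r) *\<^sub>R h)))) (at y)"
    by (rule has_derivative_mult_right)
  then have "((\<lambda>y. (1 / r ^ CARD('d)) * bump ((1 / r) *\<^sub>R (y - a))) has_derivative
      (\<lambda>h. (1 / r ^ Suc CARD('d)) * (bump_grad ((1 / r) *\<^sub>R (y - a)) \<bullet> h))) (at y)"
    by (rule has_derivative_eq_rhs) (simp add: fun_eq_iff)
  moreover have "kern a r = (\<lambda>y. (1 / r ^ CARD('d)) * bump ((1 / r) *\<^sub>R (y - a)))"
    by (rule ext) (simp add: kern_def)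
  ultimately show ?thesis by (simp only:)
qed

lemma flow_has_derivative:
  fixes v :: "real^'d"
  assumes r: "0 < r"
  shows "(flow v \<sigma> a r has_derivative (\<lambda>h. (1 / r ^ Suc CARD('d)) *\<^sub>R
    ((bump_grad ((1 / r) *\<^sub>R (y - a)) \<bullet> h) *\<^sub>R (v + (\<sigma> / r) *\<^sub>R (y - a))
      + (bump ((1 / r) *\<^sub>R (y - a)) * \<sigma>) *\<^sub>R h))) (at y)"
proof -
  have w: "((\<lambda>y. v + (\<sigma> / r) *\<^sub>R (y - a)) has_derivative (\<lambda>h. (\<sigma> / r) *\<^sub>R h)) (at y)"
    by (auto intro!: derivative_eq_intros)
  have "flow v \<sigma> a r = (\<lambda>y. kern a r y *\<^sub>R (v + (\<sigma> / r) *\<^sub>R (y - a)))" by (rule ext) (simp add: flow_def)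
  moreover have "((\<lambda>y. kern a r y *\<^sub>R (v + (\<sigma> / r) *\<^sub>R (y - a))) has_derivative (\<lambda>h. (1 / r ^ Suc CARD('d)) *\<^sub>R
    ((bump_grad ((1 / r) *\<^sub>R (y - a)) \<bullet> h) *\<^sub>R (v + (\<sigma> / r) *\<^sub>R (y - a))
      + (bump ((1 / r) *\<^sub>R (y - a)) * \<sigma>) *\<^sub>R h))) (at y)"
    by (rule has_derivative_eq_rhs[OF has_derivative_scaleR[OF kern_has_derivative[OF r] w]])
       (use r in \<open>auto simp: fun_eq_iff kern_def scaleR_add_right\<close>)
  ultimately show ?thesis by simp
qed

lemma flow_component_derivative:
  fixes v :: "real^'d"
  assumes r: "0 < r"
  shows "((\<lambda>y. flow v \<sigma> a r y $ i) has_derivative (\<lambda>h. flow_grad v \<sigma> a r i y \<bullet> h)) (at y)"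
  by (rule has_derivative_eq_rhs[OF bounded_linear.has_derivative[OF bounded_linear_vec_nth flow_has_derivative[OF r]]])
     (simp add: fun_eq_iff flow_grad_def inner_add_left inner_axis' algebra_simps)

lemma continuous_flow_grad: "continuous_on UNIV (flow_grad v \<sigma> a r i)"
proof -
  have b: "continuous_on UNIV (bump :: real^'d \<Rightarrow> real)"
    by (rule continuous_of_gradient[OF bump_has_derivative])
  have g: "continuous_on UNIV (bump_grad :: real^'d \<Rightarrow> real^'d)"
    unfolding bump_grad_def by (intro continuous_intros)
  have "continuous_on UNIV (\<lambda>y. bump ((1 / r) *\<^sub>R (y - a)))" "continuous_on UNIV (\<lambda>y. bump_grad ((1 / r) *\<^sub>R (y - a)))"
    by (rule continuous_on_compose2[OF b] continuous_on_compose2[OF g], auto intro!: continuous_intros)+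
  then show ?thesis unfolding flow_grad_def by (intro continuous_intros)
qed

lemma flow_divergence:
  fixes v :: "real^'d"
  shows "(\<Sum>i\<in>UNIV. flow_grad v \<sigma> a r i y $ i) = (1 / r ^ Suc CARD('d)) *
    (bump_grad ((1 / r) *\<^sub>R (y - a)) \<bullet> (v + (\<sigma> / r) *\<^sub>R (y - a)) + real CARD('d) * \<sigma> * bump ((1 / r) *\<^sub>R (y - a)))"
proof -
  have "(\<Sum>i\<in>UNIV. flow_grad v \<sigma> a r i y $ i) = (\<Sum>i\<in>UNIV. (1 / r ^ Suc CARD('d)) *
     ((v + (\<sigma> / r) *\<^sub>R (y - a)) $ i * bump_grad ((1 / r) *\<^sub>R (y - a)) $ i + bump ((1 / r) *\<^sub>R (y - a)) * \<sigma>))"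
    by (simp add: flow_grad_def)
  also have "\<dots> = (1 / r ^ Suc CARD('d)) * (\<Sum>i\<in>UNIV.
     ((v + (\<sigma> / r) *\<^sub>R (y - a)) $ i * bump_grad ((1 / r) *\<^sub>R (y - a)) $ i + bump ((1 / r) *\<^sub>R (y - a)) * \<sigma>))"
    by (rule sum_distrib_left[symmetric])
  also have "(\<Sum>i\<in>UNIV. (v + (\<sigma> / r) *\<^sub>R (y - a)) $ i * bump_grad ((1 / r) *\<^sub>R (y - a)) $ i + bump ((1 / r) *\<^sub>R (y - a)) * \<sigma>)
    = (v + (\<sigma> / r) *\<^sub>R (y - a)) \<bullet> bump_grad ((1 / r) *\<^sub>R (y - a)) + real CARD('d) * (bump ((1 / r) *\<^sub>R (y - a)) * \<sigma>)"
    by (simp only: sum.distrib sum_constant inner_vec_def inner_real_def)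
  finally show ?thesis by (simp add: inner_commute mult_ac)
qed

lemma flow_factor_le:
  fixes v :: "real^'d"
  assumes r: "0 < r" and z: "norm ((1 / r) *\<^sub>R (y - a)) < 1"
  shows "norm (v + (\<sigma> / r) *\<^sub>R (y - a)) \<le> norm v + \<bar>\<sigma>\<bar>"
proof -
  have "norm ((\<sigma> / r) *\<^sub>R (y - a)) = \<bar>\<sigma>\<bar> * norm ((1 / r) *\<^sub>R (y - a))" using r by simp
  also have "\<dots> \<le> \<bar>\<sigma>\<bar>" using z by (intro mult_left_le) auto
  finally show ?thesis using norm_triangle_ineq[of v "(\<sigma> / r) *\<^sub>R (y - a)"] by linarith
qed

lemma kern_outside: "0 < r \<Longrightarrow> y \<notin> ball a r \<Longrightarrow> kern a r y = 0"
  unfolding kern_def by (subst bump_outside[THEN conjunct1]) (auto simp: dist_norm norm_minus_commute)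

lemma flow_outside: "0 < r \<Longrightarrow> y \<notin> ball a r \<Longrightarrow> flow v \<sigma> a r y = 0"
  by (simp add: flow_def kern_outside)

lemma norm_flow_le:
  fixes v :: "real^'d"
  assumes r: "0 < r"
  shows "norm (flow v \<sigma> a r y) \<le> (norm v + \<bar>\<sigma>\<bar>) / r ^ CARD('d)"
proof (cases "norm ((1 / r) *\<^sub>R (y - a)) < 1")
  case True
  have "norm (flow v \<sigma> a r y) = bump ((1 / r) *\<^sub>R (y - a)) / r ^ CARD('d) * norm (v + (\<sigma> / r) *\<^sub>R (y - a))"
    using r by (simp add: flow_def kern_def abs_of_nonneg[OF bump_nonneg])
  also have "\<dots> \<le> 1 / r ^ CARD('d) * (norm v + \<bar>\<sigma>\<bar>)"
    using r flow_factor_le[OF r True] by (intro mult_mono divide_right_mono bump_le_1) auto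
  finally show ?thesis by simp
next
  case False
  then have "y \<notin> ball a r" using r by (auto simp: dist_norm norm_minus_commute)
  then have "flow v \<sigma> a r y = 0" by (rule flow_outside[OF r])
  then show ?thesis using r by simp
qed

text \<open>The derivative of the bump contributes \<open>4\<close> and the dilation contributes \<open>1\<close> to the constant.\<close>
lemma flow_lipschitz:
  fixes v :: "real^'d"
  assumes r: "0 < r"
  shows "norm (flow v \<sigma> a r x - flow v \<sigma> a r y) \<le> 5 * (norm v + \<bar>\<sigma>\<bar>) / r ^ Suc CARD('d) * norm (x - y)"
proof (rule differentiable_bound[of UNIV])
  show "(flow v \<sigma> a r has_derivative (\<lambda>h. (1 / r ^ Suc CARD('d)) *\<^sub>R
    ((bump_grad ((1 / r) *\<^sub>R (y - a)) \<bullet> h) *\<^sub>R (v + (\<sigma> / r) *\<^sub>R (y - a))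
      + (bump ((1 / r) *\<^sub>R (y - a)) * \<sigma>) *\<^sub>R h))) (at y within UNIV)" for y
    using flow_has_derivative[OF r] .
next
  fix y :: "real^'d"
  let ?z = "(1 / r) *\<^sub>R (y - a)" and ?w = "v + (\<sigma> / r) *\<^sub>R (y - a)" and ?M = "norm v + \<bar>\<sigma>\<bar>"
  show "onorm (\<lambda>h. (1 / r ^ Suc CARD('d)) *\<^sub>R ((bump_grad ?z \<bullet> h) *\<^sub>R ?w + (bump ?z * \<sigma>) *\<^sub>R h))
    \<le> 5 * ?M / r ^ Suc CARD('d)"
  proof (rule onorm_bound)
    fix h :: "real^'d"
    have "norm ((bump_grad ?z \<bullet> h) *\<^sub>R ?w + (bump ?z * \<sigma>) *\<^sub>R h) \<le> 5 * ?M * norm h"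
    proof (cases "norm ?z < 1")
      case True
      have "\<bar>bump_grad ?z \<bullet> h\<bar> \<le> norm (bump_grad ?z) * norm h" by (rule Cauchy_Schwarz_ineq2)
      also have "\<dots> \<le> 4 * norm h" by (intro mult_right_mono norm_bump_grad) simp
      finally have 1: "\<bar>bump_grad ?z \<bullet> h\<bar> * norm ?w \<le> 4 * norm h * ?M"
        by (intro mult_mono flow_factor_le[OF r True]) auto
      have 2: "bump ?z * \<bar>\<sigma>\<bar> * norm h \<le> 1 * ?M * norm h"
        by (intro mult_right_mono mult_mono bump_le_1) auto
      have "norm ((bump_grad ?z \<bullet> h) *\<^sub>R ?w + (bump ?z * \<sigma>) *\<^sub>R h)
        \<le> \<bar>bump_grad ?z \<bullet> h\<bar> * norm ?w + bump ?z * \<bar>\<sigma>\<bar> * norm h"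
        by (rule order_trans[OF norm_triangle_ineq]) (simp add: abs_mult bump_nonneg)
      then show ?thesis using 1 2 by (simp add: algebra_simps)
    next
      case False
      then show ?thesis using bump_outside[of ?z] by simp
    qed
    then show "norm ((1 / r ^ Suc CARD('d)) *\<^sub>R ((bump_grad ?z \<bullet> h) *\<^sub>R ?w + (bump ?z * \<sigma>) *\<^sub>R h))
      \<le> 5 * ?M / r ^ Suc CARD('d) * norm h"
      using r by (simp add: divide_right_mono)
  qed (use r in simp)
qed auto

text \<open>The continuity equation for the moving density.\<close>
lemma kern_path_derivative:
  fixes a v :: "real^'d"
  assumes r: "0 < r + s * \<sigma>"
  shows "((\<lambda>s. kern (a + s *\<^sub>R v) (r + s * \<sigma>) y) has_real_derivative
    - (\<Sum>i\<in>UNIV. flow_grad v \<sigma> (a + s *\<^sub>R v) (r + s * \<sigma>) i y $ i)) (at s)"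
proof -
  define \<rho> where "\<rho> s = r + s * \<sigma>" for s
  define z where "z s = (1 / \<rho> s) *\<^sub>R (y - (a + s *\<^sub>R v))" for s
  have \<rho>: "0 < \<rho> s" using r by (simp add: \<rho>_def)
  have d\<rho>: "(\<rho> has_real_derivative \<sigma>) (at s)" unfolding \<rho>_def by (auto intro!: derivative_eq_intros)
  have "((\<lambda>s. 1 / \<rho> s) has_real_derivative (- \<sigma> / (\<rho> s)\<^sup>2)) (at s)"
    using \<rho> by (auto intro!: derivative_eq_intros d\<rho> simp: power2_eq_square)
  then have 1: "((\<lambda>s. 1 / \<rho> s) has_derivative (\<lambda>h. (- \<sigma> / (\<rho> s)\<^sup>2) * h)) (at s)"
    by (simp only: has_field_derivative_def)
  have 2: "((\<lambda>s. y - (a + s *\<^sub>R v)) has_derivative (\<lambda>h. - (h *\<^sub>R v))) (at s)"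
    by (auto intro!: derivative_eq_intros)
  have dz: "(z has_derivative (\<lambda>h. h *\<^sub>R (- ((1 / \<rho> s) *\<^sub>R (v + \<sigma> *\<^sub>R z s))))) (at s)"
    unfolding z_def[abs_def]
    by (rule has_derivative_eq_rhs[OF has_derivative_scaleR[OF 1 2]])
       (use \<rho> in \<open>auto simp: fun_eq_iff z_def power2_eq_square algebra_simps\<close>)
  have db: "((\<lambda>s. bump (z s)) has_real_derivative - ((1 / \<rho> s) * (bump_grad (z s) \<bullet> (v + \<sigma> *\<^sub>R z s)))) (at s)"
    unfolding has_field_derivative_def
    by (rule has_derivative_eq_rhs[OF has_derivative_compose[OF dz bump_has_derivative]])
       (auto simp: fun_eq_iff mult_ac)
  have "((\<lambda>s. bump (z s) / \<rho> s ^ CARD('d)) has_real_derivative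
      (- ((1 / \<rho> s) * (bump_grad (z s) \<bullet> (v + \<sigma> *\<^sub>R z s))) * \<rho> s ^ CARD('d)
        - bump (z s) * (real CARD('d) * (\<sigma> * \<rho> s ^ (CARD('d) - Suc 0)))) / (\<rho> s ^ CARD('d) * \<rho> s ^ CARD('d))) (at s)"
    using \<rho> by (intro DERIV_divide db DERIV_power d\<rho>) auto
  moreover have "(- ((1 / \<rho> s) * (bump_grad (z s) \<bullet> (v + \<sigma> *\<^sub>R z s))) * \<rho> s ^ CARD('d)
        - bump (z s) * (real CARD('d) * (\<sigma> * \<rho> s ^ (CARD('d) - Suc 0)))) / (\<rho> s ^ CARD('d) * \<rho> s ^ CARD('d))
      = - (1 / \<rho> s ^ Suc CARD('d) * (bump_grad (z s) \<bullet> (v + \<sigma> *\<^sub>R z s) + real CARD('d) * \<sigma> * bump (z s)))"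
  proof -
    obtain m where m: "CARD('d) = Suc m" by (metis Suc_pred' zero_less_card_finite)
    show ?thesis unfolding m using \<rho> by (simp add: field_simps)
  qed
  moreover have "(\<sigma> / \<rho> s) *\<^sub>R (y - (a + s *\<^sub>R v)) = \<sigma> *\<^sub>R z s" by (simp add: z_def)
  ultimately show ?thesis
    unfolding flow_divergence kern_def by (simp only: \<rho>_def[symmetric] z_def[symmetric])
qed

context discrete_gradient begin

section \<open>Testing with a smooth vector field\<close>

text \<open>The vector \<open>b\<close> is an elementwise constant approximation of \<open>Q\<close>: the three terms are the
  consistency errors on the facets and in the interior, both small of order \<open>h\<close>, and the contribution of \<open>p\<close>.\<close>
lemma elem_contribution_le:
  assumes K: "K \<in> T" and Q: "continuous_on UNIV Q" and b: "norm b \<le> M1"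
    and L: "\<And>x. x \<in> K \<Longrightarrow> norm (Q x - b) \<le> L * mesh_size T" and L0: "0 \<le> L"
  shows "((\<Sum>e | e facet_of K. LINT x:e|surface_lborel e. (u K x - uhat e x) * ((Q x - b) \<bullet> outward_normal K e))
      - (LINT x:K|lborel. grad K x \<bullet> (Q x - b)) + (LINT x:K|lborel. p K x \<bullet> b))\<^sup>2
    \<le> flux_const CARD('d) \<kappa> A Cs * mesh_size T ^ CARD('d) * (M1\<^sup>2 + L\<^sup>2 * ((mesh_size T)\<^sup>2 + mesh_size T)) * energy K"
    (is "(?X - ?Y + ?Z)\<^sup>2 \<le> _")
proof -
  let ?h = "mesh_size T" and ?n = "CARD('d)"
  define c1 c3 where "c1 = facet_const ?n \<kappa>" and "c3 = grad_const ?n \<kappa> A Cs"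
  have h: "0 < ?h" by (rule mesh_size_pos)
  have cpos: "0 < c1" "0 < c3" using consts_pos by (auto simp: c1_def c3_def)
  note si = set_integrable_simplex[OF simplex[OF K]]
  have Km: "K \<in> sets lborel" "emeasure lborel K < \<infinity>"
    using compact_elem[OF K] emeasure_simplex_finite[OF simplex[OF K]] by (auto simp: borel_compact)
  have vol: "measure lborel K \<le> 2 ^ ?n * ?h ^ ?n" using elem_measure(1)[OF K] by (simp add: power_mult_distrib)
  have E: "0 \<le> energy K" by (rule energy_nonneg)
  have M1: "0 \<le> M1" using b norm_ge_zero[of b] by linarith
  have Z: "?Z\<^sup>2 \<le> 2 ^ ?n * ?h ^ ?n * (M1\<^sup>2 * energy K)"
  proof -
    have "?Z\<^sup>2 \<le> measure lborel K * (M1\<^sup>2 * (LINT x:K|lborel. p K x \<bullet> p K x))"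
    proof (intro set_integral_product_square_le Km si continuous_intros cont_p[OF K])
      fix x
      have "(p K x \<bullet> b)\<^sup>2 \<le> (p K x \<bullet> p K x) * (b \<bullet> b)" by (rule Cauchy_Schwarz_ineq)
      also have "\<dots> \<le> (p K x \<bullet> p K x) * M1\<^sup>2"
        using b by (intro mult_left_mono) (auto simp: power2_norm_eq_inner[symmetric] intro: power_mono)
      finally show "(p K x \<bullet> b)\<^sup>2 \<le> M1\<^sup>2 * (p K x \<bullet> p K x)" by (simp only: mult.commute)
    qed simp
    also have "\<dots> \<le> (2 ^ ?n * ?h ^ ?n) * (M1\<^sup>2 * energy K)"
      using vol p_energy[of K] h by (intro mult_mono mult_left_mono mult_nonneg_nonneg set_integral_nonneg_pointwise) auto
    finally show ?thesis .
  qed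
  have Y: "?Y\<^sup>2 \<le> 2 ^ ?n * ?h ^ ?n * (L\<^sup>2 * (c3 * (?h\<^sup>2 + ?h) * energy K))"
  proof -
    have "?Y\<^sup>2 \<le> measure lborel K * ((L * ?h)\<^sup>2 * (LINT x:K|lborel. grad K x \<bullet> grad K x))"
    proof (intro set_integral_product_square_le Km si continuous_intros cont_grad[OF K] Q)
      fix x assume x: "x \<in> K"
      have "(grad K x \<bullet> (Q x - b))\<^sup>2 \<le> (grad K x \<bullet> grad K x) * ((Q x - b) \<bullet> (Q x - b))" by (rule Cauchy_Schwarz_ineq)
      also have "\<dots> \<le> (grad K x \<bullet> grad K x) * (L * ?h)\<^sup>2"
        using L[OF x] by (intro mult_left_mono) (auto simp: power2_norm_eq_inner[symmetric] intro: power_mono)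
      finally show "(grad K x \<bullet> (Q x - b))\<^sup>2 \<le> (L * ?h)\<^sup>2 * (grad K x \<bullet> grad K x)" by (simp only: mult.commute)
    qed simp
    also have "\<dots> = measure lborel K * (L\<^sup>2 * (?h * (?h * (LINT x:K|lborel. grad K x \<bullet> grad K x))))"
      by (simp add: power_mult_distrib power2_eq_square mult.assoc)
    also have "\<dots> \<le> measure lborel K * (L\<^sup>2 * (?h * (c3 * (?h + 1) * energy K)))"
      using gradient_bound[OF K] h unfolding c3_def by (intro mult_left_mono) auto
    also have "\<dots> \<le> (2 ^ ?n * ?h ^ ?n) * (L\<^sup>2 * (?h * (c3 * (?h + 1) * energy K)))"
      using vol h cpos E by (intro mult_right_mono mult_nonneg_nonneg) auto
    finally show ?thesis by (simp add: power2_eq_square algebra_simps)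
  qed
  have X: "?X\<^sup>2 \<le> real (Suc ?n) * c1 * ?h ^ ?n * (L\<^sup>2 * ?h * energy K)"
  proof -
    define X where "X e = (LINT x:e|surface_lborel e. (u K x - uhat e x) * ((Q x - b) \<bullet> outward_normal K e))" for e
    have Xe: "(X e)\<^sup>2 \<le> c1 * ?h ^ (?n - 1) * ((L * ?h)\<^sup>2 * jump K e)" if e: "e facet_of K" for e
    proof -
      note sf = set_integrable_facet[OF simplex[OF K] e]
      have fe: "emeasure (surface_lborel e) e < \<infinity>" by (rule emeasure_facet_finite[OF simplex[OF K] e])
      have es: "e \<in> sets (surface_lborel e)" using compact_facet[OF simplex[OF K] e] by (simp add: borel_compact)
      have n1: "norm (outward_normal K e) = 1" by (rule facet_hyperplane[OF simplex[OF K] e])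
      have eK: "e \<subseteq> K" using e facet_of_imp_subset by blast
      have "(X e)\<^sup>2 \<le> measure (surface_lborel e) e * ((L * ?h)\<^sup>2 * jump K e)"
        unfolding X_def jump_def
      proof (intro set_integral_product_square_le es fe sf continuous_intros cont_u[OF K] cont_uhat[OF K e] Q)
        fix x assume x: "x \<in> e"
        have "\<bar>(Q x - b) \<bullet> outward_normal K e\<bar> \<le> norm (Q x - b) * norm (outward_normal K e)" by (rule Cauchy_Schwarz_ineq2)
        also have "\<dots> \<le> L * ?h" using L[of x] x eK n1 by auto
        finally have "((Q x - b) \<bullet> outward_normal K e)\<^sup>2 \<le> (L * ?h)\<^sup>2" by (metis abs_ge_zero power2_abs power_mono)
        then show "((u K x - uhat e x) * ((Q x - b) \<bullet> outward_normal K e))\<^sup>2 \<le> (L * ?h)\<^sup>2 * (u K x - uhat e x)\<^sup>2"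
          unfolding power_mult_distrib[of "u K x - uhat e x"] by (subst mult.commute) (rule mult_right_mono, auto)
      qed simp
      also have "\<dots> \<le> c1 * ?h ^ (?n - 1) * ((L * ?h)\<^sup>2 * jump K e)"
        using facet_measure_le[OF K e] jump_nonneg[of K e] unfolding c1_def by (intro mult_right_mono) auto
      finally show ?thesis .
    qed
    have "?X\<^sup>2 = (\<Sum>e | e facet_of K. X e)\<^sup>2" unfolding X_def ..
    also have "\<dots> \<le> (\<Sum>e | e facet_of K. (X e)\<^sup>2) * real (card {e. e facet_of K})"
      by (rule sum_squared_le_sum_of_squares)
    also have "\<dots> = real (Suc ?n) * (\<Sum>e | e facet_of K. (X e)\<^sup>2)"
      using finite_facets_simplex[OF simplex[OF K]] by (simp only: mult.commute)
    also have "(\<Sum>e | e facet_of K. (X e)\<^sup>2) \<le> (\<Sum>e | e facet_of K. c1 * ?h ^ (?n - 1) * ((L * ?h)\<^sup>2 * jump K e))"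
      by (rule sum_mono) (rule Xe, simp)
    also have "\<dots> = c1 * ?h ^ (?n - 1) * ((L * ?h)\<^sup>2 * (\<Sum>e | e facet_of K. jump K e))"
      by (simp only: sum_distrib_left)
    also have "\<dots> \<le> c1 * ?h ^ (?n - 1) * ((L * ?h)\<^sup>2 * energy K)"
      using cpos h by (intro mult_left_mono jumps_energy) auto
    also have "c1 * ?h ^ (?n - 1) * ((L * ?h)\<^sup>2 * energy K) = c1 * (?h * ?h ^ (?n - 1)) * (L\<^sup>2 * ?h * energy K)"
      by (simp add: power2_eq_square)
    also have "?h * ?h ^ (?n - 1) = ?h ^ ?n" by (metis Suc_pred' power_Suc zero_less_card_finite)
    finally show ?thesis by (simp add: mult.assoc del: of_nat_Suc)
  qed
  have hh: "0 \<le> ?h\<^sup>2 + ?h" "?h \<le> ?h\<^sup>2 + ?h" using h by auto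
  have "(?X - ?Y + ?Z)\<^sup>2 \<le> 3 * (?X\<^sup>2 + ?Y\<^sup>2 + ?Z\<^sup>2)"
  proof -
    have "0 \<le> (x + y)\<^sup>2 + (x - z)\<^sup>2 + (y + z)\<^sup>2" for x y z :: real by simp
    from this[of ?X ?Y ?Z] show ?thesis by (simp add: power2_eq_square algebra_simps)
  qed
  also have "\<dots> \<le> 3 * (real (Suc ?n) * c1 * ?h ^ ?n * (L\<^sup>2 * ?h * energy K)
      + 2 ^ ?n * ?h ^ ?n * (L\<^sup>2 * (c3 * (?h\<^sup>2 + ?h) * energy K)) + 2 ^ ?n * ?h ^ ?n * (M1\<^sup>2 * energy K))"
    by (intro mult_left_mono add_mono X Y Z) simp
  also have "\<dots> \<le> 3 * (real (Suc ?n) * c1 * ?h ^ ?n * ((M1\<^sup>2 + L\<^sup>2 * (?h\<^sup>2 + ?h)) * energy K)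
      + 2 ^ ?n * ?h ^ ?n * (c3 * ((M1\<^sup>2 + L\<^sup>2 * (?h\<^sup>2 + ?h)) * energy K))
      + 2 ^ ?n * ?h ^ ?n * ((M1\<^sup>2 + L\<^sup>2 * (?h\<^sup>2 + ?h)) * energy K))"
  proof -
    have a: "L\<^sup>2 * ?h \<le> M1\<^sup>2 + L\<^sup>2 * (?h\<^sup>2 + ?h)"
      using mult_left_mono[OF hh(2), of "L\<^sup>2"] by (simp add: add_increasing)
    have b: "L\<^sup>2 * (?h\<^sup>2 + ?h) \<le> M1\<^sup>2 + L\<^sup>2 * (?h\<^sup>2 + ?h)" "M1\<^sup>2 \<le> M1\<^sup>2 + L\<^sup>2 * (?h\<^sup>2 + ?h)"
      using hh(1) by auto
    have c: "L\<^sup>2 * (c3 * (?h\<^sup>2 + ?h) * energy K) = c3 * (L\<^sup>2 * (?h\<^sup>2 + ?h) * energy K)" by simp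
    show ?thesis unfolding c using cpos h E a b
      by (intro mult_left_mono add_mono mult_right_mono) auto
  qed
  also have "\<dots> = flux_const ?n \<kappa> A Cs * ?h ^ ?n * (M1\<^sup>2 + L\<^sup>2 * (?h\<^sup>2 + ?h)) * energy K"
  proof -
    have "3 * (d * c1 * H * (B * e) + P * H * (c3 * (B * e)) + P * H * (B * e)) = 3 * (P + P * c3 + d * c1) * H * B * e"
      for d H B e P :: real by (simp add: algebra_simps)
    then show ?thesis unfolding flux_const_def c1_def[symmetric] c3_def[symmetric] .
  qed
  finally show ?thesis .
qed

text \<open>The values \<open>b K\<close> are arbitrary. They enter through the test function that equals \<open>b K\<close> on
  \<open>K\<close>, which is admissible in every degree.\<close>
lemma field_identity:
  assumes Q: "\<And>i x. ((\<lambda>y. Q y $ i) has_derivative (\<lambda>h. J i x \<bullet> h)) (at x)"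
    and J: "\<And>i. continuous_on UNIV (J i)" and out: "\<And>x. x \<notin> \<Omega> \<Longrightarrow> Q x = 0"
  shows "(\<Sum>K\<in>T. LINT x:K|lborel. u K x * (\<Sum>i\<in>UNIV. J i x $ i)) =
    (\<Sum>K\<in>T. (\<Sum>e | e facet_of K. LINT x:e|surface_lborel e. (u K x - uhat e x) * ((Q x - b K) \<bullet> outward_normal K e))
      - (LINT x:K|lborel. grad K x \<bullet> (Q x - b K)) + (LINT x:K|lborel. p K x \<bullet> b K))"
proof -
  have cQ: "continuous_on UNIV Q" by (rule continuous_on_components, rule continuous_of_gradient[OF Q])
  define uQ where "uQ K = (\<Sum>e | e facet_of K. LINT x:e|surface_lborel e. u K x * (Q x \<bullet> outward_normal K e))" for K
  define hQ where "hQ K = (\<Sum>e | e facet_of K. LINT x:e|surface_lborel e. uhat e x * (Q x \<bullet> outward_normal K e))" for K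
  define ub where "ub K = (\<Sum>e | e facet_of K. LINT x:e|surface_lborel e. u K x * (b K \<bullet> outward_normal K e))" for K
  define hb where "hb K = (\<Sum>e | e facet_of K. LINT x:e|surface_lborel e. uhat e x * (b K \<bullet> outward_normal K e))" for K
  have green1: "(LINT x:K|lborel. u K x * (\<Sum>i\<in>UNIV. J i x $ i)) = uQ K - (LINT x:K|lborel. grad K x \<bullet> Q x)" if K: "K \<in> T" for K
    using simplex_green[OF simplex[OF K] grad(1)[OF K] cont_grad[OF K] Q J] by (simp add: uQ_def)
  have green2: "(LINT x:K|lborel. grad K x \<bullet> b K) = ub K" if K: "K \<in> T" for K
    using simplex_green[OF simplex[OF K] grad(1)[OF K] cont_grad[OF K], of "\<lambda>_. b K" "\<lambda>_ _. 0"] by (simp add: ub_def)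
  have cancel: "(\<Sum>K\<in>T. hQ K) = 0"
    unfolding hQ_def
  proof (rule skeleton_cancellation[of "\<lambda>e n. LINT x:e|surface_lborel e. uhat e x * (Q x \<bullet> n)"])
    fix e n show "(LINT x:e|surface_lborel e. uhat e x * (Q x \<bullet> - n)) = - (LINT x:e|surface_lborel e. uhat e x * (Q x \<bullet> n))"
      by (simp add: set_lebesgue_integral_def)
  next
    fix e n assume dis: "e \<inter> \<Omega> = {}"
    have "indicat_real e x *\<^sub>R (uhat e x * (Q x \<bullet> n)) = 0" for x
    proof (cases "x \<in> e")
      case True
      then have "x \<notin> \<Omega>" using dis by blast
      then show ?thesis by (simp add: out)
    qed simp
    then show "(LINT x:e|surface_lborel e. uhat e x * (Q x \<bullet> n)) = 0"
      unfolding set_lebesgue_integral_def by (simp only: integral_zero)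
  qed
  have tested: "(\<Sum>K\<in>T. LINT x:K|lborel. p K x \<bullet> b K) = - (\<Sum>K\<in>T. hb K)"
  proof -
    define q where "q K = (\<lambda>_::real^'d. b K)" for K
    have qV: "q \<in> V_space k T"
      unfolding V_space_def polys_on_def q_def by (auto intro!: bexI[OF _ polys_const])
    have div: "broken_div q K x = 0" if K: "K \<in> T" "x \<in> K" for K x
      using broken_div_eq[OF convex_elem[OF K(1)] interior_elem_nonempty[OF K(1)] K(2), of q "\<lambda>_. b K" "\<lambda>_ _. 0"]
      by (simp add: q_def)
    have "mesh_inner T u (broken_div q) = (\<Sum>K\<in>T. 0)"
      unfolding mesh_inner_def
    proof (rule sum.cong[OF refl])
      fix K assume K: "K \<in> T"
      have "indicat_real K x *\<^sub>R (u K x \<bullet> broken_div q K x) = 0" for x using div[OF K, of x] by (cases "x \<in> K") auto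
      then show "(LINT x:K|lborel. u K x \<bullet> broken_div q K x) = 0"
        unfolding set_lebesgue_integral_def by (simp only: integral_zero)
    qed
    moreover have "mesh_inner T p q = (\<Sum>K\<in>T. LINT x:K|lborel. p K x \<bullet> b K)" unfolding mesh_inner_def q_def ..
    moreover have "skel_inner T (\<lambda>K e. uhat e) (\<lambda>K e x. q K x \<bullet> outward_normal K e) = (\<Sum>K\<in>T. hb K)"
      unfolding skel_inner_def q_def hb_def ..
    moreover have "mesh_inner T p q = mesh_inner T u (broken_div q)
       - skel_inner T (\<lambda>K e. uhat e) (\<lambda>K e x. q K x \<bullet> outward_normal K e)"
      using equation qV unfolding gradient_eq_def by blast
    ultimately show ?thesis by simp
  qed
  have split: "(\<Sum>e | e facet_of K. LINT x:e|surface_lborel e. (u K x - uhat e x) * ((Q x - b K) \<bullet> outward_normal K e))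
      = uQ K - hQ K - (ub K - hb K)" if K: "K \<in> T" for K
    unfolding uQ_def hQ_def ub_def hb_def sum_subtractf[symmetric]
  proof (intro sum.cong refl)
    fix e assume "e \<in> {e. e facet_of K}"
    then have e: "e facet_of K" by simp
    note sf = set_integrable_facet[OF simplex[OF K] e]
    let ?n = "outward_normal K e"
    have i: "set_integrable (surface_lborel e) e (\<lambda>x. u K x * (Q x \<bullet> ?n))" "set_integrable (surface_lborel e) e (\<lambda>x. uhat e x * (Q x \<bullet> ?n))"
      "set_integrable (surface_lborel e) e (\<lambda>x. u K x * (b K \<bullet> ?n))" "set_integrable (surface_lborel e) e (\<lambda>x. uhat e x * (b K \<bullet> ?n))"
      by (intro sf continuous_intros cont_u[OF K] cont_uhat[OF K e] cQ)+
    have "(u K x - uhat e x) * ((Q x - b K) \<bullet> ?n) = (u K x * (Q x \<bullet> ?n) - uhat e x * (Q x \<bullet> ?n))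
        - (u K x * (b K \<bullet> ?n) - uhat e x * (b K \<bullet> ?n))" for x
      by (simp add: inner_diff_left algebra_simps)
    then show "(LINT x:e|surface_lborel e. (u K x - uhat e x) * ((Q x - b K) \<bullet> ?n))
      = (LINT x:e|surface_lborel e. u K x * (Q x \<bullet> ?n)) - (LINT x:e|surface_lborel e. uhat e x * (Q x \<bullet> ?n))
      - ((LINT x:e|surface_lborel e. u K x * (b K \<bullet> ?n)) - (LINT x:e|surface_lborel e. uhat e x * (b K \<bullet> ?n)))"
      using i by (simp only: set_integral_diff)
  qed
  have volsplit: "(LINT x:K|lborel. grad K x \<bullet> (Q x - b K)) = (LINT x:K|lborel. grad K x \<bullet> Q x) - ub K" if K: "K \<in> T" for K
  proof -
    have i: "set_integrable lborel K (\<lambda>x. grad K x \<bullet> Q x)" "set_integrable lborel K (\<lambda>x. grad K x \<bullet> b K)"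
      by (intro set_integrable_simplex[OF simplex[OF K]] continuous_intros cont_grad[OF K] cQ)+
    show ?thesis unfolding green2[OF K, symmetric] inner_diff_right using i by (simp only: set_integral_diff)
  qed
  have "(\<Sum>K\<in>T. LINT x:K|lborel. u K x * (\<Sum>i\<in>UNIV. J i x $ i)) = (\<Sum>K\<in>T. uQ K - (LINT x:K|lborel. grad K x \<bullet> Q x))"
    by (rule sum.cong[OF refl green1])
  also have "\<dots> = (\<Sum>K\<in>T. uQ K - (LINT x:K|lborel. grad K x \<bullet> Q x)) - (\<Sum>K\<in>T. hQ K)
      + ((\<Sum>K\<in>T. hb K) + (\<Sum>K\<in>T. LINT x:K|lborel. p K x \<bullet> b K))"
    using cancel tested by simp
  also have "\<dots> = (\<Sum>K\<in>T. (uQ K - hQ K - (ub K - hb K)) - ((LINT x:K|lborel. grad K x \<bullet> Q x) - ub K) + (LINT x:K|lborel. p K x \<bullet> b K))"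
    unfolding sum_subtractf[symmetric] sum.distrib[symmetric] by (intro sum.cong refl) simp
  also have "\<dots> = (\<Sum>K\<in>T. (\<Sum>e | e facet_of K. LINT x:e|surface_lborel e. (u K x - uhat e x) * ((Q x - b K) \<bullet> outward_normal K e))
      - (LINT x:K|lborel. grad K x \<bullet> (Q x - b K)) + (LINT x:K|lborel. p K x \<bullet> b K))"
    by (intro sum.cong refl) (simp only: split volsplit)
  finally show ?thesis .
qed

text \<open>The Cauchy-Schwarz inequality over the elements that meet the support of \<open>Q\<close> gives the factor \<open>card N\<close>. With the factor
  \<open>h\<^sup>d\<close> it is the volume of a neighbourhood of the support.\<close>
lemma field_estimate:
  assumes Q: "\<And>i x. ((\<lambda>y. Q y $ i) has_derivative (\<lambda>h. J i x \<bullet> h)) (at x)"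
    and J: "\<And>i. continuous_on UNIV (J i)" and out: "\<And>x. x \<notin> \<Omega> \<Longrightarrow> Q x = 0"
    and M1: "\<And>x. norm (Q x) \<le> M1" and L: "\<And>x y. norm (Q x - Q y) \<le> L * norm (x - y)" and L0: "0 \<le> L"
    and N: "N \<subseteq> T" "\<And>K x. K \<in> T - N \<Longrightarrow> x \<in> K \<Longrightarrow> Q x = 0"
  shows "(\<Sum>K\<in>T. LINT x:K|lborel. u K x * (\<Sum>i\<in>UNIV. J i x $ i))\<^sup>2
    \<le> flux_const CARD('d) \<kappa> A Cs * mesh_size T ^ CARD('d) * (M1\<^sup>2 + L\<^sup>2 * ((mesh_size T)\<^sup>2 + mesh_size T))
      * real (card N) * (\<Sum>K\<in>N. energy K)"
proof -
  have cQ: "continuous_on UNIV Q" by (rule continuous_on_components, rule continuous_of_gradient[OF Q])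
  have "\<forall>K\<in>T. \<exists>x. x \<in> K" using interior_elem_nonempty interior_subset by fastforce
  then obtain z where z: "\<And>K. K \<in> T \<Longrightarrow> z K \<in> K" by metis
  define b where "b K = Q (z K)" for K
  define F where "F K = (\<Sum>e | e facet_of K. LINT x:e|surface_lborel e. (u K x - uhat e x) * ((Q x - b K) \<bullet> outward_normal K e))
      - (LINT x:K|lborel. grad K x \<bullet> (Q x - b K)) + (LINT x:K|lborel. p K x \<bullet> b K)" for K
  let ?c = "flux_const CARD('d) \<kappa> A Cs * mesh_size T ^ CARD('d) * (M1\<^sup>2 + L\<^sup>2 * ((mesh_size T)\<^sup>2 + mesh_size T))"
  have zero: "F K = 0" if K: "K \<in> T - N" for K
  proof -
    have b0: "b K = 0" using N(2)[OF K z] K by (simp add: b_def)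
    have 1: "indicat_real K x *\<^sub>R (grad K x \<bullet> (Q x - b K)) = 0" for x
      using N(2)[OF K, of x] b0 by (cases "x \<in> K") auto
    have 2: "indicat_real e x *\<^sub>R ((u K x - uhat e x) * ((Q x - b K) \<bullet> outward_normal K e)) = 0" if "e facet_of K" for e x
      using N(2)[OF K, of x] b0 facet_of_imp_subset[OF that] by (cases "x \<in> e") auto
    have 3: "(LINT x:e|surface_lborel e. (u K x - uhat e x) * ((Q x - b K) \<bullet> outward_normal K e)) = 0" if "e facet_of K" for e
      unfolding set_lebesgue_integral_def by (simp only: 2[OF that] integral_zero)
    have 4: "(LINT x:K|lborel. grad K x \<bullet> (Q x - b K)) = 0"
      unfolding set_lebesgue_integral_def by (simp only: 1 integral_zero)
    have 5: "(LINT x:K|lborel. p K x \<bullet> b K) = 0" by (simp add: b0)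
    show ?thesis unfolding F_def 4 5 using 3 by (simp add: sum.neutral)
  qed
  have FK: "(F K)\<^sup>2 \<le> ?c * energy K" if K: "K \<in> T" for K
    unfolding F_def
  proof (rule elem_contribution_le[OF K cQ _ _ L0])
    show "norm (b K) \<le> M1" unfolding b_def by (rule M1)
    fix x assume x: "x \<in> K"
    have "norm (Q x - b K) \<le> L * norm (x - z K)" unfolding b_def by (rule L)
    also have "\<dots> \<le> L * mesh_size T" using dist_elem_le[OF K x z[OF K]] L0 by (intro mult_left_mono) (auto simp: dist_norm)
    finally show "norm (Q x - b K) \<le> L * mesh_size T" .
  qed
  have "(\<Sum>K\<in>T. LINT x:K|lborel. u K x * (\<Sum>i\<in>UNIV. J i x $ i)) = (\<Sum>K\<in>T. F K)"
    unfolding F_def by (rule field_identity[OF Q J out])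
  also have "\<dots> = (\<Sum>K\<in>N. F K)"
    using zero by (intro sum.mono_neutral_right finite_mesh N(1)) auto
  finally have "(\<Sum>K\<in>T. LINT x:K|lborel. u K x * (\<Sum>i\<in>UNIV. J i x $ i))\<^sup>2 = (\<Sum>K\<in>N. F K)\<^sup>2" by simp
  also have "\<dots> \<le> (\<Sum>K\<in>N. (F K)\<^sup>2) * real (card N)" by (rule sum_squared_le_sum_of_squares)
  also have "\<dots> \<le> (\<Sum>K\<in>N. ?c * energy K) * real (card N)"
    using FK N(1) by (intro mult_right_mono sum_mono) auto
  also have "\<dots> = ?c * real (card N) * (\<Sum>K\<in>N. energy K)" by (simp add: sum_distrib_left[symmetric])
  finally show ?thesis .
qed

end

section \<open>Counting elements near a point and near the boundary\<close>

definition inrad_const :: "nat \<Rightarrow> real \<Rightarrow> real \<Rightarrow> real" where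
  "inrad_const n \<kappa> A = \<kappa> / (2 ^ n * real (Suc n)) / A"

definition count_const :: "nat \<Rightarrow> real \<Rightarrow> real \<Rightarrow> nat \<Rightarrow> real" where
  "count_const n \<kappa> A m = real m * 4 * 2 ^ (n - 1) / (unit_ball_vol (real n) * inrad_const n \<kappa> A ^ n)"

lemma simplex_boundary_hyperplanes:
  fixes K :: "(real^'d) set"
  assumes K: "int CARD('d) simplex K"
  shows "\<exists>H. finite H \<and> (\<forall>(n, a)\<in>H. norm n = 1) \<and> (\<forall>x\<in>K - interior K. \<exists>(n, a)\<in>H. n \<bullet> x = a)"
proof (rule simplex_barycentric[OF K])
  fix C and \<nu> :: "real^'d \<Rightarrow> real^'d" and \<alpha> \<eta> :: "real^'d \<Rightarrow> real"
  assume C: "finite C" and \<nu>: "\<And>c. c \<in> C \<Longrightarrow> norm (\<nu> c) = 1"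
    and Kl: "K = {x. \<forall>c\<in>C. \<nu> c \<bullet> x \<le> \<alpha> c}"
  have "\<exists>c\<in>C. \<nu> c \<bullet> x = \<alpha> c" if x: "x \<in> K - interior K" for x
  proof (rule ccontr)
    assume no: "\<not> ?thesis"
    let ?U = "\<Inter>c\<in>C. {x. \<nu> c \<bullet> x < \<alpha> c}"
    have "open ?U" using C by (intro open_INT) (auto simp: open_halfspace_lt)
    moreover have "?U \<subseteq> K" unfolding Kl by (auto intro: less_imp_le)
    ultimately have "?U \<subseteq> interior K" by (rule interior_maximal[rotated])
    moreover have "\<nu> c \<bullet> x < \<alpha> c" if "c \<in> C" for c
    proof -
      have "\<nu> c \<bullet> x \<le> \<alpha> c" using x that unfolding Kl by blast
      moreover have "\<nu> c \<bullet> x \<noteq> \<alpha> c" using no that by blast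
      ultimately show ?thesis by simp
    qed
    then have "x \<in> ?U" by blast
    ultimately show False using x by blast
  qed
  then show ?thesis using C \<nu> by (intro exI[of _ "(\<lambda>c. (\<nu> c, \<alpha> c)) ` C"]) auto
qed

context regular_mesh begin

text \<open>The union of finitely many simplices has a boundary in the union of their facet hyperplanes. Applied
  to one mesh, this gives hyperplanes that serve for every mesh of the same domain.\<close>
lemma boundary_in_hyperplanes:
  "\<exists>H. finite H \<and> (\<forall>(n, a)\<in>H. norm n = 1) \<and> (\<forall>x\<in>frontier \<Omega>. \<exists>(n, a)\<in>H. n \<bullet> x = a)"
proof -
  have "\<forall>K\<in>T. \<exists>H. finite H \<and> (\<forall>(n, a)\<in>H. norm n = 1) \<and> (\<forall>x\<in>K - interior K. \<exists>(n, a)\<in>H. n \<bullet> x = a)"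
    using simplex_boundary_hyperplanes[OF simplex] by blast
  from bchoice[OF this] obtain H where H: "\<forall>K\<in>T. finite (H K) \<and> (\<forall>(n, a)\<in>H K. norm n = 1) \<and>
      (\<forall>x\<in>K - interior K. \<exists>(n, a)\<in>H K. n \<bullet> x = a)" by (rule exE)
  have "\<exists>(n, a)\<in>(\<Union>K\<in>T. H K). n \<bullet> x = a" if x: "x \<in> frontier \<Omega>" for x
  proof -
    have "x \<in> closure \<Omega>" using x by (simp add: frontier_def)
    then obtain K where K: "K \<in> T" "x \<in> K" using Union_mesh by blast
    have "interior K \<subseteq> interior (closure \<Omega>)" using K Union_mesh by (intro interior_mono) blast
    then have "x \<notin> interior K" using x regular_dom open_dom by (auto simp: frontier_def interior_open)
    then obtain n a where na: "(n, a) \<in> H K" "n \<bullet> x = a" using H K by blast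
    then have "(n, a) \<in> (\<Union>K\<in>T. H K)" using K(1) by blast
    with na(2) show ?thesis by blast
  qed
  moreover have "finite (\<Union>K\<in>T. H K)" using H finite_mesh by blast
  moreover have "\<forall>(n, a)\<in>(\<Union>K\<in>T. H K). norm n = 1" using H by blast
  ultimately show ?thesis by (intro exI[of _ "\<Union>K\<in>T. H K"]) blast
qed

text \<open>A radius such that every element contains a ball of this radius: quasi-uniformity makes it
  independent of the element.\<close>
definition inrad where "inrad = inrad_const CARD('d) \<kappa> A * mesh_size T"

definition ctr :: "(real^'d) set \<Rightarrow> real^'d" where "ctr K = (SOME x. ball x inrad \<subseteq> K)"

lemma inrad_const_pos: "0 < inrad_const CARD('d) \<kappa> A"
  using \<kappa> A_ge_1 by (simp add: inrad_const_def)

lemma count_const_nonneg: "0 \<le> count_const CARD('d) \<kappa> A mH"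
proof -
  have "0 < unit_ball_vol (real CARD('d))" by (rule unit_ball_vol_pos) simp
  then show ?thesis unfolding count_const_def using inrad_const_pos by (intro divide_nonneg_pos mult_pos_pos) auto
qed

lemma inrad_pos: "0 < inrad"
  using inrad_const_pos mesh_size_pos by (simp add: inrad_def)

lemma ball_ctr: assumes K: "K \<in> T" shows "ball (ctr K) inrad \<subseteq> K"
proof -
  obtain x where x: "ball x (\<kappa> / (2 ^ CARD('d) * real (Suc CARD('d))) * diameter K) \<subseteq> K"
    using simplex_shape(2)[OF simplex[OF K] \<kappa> shape_elem[OF K]] by blast
  have "mesh_size T / A \<le> diameter K" using mesh_size_le_diameter[OF K] A_ge_1 by (simp add: pos_divide_le_eq mult.commute)
  then have "\<kappa> / (2 ^ CARD('d) * real (Suc CARD('d))) * (mesh_size T / A) \<le> \<kappa> / (2 ^ CARD('d) * real (Suc CARD('d))) * diameter K"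
    using \<kappa> by (intro mult_left_mono) auto
  then have "inrad \<le> \<kappa> / (2 ^ CARD('d) * real (Suc CARD('d))) * diameter K" by (simp add: inrad_def inrad_const_def)
  then have "ball x inrad \<subseteq> ball x (\<kappa> / (2 ^ CARD('d) * real (Suc CARD('d))) * diameter K)" by (rule subset_ball)
  with x have "ball x inrad \<subseteq> K" by (rule order_trans[rotated])
  then show ?thesis unfolding ctr_def by (rule someI)
qed

lemma ctr_in: "K \<in> T \<Longrightarrow> ctr K \<in> K"
  using ball_ctr[of K] inrad_pos by (meson centre_in_ball subsetD)

lemma inrad_le: "inrad \<le> mesh_size T"
proof -
  obtain K where K: "K \<in> T" using mesh_nonempty by blast
  have "ball (ctr K) inrad \<subseteq> cball (ctr K) (mesh_size T)"
    using ball_ctr[OF K] dist_elem_le[OF K ctr_in[OF K]] by auto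
  then show ?thesis using inrad_pos mesh_size_pos by (simp add: ball_subset_cball_iff)
qed

lemma elem_in_dom: "K \<in> T \<Longrightarrow> K \<subseteq> closure \<Omega>"
  using Union_mesh by blast

lemma mesh_size_le_dom: "mesh_size T \<le> diameter (closure \<Omega>)"
proof -
  have "mesh_size T \<in> diameter ` T" unfolding mesh_size_def using finite_mesh mesh_nonempty by (intro Max_in) auto
  then obtain K where K: "K \<in> T" "mesh_size T = diameter K" by auto
  show ?thesis unfolding K(2) by (rule diameter_subset[OF elem_in_dom[OF K(1)] bounded_closure[OF bounded_dom]])
qed

text \<open>The balls inside different elements are disjoint, so their volumes add up.\<close>
lemma count_le:
  assumes S: "S \<subseteq> T" and B: "\<And>K. K \<in> S \<Longrightarrow> ball (ctr K) inrad \<subseteq> B" and V: "emeasure lborel B \<le> ennreal V"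
    and Bm: "B \<in> sets lborel" and V0: "0 \<le> V"
  shows "real (card S) * (unit_ball_vol (real CARD('d)) * inrad ^ CARD('d)) \<le> V"
proof -
  have fS: "finite S" using S finite_mesh finite_subset by blast
  let ?b = "unit_ball_vol (real CARD('d)) * inrad ^ CARD('d)"
  have b0: "0 \<le> ?b" using inrad_pos by (intro mult_nonneg_nonneg) (auto simp: unit_ball_vol_nonneg)
  have dis: "disjoint_family_on (\<lambda>K. ball (ctr K) inrad) S"
    unfolding disjoint_family_on_def
  proof (intro ballI impI)
    fix K K' assume K: "K \<in> S" "K' \<in> S" "K \<noteq> K'"
    have "ball (ctr K) inrad \<subseteq> interior K" using ball_ctr[of K] K S by (intro interior_maximal) auto
    then show "ball (ctr K) inrad \<inter> ball (ctr K') inrad = {}"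
      using ball_ctr[of K'] interior_elem_disjoint[of K K'] K S by blast
  qed
  have eb: "emeasure lborel (ball (ctr K) inrad) = ennreal ?b" for K
    using inrad_pos by (simp add: emeasure_ball)
  have "ennreal (real (card S) * ?b) = (\<Sum>K\<in>S. ennreal ?b)"
    using b0 by (simp add: ennreal_mult ennreal_of_nat_eq_real_of_nat)
  also have "\<dots> = (\<Sum>K\<in>S. emeasure lborel (ball (ctr K) inrad))" by (simp only: eb)
  also have "\<dots> = emeasure lborel (\<Union>K\<in>S. ball (ctr K) inrad)"
    by (rule sum_emeasure[OF _ dis fS]) auto
  also have "\<dots> \<le> emeasure lborel B" using B Bm by (intro emeasure_mono) auto
  finally have "ennreal (real (card S) * ?b) \<le> ennreal V" using V by (rule order_trans)
  then show ?thesis using V0 by simp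
qed

lemma count_ball:
  assumes S: "S \<subseteq> T" and r: "0 \<le> r" and near: "\<And>K. K \<in> S \<Longrightarrow> dist y (ctr K) \<le> r"
  shows "real (card S) * mesh_size T ^ CARD('d) \<le> ((r + inrad) / inrad_const CARD('d) \<kappa> A) ^ CARD('d)"
proof -
  let ?v = "unit_ball_vol (real CARD('d))"
  have v: "0 < ?v" by (rule unit_ball_vol_pos) simp
  have "real (card S) * (?v * inrad ^ CARD('d)) \<le> ?v * (r + inrad) ^ CARD('d)"
  proof (rule count_le[OF S, of "ball y (r + inrad)"])
    fix K assume KS: "K \<in> S"
    show "ball (ctr K) inrad \<subseteq> ball y (r + inrad)"
    proof
      fix w assume "w \<in> ball (ctr K) inrad"
      then show "w \<in> ball y (r + inrad)" using near[OF KS] dist_triangle[of y w "ctr K"] by simp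
    qed
  next
    show "emeasure lborel (ball y (r + inrad)) \<le> ennreal (?v * (r + inrad) ^ CARD('d))"
      using r inrad_pos by (simp add: emeasure_ball)
    show "0 \<le> ?v * (r + inrad) ^ CARD('d)" using v r inrad_pos by (intro mult_nonneg_nonneg) auto
  qed simp
  then have "?v * (real (card S) * inrad ^ CARD('d)) \<le> ?v * (r + inrad) ^ CARD('d)" by (simp only: mult.left_commute)
  then have "real (card S) * inrad ^ CARD('d) \<le> (r + inrad) ^ CARD('d)" using v by simp
  then show ?thesis using inrad_const_pos
    by (simp add: inrad_def power_mult_distrib power_divide pos_le_divide_eq mult_ac)
qed

text \<open>Elements that touch one of the hyperplanes lie in a layer of thickness \<open>4 h\<close> around it; this
  gains one power of \<open>h\<close> over the count in a ball.\<close>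
lemma count_boundary:
  assumes S: "S \<subseteq> T" and r: "0 \<le> r" and near: "\<And>K. K \<in> S \<Longrightarrow> dist y (ctr K) \<le> r"
    and H: "finite H" "\<And>n a. (n, a) \<in> H \<Longrightarrow> norm n = 1" and K: "\<And>K. K \<in> S \<Longrightarrow> \<exists>(n, a)\<in>H. \<exists>x\<in>K. n \<bullet> x = a"
  shows "real (card S) * mesh_size T ^ (CARD('d) - 1) \<le> count_const CARD('d) \<kappa> A (card H) * (r + inrad) ^ (CARD('d) - 1)"
proof -
  let ?v = "unit_ball_vol (real CARD('d))" and ?h = "mesh_size T" and ?m = "CARD('d) - 1"
  let ?\<iota> = "inrad_const CARD('d) \<kappa> A"
  have v: "0 < ?v" by (rule unit_ball_vol_pos) simp
  note h = mesh_size_pos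
  define Z where "Z = (\<lambda>(n, a). cball y (r + inrad) \<inter> {x. a - 2 * ?h \<le> n \<bullet> x} \<inter> {x. n \<bullet> x \<le> a + 2 * ?h})"
  have Zc: "closed (Z p)" for p
    unfolding Z_def by (cases p) (auto intro!: closed_Int closed_halfspace_le closed_halfspace_ge)
  define V where "V = 4 * ?h * (2 * (r + inrad)) ^ ?m"
  have V0: "0 \<le> V" unfolding V_def using h r inrad_pos by (intro mult_nonneg_nonneg zero_le_power) auto
  have Zm: "emeasure lborel (Z p) \<le> ennreal V" if p: "p \<in> H" for p
  proof -
    obtain n a where na: "p = (n, a)" by (cases p)
    have "emeasure lborel (Z p) \<le> ennreal ((a + 2 * ?h - (a - 2 * ?h)) * (2 * (r + inrad)) ^ ?m)"
      using r inrad_pos h H(2)[of n a] p na by (intro measure_ball_slab_le[of n _ _ _ _ y]) (auto simp: Z_def)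
    then show ?thesis by (simp add: V_def)
  qed
  have "real (card S) * (?v * inrad ^ CARD('d)) \<le> real (card H) * V"
  proof (rule count_le[OF S, of "\<Union>p\<in>H. Z p"])
    fix K assume KS: "K \<in> S"
    then have KT: "K \<in> T" using S by blast
    obtain n a x where na: "(n, a) \<in> H" "x \<in> K" "n \<bullet> x = a" using K[OF KS] by blast
    have "ball (ctr K) inrad \<subseteq> Z (n, a)"
    proof
      fix w assume w: "w \<in> ball (ctr K) inrad"
      have "dist y w \<le> r + inrad" using near[OF KS] w dist_triangle[of y w "ctr K"] by (simp add: dist_commute)
      moreover have "\<bar>n \<bullet> (w - x)\<bar> \<le> norm n * norm (w - x)" by (rule Cauchy_Schwarz_ineq2)
      then have "\<bar>n \<bullet> w - a\<bar> \<le> dist w x" using H(2)[OF na(1)] na(3) by (simp add: inner_diff_right dist_norm)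
      moreover have "dist w x \<le> ?h" using ball_ctr[OF KT] w by (intro dist_elem_le[OF KT _ na(2)]) blast
      ultimately show "w \<in> Z (n, a)" using h by (auto simp: Z_def)
    qed
    then show "ball (ctr K) inrad \<subseteq> (\<Union>p\<in>H. Z p)" using na(1) by blast
  next
    have "emeasure lborel (\<Union>p\<in>H. Z p) \<le> (\<Sum>p\<in>H. emeasure lborel (Z p))"
      using Zc by (intro emeasure_subadditive_finite H(1)) auto
    also have "\<dots> \<le> (\<Sum>p\<in>H. ennreal V)" by (intro sum_mono Zm)
    also have "\<dots> = ennreal (real (card H) * V)" using V0 by (simp add: ennreal_mult ennreal_of_nat_eq_real_of_nat)
    finally show "emeasure lborel (\<Union>p\<in>H. Z p) \<le> ennreal (real (card H) * V)" .
    show "(\<Union>p\<in>H. Z p) \<in> sets lborel" using Zc H(1) by (auto intro!: closed_UN borel_closed)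
    show "0 \<le> real (card H) * V" using V0 by (intro mult_nonneg_nonneg) auto
  qed
  moreover have "inrad ^ CARD('d) = ?\<iota> ^ CARD('d) * (?h * ?h ^ ?m)"
  proof -
    have "?h ^ CARD('d) = ?h * ?h ^ ?m" by (metis Suc_pred' power_Suc zero_less_card_finite)
    then show ?thesis by (simp add: inrad_def power_mult_distrib)
  qed
  ultimately have "?h * (real (card S) * ?h ^ ?m * (?v * ?\<iota> ^ CARD('d))) \<le> ?h * (real (card H) * 4 * 2 ^ ?m * (r + inrad) ^ ?m)"
    by (simp only: V_def power_mult_distrib) (simp only: mult_ac)
  then have "real (card S) * ?h ^ ?m * (?v * ?\<iota> ^ CARD('d)) \<le> real (card H) * 4 * 2 ^ ?m * (r + inrad) ^ ?m"
    using h by (simp only: mult_le_cancel_left_pos)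
  moreover have "0 < ?v * ?\<iota> ^ CARD('d)" using v inrad_const_pos by simp
  ultimately show ?thesis unfolding count_const_def by (simp only: pos_le_divide_eq times_divide_eq_left)
qed

end

section \<open>Faces that cover the same set\<close>

lemma surface_hyperplane_slice_null:
  fixes n m :: "real^'d"
  assumes n: "norm n = 1" and H: "affine hull S = {x. n \<bullet> x = \<alpha>}"
    and ne: "{x. m \<bullet> x = \<beta>} \<noteq> {x. n \<bullet> x = \<alpha>}" and m: "norm m = 1"
  shows "emeasure (surface_lborel S) {x. n \<bullet> x = \<alpha> \<and> m \<bullet> x = \<beta>} = 0"
proof -
  define A where "A = {x. n \<bullet> x = \<alpha> \<and> m \<bullet> x = \<beta>}"
  have "A = {x. n \<bullet> x = \<alpha>} \<inter> {x. m \<bullet> x = \<beta>}" by (auto simp: A_def)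
  then have cA: "closed A" by (simp add: closed_Int closed_hyperplane)
  have [measurable]: "A \<in> sets borel" using cA by simp
  \<comment> \<open>The part of \<open>m\<close> tangential to the hyperplane with normal \<open>n\<close>; it vanishes only for parallel hyperplanes.\<close>
  define w where "w = m - (m \<bullet> n) *\<^sub>R n"
  have nn: "n \<bullet> n = 1" using n by (simp add: norm_eq_1)
  have wn: "w \<bullet> n = 0" by (simp add: w_def inner_diff_left nn)
  have mem: "w \<bullet> x = \<beta> - (m \<bullet> n) * \<alpha>" if "x - (n \<bullet> x - \<alpha>) *\<^sub>R n \<in> A" for x
  proof -
    let ?y = "x - (n \<bullet> x - \<alpha>) *\<^sub>R n"
    have "w \<bullet> x = w \<bullet> ?y" by (simp add: inner_diff_right wn)
    also have "\<dots> = m \<bullet> ?y - (m \<bullet> n) * (n \<bullet> ?y)" by (simp only: w_def inner_diff_left inner_scaleR_left)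
    finally show ?thesis using that by (simp only: A_def mem_Collect_eq)
  qed
  have "emeasure (surface_lborel S) A = ennreal 1 * (\<integral>\<^sup>+x. indicator A x \<partial>surface_lborel S)" by simp
  also have "\<dots> = (\<integral>\<^sup>+y. indicator A (y - (n \<bullet> y - \<alpha>) *\<^sub>R n) * indicator {0..1} (n \<bullet> y - \<alpha>) \<partial>lborel)"
    by (rule nn_integral_slab[OF n H, symmetric]) auto
  also have "\<dots> = 0"
  proof (cases "w = 0")
    case False
    have neg: "{x. w \<bullet> x = \<beta> - (m \<bullet> n) * \<alpha>} \<in> null_sets lborel"
      using negligible_hyperplane[of w "\<beta> - (m \<bullet> n) * \<alpha>"] False closed_hyperplane[of w]
      by (intro null_setsI) (auto simp: negligible_iff_null_sets null_sets_def dest: borel_closed)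
    show ?thesis
    proof (subst nn_integral_0_iff_AE)
      show "AE y in lborel. indicator A (y - (n \<bullet> y - \<alpha>) *\<^sub>R n) * indicator {0..1} (n \<bullet> y - \<alpha>) = (0::ennreal)"
        using AE_not_in[OF neg] by eventually_elim (use mem in \<open>auto split: split_indicator\<close>)
    qed simp
  next
    case True
    then have mn: "m = (m \<bullet> n) *\<^sub>R n" by (simp add: w_def)
    from arg_cong[OF mn, of norm] have "norm m = \<bar>m \<bullet> n\<bar> * norm n" by (simp only: norm_scaleR)
    then have c: "m \<bullet> n \<noteq> 0" using n m by auto
    have "A = {}"
    proof (rule ccontr)
      assume "A \<noteq> {}"
      then obtain x0 where x0: "n \<bullet> x0 = \<alpha>" "m \<bullet> x0 = \<beta>" by (auto simp: A_def)
      have mx: "m \<bullet> x = (m \<bullet> n) * (n \<bullet> x)" for x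
        using arg_cong[OF mn, of "\<lambda>v. v \<bullet> x"] by (simp only: inner_scaleR_left)
      have \<beta>: "\<beta> = (m \<bullet> n) * \<alpha>" using mx[of x0] x0 by (simp only:)
      have "m \<bullet> x = \<beta> \<longleftrightarrow> n \<bullet> x = \<alpha>" for x
        unfolding mx[of x] \<beta> using c by (simp only: mult_cancel_left simp_thms)
      then have "{x. m \<bullet> x = \<beta>} = {x. n \<bullet> x = \<alpha>}" by blast
      with ne show False by blast
    qed
    then show ?thesis by simp
  qed
  finally show ?thesis unfolding A_def .
qed

text \<open>Only the faces in the hyperplane of \<open>S\<close> matter, since the others meet \<open>S\<close> in a null set; on those
  faces the surface measure is the same, because it depends on the affine hull only.\<close>
lemma faces_cover_measure:
  fixes n :: "real^'d"
  assumes n: "norm n = 1" and H: "affine hull S = {x. n \<bullet> x = \<alpha>}" and S: "S \<subseteq> \<Union>E" "compact S" and E: "finite E"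
    and face: "\<And>e. e \<in> E \<Longrightarrow> compact e \<and> (\<exists>m \<beta>. norm m = 1 \<and> affine hull e = {x. m \<bullet> x = \<beta>})"
  shows "measure (surface_lborel S) S \<le> (\<Sum>e\<in>E. measure (surface_lborel e) e)"
proof -
  have fin: "emeasure (surface_lborel e) e = ennreal (measure (surface_lborel e) e)" if e: "e \<in> E" for e
  proof -
    obtain m \<beta> where m: "norm m = 1" "affine hull e = {x. m \<bullet> x = \<beta>}" using face[OF e] by blast
    have "emeasure (surface_lborel e) e < \<infinity>"
      using face[OF e] by (intro emeasure_surface_lborel_bounded[OF m]) (auto simp: compact_imp_bounded borel_compact)
    then show ?thesis by (simp add: emeasure_eq_ennreal_measure)
  qed
  have finS: "emeasure (surface_lborel S) S = ennreal (measure (surface_lborel S) S)"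
    using emeasure_surface_lborel_bounded[OF n H, of S] S(2)
    by (simp add: compact_imp_bounded borel_compact emeasure_eq_ennreal_measure less_top)
  have piece: "emeasure (surface_lborel S) (e \<inter> S) \<le> emeasure (surface_lborel e) e" if e: "e \<in> E" for e
  proof -
    obtain m \<beta> where m: "norm m = 1" "affine hull e = {x. m \<bullet> x = \<beta>}" using face[OF e] by blast
    show ?thesis
    proof (cases "affine hull e = affine hull S")
      case True
      then have "surface_lborel S = surface_lborel e" by (intro surface_lborel_cong) simp
      then show ?thesis using face[OF e] by (auto intro!: emeasure_mono simp: borel_compact)
    next
      case False
      have "e \<inter> S \<subseteq> {x. n \<bullet> x = \<alpha> \<and> m \<bullet> x = \<beta>}"
        using hull_subset[of e affine] hull_subset[of S affine] unfolding m(2) H by blast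
      moreover have "closed {x. n \<bullet> x = \<alpha> \<and> m \<bullet> x = \<beta>}"
        unfolding Collect_conj_eq by (intro closed_Int closed_hyperplane)
      ultimately have "emeasure (surface_lborel S) (e \<inter> S) \<le> emeasure (surface_lborel S) {x. n \<bullet> x = \<alpha> \<and> m \<bullet> x = \<beta>}"
        by (intro emeasure_mono) (auto intro: borel_closed)
      also have "\<dots> = 0" using False m H by (intro surface_hyperplane_slice_null[OF n H]) auto
      finally show ?thesis by simp
    qed
  qed
  have "emeasure (surface_lborel S) S = emeasure (surface_lborel S) (\<Union>e\<in>E. e \<inter> S)"
    using S(1) by (intro arg_cong[of _ _ "emeasure _"]) blast
  also have "\<dots> \<le> (\<Sum>e\<in>E. emeasure (surface_lborel S) (e \<inter> S))"
    using face S(2) by (intro emeasure_subadditive_finite E) (auto intro!: borel_compact compact_Int)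
  also have "\<dots> \<le> (\<Sum>e\<in>E. emeasure (surface_lborel e) e)" by (rule sum_mono[OF piece])
  also have "\<dots> = ennreal (\<Sum>e\<in>E. measure (surface_lborel e) e)" using fin by simp
  finally show ?thesis unfolding finS by (simp add: sum_nonneg)
qed

section \<open>Averages over moving balls\<close>

context discrete_gradient begin

text \<open>The average is not normalized: the mass of \<open>kern a r\<close> is the same for all balls (\<open>kern_mass\<close>).\<close>
definition avg where "avg a r = (\<Sum>K\<in>T. LINT y:K|lborel. u K y * kern a r y)"

text \<open>The fundamental theorem of calculus along the path, pointwise in \<open>y\<close>, followed by Fubini's theorem.\<close>
lemma path_integral:
  fixes a v :: "real^'d"
  assumes r: "\<And>s. s \<in> {0..1} \<Longrightarrow> 0 < r + s * \<sigma>"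
    and g: "g = (\<lambda>s y. \<Sum>i\<in>UNIV. flow_grad v \<sigma> (a + s *\<^sub>R v) (r + s * \<sigma>) i y $ i)"
  shows "avg (a + v) (r + \<sigma>) - avg a r
    = (LINT s:{0..1}|lborel. - (\<Sum>K\<in>T. LINT y:K|lborel. u K y * g s y))"
proof -
  have nz: "r + fst z * \<sigma> \<noteq> 0" if "z \<in> {0..1} \<times> UNIV" for z :: "real \<times> (real^'d)"
    using r[of "fst z"] that by auto
  have cg: "continuous_on ({0..1} \<times> UNIV) (\<lambda>(s, y). g s y)"
    unfolding g flow_divergence bump_def bump_grad_def case_prod_unfold
    by (intro continuous_intros ballI power_not_zero; erule nz)
  have ftc: "(LINT s:{0..1}|lborel. - g s y) = kern (a + v) (r + \<sigma>) y - kern a r y" for y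
  proof -
    have "(LINT s|lborel. indicat_real {0..1} s *\<^sub>R (- g s y))
      = kern (a + 1 *\<^sub>R v) (r + 1 * \<sigma>) y - kern (a + 0 *\<^sub>R v) (r + 0 * \<sigma>) y"
    proof (rule integral_FTC_atLeastAtMost[where a = 0 and b = 1 and F = "\<lambda>s. kern (a + s *\<^sub>R v) (r + s * \<sigma>) y" and f = "\<lambda>s. - g s y"])
      fix s :: real assume s: "0 \<le> s" "s \<le> 1"
      have "((\<lambda>s. kern (a + s *\<^sub>R v) (r + s * \<sigma>) y) has_real_derivative - g s y) (at s)"
      proof -
        have "0 < r + s * \<sigma>" using r[of s] s by simp
        from kern_path_derivative[OF this, of a v y] show ?thesis by (simp only: g)
      qed
      then show "((\<lambda>s. kern (a + s *\<^sub>R v) (r + s * \<sigma>) y) has_vector_derivative - g s y) (at s within {0..1})"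
        unfolding has_real_derivative_iff_has_vector_derivative by (rule has_vector_derivative_at_within)
    next
      have "continuous_on {0..1} (\<lambda>s. (\<lambda>(s, y). g s y) (s, y))"
        by (rule continuous_on_compose2[OF cg]) (auto intro!: continuous_intros)
      then show "continuous_on {0..1} (\<lambda>s. - g s y)" by (auto intro!: continuous_intros)
    qed simp
    then show ?thesis by (simp add: set_lebesgue_integral_def)
  qed
  define \<Phi> where "\<Phi> K s y = (indicat_real {0..1} s * indicat_real K y) * (u K y * (- g s y))" for K s y
  have int\<Phi>: "integrable (lborel \<Otimes>\<^sub>M lborel) (\<lambda>(s, y). \<Phi> K s y)" if K: "K \<in> T" for K
  proof -
    have "integrable lborel (\<lambda>z. indicator ({0..1} \<times> K) z *\<^sub>R (u K (snd z) * - ((\<lambda>(s, y). g s y) z)))"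
      by (intro borel_integrable_compact compact_Times compact_elem[OF K] continuous_intros
          continuous_on_compose2[OF cont_u[OF K]] continuous_on_subset[OF cg]) auto
    moreover have "(\<lambda>z. indicator ({0..1} \<times> K) z *\<^sub>R (u K (snd z) * - ((\<lambda>(s, y). g s y) z))) = (\<lambda>(s, y). \<Phi> K s y)"
      by (rule ext) (auto simp: \<Phi>_def indicator_times)
    ultimately show ?thesis unfolding lborel_prod by (simp only:)
  qed
  have swap: "(LINT y:K|lborel. u K y * kern (a + v) (r + \<sigma>) y) - (LINT y:K|lborel. u K y * kern a r y)
      = (LINT s|lborel. LINT y|lborel. \<Phi> K s y)" if K: "K \<in> T" for K
  proof -
    have k: "continuous_on UNIV (kern a' r' :: real^'d \<Rightarrow> real)" for a' r'
      unfolding kern_def bump_def divide_inverse by (intro continuous_intros)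
    have "(LINT y:K|lborel. u K y * kern (a + v) (r + \<sigma>) y) - (LINT y:K|lborel. u K y * kern a r y)
      = (LINT y:K|lborel. u K y * kern (a + v) (r + \<sigma>) y - u K y * kern a r y)"
      by (intro set_integral_diff(2)[symmetric] set_integrable_simplex[OF simplex[OF K]] continuous_intros cont_u[OF K] k)
    also have "\<dots> = (LINT y|lborel. LINT s|lborel. \<Phi> K s y)"
      unfolding set_lebesgue_integral_def
    proof (intro Bochner_Integration.integral_cong refl)
      fix y
      have "(LINT s|lborel. \<Phi> K s y) = (LINT s|lborel. (indicat_real K y * u K y) * (indicat_real {0..1} s *\<^sub>R (- g s y)))"
        unfolding \<Phi>_def by (intro Bochner_Integration.integral_cong refl) simp
      also have "\<dots> = (indicat_real K y * u K y) * (kern (a + v) (r + \<sigma>) y - kern a r y)"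
        by (simp only: integral_mult_right_zero ftc[of y, unfolded set_lebesgue_integral_def])
      finally show "indicat_real K y *\<^sub>R (u K y * kern (a + v) (r + \<sigma>) y - u K y * kern a r y) = (LINT s|lborel. \<Phi> K s y)"
        by (simp add: right_diff_distrib)
    qed
    also have "\<dots> = (LINT s|lborel. LINT y|lborel. \<Phi> K s y)"
      by (rule lborel_pair.Fubini_integral[OF int\<Phi>[OF K]])
    finally show ?thesis .
  qed
  have "avg (a + v) (r + \<sigma>) - avg a r = (\<Sum>K\<in>T. LINT s|lborel. LINT y|lborel. \<Phi> K s y)"
    unfolding avg_def sum_subtractf[symmetric] by (rule sum.cong[OF refl swap])
  also have "\<dots> = (LINT s|lborel. (\<Sum>K\<in>T. LINT y|lborel. \<Phi> K s y))"
    by (rule Bochner_Integration.integral_sum[symmetric]) (rule lborel_pair.integrable_fst[OF int\<Phi>])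
  also have "\<dots> = (LINT s:{0..1}|lborel. - (\<Sum>K\<in>T. LINT y:K|lborel. u K y * g s y))"
    unfolding set_lebesgue_integral_def
  proof (intro Bochner_Integration.integral_cong refl)
    fix s :: real
    have "(LINT y|lborel. \<Phi> K s y) = indicat_real {0..1} s * - (LINT y|lborel. indicat_real K y *\<^sub>R (u K y * g s y))" for K
    proof -
      have "(LINT y|lborel. \<Phi> K s y) = (LINT y|lborel. (- indicat_real {0..1} s) * (indicat_real K y *\<^sub>R (u K y * g s y)))"
        unfolding \<Phi>_def by (intro Bochner_Integration.integral_cong refl) simp
      then show ?thesis by simp
    qed
    then show "(\<Sum>K\<in>T. LINT y|lborel. \<Phi> K s y)
      = indicat_real {0..1} s *\<^sub>R - (\<Sum>K\<in>T. LINT y|lborel. indicat_real K y *\<^sub>R (u K y * g s y))"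
      by (simp add: sum_distrib_left sum_negf)
  qed
  finally show ?thesis .
qed

text \<open>At each time the flow field vanishes outside \<open>\<Omega>\<close> and \<open>field_estimate\<close> applies. The radius \<open>\<rho>\<close> is a lower
  bound for the radii along the path, and \<open>25\<close> is the square of the Lipschitz factor of the flow.\<close>
lemma path_estimate:
  fixes a b :: "real^'d"
  assumes \<rho>: "0 < \<rho>" "\<rho> \<le> r" "\<rho> \<le> r'"
    and inside: "\<And>s. s \<in> {0..1} \<Longrightarrow> ball (a + s *\<^sub>R (b - a)) (r + s * (r' - r)) \<subseteq> \<Omega>"
    and N: "N \<subseteq> T" "\<And>K s. K \<in> T \<Longrightarrow> s \<in> {0..1} \<Longrightarrow> K \<inter> ball (a + s *\<^sub>R (b - a)) (r + s * (r' - r)) \<noteq> {} \<Longrightarrow> K \<in> N"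
  shows "(avg b r' - avg a r)\<^sup>2 \<le> 25 * flux_const CARD('d) \<kappa> A Cs * mesh_size T ^ CARD('d)
    * ((norm (b - a) + \<bar>r' - r\<bar>) / \<rho> ^ Suc CARD('d))\<^sup>2 * (\<rho>\<^sup>2 + (mesh_size T)\<^sup>2 + mesh_size T)
    * real (card N) * (\<Sum>K\<in>N. energy K)" (is "_ \<le> ?B")
proof -
  let ?h = "mesh_size T" and ?M = "norm (b - a) + \<bar>r' - r\<bar>" and ?n = "CARD('d)"
  have h: "0 < ?h" by (rule mesh_size_pos)
  define g where "g = (\<lambda>s y. \<Sum>i\<in>UNIV. flow_grad (b - a) (r' - r) (a + s *\<^sub>R (b - a)) (r + s * (r' - r)) i y $ i)"
  define D where "D s = (\<Sum>K\<in>T. LINT y:K|lborel. u K y * g s y)" for s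
  have \<rho>s: "\<rho> \<le> r + s * (r' - r)" if "s \<in> {0..1}" for s
  proof -
    have "(1 - s) * \<rho> + s * \<rho> \<le> (1 - s) * r + s * r'" using that \<rho> by (intro add_mono mult_left_mono) auto
    then show ?thesis by (simp add: algebra_simps)
  qed
  have E: "0 \<le> (\<Sum>K\<in>N. energy K)" by (intro sum_nonneg energy_nonneg)
  have B0: "0 \<le> ?B" using consts_pos(4) h \<rho>(1) E by (intro mult_nonneg_nonneg) auto
  have DB: "(D s)\<^sup>2 \<le> ?B" if s: "s \<in> {0..1}" for s
  proof -
    let ?R = "r + s * (r' - r)" and ?c = "a + s *\<^sub>R (b - a)"
    let ?F = "flow (b - a) (r' - r) ?c ?R"
    have R: "0 < ?R" using \<rho>s[OF s] \<rho>(1) by simp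
    have "(D s)\<^sup>2 \<le> flux_const ?n \<kappa> A Cs * ?h ^ ?n * ((?M / \<rho> ^ ?n)\<^sup>2 + (5 * ?M / \<rho> ^ Suc ?n)\<^sup>2 * (?h\<^sup>2 + ?h))
        * real (card N) * (\<Sum>K\<in>N. energy K)"
      unfolding D_def g_def
    proof (rule field_estimate[OF flow_component_derivative[OF R] continuous_flow_grad _ _ _ _ N(1)])
      show "?F x = 0" if "x \<notin> \<Omega>" for x using flow_outside[OF R] inside[OF s] that by blast
      show "norm (?F x) \<le> ?M / \<rho> ^ ?n" for x
      proof -
        have "norm (?F x) \<le> ?M / ?R ^ ?n" by (rule norm_flow_le[OF R])
        also have "\<dots> \<le> ?M / \<rho> ^ ?n" using \<rho>s[OF s] \<rho>(1) R by (intro divide_left_mono power_mono mult_pos_pos zero_less_power) auto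
        finally show ?thesis .
      qed
      show "norm (?F x - ?F y) \<le> 5 * ?M / \<rho> ^ Suc ?n * norm (x - y)" for x y
      proof -
        have "norm (?F x - ?F y) \<le> 5 * ?M / ?R ^ Suc ?n * norm (x - y)" by (rule flow_lipschitz[OF R])
        also have "\<dots> \<le> 5 * ?M / \<rho> ^ Suc ?n * norm (x - y)"
          using \<rho>s[OF s] \<rho>(1) R by (intro mult_right_mono divide_left_mono power_mono mult_pos_pos zero_less_power) auto
        finally show ?thesis .
      qed
      show "0 \<le> 5 * ?M / \<rho> ^ Suc ?n" using \<rho>(1) by (intro divide_nonneg_pos) auto
      fix K x assume K: "K \<in> T - N" and x: "x \<in> K"
      have "x \<notin> ball ?c ?R" using N(2)[of K s] s K x by blast
      then show "?F x = 0" by (rule flow_outside[OF R])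
    qed
    also have "\<dots> \<le> flux_const ?n \<kappa> A Cs * ?h ^ ?n * (25 * ((?M / \<rho> ^ Suc ?n)\<^sup>2 * (\<rho>\<^sup>2 + ?h\<^sup>2 + ?h)))
        * real (card N) * (\<Sum>K\<in>N. energy K)"
    proof -
      have "?M / \<rho> ^ ?n = ?M / \<rho> ^ Suc ?n * \<rho>" using \<rho>(1) by simp
      then have "(?M / \<rho> ^ ?n)\<^sup>2 = (?M / \<rho> ^ Suc ?n)\<^sup>2 * \<rho>\<^sup>2" by (simp only: power_mult_distrib)
      moreover have "5 * ?M / \<rho> ^ Suc ?n = 5 * (?M / \<rho> ^ Suc ?n)" by simp
      then have "(5 * ?M / \<rho> ^ Suc ?n)\<^sup>2 = 25 * (?M / \<rho> ^ Suc ?n)\<^sup>2" by (simp only: power_mult_distrib) simp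
      moreover have "X * \<rho>\<^sup>2 + 25 * X * (?h\<^sup>2 + ?h) \<le> 25 * (X * (\<rho>\<^sup>2 + ?h\<^sup>2 + ?h))" if "0 \<le> X" for X
      proof -
        have "0 \<le> 24 * (X * \<rho>\<^sup>2)" using that by simp
        then show ?thesis by (simp add: algebra_simps)
      qed
      ultimately have "(?M / \<rho> ^ ?n)\<^sup>2 + (5 * ?M / \<rho> ^ Suc ?n)\<^sup>2 * (?h\<^sup>2 + ?h) \<le> 25 * ((?M / \<rho> ^ Suc ?n)\<^sup>2 * (\<rho>\<^sup>2 + ?h\<^sup>2 + ?h))"
        by (simp only: zero_le_power2)
      then show ?thesis using consts_pos(4) h E by (intro mult_right_mono mult_left_mono) auto
    qed
    finally show ?thesis by (simp only: mult_ac)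
  qed
  have "avg (a + (b - a)) (r + (r' - r)) - avg a r = (LINT s:{0..1}|lborel. - D s)"
    unfolding D_def by (rule path_integral[OF _ g_def]) (use \<rho>s \<rho>(1) in fastforce)
  then have eq: "avg b r' - avg a r = (LINT s|lborel. indicat_real {0..1} s *\<^sub>R - D s)"
    by (simp add: set_lebesgue_integral_def)
  have Ds: "norm (indicat_real {0..1} s *\<^sub>R - D s) \<le> sqrt ?B * indicat_real {0..1} s" for s
    using real_le_rsqrt[of "\<bar>D s\<bar>"] DB[of s] by (cases "s \<in> {0..1}") auto
  have "norm (avg b r' - avg a r) \<le> (LINT s|lborel. norm (indicat_real {0..1} s *\<^sub>R - D s))"
    unfolding eq by (rule integral_norm_bound)
  also have "\<dots> \<le> (LINT s|lborel. sqrt ?B * indicat_real {0..1::real} s)"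
    by (rule integral_mono'[OF _ Ds]) (use B0 in auto)
  also have "\<dots> = sqrt ?B" by simp
  finally have "\<bar>avg b r' - avg a r\<bar> \<le> sqrt ?B" by simp
  then have "(avg b r' - avg a r)\<^sup>2 \<le> (sqrt ?B)\<^sup>2" by (metis abs_ge_zero power2_abs power_mono)
  then show ?thesis using B0 by simp
qed

end

section \<open>Chains of balls from the boundary\<close>

lemma weighted_Cauchy_Schwarz:
  fixes d w :: "'a \<Rightarrow> real"
  assumes w: "\<And>j. j \<in> I \<Longrightarrow> 0 < w j"
  shows "(\<Sum>j\<in>I. d j)\<^sup>2 \<le> (\<Sum>j\<in>I. w j) * (\<Sum>j\<in>I. (d j)\<^sup>2 / w j)"
proof -
  have "(\<Sum>j\<in>I. d j)\<^sup>2 = (\<Sum>j\<in>I. sqrt (w j) * (d j / sqrt (w j)))\<^sup>2"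
  proof (intro arg_cong[of _ _ "\<lambda>x. x\<^sup>2"] sum.cong refl)
    fix j assume "j \<in> I"
    then have "0 < w j" by (rule w)
    then show "d j = sqrt (w j) * (d j / sqrt (w j))" by simp
  qed
  also have "\<dots> \<le> (\<Sum>j\<in>I. (sqrt (w j))\<^sup>2) * (\<Sum>j\<in>I. (d j / sqrt (w j))\<^sup>2)"
    by (rule Cauchy_Schwarz_ineq_sum)
  also have "(\<Sum>j\<in>I. (sqrt (w j))\<^sup>2) = (\<Sum>j\<in>I. w j)" using w by (intro sum.cong) (auto intro: less_imp_le)
  also have "(\<Sum>j\<in>I. (d j / sqrt (w j))\<^sup>2) = (\<Sum>j\<in>I. (d j)\<^sup>2 / w j)"
    using w by (intro sum.cong) (auto simp: power_divide intro: less_imp_le)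
  finally show ?thesis .
qed

text \<open>The weights increase towards both ends of the chain: the cost of a step is governed by \<open>t = 2\<^sup>-\<^sup>j\<close> at
  large scales and by \<open>h / t\<close>, which is comparable to \<open>2\<^sup>j\<^sup>-\<^sup>J\<close>, at small ones.\<close>
lemma geometric_sums_le:
  fixes q :: real
  assumes "0 < q" "q < 1"
  shows "(\<Sum>j<J. q ^ j + q ^ (J - j)) \<le> 2 / (1 - q)"
proof -
  have g: "(\<Sum>j<J. q ^ j) \<le> 1 / (1 - q)"
    using assms sum_gp_strict[of q J] by (auto simp: divide_right_mono)
  have "(\<Sum>j<J. q ^ (J - j)) \<le> (\<Sum>j<J. q ^ (J - Suc j))"
    using assms by (intro sum_mono power_decreasing) auto
  also have "\<dots> = (\<Sum>j<J. q ^ j)" by (rule sum.nat_diff_reindex)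
  finally show ?thesis using g by (simp add: sum.distrib)
qed

lemma continuous_kern: "continuous_on UNIV (kern a r :: real^'d \<Rightarrow> real)"
  unfolding kern_def bump_def divide_inverse by (intro continuous_intros)

lemma kern_mass:
  "\<exists>m>0. \<forall>a r. 0 < r \<longrightarrow> (LINT y|lborel. kern a r (y::real^'d)) = m"
proof -
  define m where "m = (LINT y|lborel. bump (y::real^'d))"
  have cb: "continuous_on UNIV (bump :: real^'d \<Rightarrow> real)"
    by (rule continuous_of_gradient[OF bump_has_derivative])
  have eqb: "indicat_real (cball 0 1) y *\<^sub>R bump y = bump y" for y :: "real^'d"
    using bump_outside[of y] by (cases "y \<in> cball 0 1") auto
  have fin: "emeasure lborel (cball 0 1 :: (real^'d) set) < \<infinity>" by (rule emeasure_bounded_finite) simp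
  have "set_integrable lborel (cball 0 1) (bump :: real^'d \<Rightarrow> real)"
    by (rule set_integrable_compact_finite[OF compact_cball _ fin cb]) simp
  then have ib: "integrable lborel (bump :: real^'d \<Rightarrow> real)" unfolding set_integrable_def eqb .
  have "0 < 9/16 * measure lborel (ball 0 (1/2) :: (real^'d) set)" by simp
  also have "\<dots> = (LINT y|lborel. 9/16 * indicat_real (ball 0 (1/2)) (y::real^'d))" by simp
  also have "\<dots> \<le> m" unfolding m_def
  proof (rule integral_mono[OF _ ib])
    have "emeasure lborel (ball 0 (1/2) :: (real^'d) set) < \<infinity>" by (rule emeasure_bounded_finite) simp
    then show "integrable lborel (\<lambda>y. 9/16 * indicat_real (ball 0 (1/2)) (y::real^'d))" by simp
    fix y :: "real^'d"
    show "9/16 * indicat_real (ball 0 (1/2)) y \<le> bump y"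
    proof (cases "y \<in> ball 0 (1/2)")
      case True
      then have "(norm y)\<^sup>2 \<le> (1/2)\<^sup>2" by (intro power_mono) auto
      then have "y \<bullet> y \<le> 1/4" by (simp add: power2_norm_eq_inner power_divide)
      then have "3/4 \<le> max 0 (1 - y \<bullet> y)" by linarith
      then have "(3/4)\<^sup>2 \<le> bump y" unfolding bump_def by (rule power_mono) simp
      then show ?thesis using True by (simp add: power2_eq_square)
    qed (simp add: bump_nonneg)
  qed
  finally have m: "0 < m" .
  have "(LINT y|lborel. kern a r (y::real^'d)) = m" if r: "0 < r" for a r
  proof -
    have [measurable]: "(kern a r :: real^'d \<Rightarrow> real) \<in> borel_measurable borel"
      by (rule borel_measurable_continuous_onI[OF continuous_kern])
    have "(LINT y|lborel. kern a r (y::real^'d))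
      = (LINT y|density (distr lborel borel (\<lambda>x. a + r *\<^sub>R x)) (\<lambda>_. \<bar>r\<bar> ^ DIM(real^'d)). kern a r (y::real^'d))"
      using r by (subst lborel_affine[of r a]) auto
    also have "\<dots> = (LINT y|lborel. r ^ CARD('d) * kern a r (a + r *\<^sub>R y))"
      using r by (subst integral_density) (auto simp: integral_distr)
    also have "\<dots> = m" unfolding m_def kern_def using r by simp
    finally show ?thesis .
  qed
  with m show ?thesis by blast
qed

definition step_const :: "nat \<Rightarrow> real \<Rightarrow> real \<Rightarrow> real \<Rightarrow> real \<Rightarrow> real \<Rightarrow> real" where
  "step_const n \<kappa> A Cs Dm R = 25 * flux_const n \<kappa> A Cs
     * (Dm * (1 + 2 / inrad_const n \<kappa> A) / inrad_const n \<kappa> A) ^ n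
     * (Dm / 2 * (2 / R) ^ Suc n)\<^sup>2 * (R\<^sup>2 / 4 + Dm + 1)"

context discrete_gradient begin

text \<open>The ball is the image of \<open>ball g R\<close> under the homothety with centre \<open>x\<close> and ratio \<open>t\<close>, which maps
  \<open>G\<close> into itself. An open subset of \<open>closure \<Omega>\<close> lies in \<open>\<Omega>\<close> because \<open>\<Omega>\<close> is regular open.\<close>
lemma homothetic_ball_inside:
  assumes G: "convex G" "G \<subseteq> closure \<Omega>" "ball g R \<subseteq> G" and x: "x \<in> G" and t: "0 < t" "t \<le> 1"
  shows "ball (x + t *\<^sub>R (g - x)) (t * R) \<subseteq> \<Omega>"
proof -
  have "ball (x + t *\<^sub>R (g - x)) (t * R) \<subseteq> G"
  proof
    fix y assume y: "y \<in> ball (x + t *\<^sub>R (g - x)) (t * R)"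
    define w where "w = x + (1 / t) *\<^sub>R (y - x)"
    have "y - (x + t *\<^sub>R (g - x)) = t *\<^sub>R (w - g)" using t by (simp add: w_def algebra_simps)
    then have "norm (y - (x + t *\<^sub>R (g - x))) = t * norm (w - g)" using t by simp
    then have "t * norm (w - g) < t * R" using y by (simp add: dist_norm norm_minus_commute)
    then have "w \<in> ball g R" using t by (simp add: dist_norm norm_minus_commute)
    then have "w \<in> G" using G(3) by blast
    moreover have "y = (1 - t) *\<^sub>R x + t *\<^sub>R w" using t by (simp add: w_def algebra_simps)
    ultimately show "y \<in> G" using convexD_alt[OF G(1) x, of w t] t by simp
  qed
  then have "ball (x + t *\<^sub>R (g - x)) (t * R) \<subseteq> interior (closure \<Omega>)"
    using G(2) by (intro interior_maximal) auto
  then show ?thesis by (simp add: regular_dom)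
qed

text \<open>One halving of the scale. As \<open>t\<close> is larger than a multiple of \<open>h\<close>, at most a multiple of
  \<open>(t / h)\<^sup>d\<close> elements are involved; this absorbs the factor \<open>h\<^sup>d\<close> of the path estimate.\<close>
lemma chain_step:
  assumes G: "convex G" "G \<subseteq> closure \<Omega>" "ball g R \<subseteq> G" and R: "0 < R" and x: "x \<in> G" and t: "0 < t" "t \<le> 1"
    and Dm: "norm (g - x) + R \<le> Dm" "mesh_size T \<le> Dm" and small: "inrad < t * Dm"
  shows "(avg (x + (t / 2) *\<^sub>R (g - x)) (t / 2 * R) - avg (x + t *\<^sub>R (g - x)) (t * R))\<^sup>2
    \<le> step_const CARD('d) \<kappa> A Cs Dm R * ((t\<^sup>2 + mesh_size T) / t ^ CARD('d))
      * (\<Sum>K | K \<in> T \<and> dist x (ctr K) \<le> t * Dm + mesh_size T. energy K)"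
proof -
  let ?n = "CARD('d)" and ?h = "mesh_size T" and ?\<iota> = "inrad_const CARD('d) \<kappa> A"
  define N where "N = {K. K \<in> T \<and> dist x (ctr K) \<le> t * Dm + ?h}"
  define a b where "a = x + t *\<^sub>R (g - x)" and "b = x + (t / 2) *\<^sub>R (g - x)"
  define \<rho> where "\<rho> = t / 2 * R"
  define S where "S = (\<Sum>K\<in>N. energy K)"
  have S0: "0 \<le> S" unfolding S_def by (intro sum_nonneg energy_nonneg)
  have \<rho>: "0 < \<rho>" using t R by (simp add: \<rho>_def)
  note h = mesh_size_pos
  have D0: "0 < Dm" using h Dm(2) by linarith
  have ab: "a + s *\<^sub>R (b - a) = x + (t * (1 - s / 2)) *\<^sub>R (g - x)" for s
  proof -
    have "b - a = (- (t / 2)) *\<^sub>R (g - x)" unfolding a_def b_def by (simp add: scaleR_left_diff_distrib[symmetric])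
    then have "a + s *\<^sub>R (b - a) = x + (t + s * (- (t / 2))) *\<^sub>R (g - x)"
      by (simp only: a_def scaleR_scaleR scaleR_left_distrib add.assoc)
    moreover have "t + s * (- (t / 2)) = t * (1 - s / 2)" by (simp add: algebra_simps)
    ultimately show ?thesis by (simp only:)
  qed
  have rr: "t * R + s * (t / 2 * R - t * R) = t * (1 - s / 2) * R" for s by (simp add: algebra_simps)
  have "(avg b (t / 2 * R) - avg a (t * R))\<^sup>2 \<le> 25 * flux_const ?n \<kappa> A Cs * ?h ^ ?n
    * ((norm (b - a) + \<bar>t / 2 * R - t * R\<bar>) / \<rho> ^ Suc ?n)\<^sup>2 * (\<rho>\<^sup>2 + ?h\<^sup>2 + ?h) * real (card N) * S"
    unfolding S_def
  proof (rule path_estimate[OF \<rho>])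
    show "\<rho> \<le> t * R" "\<rho> \<le> t / 2 * R" using t R by (auto simp: \<rho>_def)
    show "ball (a + s *\<^sub>R (b - a)) (t * R + s * (t / 2 * R - t * R)) \<subseteq> \<Omega>" if s: "s \<in> {0..1}" for s
      unfolding ab rr using s t by (intro homothetic_ball_inside[OF G x]) (auto intro!: mult_le_one)
    show "N \<subseteq> T" by (auto simp: N_def)
    fix K s assume K: "K \<in> T" and s: "s \<in> {0..1::real}"
      and meet: "K \<inter> ball (a + s *\<^sub>R (b - a)) (t * R + s * (t / 2 * R - t * R)) \<noteq> {}"
    then obtain z where z: "z \<in> K" "z \<in> ball (x + (t * (1 - s / 2)) *\<^sub>R (g - x)) (t * (1 - s / 2) * R)"
      unfolding ab rr by blast
    let ?t = "t * (1 - s / 2)"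
    have tt: "0 \<le> ?t" "?t \<le> t" using s t by (auto simp: mult_left_le)
    have "norm (x - z) \<le> norm (x + ?t *\<^sub>R (g - x) - z) + norm (?t *\<^sub>R (g - x))"
      using norm_triangle_ineq4[of "x + ?t *\<^sub>R (g - x) - z" "?t *\<^sub>R (g - x)"] by (simp add: algebra_simps)
    also have "\<dots> \<le> ?t * R + ?t * norm (g - x)" using z(2) tt by (intro add_mono) (auto simp: dist_norm)
    also have "\<dots> = ?t * (norm (g - x) + R)" by (simp add: distrib_left)
    also have "\<dots> \<le> t * Dm" using tt Dm(1) R by (intro mult_mono) auto
    finally have "dist x z \<le> t * Dm" by (simp add: dist_norm)
    moreover have "dist z (ctr K) \<le> ?h" by (rule dist_elem_le[OF K z(1) ctr_in[OF K]])
    ultimately have "dist x (ctr K) \<le> t * Dm + ?h" using dist_triangle[of x "ctr K" z] by linarith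
    then show "K \<in> N" using K by (simp add: N_def)
  qed
  also have "\<dots> = 25 * flux_const ?n \<kappa> A Cs * (real (card N) * ?h ^ ?n)
    * ((norm (b - a) + \<bar>t / 2 * R - t * R\<bar>) / \<rho> ^ Suc ?n)\<^sup>2 * (\<rho>\<^sup>2 + ?h\<^sup>2 + ?h) * S" by (simp only: mult_ac)
  also have "\<dots> \<le> 25 * flux_const ?n \<kappa> A Cs * (t * (Dm * (1 + 2 / ?\<iota>) / ?\<iota>)) ^ ?n
    * (Dm / 2 * (2 / R) ^ Suc ?n / t ^ ?n)\<^sup>2 * ((R\<^sup>2 / 4 + Dm + 1) * (t\<^sup>2 + ?h)) * S"
  proof -
    have hi: "?h \<le> t * Dm / ?\<iota>" using small inrad_const_pos unfolding inrad_def by (simp add: pos_le_divide_eq mult.commute)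
    have "real (card N) * ?h ^ ?n \<le> ((t * Dm + ?h + inrad) / ?\<iota>) ^ ?n"
      by (rule count_ball[of N _ x]) (use D0 t h in \<open>auto simp: N_def\<close>)
    also have "\<dots> \<le> (t * (Dm * (1 + 2 / ?\<iota>) / ?\<iota>)) ^ ?n"
    proof (rule power_mono)
      have "t * Dm + ?h + inrad \<le> t * Dm + 2 * (t * Dm / ?\<iota>)" using hi inrad_le by linarith
      also have "\<dots> = t * (Dm * (1 + 2 / ?\<iota>))" by (simp add: algebra_simps)
      finally show "(t * Dm + ?h + inrad) / ?\<iota> \<le> t * (Dm * (1 + 2 / ?\<iota>) / ?\<iota>)"
        using inrad_const_pos by (simp add: divide_right_mono)
      show "0 \<le> (t * Dm + ?h + inrad) / ?\<iota>" using t D0 h inrad_pos inrad_const_pos by (intro divide_nonneg_pos) auto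
    qed
    finally have 1: "real (card N) * ?h ^ ?n \<le> (t * (Dm * (1 + 2 / ?\<iota>) / ?\<iota>)) ^ ?n" .
    have "b - a = - ((t / 2) *\<^sub>R (g - x))" unfolding a_def b_def by (simp add: scaleR_left_diff_distrib[symmetric])
    then have "norm (b - a) = t / 2 * norm (g - x)" using t by simp
    moreover have "\<bar>t / 2 * R - t * R\<bar> = t / 2 * R" using t R by simp
    ultimately have M: "norm (b - a) + \<bar>t / 2 * R - t * R\<bar> = t / 2 * (norm (g - x) + R)" by (simp add: distrib_left)
    have "(norm (b - a) + \<bar>t / 2 * R - t * R\<bar>) / \<rho> ^ Suc ?n \<le> (t / 2 * Dm) / \<rho> ^ Suc ?n"
      unfolding M using t Dm(1) \<rho> by (intro divide_right_mono mult_left_mono) auto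
    also have "\<dots> = Dm / 2 * (2 / R) ^ Suc ?n / t ^ ?n"
      unfolding \<rho>_def using t R by (simp add: power_mult_distrib power_divide)
    finally have 2: "((norm (b - a) + \<bar>t / 2 * R - t * R\<bar>) / \<rho> ^ Suc ?n)\<^sup>2 \<le> (Dm / 2 * (2 / R) ^ Suc ?n / t ^ ?n)\<^sup>2"
      using \<rho> by (intro power_mono divide_nonneg_pos) auto
    have "?h\<^sup>2 \<le> Dm * ?h" unfolding power2_eq_square using Dm(2) h by (intro mult_right_mono) auto
    moreover have "0 \<le> R\<^sup>2 / 4 * ?h + (Dm + 1) * t\<^sup>2" using h D0 by simp
    moreover have "\<rho>\<^sup>2 = t\<^sup>2 * R\<^sup>2 / 4" by (simp add: \<rho>_def power_mult_distrib power_divide)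
    moreover have "(R\<^sup>2 / 4 + Dm + 1) * (t\<^sup>2 + ?h)
        = t\<^sup>2 * R\<^sup>2 / 4 + Dm * ?h + ?h + (R\<^sup>2 / 4 * ?h + (Dm + 1) * t\<^sup>2)"
      by (simp add: algebra_simps)
    ultimately have 3: "\<rho>\<^sup>2 + ?h\<^sup>2 + ?h \<le> (R\<^sup>2 / 4 + Dm + 1) * (t\<^sup>2 + ?h)" by linarith
    show ?thesis using consts_pos(4) S0 h D0
      by (intro mult_right_mono[OF _ S0] mult_mono[OF mult_mono[OF mult_left_mono[OF 1] 2] 3] mult_nonneg_nonneg)
         (use t inrad_const_pos in auto)
  qed
  also have "\<dots> = step_const ?n \<kappa> A Cs Dm R * ((t\<^sup>2 + ?h) / t ^ ?n) * S"
  proof -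
    have "c * (t * P) ^ ?n * (Q / t ^ ?n)\<^sup>2 * (W * Y) * S = c * P ^ ?n * Q\<^sup>2 * W * (Y / t ^ ?n) * S" for c P Q W Y :: real
      using t by (simp add: power_mult_distrib power_divide power2_eq_square)
    then show ?thesis unfolding step_const_def .
  qed
  finally show ?thesis unfolding S_def N_def a_def b_def .
qed

text \<open>Inside one element the normalized average differs from the values of \<open>u\<close> by at most the oscillation of
  the polynomial.\<close>
lemma local_average:
  assumes K: "K \<in> T" and r: "0 < r" and sub: "ball a r \<subseteq> K" and x: "x \<in> K"
    and m: "0 < m" "(LINT y|lborel. kern a r y) = m"
  shows "mesh_size T ^ CARD('d) * (u K x - avg a r / m)\<^sup>2
    \<le> sup_const CARD('d) \<kappa> A Cs * grad_const CARD('d) \<kappa> A Cs * (mesh_size T * (mesh_size T + 1)) * energy K"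
    (is "_ \<le> ?B")
proof -
  let ?h = "mesh_size T" and ?n = "CARD('d)"
  note h = mesh_size_pos
  have osc: "?h ^ ?n * (u K x - u K y)\<^sup>2 \<le> ?B" if y: "y \<in> K" for y
  proof -
    have "?h ^ ?n * (u K x - u K y)\<^sup>2 \<le> sup_const ?n \<kappa> A Cs * ?h\<^sup>2 * (LINT x:K|lborel. grad K x \<bullet> grad K x)"
      by (rule oscillation_bound[OF K x y])
    also have "\<dots> = sup_const ?n \<kappa> A Cs * ?h * (?h * (LINT x:K|lborel. grad K x \<bullet> grad K x))" by (simp add: power2_eq_square)
    also have "\<dots> \<le> sup_const ?n \<kappa> A Cs * ?h * (grad_const ?n \<kappa> A Cs * (?h + 1) * energy K)"
      using gradient_bound[OF K] h consts_pos(2) by (intro mult_left_mono) auto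
    finally show ?thesis by (simp only: mult_ac)
  qed
  have B0: "0 \<le> ?B" using consts_pos h energy_nonneg[of K] by (intro mult_nonneg_nonneg) auto
  define \<omega> where "\<omega> = sqrt (?B / ?h ^ ?n)"
  have \<omega>0: "0 \<le> \<omega>" and \<omega>2: "\<omega>\<^sup>2 = ?B / ?h ^ ?n" unfolding \<omega>_def using B0 h by auto
  have osc': "\<bar>u K x - u K y\<bar> \<le> \<omega>" if y: "y \<in> K" for y
  proof (rule power2_le_imp_le[OF _ \<omega>0])
    show "\<bar>u K x - u K y\<bar>\<^sup>2 \<le> \<omega>\<^sup>2"
      unfolding \<omega>2 power2_abs using osc[OF y] h by (simp add: pos_le_divide_eq mult.commute)
  qed
  have out: "kern a r y = 0" if "y \<notin> K" for y using kern_outside[OF r, of y a] sub that by blast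
  have kpos: "0 \<le> kern a r y" for y
    unfolding kern_def using r by (intro divide_nonneg_pos bump_nonneg) simp
  have "avg a r = (\<Sum>K'\<in>T. if K' = K then (LINT y:K|lborel. u K y * kern a r y) else 0)"
    unfolding avg_def
  proof (rule sum.cong[OF refl])
    fix K' assume K': "K' \<in> T"
    have "(LINT y:K'|lborel. u K' y * kern a r y) = 0" if ne: "K' \<noteq> K"
    proof -
      have "ball a r \<subseteq> interior K" using sub by (simp add: interior_maximal)
      then have "ball a r \<inter> K' = {}" using interior_elem_disjoint[OF K K'] ne by blast
      then have "y \<in> K' \<Longrightarrow> kern a r y = 0" for y using kern_outside[OF r, of y a] by blast
      then have "indicat_real K' y *\<^sub>R (u K' y * kern a r y) = 0" for y by (cases "y \<in> K'") simp_all
      then show ?thesis unfolding set_lebesgue_integral_def by (simp only: integral_zero)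
    qed
    then show "(LINT y:K'|lborel. u K' y * kern a r y) = (if K' = K then (LINT y:K|lborel. u K y * kern a r y) else 0)" by auto
  qed
  also have "\<dots> = (LINT y:K|lborel. u K y * kern a r y)" using K finite_mesh by simp
  finally have av: "avg a r = (LINT y:K|lborel. u K y * kern a r y)" .
  note si = set_integrable_simplex[OF simplex[OF K]]
  have mK: "(LINT y:K|lborel. kern a r y) = m"
  proof -
    have "indicat_real K y *\<^sub>R kern a r y = kern a r y" for y using out by (cases "y \<in> K") auto
    then show ?thesis unfolding set_lebesgue_integral_def using m(2) by (simp only:)
  qed
  have "u K x * m - avg a r = (LINT y:K|lborel. u K x * kern a r y) - (LINT y:K|lborel. u K y * kern a r y)"
    by (simp add: mK av)
  also have "\<dots> = (LINT y:K|lborel. u K x * kern a r y - u K y * kern a r y)"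
    by (intro set_integral_diff(2)[symmetric] si continuous_intros continuous_kern cont_u[OF K])
  finally have eq: "u K x * m - avg a r = (LINT y:K|lborel. u K x * kern a r y - u K y * kern a r y)" .
  have "u K x * m - avg a r \<le> (LINT y:K|lborel. \<omega> * kern a r y)"
    unfolding eq
  proof (intro set_integral_mono si continuous_intros continuous_kern cont_u[OF K])
    fix y assume "y \<in> K"
    from osc'[OF this] have "(u K x - u K y) * kern a r y \<le> \<omega> * kern a r y" by (intro mult_right_mono kpos) auto
    then show "u K x * kern a r y - u K y * kern a r y \<le> \<omega> * kern a r y" by (simp add: left_diff_distrib)
  qed
  moreover have "(LINT y:K|lborel. (- \<omega>) * kern a r y) \<le> u K x * m - avg a r"
    unfolding eq
  proof (intro set_integral_mono si continuous_intros continuous_kern cont_u[OF K])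
    fix y assume "y \<in> K"
    from osc'[OF this] have "(- \<omega>) * kern a r y \<le> (u K x - u K y) * kern a r y" by (intro mult_right_mono kpos) auto
    then show "(- \<omega>) * kern a r y \<le> u K x * kern a r y - u K y * kern a r y" by (simp add: left_diff_distrib)
  qed
  ultimately have "\<bar>u K x * m - avg a r\<bar> \<le> \<omega> * m" unfolding set_integral_mult_right mK by (simp add: abs_le_iff)
  moreover have "u K x - avg a r / m = (u K x * m - avg a r) / m" using m(1) by (simp add: diff_divide_distrib)
  ultimately have "\<bar>u K x - avg a r / m\<bar> \<le> \<omega>" using m(1) by (simp add: pos_divide_le_eq)
  then have "(u K x - avg a r / m)\<^sup>2 \<le> \<omega>\<^sup>2" by (metis abs_ge_zero power2_abs power_mono)
  then show ?thesis unfolding \<omega>2 using h by (simp add: pos_le_divide_eq mult.commute)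
qed

end

definition chain_const :: "nat \<Rightarrow> real \<Rightarrow> real \<Rightarrow> real \<Rightarrow> real \<Rightarrow> real \<Rightarrow> nat \<Rightarrow> real" where
  "chain_const n \<kappa> A Cs Dm R mH = 48 * step_const n \<kappa> A Cs Dm R * count_const n \<kappa> A mH
     * (Dm * (1 + 2 / inrad_const n \<kappa> A)) ^ (n - 1) * (1 + 2 * Dm / inrad_const n \<kappa> A)"

context discrete_gradient begin

lemma step_const_nonneg: "0 \<le> Dm \<Longrightarrow> 0 < R \<Longrightarrow> 0 \<le> step_const CARD('d) \<kappa> A Cs Dm R"
  unfolding step_const_def using consts_pos(4) inrad_const_pos by (intro mult_nonneg_nonneg) auto

text \<open>Each element \<open>K'\<close> is counted once for every \<open>K \<in> S\<close> near it, and these elements \<open>K\<close> touch the hyperplanes.\<close>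
lemma neighbour_sum_le:
  assumes S: "S \<subseteq> T" and H: "finite H" "\<And>n a. (n, a) \<in> H \<Longrightarrow> norm n = 1"
    and SH: "\<And>K. K \<in> S \<Longrightarrow> \<exists>(n, a)\<in>H. \<exists>x\<in>K. n \<bullet> x = a" and r: "0 \<le> r"
  shows "mesh_size T ^ (CARD('d) - 1) * (\<Sum>K\<in>S. \<Sum>K' | K' \<in> T \<and> dist (ctr K) (ctr K') \<le> r. energy K')
    \<le> count_const CARD('d) \<kappa> A (card H) * (r + inrad) ^ (CARD('d) - 1) * (\<Sum>K\<in>T. energy K)"
proof -
  let ?m = "CARD('d) - 1" and ?h = "mesh_size T"
  have fS: "finite S" using S finite_mesh finite_subset by blast
  have "?h ^ ?m * (\<Sum>K\<in>S. \<Sum>K' | K' \<in> T \<and> dist (ctr K) (ctr K') \<le> r. energy K')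
    = ?h ^ ?m * (\<Sum>K'\<in>T. \<Sum>K | K \<in> S \<and> dist (ctr K) (ctr K') \<le> r. energy K')"
    by (simp only: sum.swap_restrict[OF fS finite_mesh])
  also have "\<dots> = (\<Sum>K'\<in>T. (real (card {K. K \<in> S \<and> dist (ctr K) (ctr K') \<le> r}) * ?h ^ ?m) * energy K')"
    unfolding sum_distrib_left by (intro sum.cong refl) simp
  also have "\<dots> \<le> (\<Sum>K'\<in>T. (count_const CARD('d) \<kappa> A (card H) * (r + inrad) ^ ?m) * energy K')"
  proof (intro sum_mono mult_right_mono energy_nonneg)
    fix K' assume "K' \<in> T"
    show "real (card {K. K \<in> S \<and> dist (ctr K) (ctr K') \<le> r}) * ?h ^ ?m \<le> count_const CARD('d) \<kappa> A (card H) * (r + inrad) ^ ?m"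
      by (rule count_boundary[OF _ r, of _ "ctr K'"]) (use S H SH in \<open>auto simp: dist_commute\<close>)
  qed
  finally show ?thesis by (simp only: sum_distrib_left)
qed

text \<open>The scale is halved \<open>J\<close> times, until the ball lies within the inscribed ball of \<open>K\<close>; all chains
  have the same length. With the weights \<open>(2/3)\<^sup>j + (2/3)\<^sup>J\<^sup>-\<^sup>j\<close> in the Cauchy-Schwarz inequality, the costs
  \<open>2\<^sup>-\<^sup>j\<close> and \<open>2\<^sup>j\<^sup>-\<^sup>J\<close> leave the summable remainders \<open>(3/4)\<^sup>j\<close> and \<open>(3/4)\<^sup>J\<^sup>-\<^sup>j\<close>.\<close>
lemma chain_sum:
  assumes S: "S \<subseteq> T" and H: "finite H" "\<And>n a. (n, a) \<in> H \<Longrightarrow> norm n = 1"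
    and SH: "\<And>K. K \<in> S \<Longrightarrow> \<exists>(n, a)\<in>H. \<exists>x\<in>K. n \<bullet> x = a"
    and G: "\<And>K. K \<in> S \<Longrightarrow> convex (G K)" "\<And>K. K \<in> S \<Longrightarrow> G K \<subseteq> closure \<Omega>" "\<And>K. K \<in> S \<Longrightarrow> ball (g K) R \<subseteq> G K"
      "\<And>K. K \<in> S \<Longrightarrow> ctr K \<in> G K"
    and R: "0 < R" and Dm: "\<And>K. K \<in> S \<Longrightarrow> norm (g K - ctr K) + R \<le> Dm" "mesh_size T \<le> Dm"
  obtains c r where "0 < r" "\<And>K. K \<in> S \<Longrightarrow> ball (c K) r \<subseteq> K"
    "mesh_size T ^ (CARD('d) - 1) * (\<Sum>K\<in>S. (avg (c K) r - avg (g K) R)\<^sup>2)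
      \<le> chain_const CARD('d) \<kappa> A Cs Dm R (card H) * (\<Sum>K\<in>T. energy K)"
proof -
  let ?n = "CARD('d)" and ?m = "CARD('d) - 1" and ?h = "mesh_size T" and ?\<iota> = "inrad_const CARD('d) \<kappa> A"
  define E where "E = (\<Sum>K\<in>T. energy K)"
  have E0: "0 \<le> E" unfolding E_def by (intro sum_nonneg energy_nonneg)
  note h = mesh_size_pos
  have D0: "0 < Dm" using h Dm(2) by linarith
  have fS: "finite S" using S finite_mesh finite_subset by blast
  define t where "t j = (1/2::real) ^ j" for j :: nat
  have t: "0 < t j" "t j \<le> 1" for j unfolding t_def by (auto intro: power_le_one)
  have tS: "t (Suc j) = t j / 2" for j by (simp add: t_def)
  \<comment> \<open>\<open>J\<close> is the first scale at which the ball lies in the inscribed ball of its element; all earlier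
    scales exceed a multiple of \<open>h\<close>, as \<open>chain_step\<close> requires.\<close>
  have "\<exists>j. t j * Dm \<le> inrad"
  proof -
    obtain j where "(1/2::real) ^ j < inrad / Dm"
      using real_arch_pow_inv[of "inrad / Dm" "1/2"] inrad_pos D0 by auto
    then show ?thesis using D0 by (intro exI[of _ j]) (simp add: t_def pos_less_divide_eq less_imp_le)
  qed
  then obtain J where J: "t J * Dm \<le> inrad" "\<And>j. j < J \<Longrightarrow> inrad < t j * Dm"
    using LeastI_ex[of "\<lambda>j. t j * Dm \<le> inrad"] not_less_Least[of _ "\<lambda>j. t j * Dm \<le> inrad"] by (metis not_le)
  define y where "y K j = ctr K + t j *\<^sub>R (g K - ctr K)" for K j
  define a where "a K j = avg (y K j) (t j * R)" for K j
  define w where "w j = (2/3::real) ^ j + (2/3) ^ (J - j)" for j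
  have w: "0 < w j" for j unfolding w_def by (intro add_pos_pos) auto
  have W: "(\<Sum>j<J. w j) \<le> 6" unfolding w_def using geometric_sums_le[of "2/3" J] by simp
  define C1 where "C1 = step_const ?n \<kappa> A Cs Dm R"
  define C2 where "C2 = count_const ?n \<kappa> A (card H)"
  define P where "P = Dm * (1 + 2 / ?\<iota>)"
  define q where "q = 2 * Dm / ?\<iota>"
  have C1: "0 \<le> C1" unfolding C1_def by (rule step_const_nonneg) (use D0 R in auto)
  have C2: "0 \<le> C2" unfolding C2_def by (rule count_const_nonneg)
  have P: "0 \<le> P" unfolding P_def using D0 inrad_const_pos by (intro mult_nonneg_nonneg) auto
  have q: "0 \<le> q" unfolding q_def using D0 inrad_const_pos by simp
  define N where "N K j = (\<Sum>K' | K' \<in> T \<and> dist (ctr K) (ctr K') \<le> t j * Dm + ?h. energy K')" for K j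
  have step: "(a K (Suc j) - a K j)\<^sup>2 \<le> C1 * ((t j)\<^sup>2 + ?h) / t j ^ ?n * N K j" if K: "K \<in> S" and j: "j < J" for K j
    using chain_step[OF G(1)[OF K] G(2)[OF K] G(3)[OF K] R G(4)[OF K] t Dm(1)[OF K] Dm(2) J(2)[OF j]]
    unfolding a_def y_def C1_def N_def tS by simp
  have tele: "(a K J - a K 0)\<^sup>2 \<le> 6 * (\<Sum>j<J. (a K (Suc j) - a K j)\<^sup>2 / w j)" for K
  proof -
    have "(a K J - a K 0)\<^sup>2 = (\<Sum>j<J. a K (Suc j) - a K j)\<^sup>2" by (simp only: sum_lessThan_telescope)
    also have "\<dots> \<le> (\<Sum>j<J. w j) * (\<Sum>j<J. (a K (Suc j) - a K j)\<^sup>2 / w j)" by (rule weighted_Cauchy_Schwarz) (rule w)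
    also have "\<dots> \<le> 6 * (\<Sum>j<J. (a K (Suc j) - a K j)\<^sup>2 / w j)"
      using w by (intro mult_right_mono W sum_nonneg divide_nonneg_pos) auto
    finally show ?thesis .
  qed
  have level: "?h ^ ?m * (\<Sum>K\<in>S. (a K (Suc j) - a K j)\<^sup>2 / w j)
      \<le> C1 * C2 * P ^ ?m * (1 + q) * E * ((3/4) ^ j + (3/4) ^ (J - j))" if j: "j < J" for j
  proof -
    have hi: "?h \<le> t j * Dm / ?\<iota>" using J(2)[OF j] inrad_const_pos unfolding inrad_def by (simp add: pos_le_divide_eq mult.commute)
    have hJ: "?h \<le> q * (1/2) ^ J"
    proof -
      obtain J' where J': "J = Suc J'" using j by (cases J) auto
      have "?h \<le> t J' * Dm / ?\<iota>" using J(2)[of J'] J' inrad_const_pos unfolding inrad_def by (simp add: pos_le_divide_eq mult.commute)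
      also have "\<dots> = q * (1/2) ^ J" unfolding q_def J' by (simp add: t_def)
      finally show ?thesis .
    qed
    have "?h ^ ?m * (\<Sum>K\<in>S. (a K (Suc j) - a K j)\<^sup>2 / w j) \<le> ?h ^ ?m * (\<Sum>K\<in>S. (C1 * ((t j)\<^sup>2 + ?h) / t j ^ ?n * N K j) / w j)"
      using h w[of j] step[OF _ j] by (intro mult_left_mono sum_mono divide_right_mono) auto
    also have "\<dots> = C1 * ((t j)\<^sup>2 + ?h) / t j ^ ?n / w j * (?h ^ ?m * (\<Sum>K\<in>S. N K j))"
    proof -
      have pull: "(\<Sum>K\<in>S. c * N K j / b) = c * (\<Sum>K\<in>S. N K j) / b" for c b :: real
        by (simp only: sum_distrib_left sum_divide_distrib)
      show ?thesis unfolding pull by (simp add: mult_ac)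
    qed
    also have "\<dots> \<le> C1 * ((t j)\<^sup>2 + ?h) / t j ^ ?n / w j * (C2 * (t j * P) ^ ?m * E)"
    proof (rule mult_left_mono)
      have "?h ^ ?m * (\<Sum>K\<in>S. N K j) \<le> C2 * (t j * Dm + ?h + inrad) ^ ?m * E"
        unfolding N_def C2_def E_def by (rule neighbour_sum_le[OF S H SH]) (use D0 t[of j] h in auto)
      also have "\<dots> \<le> C2 * (t j * P) ^ ?m * E"
      proof (intro mult_right_mono mult_left_mono power_mono E0 C2)
        have "t j * Dm + ?h + inrad \<le> t j * Dm + 2 * (t j * Dm / ?\<iota>)" using hi inrad_le by linarith
        also have "\<dots> = t j * P" unfolding P_def by (simp add: algebra_simps)
        finally show "t j * Dm + ?h + inrad \<le> t j * P" .
      qed (use D0 t[of j] h inrad_pos in auto)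
      finally show "?h ^ ?m * (\<Sum>K\<in>S. N K j) \<le> C2 * (t j * P) ^ ?m * E" .
      show "0 \<le> C1 * ((t j)\<^sup>2 + ?h) / t j ^ ?n / w j"
        using C1 h t[of j] w[of j] by (intro divide_nonneg_pos mult_nonneg_nonneg) auto
    qed
    also have "\<dots> = C1 * C2 * P ^ ?m * E * (((t j)\<^sup>2 + ?h) / t j / w j)"
    proof -
      have "?n = Suc ?m" by (simp add: Suc_pred')
      then have tn: "t j ^ ?n = t j * t j ^ ?m" by (metis power_Suc)
      have "c * X / (tt * T') / ww * (d * (T' * PP) * e) = c * d * PP * e * (X / tt / ww)" if "T' \<noteq> 0" for c X tt T' ww d PP e :: real
        using that by simp
      from this[of "t j ^ ?m"] show ?thesis unfolding tn power_mult_distrib using t[of j] by simp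
    qed
    also have "\<dots> \<le> C1 * C2 * P ^ ?m * E * ((1 + q) * ((3/4) ^ j + (3/4) ^ (J - j)))"
    proof (rule mult_left_mono)
      have "(1/2::real) ^ J = (1/2) ^ (J - j) * t j" unfolding t_def by (subst power_add[symmetric]) (use j in simp)
      then have "?h \<le> q * (1/2) ^ (J - j) * t j" using hJ by simp
      then have "((t j)\<^sup>2 + ?h) / t j \<le> (t j * t j + q * (1/2) ^ (J - j) * t j) / t j"
        using t[of j] by (intro divide_right_mono) (auto simp: power2_eq_square)
      also have "\<dots> = (1/2) ^ j + q * (1/2) ^ (J - j)"
        using t[of j] by (simp add: add_divide_distrib t_def)
      also have "(1/2::real) ^ j = (3/4) ^ j * (2/3) ^ j" by (simp add: power_mult_distrib[symmetric])
      also have "(1/2::real) ^ (J - j) = (3/4) ^ (J - j) * (2/3) ^ (J - j)" by (simp add: power_mult_distrib[symmetric])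
      also have "(3/4) ^ j * (2/3) ^ j + q * ((3/4) ^ (J - j) * (2/3) ^ (J - j)) \<le> (1 + q) * ((3/4) ^ j + (3/4) ^ (J - j)) * w j"
      proof -
        have ineq: "a' * c' + q * (b' * d') \<le> (1 + q) * (a' + b') * (c' + d')"
          if "0 \<le> a'" "0 \<le> b'" "0 \<le> c'" "0 \<le> d'" for a' b' c' d' :: real
        proof -
          have "0 \<le> a' * d' + b' * c' + b' * d' + q * (a' * c') + q * (a' * d') + q * (b' * c')"
            using that q by (intro add_nonneg_nonneg mult_nonneg_nonneg) auto
          then show ?thesis by (simp add: algebra_simps)
        qed
        show ?thesis unfolding w_def by (rule ineq) auto
      qed
      finally show "((t j)\<^sup>2 + ?h) / t j / w j \<le> (1 + q) * ((3/4) ^ j + (3/4) ^ (J - j))"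
        using w[of j] by (simp only: pos_divide_le_eq)
      show "0 \<le> C1 * C2 * P ^ ?m * E" using C1 C2 P E0 by (intro mult_nonneg_nonneg) auto
    qed
    finally show ?thesis by (simp only: mult_ac)
  qed
  have "?h ^ ?m * (\<Sum>K\<in>S. (a K J - a K 0)\<^sup>2) \<le> ?h ^ ?m * (\<Sum>K\<in>S. 6 * (\<Sum>j<J. (a K (Suc j) - a K j)\<^sup>2 / w j))"
    using h by (intro mult_left_mono sum_mono tele) auto
  also have "\<dots> = 6 * (?h ^ ?m * (\<Sum>K\<in>S. \<Sum>j<J. (a K (Suc j) - a K j)\<^sup>2 / w j))"
    by (simp only: sum_distrib_left[symmetric] mult.left_commute)
  also have "(\<Sum>K\<in>S. \<Sum>j<J. (a K (Suc j) - a K j)\<^sup>2 / w j) = (\<Sum>j<J. \<Sum>K\<in>S. (a K (Suc j) - a K j)\<^sup>2 / w j)"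
    by (rule sum.swap)
  also have "?h ^ ?m * \<dots> = (\<Sum>j<J. ?h ^ ?m * (\<Sum>K\<in>S. (a K (Suc j) - a K j)\<^sup>2 / w j))" by (rule sum_distrib_left)
  also have "6 * \<dots> \<le> 6 * (\<Sum>j<J. C1 * C2 * P ^ ?m * (1 + q) * E * ((3/4) ^ j + (3/4) ^ (J - j)))"
    using level by (intro mult_left_mono sum_mono) auto
  also have "\<dots> = 6 * (C1 * C2 * P ^ ?m * (1 + q) * E * (\<Sum>j<J. (3/4) ^ j + (3/4) ^ (J - j)))"
    by (simp only: sum_distrib_left)
  also have "\<dots> \<le> 6 * (C1 * C2 * P ^ ?m * (1 + q) * E * 8)"
    using C1 C2 P E0 q geometric_sums_le[of "3/4" J] by (intro mult_left_mono mult_nonneg_nonneg) auto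
  also have "\<dots> = chain_const ?n \<kappa> A Cs Dm R (card H) * E"
    unfolding chain_const_def C1_def C2_def P_def q_def by simp
  finally have main: "?h ^ ?m * (\<Sum>K\<in>S. (a K J - a K 0)\<^sup>2) \<le> chain_const ?n \<kappa> A Cs Dm R (card H) * E" .
  show ?thesis
  proof (rule that[of "t J * R" "\<lambda>K. y K J"])
    show "0 < t J * R" using t R by simp
    show "ball (y K J) (t J * R) \<subseteq> K" if K: "K \<in> S" for K
    proof
      fix z assume z: "z \<in> ball (y K J) (t J * R)"
      have "dist (ctr K) (y K J) = t J * norm (g K - ctr K)" using t[of J] by (simp add: y_def dist_norm)
      moreover have "dist (y K J) z < t J * R" using z by simp
      ultimately have "dist (ctr K) z < t J * (norm (g K - ctr K) + R)"
        using dist_triangle[of "ctr K" z "y K J"] by (simp add: distrib_left)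
      also have "\<dots> \<le> t J * Dm" using t[of J] Dm(1)[OF K] by (intro mult_left_mono) auto
      also have "\<dots> \<le> inrad" by (rule J(1))
      finally have "z \<in> ball (ctr K) inrad" by simp
      then show "z \<in> K" using ball_ctr[of K] S K by blast
    qed
    have "a K 0 = avg (g K) R" for K by (simp add: a_def y_def t_def)
    then show "?h ^ ?m * (\<Sum>K\<in>S. (avg (y K J) (t J * R) - avg (g K) R)\<^sup>2)
      \<le> chain_const ?n \<kappa> A Cs Dm R (card H) * (\<Sum>K\<in>T. energy K)"
      using main unfolding a_def[of _ J] E_def by simp
  qed
qed

end

section \<open>The trace on the boundary\<close>

lemma set_integral_le_measure:
  fixes f :: "'a \<Rightarrow> real"
  assumes S: "S \<in> sets M" "emeasure M S < \<infinity>" and f: "set_integrable M S f" and B: "\<And>x. x \<in> S \<Longrightarrow> f x \<le> B"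
  shows "(LINT x:S|M. f x) \<le> measure M S * B"
proof -
  have cI: "set_integrable M S (\<lambda>_. B)" unfolding set_integrable_def using S by simp
  have "(LINT x:S|M. f x) \<le> (LINT x:S|M. B)" by (rule set_integral_mono[OF f cI B])
  also have "\<dots> = measure M S * B" unfolding set_lebesgue_integral_def using sets.sets_into_space[OF S(1)]
    by (simp add: Int_absorb2)
  finally show ?thesis .
qed

lemma square_sum3_le: "((a::real) + b + c)\<^sup>2 \<le> 3 * (a\<^sup>2 + b\<^sup>2 + c\<^sup>2)"
proof -
  have "0 \<le> (a - b)\<^sup>2 + (b - c)\<^sup>2 + (a - c)\<^sup>2" by simp
  then show ?thesis by (simp add: power2_eq_square algebra_simps)
qed

context regular_mesh begin

lemma finite_boundary_faces: "finite (boundary_faces \<Omega> T)"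
proof (rule finite_subset)
  show "boundary_faces \<Omega> T \<subseteq> (\<Union>K\<in>T. {e. e facet_of K})" by (auto simp: boundary_faces_def faces_def)
  show "finite (\<Union>K\<in>T. {e. e facet_of K})" using finite_mesh finite_facets_simplex[OF simplex] by (intro finite_UN_I) auto
qed

text \<open>An element may have several boundary faces, but not more than its facets.\<close>
lemma boundary_faces_sum_le:
  assumes f: "\<And>K. 0 \<le> f K"
  shows "(\<Sum>e\<in>boundary_faces \<Omega> T. f (elem_at T e)) \<le> real (Suc CARD('d)) * (\<Sum>K\<in>elem_at T ` boundary_faces \<Omega> T. (f K :: real))"
proof -
  let ?B = "boundary_faces \<Omega> T"
  have "(\<Sum>e\<in>?B. f (elem_at T e)) = (\<Sum>K\<in>elem_at T ` ?B. \<Sum>e\<in>{e \<in> ?B. elem_at T e = K}. f (elem_at T e))"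
    by (rule sum.image_gen[OF finite_boundary_faces])
  also have "\<dots> = (\<Sum>K\<in>elem_at T ` ?B. real (card {e \<in> ?B. elem_at T e = K}) * f K)"
    by (intro sum.cong refl) simp
  also have "\<dots> \<le> (\<Sum>K\<in>elem_at T ` ?B. real (Suc CARD('d)) * f K)"
  proof (intro sum_mono mult_right_mono f)
    fix K assume "K \<in> elem_at T ` ?B"
    then have K: "K \<in> T" using elem_at_boundary(1) by blast
    have "card {e \<in> ?B. elem_at T e = K} \<le> card {e. e facet_of K}"
      using finite_facets_simplex[OF simplex[OF K]] elem_at_boundary(2) by (intro card_mono) auto
    then show "real (card {e \<in> ?B. elem_at T e = K}) \<le> real (Suc CARD('d))"
      using finite_facets_simplex[OF simplex[OF K]] by simp
  qed
  finally show ?thesis by (simp only: sum_distrib_left)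
qed

lemma boundary_count:
  assumes H: "finite H" "\<And>n a. (n, a) \<in> H \<Longrightarrow> norm n = 1" "\<And>x. x \<in> frontier \<Omega> \<Longrightarrow> \<exists>(n, a)\<in>H. n \<bullet> x = a"
    and D: "diameter (closure \<Omega>) \<le> D"
  shows "real (card (elem_at T ` boundary_faces \<Omega> T)) * mesh_size T ^ (CARD('d) - 1)
    \<le> count_const CARD('d) \<kappa> A (card H) * (2 * D) ^ (CARD('d) - 1)"
proof -
  let ?S = "elem_at T ` boundary_faces \<Omega> T"
  have ST: "?S \<subseteq> T" using elem_at_boundary(1) by blast
  obtain z where z: "z \<in> closure \<Omega>" using nonempty_dom closure_subset by blast
  have D0: "0 \<le> D" using mesh_size_le_dom mesh_size_pos D by linarith
  have "real (card ?S) * mesh_size T ^ (CARD('d) - 1) \<le> count_const CARD('d) \<kappa> A (card H) * (D + inrad) ^ (CARD('d) - 1)"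
  proof (rule count_boundary[OF ST D0 _ H(1,2)])
    fix K assume K: "K \<in> ?S"
    then have KT: "K \<in> T" using ST by blast
    have "dist z (ctr K) \<le> diameter (closure \<Omega>)"
      using diameter_bounded_bound[OF bounded_closure[OF bounded_dom] z] ctr_in[OF KT] elem_in_dom[OF KT] by blast
    then show "dist z (ctr K) \<le> D" using D by simp
    obtain e where e: "e \<in> boundary_faces \<Omega> T" "K = elem_at T e" using K by blast
    then have ef: "e facet_of K" using elem_at_boundary(2) by blast
    then obtain x where x: "x \<in> e" unfolding facet_of_def by blast
    then have "x \<in> frontier \<Omega>" using e(1) unfolding boundary_faces_def by blast
    then obtain n a where "(n, a) \<in> H" "n \<bullet> x = a" using H(3) by blast
    moreover have "x \<in> K" using x facet_of_imp_subset[OF ef] by blast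
    ultimately show "\<exists>(n, a)\<in>H. \<exists>x\<in>K. n \<bullet> x = a" by blast
  qed
  also have "\<dots> \<le> count_const CARD('d) \<kappa> A (card H) * (2 * D) ^ (CARD('d) - 1)"
    using D0 inrad_pos inrad_le mesh_size_le_dom D by (intro mult_left_mono power_mono count_const_nonneg) auto
  finally show ?thesis .
qed

end

definition boundary_const :: "nat \<Rightarrow> real \<Rightarrow> real \<Rightarrow> nat \<Rightarrow> real \<Rightarrow> real" where
  "boundary_const n \<kappa> A mH D = facet_const n \<kappa> * (real (Suc n) * (count_const n \<kappa> A mH * (2 * D) ^ (n - 1)))"

definition trace_const :: "nat \<Rightarrow> real \<Rightarrow> real \<Rightarrow> real \<Rightarrow> real \<Rightarrow> real \<Rightarrow> nat \<Rightarrow> real \<Rightarrow> real \<Rightarrow> real" where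
  "trace_const n \<kappa> A Cs D R mH m Cl = facet_const n \<kappa> * (real (Suc n) * (3 *
     (sup_const n \<kappa> A Cs * grad_const n \<kappa> A Cs * (D + 1)
      + (chain_const n \<kappa> A Cs D R mH + count_const n \<kappa> A mH * (2 * D) ^ (n - 1) * Cl) / m\<^sup>2)))"

lemma (in regular_mesh) boundary_measure_le:
  assumes H: "finite H" "\<And>n a. (n, a) \<in> H \<Longrightarrow> norm n = 1" "\<And>x. x \<in> frontier \<Omega> \<Longrightarrow> \<exists>(n, a)\<in>H. n \<bullet> x = a"
    and D: "diameter (closure \<Omega>) \<le> D"
  shows "(\<Sum>e\<in>boundary_faces \<Omega> T. measure (surface_lborel e) e) \<le> boundary_const CARD('d) \<kappa> A (card H) D"
proof -
  let ?B = "boundary_faces \<Omega> T" and ?n = "CARD('d)" and ?h = "mesh_size T"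
  define c where "c = facet_const ?n \<kappa>"
  have c: "0 \<le> c" using \<kappa> by (simp add: c_def facet_const_def)
  have "(\<Sum>e\<in>?B. measure (surface_lborel e) e) \<le> (\<Sum>e\<in>?B. (\<lambda>_. c * ?h ^ (?n - 1)) (elem_at T e))"
    using facet_measure_le[OF elem_at_boundary] unfolding c_def by (intro sum_mono) simp
  also have "\<dots> \<le> real (Suc ?n) * (\<Sum>K\<in>elem_at T ` ?B. c * ?h ^ (?n - 1))"
    using c mesh_size_pos by (intro boundary_faces_sum_le) simp
  also have "\<dots> = c * (real (Suc ?n) * (real (card (elem_at T ` ?B)) * ?h ^ (?n - 1)))" by simp
  also have "\<dots> \<le> c * (real (Suc ?n) * (count_const ?n \<kappa> A (card H) * (2 * D) ^ (?n - 1)))"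
    using boundary_count[OF H D] c by (intro mult_left_mono) auto
  finally show ?thesis unfolding boundary_const_def c_def .
qed

context discrete_gradient begin

text \<open>On a boundary element the difference \<open>u - c0\<close> splits into the oscillation of \<open>u\<close>, the difference along the chain to the
  reference ball, and the difference between the reference ball and \<open>c0\<close>. Here \<open>T0\<close> is the reference mesh, with a ball of the
  common radius \<open>R\<close> in each of its elements.\<close>
lemma boundary_trace:
  assumes m: "0 < m" "\<And>a r. 0 < r \<Longrightarrow> (LINT y|lborel. kern a r (y :: real^'d)) = m"
    and H: "finite H" "\<And>n a. (n, a) \<in> H \<Longrightarrow> norm n = 1" "\<And>x. x \<in> frontier \<Omega> \<Longrightarrow> \<exists>(n, a)\<in>H. n \<bullet> x = a"
    and T0: "closure \<Omega> \<subseteq> \<Union>T0" "\<And>G. G \<in> T0 \<Longrightarrow> convex G" "\<And>G. G \<in> T0 \<Longrightarrow> G \<subseteq> closure \<Omega>"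
      "\<And>G. G \<in> T0 \<Longrightarrow> ball (g G) R \<subseteq> G"
    and R: "0 < R" and D: "diameter (closure \<Omega>) + R \<le> D"
    and link: "\<And>G. G \<in> T0 \<Longrightarrow> (avg (g G) R - m * c0)\<^sup>2 \<le> Cl * (\<Sum>K\<in>T. energy K)" and Cl: "0 \<le> Cl"
  shows "(\<Sum>e\<in>boundary_faces \<Omega> T. LINT x:e|surface_lborel e. (u (elem_at T e) x - c0)\<^sup>2)
    \<le> trace_const CARD('d) \<kappa> A Cs D R (card H) m Cl * (\<Sum>K\<in>T. energy K)"
proof -
  let ?B = "boundary_faces \<Omega> T" and ?n = "CARD('d)" and ?h = "mesh_size T" and ?S = "elem_at T ` boundary_faces \<Omega> T"
  define E where "E = (\<Sum>K\<in>T. energy K)"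
  have E0: "0 \<le> E" unfolding E_def by (intro sum_nonneg energy_nonneg)
  note h = mesh_size_pos
  have hD: "?h \<le> D" using mesh_size_le_dom R D by linarith
  have dD: "diameter (closure \<Omega>) \<le> D" using R D by linarith
  have ST: "?S \<subseteq> T" using elem_at_boundary(1) by blast
  have fS: "finite ?S" using finite_boundary_faces by simp
  have "\<forall>K\<in>?S. \<exists>G. G \<in> T0 \<and> ctr K \<in> G" using ST ctr_in elem_in_dom T0(1) by blast
  from bchoice[OF this] obtain G where G: "\<And>K. K \<in> ?S \<Longrightarrow> G K \<in> T0" "\<And>K. K \<in> ?S \<Longrightarrow> ctr K \<in> G K" by blast
  have SH: "\<exists>(n, a)\<in>H. \<exists>x\<in>K. n \<bullet> x = a" if K: "K \<in> ?S" for K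
  proof -
    obtain e where e: "e \<in> ?B" "K = elem_at T e" using K by blast
    then have ef: "e facet_of K" using elem_at_boundary(2) by blast
    then obtain x where x: "x \<in> e" unfolding facet_of_def by blast
    then have "x \<in> frontier \<Omega>" using e(1) unfolding boundary_faces_def by blast
    then obtain n a where "(n, a) \<in> H" "n \<bullet> x = a" using H(3) by blast
    moreover have "x \<in> K" using x facet_of_imp_subset[OF ef] by blast
    ultimately show ?thesis by blast
  qed
  have far: "norm (g (G K) - ctr K) + R \<le> D" if K: "K \<in> ?S" for K
  proof -
    have "g (G K) \<in> G K" using T0(4)[OF G(1)[OF K]] R by (meson centre_in_ball subsetD)
    then have "g (G K) \<in> closure \<Omega>" "ctr K \<in> closure \<Omega>" using T0(3)[OF G(1)[OF K]] G(2)[OF K] by auto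
    then have "dist (g (G K)) (ctr K) \<le> diameter (closure \<Omega>)"
      by (rule diameter_bounded_bound[OF bounded_closure[OF bounded_dom]])
    then show ?thesis using D by (simp add: dist_norm)
  qed
  obtain c r where r: "0 < r" and cr: "\<And>K. K \<in> ?S \<Longrightarrow> ball (c K) r \<subseteq> K"
    and ch: "?h ^ (?n - 1) * (\<Sum>K\<in>?S. (avg (c K) r - avg (g (G K)) R)\<^sup>2)
      \<le> chain_const ?n \<kappa> A Cs D R (card H) * (\<Sum>K\<in>T. energy K)"
    by (rule chain_sum[of ?S H G "\<lambda>K. g (G K)" R D])
       (use ST H(1,2) SH T0(2-4)[OF G(1)] G(2) R far hD in auto)
  define L where "L = sup_const ?n \<kappa> A Cs * grad_const ?n \<kappa> A Cs"
  have L: "0 \<le> L" unfolding L_def using consts_pos by (intro mult_nonneg_nonneg) auto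
  define F where "F K = 3 * (L * (D + 1) * energy K
      + (?h ^ (?n - 1) * (avg (c K) r - avg (g (G K)) R)\<^sup>2 + ?h ^ (?n - 1) * (Cl * E)) / m\<^sup>2)" for K
  have F0: "0 \<le> F K" for K
    unfolding F_def using L hD h energy_nonneg[of K] E0 Cl m by (intro mult_nonneg_nonneg add_nonneg_nonneg divide_nonneg_pos) auto
  have pw: "?h ^ (?n - 1) * (u K x - c0)\<^sup>2 \<le> F K" if K: "K \<in> ?S" and x: "x \<in> K" for K x
  proof -
    have KT: "K \<in> T" using K ST by blast
    have nS: "?h ^ ?n = ?h * ?h ^ (?n - 1)" by (metis Suc_pred' power_Suc zero_less_card_finite)
    have "?h * (?h ^ (?n - 1) * (u K x - avg (c K) r / m)\<^sup>2) \<le> ?h * (L * (?h + 1) * energy K)"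
      using local_average[OF KT r cr[OF K] x m(1) m(2)[OF r]] unfolding nS L_def by (simp only: mult_ac)
    then have "?h ^ (?n - 1) * (u K x - avg (c K) r / m)\<^sup>2 \<le> L * (?h + 1) * energy K" using h by simp
    also have "\<dots> \<le> L * (D + 1) * energy K"
      using hD L energy_nonneg by (intro mult_right_mono mult_left_mono) auto
    finally have 1: "?h ^ (?n - 1) * (u K x - avg (c K) r / m)\<^sup>2 \<le> L * (D + 1) * energy K" .
    have split: "u K x - c0 = (u K x - avg (c K) r / m) + (avg (c K) r - avg (g (G K)) R) / m + (avg (g (G K)) R - m * c0) / m"
      using m(1) by (simp add: field_simps)
    have "(u K x - c0)\<^sup>2 \<le> 3 * ((u K x - avg (c K) r / m)\<^sup>2 + ((avg (c K) r - avg (g (G K)) R) / m)\<^sup>2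
        + ((avg (g (G K)) R - m * c0) / m)\<^sup>2)"
      unfolding split by (rule square_sum3_le)
    also have "\<dots> \<le> 3 * ((u K x - avg (c K) r / m)\<^sup>2 + (avg (c K) r - avg (g (G K)) R)\<^sup>2 / m\<^sup>2 + Cl * E / m\<^sup>2)"
      using link[OF G(1)[OF K]] m(1) unfolding E_def by (simp add: power_divide divide_right_mono)
    finally have "?h ^ (?n - 1) * (u K x - c0)\<^sup>2
      \<le> ?h ^ (?n - 1) * (3 * ((u K x - avg (c K) r / m)\<^sup>2 + (avg (c K) r - avg (g (G K)) R)\<^sup>2 / m\<^sup>2 + Cl * E / m\<^sup>2))"
      using h by (intro mult_left_mono) auto
    also have "\<dots> = 3 * (?h ^ (?n - 1) * (u K x - avg (c K) r / m)\<^sup>2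
      + (?h ^ (?n - 1) * (avg (c K) r - avg (g (G K)) R)\<^sup>2 + ?h ^ (?n - 1) * (Cl * E)) / m\<^sup>2)"
      by (simp add: algebra_simps add_divide_distrib)
    also have "\<dots> \<le> F K" unfolding F_def using 1 by simp
    finally show ?thesis .
  qed
  define c1 where "c1 = facet_const ?n \<kappa>"
  have c1: "0 \<le> c1" using consts_pos(1) by (simp add: c1_def)
  have face: "(LINT x:e|surface_lborel e. (u (elem_at T e) x - c0)\<^sup>2) \<le> c1 * F (elem_at T e)" if e: "e \<in> ?B" for e
  proof -
    let ?K = "elem_at T e"
    have K: "?K \<in> T" "?K \<in> ?S" and ef: "e facet_of ?K" using elem_at_boundary[OF e] e by auto
    note sK = simplex[OF K(1)]
    have hp: "0 < ?h ^ (?n - 1)" using h by simp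
    have "(LINT x:e|surface_lborel e. (u ?K x - c0)\<^sup>2) \<le> measure (surface_lborel e) e * (F ?K / ?h ^ (?n - 1))"
    proof (rule set_integral_le_measure)
      show "e \<in> sets (surface_lborel e)" using compact_facet[OF sK ef] by (simp add: borel_compact)
      show "emeasure (surface_lborel e) e < \<infinity>" by (rule emeasure_facet_finite[OF sK ef])
      show "set_integrable (surface_lborel e) e (\<lambda>x. (u ?K x - c0)\<^sup>2)"
        by (intro set_integrable_facet[OF sK ef] continuous_intros cont_u[OF K(1)])
      fix x assume "x \<in> e"
      then have "x \<in> ?K" using facet_of_imp_subset[OF ef] by blast
      from pw[OF K(2) this] show "(u ?K x - c0)\<^sup>2 \<le> F ?K / ?h ^ (?n - 1)"
        unfolding pos_le_divide_eq[OF hp] by (simp only: mult.commute)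
    qed
    also have "\<dots> \<le> (c1 * ?h ^ (?n - 1)) * (F ?K / ?h ^ (?n - 1))"
      using facet_measure_le[OF K(1) ef] F0[of ?K] hp unfolding c1_def by (intro mult_right_mono divide_nonneg_pos) auto
    also have "\<dots> = c1 * F ?K" using h by simp
    finally show ?thesis .
  qed
  have "(\<Sum>e\<in>?B. LINT x:e|surface_lborel e. (u (elem_at T e) x - c0)\<^sup>2) \<le> (\<Sum>e\<in>?B. c1 * F (elem_at T e))"
    by (intro sum_mono face)
  also have "\<dots> = c1 * (\<Sum>e\<in>?B. F (elem_at T e))" by (simp only: sum_distrib_left)
  also have "\<dots> \<le> c1 * (real (Suc ?n) * (\<Sum>K\<in>?S. F K))" by (intro mult_left_mono c1 boundary_faces_sum_le F0)
  also have "\<dots> \<le> c1 * (real (Suc ?n) * (3 * (L * (D + 1) * E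
      + (chain_const ?n \<kappa> A Cs D R (card H) * E + count_const ?n \<kappa> A (card H) * (2 * D) ^ (?n - 1) * (Cl * E)) / m\<^sup>2)))"
  proof (intro mult_left_mono c1)
    have "(\<Sum>K\<in>?S. F K) = 3 * (L * (D + 1) * (\<Sum>K\<in>?S. energy K)
      + (?h ^ (?n - 1) * (\<Sum>K\<in>?S. (avg (c K) r - avg (g (G K)) R)\<^sup>2) + real (card ?S) * ?h ^ (?n - 1) * (Cl * E)) / m\<^sup>2)"
      unfolding F_def sum_distrib_left[symmetric] sum.distrib sum_divide_distrib[symmetric] sum_constant
      by (simp only: mult_ac)
    also have "\<dots> \<le> 3 * (L * (D + 1) * E
      + (chain_const ?n \<kappa> A Cs D R (card H) * E + count_const ?n \<kappa> A (card H) * (2 * D) ^ (?n - 1) * (Cl * E)) / m\<^sup>2)"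
    proof (intro mult_left_mono add_mono divide_right_mono)
      show "(\<Sum>K\<in>?S. energy K) \<le> E" unfolding E_def by (intro sum_mono2 finite_mesh ST energy_nonneg)
      show "?h ^ (?n - 1) * (\<Sum>K\<in>?S. (avg (c K) r - avg (g (G K)) R)\<^sup>2) \<le> chain_const ?n \<kappa> A Cs D R (card H) * E"
        using ch unfolding E_def .
      show "real (card ?S) * ?h ^ (?n - 1) * (Cl * E) \<le> count_const ?n \<kappa> A (card H) * (2 * D) ^ (?n - 1) * (Cl * E)"
        using boundary_count[OF H dD] Cl E0 by (intro mult_right_mono mult_nonneg_nonneg) auto
    qed (use L hD h in auto)
    finally show "(\<Sum>K\<in>?S. F K) \<le> 3 * (L * (D + 1) * E
      + (chain_const ?n \<kappa> A Cs D R (card H) * E + count_const ?n \<kappa> A (card H) * (2 * D) ^ (?n - 1) * (Cl * E)) / m\<^sup>2)" .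
  qed simp
  also have "\<dots> = trace_const ?n \<kappa> A Cs D R (card H) m Cl * E"
  proof -
    have "c1 * (s * (3 * (X * E + (Y * E + Z * (Cl * E)) / M))) = c1 * (s * (3 * (X + (Y + Z * Cl) / M))) * E" for s X Y Z M
      by (simp add: algebra_simps add_divide_distrib)
    then show ?thesis unfolding trace_const_def c1_def L_def .
  qed
  finally show ?thesis unfolding E_def .
qed

end

section \<open>Linking balls in a connected domain\<close>

text \<open>The constant may depend on the two balls, but not on the mesh or on the discrete functions.\<close>
definition balls_linked :: "(real^'d) set \<Rightarrow> real \<Rightarrow> real \<Rightarrow> nat \<Rightarrow> real \<Rightarrow> real^'d \<Rightarrow> real \<Rightarrow> real^'d \<Rightarrow> real \<Rightarrow> bool" where
  "balls_linked \<Omega> \<kappa> A k Cs a r b r' \<longleftrightarrow> (\<exists>C\<ge>0. \<forall>T u uhat p. discrete_gradient \<Omega> T \<kappa> A k u uhat p Cs \<longrightarrow>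
     (discrete_gradient.avg T u b r' - discrete_gradient.avg T u a r)\<^sup>2
       \<le> C * (\<Sum>K\<in>T. discrete_gradient.energy u uhat p K))"

lemma balls_linked_sym:
  assumes "balls_linked \<Omega> \<kappa> A k Cs a r b r'"
  shows "balls_linked \<Omega> \<kappa> A k Cs b r' a r"
  using assms unfolding balls_linked_def by (simp only: power2_commute)

lemma balls_linked_trans:
  fixes \<Omega> :: "(real^'d) set"
  assumes ab: "balls_linked \<Omega> \<kappa> A k Cs a r b r'" and bc: "balls_linked \<Omega> \<kappa> A k Cs b r' c r''"
  shows "balls_linked \<Omega> \<kappa> A k Cs a r c r''"
proof -
  obtain C1 where C1: "0 \<le> C1" "\<And>T u uhat p. discrete_gradient \<Omega> T \<kappa> A k u uhat p Cs \<Longrightarrow>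
     (discrete_gradient.avg T u b r' - discrete_gradient.avg T u a r)\<^sup>2
       \<le> C1 * (\<Sum>K\<in>T. discrete_gradient.energy u uhat p K)"
    using ab unfolding balls_linked_def by auto
  obtain C2 where C2: "0 \<le> C2" "\<And>T u uhat p. discrete_gradient \<Omega> T \<kappa> A k u uhat p Cs \<Longrightarrow>
     (discrete_gradient.avg T u c r'' - discrete_gradient.avg T u b r')\<^sup>2
       \<le> C2 * (\<Sum>K\<in>T. discrete_gradient.energy u uhat p K)"
    using bc unfolding balls_linked_def by auto
  have "(discrete_gradient.avg T u c r'' - discrete_gradient.avg T u a r)\<^sup>2
       \<le> (2 * (C1 + C2)) * (\<Sum>K\<in>T. discrete_gradient.energy u uhat p K)"
    if dg: "discrete_gradient \<Omega> T \<kappa> A k u uhat p Cs" for T u uhat p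
  proof -
    have "(z - x)\<^sup>2 \<le> 2 * ((y - x)\<^sup>2 + (z - y)\<^sup>2)" for x y z :: real
    proof -
      have "0 \<le> (x + z - 2 * y)\<^sup>2" by simp
      then show ?thesis by (simp add: power2_eq_square algebra_simps)
    qed
    from this[of "discrete_gradient.avg T u c r''" "discrete_gradient.avg T u a r" "discrete_gradient.avg T u b r'"]
      C1(2)[OF dg] C2(2)[OF dg]
    show ?thesis by (simp add: distrib_left distrib_right)
  qed
  then show ?thesis unfolding balls_linked_def using C1(1) C2(1) by (intro exI[of _ "2 * (C1 + C2)"]) auto
qed

lemma (in discrete_gradient) straight_path_bound:
  assumes r: "0 < r" "0 < r'"
    and inside: "\<And>s. s \<in> {0..1} \<Longrightarrow> ball (a + s *\<^sub>R (b - a)) (r + s * (r' - r)) \<subseteq> \<Omega>"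
    and D: "D = diameter (closure \<Omega>)" and \<rho>: "\<rho> = min r r'"
  shows "(avg b r' - avg a r)\<^sup>2 \<le> 25 * flux_const CARD('d) \<kappa> A Cs * (2 * D / inrad_const CARD('d) \<kappa> A) ^ CARD('d)
    * ((norm (b - a) + \<bar>r' - r\<bar>) / \<rho> ^ Suc CARD('d))\<^sup>2 * (\<rho>\<^sup>2 + D\<^sup>2 + D) * (\<Sum>K\<in>T. energy K)"
proof -
  let ?n = "CARD('d)" and ?h = "mesh_size T" and ?M = "((norm (b - a) + \<bar>r' - r\<bar>) / \<rho> ^ Suc CARD('d))\<^sup>2"
  note h = mesh_size_pos
  have hD: "?h \<le> D" unfolding D by (rule mesh_size_le_dom)
  define E where "E = (\<Sum>K\<in>T. energy K)"
  have E0: "0 \<le> E" unfolding E_def by (intro sum_nonneg energy_nonneg)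
  obtain z where z: "z \<in> closure \<Omega>" using nonempty_dom closure_subset by blast
  have "(avg b r' - avg a r)\<^sup>2 \<le> 25 * flux_const ?n \<kappa> A Cs * ?h ^ ?n * ?M * (\<rho>\<^sup>2 + ?h\<^sup>2 + ?h) * real (card T) * E"
    unfolding E_def by (rule path_estimate[OF _ _ _ inside]) (use r \<rho> in auto)
  also have "\<dots> = 25 * flux_const ?n \<kappa> A Cs * (real (card T) * ?h ^ ?n) * ?M * (\<rho>\<^sup>2 + ?h\<^sup>2 + ?h) * E" by (simp only: mult_ac)
  also have "\<dots> \<le> 25 * flux_const ?n \<kappa> A Cs * (2 * D / inrad_const ?n \<kappa> A) ^ ?n * ?M * (\<rho>\<^sup>2 + D\<^sup>2 + D) * E"
  proof -
    have "real (card T) * ?h ^ ?n \<le> ((D + inrad) / inrad_const ?n \<kappa> A) ^ ?n"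
    proof (rule count_ball[of T D z])
      show "0 \<le> D" using hD h by linarith
      show "dist z (ctr K) \<le> D" if K: "K \<in> T" for K
        unfolding D using diameter_bounded_bound[OF bounded_closure[OF bounded_dom] z] ctr_in[OF K] elem_in_dom[OF K] by blast
    qed simp
    also have "\<dots> \<le> (2 * D / inrad_const ?n \<kappa> A) ^ ?n"
      using h hD inrad_pos inrad_le inrad_const_pos by (intro power_mono divide_right_mono divide_nonneg_pos) auto
    finally have 1: "real (card T) * ?h ^ ?n \<le> (2 * D / inrad_const ?n \<kappa> A) ^ ?n" .
    have 2: "\<rho>\<^sup>2 + ?h\<^sup>2 + ?h \<le> \<rho>\<^sup>2 + D\<^sup>2 + D" using power_mono[OF hD less_imp_le[OF h], of 2] hD by linarith
    have D0: "0 \<le> D" using hD h by linarith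
    show ?thesis
      using consts_pos(4) h D0 inrad_const_pos
      by (intro mult_right_mono[OF _ E0] mult_mono[OF mult_right_mono[OF mult_left_mono[OF 1]] 2] mult_nonneg_nonneg) auto
  qed
  finally show ?thesis unfolding E_def .
qed

lemma balls_linked_straight:
  fixes \<Omega> :: "(real^'d) set"
  assumes r: "0 < r" "0 < r'"
    and inside: "\<And>s. s \<in> {0..1} \<Longrightarrow> ball (a + s *\<^sub>R (b - a)) (r + s * (r' - r)) \<subseteq> \<Omega>"
  shows "balls_linked \<Omega> \<kappa> A k Cs a r b r'"
proof -
  define C where "C = 25 * flux_const CARD('d) \<kappa> A Cs * (2 * diameter (closure \<Omega>) / inrad_const CARD('d) \<kappa> A) ^ CARD('d)
    * ((norm (b - a) + \<bar>r' - r\<bar>) / min r r' ^ Suc CARD('d))\<^sup>2 * ((min r r')\<^sup>2 + (diameter (closure \<Omega>))\<^sup>2 + diameter (closure \<Omega>))"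
  have "(discrete_gradient.avg T u b r' - discrete_gradient.avg T u a r)\<^sup>2
       \<le> max 0 C * (\<Sum>K\<in>T. discrete_gradient.energy u uhat p K)"
    if dg: "discrete_gradient \<Omega> T \<kappa> A k u uhat p Cs" for T u uhat p
  proof -
    have "(discrete_gradient.avg T u b r' - discrete_gradient.avg T u a r)\<^sup>2
       \<le> C * (\<Sum>K\<in>T. discrete_gradient.energy u uhat p K)"
      unfolding C_def by (rule discrete_gradient.straight_path_bound[OF dg r inside refl refl])
    also have "\<dots> \<le> max 0 C * (\<Sum>K\<in>T. discrete_gradient.energy u uhat p K)"
      by (intro mult_right_mono sum_nonneg discrete_gradient.energy_nonneg[OF dg]) simp
    finally show ?thesis .
  qed
  then show ?thesis unfolding balls_linked_def by (intro exI[of _ "max 0 C"]) auto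
qed

lemma ball_subset_convex_path:
  fixes a b :: "'a::real_normed_vector"
  assumes s: "s \<in> {0..1::real}" and a: "ball a r \<subseteq> cball z R" and b: "ball b r' \<subseteq> cball z R" and r: "0 < r" "0 < r'"
  shows "ball (a + s *\<^sub>R (b - a)) (r + s * (r' - r)) \<subseteq> cball z R"
proof
  fix y assume y: "y \<in> ball (a + s *\<^sub>R (b - a)) (r + s * (r' - r))"
  define q where "q = r + s * (r' - r)"
  have "q = (1 - s) * r + s * r'" by (simp add: q_def algebra_simps)
  then have q: "0 < q" using s r by (cases "s = 0") (auto intro!: add_nonneg_pos)
  define v where "v = (1 / q) *\<^sub>R (y - (a + s *\<^sub>R (b - a)))"
  have nv: "norm v < 1" using y q unfolding v_def q_def[symmetric] by (simp add: dist_norm norm_minus_commute)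
  have "a + r *\<^sub>R v \<in> ball a r" "b + r' *\<^sub>R v \<in> ball b r'" using nv r by (auto simp: dist_norm)
  then have ab: "a + r *\<^sub>R v \<in> cball z R" "b + r' *\<^sub>R v \<in> cball z R" using a b by auto
  have "y = a + s *\<^sub>R (b - a) + q *\<^sub>R v" using q by (simp add: v_def)
  also have "\<dots> = (1 - s) *\<^sub>R (a + r *\<^sub>R v) + s *\<^sub>R (b + r' *\<^sub>R v)"
    unfolding q_def by (simp add: algebra_simps)
  finally show "y \<in> cball z R" using convexD_alt[OF convex_cball ab, of s] s by simp
qed

text \<open>Being linked for all radii is an equivalence relation on the centres, and it has open classes: within a
  ball in \<open>\<Omega>\<close>, shrink, move, and grow again.\<close>
lemma balls_linked_connected:
  fixes \<Omega> :: "(real^'d) set"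
  assumes \<Omega>: "open \<Omega>" "connected \<Omega>" and r: "0 < r" "0 < r'" and ab: "ball a r \<subseteq> \<Omega>" "ball b r' \<subseteq> \<Omega>"
  shows "balls_linked \<Omega> \<kappa> A k Cs a r b r'"
proof -
  let ?l = "balls_linked \<Omega> \<kappa> A k Cs"
  define R where "R x y \<longleftrightarrow> (\<forall>r r'. 0 < r \<longrightarrow> 0 < r' \<longrightarrow> ball x r \<subseteq> \<Omega> \<longrightarrow> ball y r' \<subseteq> \<Omega> \<longrightarrow> ?l x r y r')" for x y
  have same: "?l x s x s'" if "0 < s" "0 < s'" "ball x s \<subseteq> \<Omega>" "ball x s' \<subseteq> \<Omega>" for x s s'
  proof (rule balls_linked_straight[OF that(1,2)])
    fix t assume t: "t \<in> {0..1::real}"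
    have "s + t * (s' - s) \<le> max s s'"
    proof -
      have "(1 - t) * s + t * s' \<le> (1 - t) * max s s' + t * max s s'"
        using t by (intro add_mono mult_left_mono) auto
      then show ?thesis by (simp add: algebra_simps)
    qed
    moreover have "ball x (max s s') \<subseteq> \<Omega>" using that(3,4) by (cases "s \<le> s'") (auto simp: max_def)
    ultimately show "ball (x + t *\<^sub>R (x - x)) (s + t * (s' - s)) \<subseteq> \<Omega>"
      using subset_ball[of "s + t * (s' - s)" "max s s'" x] by simp
  qed
  have RD: "?l x s y s'" if "R x y" "0 < s" "0 < s'" "ball x s \<subseteq> \<Omega>" "ball y s' \<subseteq> \<Omega>" for x y s s'
    using that unfolding R_def by blast
  have "R a b"
  proof (rule connected_equivalence_relation[OF \<Omega>(2)])
    show "a \<in> \<Omega>" using ab(1) r(1) by (meson centre_in_ball subsetD)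
    show "b \<in> \<Omega>" using ab(2) r(2) by (meson centre_in_ball subsetD)
    show "R y x" if xy: "R x y" for x y
      unfolding R_def
    proof (intro allI impI)
      fix r r' assume *: "0 < r" "0 < r'" "ball y r \<subseteq> \<Omega>" "ball x r' \<subseteq> \<Omega>"
      show "?l y r x r'" by (rule balls_linked_sym[OF RD[OF xy *(2,1,4,3)]])
    qed
    show "R x z" if xy: "R x y" and yz: "R y z" and y: "y \<in> \<Omega>" for x y z
      unfolding R_def
    proof (intro allI impI)
      fix r r' assume *: "0 < r" "0 < r'" "ball x r \<subseteq> \<Omega>" "ball z r' \<subseteq> \<Omega>"
      obtain s where s: "0 < s" "ball y s \<subseteq> \<Omega>" using \<Omega>(1) y by (meson openE)
      show "?l x r z r'"
        by (rule balls_linked_trans[OF RD[OF xy *(1) s(1) *(3) s(2)] RD[OF yz s(1) *(2) s(2) *(4)]])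
    qed
    fix x assume x: "x \<in> \<Omega>"
    obtain d where d: "0 < d" "cball x d \<subseteq> \<Omega>" using \<Omega>(1) x by (meson open_contains_cball)
    have "R x y" if y: "y \<in> ball x (d / 2)" for y
      unfolding R_def
    proof (intro allI impI)
      fix r r' assume *: "0 < r" "0 < r'" "ball x r \<subseteq> \<Omega>" "ball y r' \<subseteq> \<Omega>"
      have bx: "ball x (d / 2) \<subseteq> cball x d" using d(1) by (intro subsetI) (simp add: less_imp_le)
      have byc: "ball y (d / 2) \<subseteq> cball x d"
      proof
        fix w assume "w \<in> ball y (d / 2)"
        then show "w \<in> cball x d" using y dist_triangle[of x w y] by simp
      qed
      have d2: "0 < d / 2" using d(1) by simp
      have 1: "?l x r x (d / 2)" by (rule same[OF *(1) d2 *(3) order_trans[OF bx d(2)]])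
      have 2: "?l x (d / 2) y (d / 2)"
      proof (rule balls_linked_straight[OF d2 d2])
        fix s assume s: "s \<in> {0..1::real}"
        show "ball (x + s *\<^sub>R (y - x)) (d / 2 + s * (d / 2 - d / 2)) \<subseteq> \<Omega>"
          by (rule order_trans[OF ball_subset_convex_path[OF s bx byc d2 d2] d(2)])
      qed
      have 3: "?l y (d / 2) y r'" by (rule same[OF d2 *(2) order_trans[OF byc d(2)] *(4)])
      show "?l x r y r'" by (rule balls_linked_trans[OF balls_linked_trans[OF 1 2] 3])
    qed
    moreover have "openin (top_of_set \<Omega>) (ball x (d / 2))"
    proof (rule open_subset)
      have "ball x (d / 2) \<subseteq> cball x d" using d(1) by (intro subsetI) (simp add: less_imp_le)
      then show "ball x (d / 2) \<subseteq> \<Omega>" using d(2) by (rule order_trans)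
    qed simp
    moreover have "x \<in> ball x (d / 2)" using d by simp
    ultimately show "\<exists>T. openin (top_of_set \<Omega>) T \<and> x \<in> T \<and> (\<forall>y\<in>T. R x y)" by (intro exI[of _ "ball x (d / 2)"]) blast
  qed
  from RD[OF this r ab] show ?thesis .
qed

section \<open>The mean over part of the boundary\<close>

lemma (in regular_mesh) face_hyperplane:
  assumes "e \<in> faces T"
  shows "compact e \<and> (\<exists>m \<beta>. norm m = 1 \<and> affine hull e = {x. m \<bullet> x = \<beta>})"
proof -
  obtain K where K: "K \<in> T" "e facet_of K" using assms by (auto simp: faces_def)
  have "\<exists>m \<beta>. norm m = 1 \<and> affine hull e = {x. m \<bullet> x = \<beta>}"
    by (rule facet_hyperplane[OF simplex[OF K(1)] K(2)]) blast
  then show ?thesis using compact_facet[OF simplex[OF K(1)] K(2)] by blast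
qed

lemma facet_integral_square_le:
  fixes f g :: "real^'d \<Rightarrow> real"
  assumes K: "int CARD('d) simplex K" "e facet_of K" and f: "continuous_on UNIV f" and g: "continuous_on UNIV g"
  shows "(LINT x:e|surface_lborel e. (f x)\<^sup>2)
    \<le> 2 * (LINT x:e|surface_lborel e. (f x - g x)\<^sup>2) + 2 * (LINT x:e|surface_lborel e. (g x)\<^sup>2)"
proof -
  note si = set_integrable_facet[OF K]
  have "(LINT x:e|surface_lborel e. (f x)\<^sup>2) \<le> (LINT x:e|surface_lborel e. 2 * (f x - g x)\<^sup>2 + 2 * (g x)\<^sup>2)"
  proof (rule set_integral_mono)
    show "set_integrable (surface_lborel e) e (\<lambda>x. (f x)\<^sup>2)" by (intro si continuous_intros f)
    show "set_integrable (surface_lborel e) e (\<lambda>x. 2 * (f x - g x)\<^sup>2 + 2 * (g x)\<^sup>2)" by (intro si continuous_intros f g)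
    fix x
    have "0 \<le> (f x - 2 * g x)\<^sup>2" by simp
    then show "(f x)\<^sup>2 \<le> 2 * (f x - g x)\<^sup>2 + 2 * (g x)\<^sup>2" by (simp add: power2_eq_square algebra_simps)
  qed
  also have "\<dots> = (LINT x:e|surface_lborel e. 2 * (f x - g x)\<^sup>2) + (LINT x:e|surface_lborel e. 2 * (g x)\<^sup>2)"
    by (intro set_integral_add(2) si continuous_intros f g)
  finally show ?thesis by simp
qed

definition mean_const :: "real \<Rightarrow> real \<Rightarrow> real \<Rightarrow> real" where
  "mean_const Ct C\<sigma> s = 4 * (Ct + 1) + 2 * C\<sigma> * (2 / s\<^sup>2 + 4 * (Ct + 1) / s)"

context discrete_gradient begin

lemma boundary_jumps_le: "(\<Sum>e\<in>boundary_faces \<Omega> T. jump (elem_at T e) e) \<le> (\<Sum>K\<in>T. energy K)"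
proof -
  let ?B = "boundary_faces \<Omega> T"
  have ST: "elem_at T ` ?B \<subseteq> T" using elem_at_boundary(1) by blast
  have "(\<Sum>e\<in>?B. jump (elem_at T e) e) = (\<Sum>K\<in>elem_at T ` ?B. \<Sum>e\<in>{e \<in> ?B. elem_at T e = K}. jump (elem_at T e) e)"
    by (rule sum.image_gen[OF finite_boundary_faces])
  also have "\<dots> = (\<Sum>K\<in>elem_at T ` ?B. \<Sum>e\<in>{e \<in> ?B. elem_at T e = K}. jump K e)"
    by (intro sum.cong refl) simp
  also have "\<dots> \<le> (\<Sum>K\<in>elem_at T ` ?B. energy K)"
  proof (rule sum_mono)
    fix K assume "K \<in> elem_at T ` ?B"
    then have K: "K \<in> T" using ST by blast
    have "(\<Sum>e\<in>{e \<in> ?B. elem_at T e = K}. jump K e) \<le> (\<Sum>e | e facet_of K. jump K e)"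
      using finite_facets_simplex[OF simplex[OF K]] elem_at_boundary(2) by (intro sum_mono2 jump_nonneg) auto
    also have "\<dots> \<le> energy K" by (rule jumps_energy)
    finally show "(\<Sum>e\<in>{e \<in> ?B. elem_at T e = K}. jump K e) \<le> energy K" .
  qed
  also have "\<dots> \<le> (\<Sum>K\<in>T. energy K)" by (intro sum_mono2 finite_mesh ST energy_nonneg)
  finally show ?thesis .
qed

text \<open>By the trace bound and the jumps, \<open>uhat\<close> is close to \<open>c0\<close> on the boundary. Its mean over
  the faces in \<open>E\<close> therefore determines \<open>c0\<close> up to the energy, provided the measure of these faces is bounded below.\<close>
lemma mean_controls_boundary:
  assumes trace: "(\<Sum>e\<in>boundary_faces \<Omega> T. LINT x:e|surface_lborel e. (u (elem_at T e) x - c0)\<^sup>2) \<le> Ct * (\<Sum>K\<in>T. energy K)"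
    and Ct: "0 \<le> Ct" and area: "(\<Sum>e\<in>boundary_faces \<Omega> T. measure (surface_lborel e) e) \<le> C\<sigma>"
    and E: "E \<subseteq> boundary_faces \<Omega> T" and s: "0 < s" "s \<le> (\<Sum>e\<in>E. measure (surface_lborel e) e)"
  shows "(\<Sum>e\<in>boundary_faces \<Omega> T. LINT x:e|surface_lborel e. (u (elem_at T e) x)\<^sup>2)
      \<le> mean_const Ct C\<sigma> s * ((\<Sum>K\<in>T. energy K) + (\<Sum>e\<in>E. LINT x:e|surface_lborel e. uhat e x)\<^sup>2)"
    and "(\<Sum>e\<in>boundary_faces \<Omega> T. LINT x:e|surface_lborel e. (uhat e x)\<^sup>2)
      \<le> mean_const Ct C\<sigma> s * ((\<Sum>K\<in>T. energy K) + (\<Sum>e\<in>E. LINT x:e|surface_lborel e. uhat e x)\<^sup>2)"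
proof -
  let ?B = "boundary_faces \<Omega> T" and ?\<sigma> = "\<lambda>e. measure (surface_lborel e) e"
  define Es where "Es = (\<Sum>K\<in>T. energy K)"
  define M where "M = (\<Sum>e\<in>E. LINT x:e|surface_lborel e. uhat e x)"
  define A where "A = (\<Sum>e\<in>E. ?\<sigma> e)"
  define b where "b e = (LINT x:e|surface_lborel e. (uhat e x - c0)\<^sup>2)" for e
  define Bh where "Bh = (2 * Ct + 2) * Es"
  have Es0: "0 \<le> Es" unfolding Es_def by (intro sum_nonneg energy_nonneg)
  have A0: "0 < A" "s \<le> A" using s by (auto simp: A_def)
  have C\<sigma>0: "0 \<le> C\<sigma>" using area sum_nonneg[of ?B ?\<sigma>] by simp
  have b0: "0 \<le> b e" for e unfolding b_def by (rule set_integral_nonneg_pointwise) simp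
  have geo: "int CARD('d) simplex (elem_at T e)" "e facet_of elem_at T e" "continuous_on UNIV (u (elem_at T e))"
      "continuous_on UNIV (uhat e)" if "e \<in> ?B" for e
    using elem_at_boundary[OF that] simplex cont_u cont_uhat by auto
  have const: "(LINT x:e|surface_lborel e. c) = ?\<sigma> e * c" if "e \<in> ?B" for e and c :: real
  proof -
    have "e \<in> sets borel" using compact_facet[OF geo(1,2)[OF that]] by (simp add: borel_compact)
    then show ?thesis unfolding set_lebesgue_integral_def by simp
  qed
  have sb: "(\<Sum>e\<in>?B. b e) \<le> Bh"
  proof -
    have "b e \<le> 2 * jump (elem_at T e) e + 2 * (LINT x:e|surface_lborel e. (u (elem_at T e) x - c0)\<^sup>2)" if e: "e \<in> ?B" for e
    proof -
      have eq: "(uhat e x - c0 - (u (elem_at T e) x - c0))\<^sup>2 = (u (elem_at T e) x - uhat e x)\<^sup>2" for x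
        by (simp add: power2_eq_square algebra_simps)
      show ?thesis
        using facet_integral_square_le[OF geo(1,2)[OF e], of "\<lambda>x. uhat e x - c0" "\<lambda>x. u (elem_at T e) x - c0"]
          geo(3,4)[OF e] unfolding b_def jump_def eq by (simp add: continuous_on_diff)
    qed
    then have "(\<Sum>e\<in>?B. b e) \<le> (\<Sum>e\<in>?B. 2 * jump (elem_at T e) e + 2 * (LINT x:e|surface_lborel e. (u (elem_at T e) x - c0)\<^sup>2))"
      by (rule sum_mono)
    also have "\<dots> = 2 * (\<Sum>e\<in>?B. jump (elem_at T e) e) + 2 * (\<Sum>e\<in>?B. LINT x:e|surface_lborel e. (u (elem_at T e) x - c0)\<^sup>2)"
      by (simp only: sum.distrib sum_distrib_left)
    also have "\<dots> \<le> 2 * Es + 2 * (Ct * Es)" using boundary_jumps_le trace unfolding Es_def by (intro add_mono mult_left_mono) auto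
    finally show ?thesis by (simp add: Bh_def algebra_simps)
  qed
  have fE: "finite E" using E finite_boundary_faces finite_subset by blast
  define d where "d e = (LINT x:e|surface_lborel e. (uhat e x - c0))" for e
  have mean: "A * c0 = M - (\<Sum>e\<in>E. d e)"
  proof -
    have "d e = (LINT x:e|surface_lborel e. uhat e x) - ?\<sigma> e * c0" if e: "e \<in> E" for e
    proof -
      have eB: "e \<in> ?B" using e E by blast
      have "d e = (LINT x:e|surface_lborel e. uhat e x) - (LINT x:e|surface_lborel e. c0)"
        unfolding d_def by (intro set_integral_diff(2) set_integrable_facet[OF geo(1,2)[OF eB]] geo(4)[OF eB] continuous_on_const)
      then show ?thesis by (simp only: const[OF eB])
    qed
    then have "(\<Sum>e\<in>E. d e) = M - A * c0" by (simp add: sum_subtractf M_def A_def sum_distrib_right)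
    then show ?thesis by simp
  qed
  have "(\<Sum>e\<in>E. d e)\<^sup>2 \<le> A * Bh"
  proof -
    have de: "\<bar>d e\<bar> \<le> sqrt (?\<sigma> e) * sqrt (b e)" if e: "e \<in> E" for e
    proof -
      have eB: "e \<in> ?B" using e E by blast
      have "e \<in> sets (surface_lborel e)" using compact_facet[OF geo(1,2)[OF eB]] by (simp add: borel_compact)
      then have "(d e)\<^sup>2 \<le> ?\<sigma> e * b e" unfolding d_def b_def
        by (rule set_integral_Cauchy_Schwarz)
          (intro emeasure_facet_finite[OF geo(1,2)[OF eB]] set_integrable_facet[OF geo(1,2)[OF eB]] continuous_intros geo(4)[OF eB])+
      then have "sqrt ((d e)\<^sup>2) \<le> sqrt (?\<sigma> e * b e)" by (rule real_sqrt_le_mono)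
      then show ?thesis by (simp add: real_sqrt_mult)
    qed
    have "\<bar>\<Sum>e\<in>E. d e\<bar> \<le> (\<Sum>e\<in>E. sqrt (?\<sigma> e) * sqrt (b e))"
      by (rule order_trans[OF sum_abs sum_mono[OF de]])
    then have "\<bar>\<Sum>e\<in>E. d e\<bar>\<^sup>2 \<le> (\<Sum>e\<in>E. sqrt (?\<sigma> e) * sqrt (b e))\<^sup>2" by (rule power_mono) simp
    also have "\<dots> \<le> (\<Sum>e\<in>E. (sqrt (?\<sigma> e))\<^sup>2) * (\<Sum>e\<in>E. (sqrt (b e))\<^sup>2)" by (rule Cauchy_Schwarz_ineq_sum)
    also have "\<dots> = A * (\<Sum>e\<in>E. b e)" unfolding A_def using b0 by simp
    also have "\<dots> \<le> A * Bh"
      using sum_mono2[OF finite_boundary_faces E, of b] b0 sb A0 by (intro mult_left_mono) auto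
    finally show ?thesis by simp
  qed
  moreover have "(A * c0)\<^sup>2 \<le> 2 * M\<^sup>2 + 2 * (\<Sum>e\<in>E. d e)\<^sup>2"
  proof -
    have "0 \<le> (M + (\<Sum>e\<in>E. d e))\<^sup>2" by simp
    then show ?thesis unfolding mean by (simp add: power2_eq_square algebra_simps)
  qed
  ultimately have "A\<^sup>2 * c0\<^sup>2 \<le> 2 * M\<^sup>2 + 2 * A * Bh" by (simp add: power_mult_distrib)
  then have "c0\<^sup>2 \<le> (2 * M\<^sup>2 + 2 * A * Bh) / A\<^sup>2" using A0 by (simp add: pos_le_divide_eq mult.commute)
  also have "\<dots> = 2 * M\<^sup>2 / A\<^sup>2 + 2 * Bh / A" using A0 by (simp add: add_divide_distrib power2_eq_square)
  also have "\<dots> \<le> 2 * M\<^sup>2 / s\<^sup>2 + 2 * Bh / s"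
    using s A0 Ct Es0 unfolding Bh_def by (intro add_mono divide_left_mono power_mono mult_pos_pos) auto
  finally have c0: "c0\<^sup>2 \<le> 2 * M\<^sup>2 / s\<^sup>2 + 2 * Bh / s" .
  have final: "(\<Sum>e\<in>?B. LINT x:e|surface_lborel e. (f e x)\<^sup>2) \<le> mean_const Ct C\<sigma> s * (Es + M\<^sup>2)"
    if f: "\<And>e. e \<in> ?B \<Longrightarrow> continuous_on UNIV (f e)" and fb: "(\<Sum>e\<in>?B. LINT x:e|surface_lborel e. (f e x - c0)\<^sup>2) \<le> Bh" for f
  proof -
    have "(\<Sum>e\<in>?B. LINT x:e|surface_lborel e. (f e x)\<^sup>2)
      \<le> (\<Sum>e\<in>?B. 2 * (LINT x:e|surface_lborel e. (f e x - c0)\<^sup>2) + 2 * (?\<sigma> e * c0\<^sup>2))"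
    proof (rule sum_mono)
      fix e assume e: "e \<in> ?B"
      show "(LINT x:e|surface_lborel e. (f e x)\<^sup>2) \<le> 2 * (LINT x:e|surface_lborel e. (f e x - c0)\<^sup>2) + 2 * (?\<sigma> e * c0\<^sup>2)"
        using facet_integral_square_le[OF geo(1,2)[OF e] f[OF e], of "\<lambda>_. c0"] const[OF e, of "c0\<^sup>2"] by simp
    qed
    also have "\<dots> = 2 * (\<Sum>e\<in>?B. LINT x:e|surface_lborel e. (f e x - c0)\<^sup>2) + 2 * ((\<Sum>e\<in>?B. ?\<sigma> e) * c0\<^sup>2)"
      by (simp only: sum.distrib sum_distrib_left sum_distrib_right)
    also have "\<dots> \<le> 2 * Bh + 2 * (C\<sigma> * (2 * M\<^sup>2 / s\<^sup>2 + 2 * Bh / s))"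
      using fb mult_mono[OF area c0 C\<sigma>0] by simp
    also have "\<dots> = (4 * (Ct + 1) + 2 * C\<sigma> * (4 * (Ct + 1) / s)) * Es + 2 * C\<sigma> * (2 / s\<^sup>2) * M\<^sup>2"
      unfolding Bh_def by (simp add: algebra_simps)
    also have "\<dots> \<le> mean_const Ct C\<sigma> s * Es + mean_const Ct C\<sigma> s * M\<^sup>2"
      unfolding mean_const_def using Ct C\<sigma>0 s(1) Es0 by (intro add_mono mult_right_mono) (auto simp: distrib_left)
    finally show ?thesis by (simp only: distrib_left)
  qed
  have uB: "(\<Sum>e\<in>?B. LINT x:e|surface_lborel e. (u (elem_at T e) x - c0)\<^sup>2) \<le> Bh"
  proof -
    have "Bh = Ct * Es + (Ct * Es + 2 * Es)" by (simp add: Bh_def algebra_simps)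
    moreover have "0 \<le> Ct * Es + 2 * Es" using Ct Es0 by simp
    ultimately show ?thesis using trace unfolding Es_def by linarith
  qed
  show "(\<Sum>e\<in>?B. LINT x:e|surface_lborel e. (u (elem_at T e) x)\<^sup>2)
      \<le> mean_const Ct C\<sigma> s * ((\<Sum>K\<in>T. energy K) + (\<Sum>e\<in>E. LINT x:e|surface_lborel e. uhat e x)\<^sup>2)"
    using final[of "\<lambda>e. u (elem_at T e)", OF geo(3) uB] unfolding Es_def M_def .
  show "(\<Sum>e\<in>?B. LINT x:e|surface_lborel e. (uhat e x)\<^sup>2)
      \<le> mean_const Ct C\<sigma> s * ((\<Sum>K\<in>T. energy K) + (\<Sum>e\<in>E. LINT x:e|surface_lborel e. uhat e x)\<^sup>2)"
    using final[of uhat, OF geo(4) sb[unfolded b_def]] unfolding Es_def M_def .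
qed

end

section \<open>The uniform estimate\<close>

lemma set_integral_eqI:
  assumes "\<And>x. x \<in> S \<Longrightarrow> f x = g x"
  shows "(LINT x:S|M. f x) = (LINT x:S|M. g x)"
proof -
  have "indicator S x *\<^sub>R f x = indicator S x *\<^sub>R g x" for x
    using assms by (cases "x \<in> S") simp_all
  then show ?thesis unfolding set_lebesgue_integral_def by (rule Bochner_Integration.integral_cong[OF refl])
qed

text \<open>One mesh of the class, if there is any, supplies the reference data for all the others: the hyperplanes of the
  boundary, the reference balls with their links, and a face \<open>e0\<close> of positive measure inside \<open>\<Gamma>\<close>.\<close>
lemma uniform_boundary_estimate:
  fixes \<Omega> \<Gamma> :: "(real^'d) set"
  assumes \<Omega>: "open \<Omega>" "connected \<Omega>"
  shows "\<exists>C>0. \<forall>T E u uhat p. discrete_gradient \<Omega> T \<kappa> A k u uhat p Cs \<longrightarrow> E \<subseteq> boundary_faces \<Omega> T \<longrightarrow> \<Gamma> = \<Union>E \<longrightarrow>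
    0 < (\<Sum>e\<in>E. measure (surface_lborel e) e) \<longrightarrow>
    (\<Sum>e\<in>boundary_faces \<Omega> T. LINT x:e|surface_lborel e. (u (elem_at T e) x)\<^sup>2)
      \<le> C * ((\<Sum>K\<in>T. discrete_gradient.energy u uhat p K) + (\<Sum>e\<in>E. LINT x:e|surface_lborel e. uhat e x)\<^sup>2) \<and>
    (\<Sum>e\<in>boundary_faces \<Omega> T. LINT x:e|surface_lborel e. (uhat e x)\<^sup>2)
      \<le> C * ((\<Sum>K\<in>T. discrete_gradient.energy u uhat p K) + (\<Sum>e\<in>E. LINT x:e|surface_lborel e. uhat e x)\<^sup>2)"
proof (cases "\<exists>T E. regular_mesh \<Omega> T \<kappa> A \<and> E \<subseteq> boundary_faces \<Omega> T \<and> \<Gamma> = \<Union>E \<and> 0 < (\<Sum>e\<in>E. measure (surface_lborel e) e)")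
  case False
  show ?thesis
  proof (intro exI[of _ 1] conjI[OF zero_less_one] allI impI)
    fix T E and u uhat :: "('d, real) broken" and p
    assume "discrete_gradient \<Omega> T \<kappa> A k u uhat p Cs"
    from discrete_gradient.axioms(1)[OF this] have "regular_mesh \<Omega> T \<kappa> A" .
    moreover assume "E \<subseteq> boundary_faces \<Omega> T" "\<Gamma> = \<Union>E" "0 < (\<Sum>e\<in>E. measure (surface_lborel e) e)"
    ultimately have False using False by blast
    then show "(\<Sum>e\<in>boundary_faces \<Omega> T. LINT x:e|surface_lborel e. (u (elem_at T e) x)\<^sup>2)
        \<le> 1 * ((\<Sum>K\<in>T. discrete_gradient.energy u uhat p K) + (\<Sum>e\<in>E. LINT x:e|surface_lborel e. uhat e x)\<^sup>2) \<and>
      (\<Sum>e\<in>boundary_faces \<Omega> T. LINT x:e|surface_lborel e. (uhat e x)\<^sup>2)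
        \<le> 1 * ((\<Sum>K\<in>T. discrete_gradient.energy u uhat p K) + (\<Sum>e\<in>E. LINT x:e|surface_lborel e. uhat e x)\<^sup>2)" ..
  qed
next
  case True
  then obtain T0 E0 where T0: "regular_mesh \<Omega> T0 \<kappa> A" and E0: "E0 \<subseteq> boundary_faces \<Omega> T0" "\<Gamma> = \<Union>E0"
    and pos: "0 < (\<Sum>e\<in>E0. measure (surface_lborel e) e)" by blast
  interpret R0: regular_mesh \<Omega> T0 \<kappa> A by (rule T0)
  obtain e0 where e0: "e0 \<in> E0" "0 < measure (surface_lborel e0) e0"
  proof -
    have "\<exists>e\<in>E0. 0 < measure (surface_lborel e) e"
    proof (rule ccontr)
      assume "\<not> ?thesis"
      then have "(\<Sum>e\<in>E0. measure (surface_lborel e) e) \<le> 0" by (intro sum_nonpos) (simp add: not_less)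
      then show False using pos by simp
    qed
    then show ?thesis using that by blast
  qed
  define s where "s = measure (surface_lborel e0) e0"
  have e0f: "e0 \<in> faces T0" using e0(1) E0(1) unfolding boundary_faces_def by blast
  obtain n0 \<beta>0 where n0: "norm n0 = 1" "affine hull e0 = {x. n0 \<bullet> x = \<beta>0}" and ce0: "compact e0"
    using R0.face_hyperplane[OF e0f] by blast
  obtain H where H: "finite H" "\<forall>(n, a)\<in>H. norm n = 1" "\<forall>x\<in>frontier \<Omega>. \<exists>(n, a)\<in>H. n \<bullet> x = a"
    using R0.boundary_in_hyperplanes by blast
  have H': "\<And>n a. (n, a) \<in> H \<Longrightarrow> norm n = 1" "\<And>x. x \<in> frontier \<Omega> \<Longrightarrow> \<exists>(n, a)\<in>H. n \<bullet> x = a"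
    using H by auto
  obtain m where m: "0 < m" "\<forall>a r. 0 < r \<longrightarrow> (LINT y|lborel. kern a r (y :: real^'d)) = m"
    using kern_mass by blast
  define R where "R = R0.inrad"
  define D where "D = diameter (closure \<Omega>) + R"
  have R: "0 < R" unfolding R_def by (rule R0.inrad_pos)
  obtain G1 where G1: "G1 \<in> T0" using R0.mesh_nonempty by blast
  have ballG: "ball (R0.ctr G) R \<subseteq> G" if "G \<in> T0" for G unfolding R_def by (rule R0.ball_ctr[OF that])
  have ballO: "ball (R0.ctr G) R \<subseteq> \<Omega>" if G: "G \<in> T0" for G
  proof -
    have "ball (R0.ctr G) R \<subseteq> interior (closure \<Omega>)"
      using order_trans[OF ballG[OF G] R0.elem_in_dom[OF G]] by (intro interior_maximal) auto
    then show ?thesis by (simp only: R0.regular_dom)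
  qed
  have "\<forall>G\<in>T0. \<exists>C\<ge>0. \<forall>T u uhat p. discrete_gradient \<Omega> T \<kappa> A k u uhat p Cs \<longrightarrow>
     (discrete_gradient.avg T u (R0.ctr G) R - discrete_gradient.avg T u (R0.ctr G1) R)\<^sup>2
       \<le> C * (\<Sum>K\<in>T. discrete_gradient.energy u uhat p K)"
    using balls_linked_connected[OF \<Omega> R R ballO[OF G1] ballO, of _ \<kappa> A k Cs] unfolding balls_linked_def by simp
  from bchoice[OF this] obtain CL where CL: "\<forall>G\<in>T0. 0 \<le> CL G \<and> (\<forall>T u uhat p. discrete_gradient \<Omega> T \<kappa> A k u uhat p Cs \<longrightarrow>
     (discrete_gradient.avg T u (R0.ctr G) R - discrete_gradient.avg T u (R0.ctr G1) R)\<^sup>2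
       \<le> CL G * (\<Sum>K\<in>T. discrete_gradient.energy u uhat p K))" by (rule exE)
  define Cl where "Cl = (\<Sum>G\<in>T0. CL G)"
  have Cl: "0 \<le> Cl" unfolding Cl_def using CL by (intro sum_nonneg) blast
  define Ct where "Ct = max 0 (trace_const CARD('d) \<kappa> A Cs D R (card H) m Cl)"
  define C\<sigma> where "C\<sigma> = max 0 (boundary_const CARD('d) \<kappa> A (card H) D)"
  define C where "C = mean_const Ct C\<sigma> s"
  have s: "0 < s" unfolding s_def by (rule e0(2))
  have "0 < C"
  proof -
    have "0 \<le> Ct" "0 \<le> C\<sigma>" unfolding Ct_def C\<sigma>_def by auto
    then show ?thesis unfolding C_def mean_const_def using s
      by (intro add_pos_nonneg mult_nonneg_nonneg add_nonneg_nonneg divide_nonneg_pos) auto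
  qed
  moreover have "(\<Sum>e\<in>boundary_faces \<Omega> T. LINT x:e|surface_lborel e. (u (elem_at T e) x)\<^sup>2)
      \<le> C * ((\<Sum>K\<in>T. discrete_gradient.energy u uhat p K) + (\<Sum>e\<in>E. LINT x:e|surface_lborel e. uhat e x)\<^sup>2) \<and>
    (\<Sum>e\<in>boundary_faces \<Omega> T. LINT x:e|surface_lborel e. (uhat e x)\<^sup>2)
      \<le> C * ((\<Sum>K\<in>T. discrete_gradient.energy u uhat p K) + (\<Sum>e\<in>E. LINT x:e|surface_lborel e. uhat e x)\<^sup>2)"
    if dg: "discrete_gradient \<Omega> T \<kappa> A k u uhat p Cs" and E: "E \<subseteq> boundary_faces \<Omega> T" and \<Gamma>: "\<Gamma> = \<Union>E" for T E u uhat p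
  proof -
    interpret dg: discrete_gradient \<Omega> T \<kappa> A k u uhat p Cs by (rule dg)
    have Es0: "0 \<le> (\<Sum>K\<in>T. dg.energy K)" by (intro sum_nonneg dg.energy_nonneg)
    have link: "(dg.avg (R0.ctr G) R - m * (dg.avg (R0.ctr G1) R / m))\<^sup>2 \<le> Cl * (\<Sum>K\<in>T. dg.energy K)" if G: "G \<in> T0" for G
    proof -
      have "(dg.avg (R0.ctr G) R - dg.avg (R0.ctr G1) R)\<^sup>2 \<le> CL G * (\<Sum>K\<in>T. dg.energy K)"
        using CL G dg by blast
      also have "\<dots> \<le> Cl * (\<Sum>K\<in>T. dg.energy K)"
        unfolding Cl_def using CL by (intro mult_right_mono member_le_sum R0.finite_mesh G Es0) auto
      finally show ?thesis using m(1) by simp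
    qed
    have "(\<Sum>e\<in>boundary_faces \<Omega> T. LINT x:e|surface_lborel e. (u (elem_at T e) x - dg.avg (R0.ctr G1) R / m)\<^sup>2)
      \<le> trace_const CARD('d) \<kappa> A Cs D R (card H) m Cl * (\<Sum>K\<in>T. dg.energy K)"
    proof (rule dg.boundary_trace[of m H T0 R0.ctr R])
      show "closure \<Omega> \<subseteq> \<Union>T0" using R0.Union_mesh by simp
      show "diameter (closure \<Omega>) + R \<le> D" unfolding D_def by simp
    qed (use m H(1) H' R0.convex_elem R0.elem_in_dom ballG R link Cl in auto)
    also have "\<dots> \<le> Ct * (\<Sum>K\<in>T. dg.energy K)" unfolding Ct_def by (intro mult_right_mono Es0) simp
    finally have trace: "(\<Sum>e\<in>boundary_faces \<Omega> T. LINT x:e|surface_lborel e. (u (elem_at T e) x - dg.avg (R0.ctr G1) R / m)\<^sup>2)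
      \<le> Ct * (\<Sum>K\<in>T. dg.energy K)" .
    have Ct0: "0 \<le> Ct" unfolding Ct_def by simp
    have "(\<Sum>e\<in>boundary_faces \<Omega> T. measure (surface_lborel e) e) \<le> boundary_const CARD('d) \<kappa> A (card H) D"
      by (rule dg.boundary_measure_le[OF H(1)]) (use H' R D_def in auto)
    then have area: "(\<Sum>e\<in>boundary_faces \<Omega> T. measure (surface_lborel e) e) \<le> C\<sigma>" unfolding C\<sigma>_def by simp
    have "s \<le> (\<Sum>e\<in>E. measure (surface_lborel e) e)"
      unfolding s_def
    proof (rule faces_cover_measure[OF n0])
      show "e0 \<subseteq> \<Union>E" using e0(1) E0(2) \<Gamma> by blast
      show "compact e0" by (rule ce0)
      show "finite E" using E dg.finite_boundary_faces finite_subset by blast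
      fix e assume "e \<in> E"
      then have "e \<in> faces T" using E unfolding boundary_faces_def by blast
      then show "compact e \<and> (\<exists>m \<beta>. norm m = 1 \<and> affine hull e = {x. m \<bullet> x = \<beta>})" by (rule dg.face_hyperplane)
    qed
    from dg.mean_controls_boundary[OF trace Ct0 area E s this] show ?thesis unfolding C_def by blast
  qed
  ultimately show ?thesis by (intro exI[of _ C]) blast
qed

lemma gradient_eq_cong:
  assumes eq: "gradient_eq k T u uhat p"
    and u: "\<And>K x. K \<in> T \<Longrightarrow> x \<in> K \<Longrightarrow> u K x = u' K x" and p: "\<And>K x. K \<in> T \<Longrightarrow> x \<in> K \<Longrightarrow> p K x = p' K x"
    and w: "\<And>e x. e \<in> faces T \<Longrightarrow> x \<in> e \<Longrightarrow> uhat e x = uhat' e x"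
  shows "gradient_eq k T u' uhat' p'"
proof -
  have "mesh_inner T p' q = mesh_inner T u' (broken_div q)
       - skel_inner T (\<lambda>K e. uhat' e) (\<lambda>K e x. q K x \<bullet> outward_normal K e)" if q: "q \<in> V_space k T" for q
  proof -
    have "mesh_inner T p' q = mesh_inner T p q"
      unfolding mesh_inner_def by (intro sum.cong refl set_integral_eqI) (simp add: p)
    moreover have "mesh_inner T u' (broken_div q) = mesh_inner T u (broken_div q)"
      unfolding mesh_inner_def by (intro sum.cong refl set_integral_eqI) (simp add: u)
    moreover have "skel_inner T (\<lambda>K e. uhat' e) (\<lambda>K e x. q K x \<bullet> outward_normal K e)
      = skel_inner T (\<lambda>K e. uhat e) (\<lambda>K e x. q K x \<bullet> outward_normal K e)"
      unfolding skel_inner_def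
    proof (intro sum.cong refl set_integral_eqI)
      fix K e x assume "K \<in> T" "e \<in> {e. e facet_of K}" "x \<in> e"
      then have "uhat e x = uhat' e x" by (intro w) (auto simp: faces_def)
      then show "uhat' e x * (q K x \<bullet> outward_normal K e) = uhat e x * (q K x \<bullet> outward_normal K e)" by simp
    qed
    ultimately show ?thesis using eq q unfolding gradient_eq_def by simp
  qed
  then show ?thesis unfolding gradient_eq_def by blast
qed

text \<open>Membership in the discrete spaces fixes only the values on elements and faces; the polynomials
  behind these values are defined everywhere.\<close>
lemma polynomial_representatives:
  fixes T :: "(real^'d) set set"
  assumes X: "(u, uhat) \<in> X_space k T" and V: "p \<in> V_space k T"
  obtains u' uhat' and p' :: "('d, real^'d) broken" where
    "\<And>K. K \<in> T \<Longrightarrow> u' K \<in> polys k" "\<And>K x. K \<in> T \<Longrightarrow> x \<in> K \<Longrightarrow> u K x = u' K x"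
    "\<And>e. e \<in> faces T \<Longrightarrow> uhat' e \<in> polys k" "\<And>e x. e \<in> faces T \<Longrightarrow> x \<in> e \<Longrightarrow> uhat e x = uhat' e x"
    "\<And>K i. K \<in> T \<Longrightarrow> (\<lambda>x. p' K x $ i) \<in> polys k" "\<And>K x. K \<in> T \<Longrightarrow> x \<in> K \<Longrightarrow> p K x = p' K x"
proof -
  have "\<forall>K\<in>T. \<exists>g. g \<in> polys k \<and> (\<forall>x\<in>K. u K x = g x)"
    using X unfolding X_space_def U_space_def polys_on_def by blast
  from bchoice[OF this] obtain u' where u': "\<forall>K\<in>T. u' K \<in> polys k \<and> (\<forall>x\<in>K. u K x = u' K x)" by (rule exE)
  have "\<forall>e\<in>faces T. \<exists>g. g \<in> polys k \<and> (\<forall>x\<in>e. uhat e x = g x)"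
    using X unfolding X_space_def F_space_def polys_on_def by blast
  from bchoice[OF this] obtain w' where w': "\<forall>e\<in>faces T. w' e \<in> polys k \<and> (\<forall>x\<in>e. uhat e x = w' e x)" by (rule exE)
  have "\<forall>Ki\<in>T \<times> UNIV. \<exists>g. g \<in> polys k \<and> (\<forall>x\<in>fst Ki. p (fst Ki) x $ (snd Ki) = g x)"
    using V unfolding V_space_def polys_on_def by fastforce
  from bchoice[OF this] obtain P where P: "\<forall>Ki\<in>T \<times> UNIV. P Ki \<in> polys k \<and> (\<forall>x\<in>fst Ki. p (fst Ki) x $ (snd Ki) = P Ki x)" by (rule exE)
  show ?thesis
  proof (rule that[of u' w' "\<lambda>K x. \<chi> i. P (K, i) x"])
    show "(\<lambda>x. (\<chi> i. P (K, i) x) $ i) \<in> polys k" if "K \<in> T" for K i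
      using P that by (auto simp: eta_contract_eq)
    show "p K x = (\<chi> i. P (K, i) x)" if "K \<in> T" "x \<in> K" for K x
      using P that by (auto simp: vec_eq_iff)
  qed (use u' w' in auto)
qed

theorem theorem5p7:
  fixes \<Omega> \<Gamma> :: "(real^'d) set" and k :: nat and \<kappa> A :: real
  assumes "CARD('d) = 2 \<or> CARD('d) = 3"
    and "open \<Omega>" and "connected \<Omega>" and "bounded \<Omega>" and "\<Omega> \<noteq> {}" and "polyhedral \<Omega>"
    and "0 < \<kappa>"
  shows "\<exists>C>0. \<forall>T E u uhat p.
    mesh_of \<Omega> T \<and> shape_regular \<kappa> T \<and> quasi_uniform A T \<and>
    E \<subseteq> boundary_faces \<Omega> T \<and> \<Gamma> = \<Union>E \<and>
    0 < (\<Sum>e\<in>E. measure (surface_lborel e) e) \<and>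
    (u, uhat) \<in> X_space k T \<and> p \<in> V_space k T \<and> gradient_eq k T u uhat p
    \<longrightarrow>
    (bdry_norm \<Omega> T (\<lambda>e. u (elem_at T e)))\<^sup>2
      \<le> C * ((1 + mesh_size T) * (mesh_norm T p)\<^sup>2
           + (skel_norm T (\<lambda>K e x. u K x - uhat e x))\<^sup>2
           + (\<Sum>e\<in>E. LINT x:e|surface_lborel e. uhat e x)\<^sup>2) \<and>
    (bdry_norm \<Omega> T uhat)\<^sup>2
      \<le> C * ((1 + mesh_size T) * (mesh_norm T p)\<^sup>2
           + (skel_norm T (\<lambda>K e x. u K x - uhat e x))\<^sup>2
           + (\<Sum>e\<in>E. LINT x:e|surface_lborel e. uhat e x)\<^sup>2)"
proof -
  obtain Cs where Cs: "0 < Cs" "\<forall>f\<in>polys k. \<forall>K::(real^'d) set. convex K \<longrightarrow> compact K \<longrightarrow>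
      (\<forall>x\<in>K. (f x)\<^sup>2 * measure lborel K \<le> Cs * (LINT y:K|lborel. (f y)\<^sup>2))"
    using polys_sup_bound[of k] by (elim exE conjE)
  obtain C where C: "0 < C" and bound: "\<forall>T E u uhat p. discrete_gradient \<Omega> T \<kappa> A k u uhat p Cs \<longrightarrow> E \<subseteq> boundary_faces \<Omega> T \<longrightarrow> \<Gamma> = \<Union>E \<longrightarrow>
    0 < (\<Sum>e\<in>E. measure (surface_lborel e) e) \<longrightarrow>
    (\<Sum>e\<in>boundary_faces \<Omega> T. LINT x:e|surface_lborel e. (u (elem_at T e) x)\<^sup>2)
      \<le> C * ((\<Sum>K\<in>T. discrete_gradient.energy u uhat p K) + (\<Sum>e\<in>E. LINT x:e|surface_lborel e. uhat e x)\<^sup>2) \<and>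
    (\<Sum>e\<in>boundary_faces \<Omega> T. LINT x:e|surface_lborel e. (uhat e x)\<^sup>2)
      \<le> C * ((\<Sum>K\<in>T. discrete_gradient.energy u uhat p K) + (\<Sum>e\<in>E. LINT x:e|surface_lborel e. uhat e x)\<^sup>2)"
    using uniform_boundary_estimate[OF assms(2,3), where \<kappa> = \<kappa> and A = A and k = k and Cs = Cs and \<Gamma> = \<Gamma>] by blast
  show ?thesis
  proof (intro exI[of _ C] conjI[OF C] allI impI, rule conjI)
    fix T E and u uhat :: "('d, real) broken" and p :: "('d, real^'d) broken"
    assume asm: "mesh_of \<Omega> T \<and> shape_regular \<kappa> T \<and> quasi_uniform A T \<and>
      E \<subseteq> boundary_faces \<Omega> T \<and> \<Gamma> = \<Union>E \<and> 0 < (\<Sum>e\<in>E. measure (surface_lborel e) e) \<and>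
      (u, uhat) \<in> X_space k T \<and> p \<in> V_space k T \<and> gradient_eq k T u uhat p"
    obtain u' uhat' and p' :: "('d, real^'d) broken" where
      u': "\<And>K. K \<in> T \<Longrightarrow> u' K \<in> polys k" "\<And>K x. K \<in> T \<Longrightarrow> x \<in> K \<Longrightarrow> u K x = u' K x" and
      w': "\<And>e. e \<in> faces T \<Longrightarrow> uhat' e \<in> polys k" "\<And>e x. e \<in> faces T \<Longrightarrow> x \<in> e \<Longrightarrow> uhat e x = uhat' e x" and
      p': "\<And>K i. K \<in> T \<Longrightarrow> (\<lambda>x. p' K x $ i) \<in> polys k" "\<And>K x. K \<in> T \<Longrightarrow> x \<in> K \<Longrightarrow> p K x = p' K x"
      using asm polynomial_representatives[of u uhat k T p] by blast
    have rm: "regular_mesh \<Omega> T \<kappa> A"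
      using assms polyhedral_interior_closure asm by (intro regular_mesh.intro) auto
    have eq': "gradient_eq k T u' uhat' p'"
      by (rule gradient_eq_cong[of k T u uhat p]) (use asm u'(2) w'(2) p'(2) in auto)
    have dg: "discrete_gradient \<Omega> T \<kappa> A k u' uhat' p' Cs"
      using u'(1) w'(1) p'(1) eq' Cs by (intro discrete_gradient.intro[OF rm] discrete_gradient_axioms.intro) auto
    interpret discrete_gradient \<Omega> T \<kappa> A k u' uhat' p' Cs by (rule dg)
    let ?B = "boundary_faces \<Omega> T"
    have Bf: "e \<in> faces T" if "e \<in> ?B" for e using that unfolding boundary_faces_def by simp
    define P where "P = (\<Sum>K\<in>T. LINT x:K|lborel. p K x \<bullet> p K x)"
    define S where "S = (\<Sum>K\<in>T. \<Sum>e | e facet_of K. LINT x:e|surface_lborel e. (u K x - uhat e x) * (u K x - uhat e x))"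
    have P0: "0 \<le> P" unfolding P_def by (intro sum_nonneg set_integral_nonneg_pointwise) simp
    have S0: "0 \<le> S" unfolding S_def by (intro sum_nonneg set_integral_nonneg_pointwise) simp
    have nP: "(mesh_norm T p)\<^sup>2 = P" unfolding mesh_norm_def mesh_inner_def using P0 P_def by simp
    have nS: "(skel_norm T (\<lambda>K e x. u K x - uhat e x))\<^sup>2 = S"
      unfolding skel_norm_def skel_inner_def using S0 S_def by simp
    have "(\<Sum>K\<in>T. energy K) = P + S"
    proof -
      have "energy K = (LINT x:K|lborel. p K x \<bullet> p K x)
          + (\<Sum>e | e facet_of K. LINT x:e|surface_lborel e. (u K x - uhat e x) * (u K x - uhat e x))" if K: "K \<in> T" for K
      proof -
        have "(LINT x:K|lborel. p' K x \<bullet> p' K x) = (LINT x:K|lborel. p K x \<bullet> p K x)"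
          by (intro set_integral_eqI) (simp add: p'(2)[OF K])
        moreover have "jump K e = (LINT x:e|surface_lborel e. (u K x - uhat e x) * (u K x - uhat e x))" if e: "e facet_of K" for e
          unfolding jump_def
        proof (rule set_integral_eqI)
          fix x assume x: "x \<in> e"
          then have "x \<in> K" using facet_of_imp_subset[OF e] by blast
          then show "(u' K x - uhat' e x)\<^sup>2 = (u K x - uhat e x) * (u K x - uhat e x)"
            using u'(2)[OF K] w'(2)[OF facet_in_faces[OF K e] x] by (simp add: power2_eq_square)
        qed
        ultimately show ?thesis unfolding energy_def by simp
      qed
      then show ?thesis unfolding P_def S_def by (simp add: sum.distrib)
    qed
    moreover have "P \<le> (1 + mesh_size T) * P" using P0 mesh_size_pos by (simp add: distrib_right)
    moreover have "(\<Sum>e\<in>E. LINT x:e|surface_lborel e. uhat' e x) = (\<Sum>e\<in>E. LINT x:e|surface_lborel e. uhat e x)"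
    proof (intro sum.cong refl set_integral_eqI)
      fix e x assume "e \<in> E" "x \<in> e"
      then show "uhat' e x = uhat e x" using asm Bf w'(2)[of e x] by auto
    qed
    ultimately have rhs: "C * ((\<Sum>K\<in>T. energy K) + (\<Sum>e\<in>E. LINT x:e|surface_lborel e. uhat' e x)\<^sup>2)
      \<le> C * ((1 + mesh_size T) * (mesh_norm T p)\<^sup>2 + (skel_norm T (\<lambda>K e x. u K x - uhat e x))\<^sup>2
           + (\<Sum>e\<in>E. LINT x:e|surface_lborel e. uhat e x)\<^sup>2)"
      unfolding nP nS using C by simp
    have norm: "(bdry_norm \<Omega> T f)\<^sup>2 = (\<Sum>e\<in>?B. LINT x:e|surface_lborel e. (f e x)\<^sup>2)" for f :: "('d, real) broken"
      unfolding bdry_norm_def by (intro real_sqrt_pow2 sum_nonneg set_integral_nonneg_pointwise) simp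
    have nu: "(bdry_norm \<Omega> T (\<lambda>e. u (elem_at T e)))\<^sup>2 = (\<Sum>e\<in>?B. LINT x:e|surface_lborel e. (u' (elem_at T e) x)\<^sup>2)"
      unfolding norm
    proof (intro sum.cong refl set_integral_eqI)
      fix e x assume e: "e \<in> ?B" and x: "x \<in> e"
      have "x \<in> elem_at T e" using x facet_of_imp_subset[OF elem_at_boundary(2)[OF e]] by blast
      then show "(u (elem_at T e) x)\<^sup>2 = (u' (elem_at T e) x)\<^sup>2" using u'(2)[OF elem_at_boundary(1)[OF e]] by simp
    qed
    have nw: "(bdry_norm \<Omega> T uhat)\<^sup>2 = (\<Sum>e\<in>?B. LINT x:e|surface_lborel e. (uhat' e x)\<^sup>2)"
      unfolding norm by (intro sum.cong refl set_integral_eqI) (simp add: w'(2)[OF Bf])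
    have EB: "E \<subseteq> ?B" "\<Gamma> = \<Union>E" "0 < (\<Sum>e\<in>E. measure (surface_lborel e) e)" using asm by auto
    have main: "(\<Sum>e\<in>?B. LINT x:e|surface_lborel e. (u' (elem_at T e) x)\<^sup>2)
        \<le> C * ((\<Sum>K\<in>T. energy K) + (\<Sum>e\<in>E. LINT x:e|surface_lborel e. uhat' e x)\<^sup>2) \<and>
      (\<Sum>e\<in>?B. LINT x:e|surface_lborel e. (uhat' e x)\<^sup>2)
        \<le> C * ((\<Sum>K\<in>T. energy K) + (\<Sum>e\<in>E. LINT x:e|surface_lborel e. uhat' e x)\<^sup>2)"
      using bound[rule_format, OF dg EB] .
    show "(bdry_norm \<Omega> T (\<lambda>e. u (elem_at T e)))\<^sup>2
      \<le> C * ((1 + mesh_size T) * (mesh_norm T p)\<^sup>2 + (skel_norm T (\<lambda>K e x. u K x - uhat e x))\<^sup>2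
           + (\<Sum>e\<in>E. LINT x:e|surface_lborel e. uhat e x)\<^sup>2)"
      unfolding nu by (rule order_trans[OF conjunct1[OF main] rhs])
    show "(bdry_norm \<Omega> T uhat)\<^sup>2
      \<le> C * ((1 + mesh_size T) * (mesh_norm T p)\<^sup>2 + (skel_norm T (\<lambda>K e x. u K x - uhat e x))\<^sup>2
           + (\<Sum>e\<in>E. LINT x:e|surface_lborel e. uhat e x)\<^sup>2)"
      unfolding nw by (rule order_trans[OF conjunct2[OF main] rhs])
  qed
qed

end
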